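(* Let $T$ and $T'$ be trees with $\nu(T)\le 4$ and $\nu(T')\le 4$. Suppose that $\operatorname{Spec}(T)=\operatorname{Spec}(T')$ and that $W_k(T)=W_k(T')$ for every integer $k$ with $3\le k\le 8$. Then $T\cong T'$.
   Context: All graphs are finite, simple and undirected. For a graph $G$, $A(G)$ is its adjacency matrix, $\operatorname{Spec}(G)$ is its adjacency spectrum (the multiset of eigenvalues of $A(G)$), $\nu(G)$ is its matching number, and $W_k(G)=\mathbf 1^{\mathsf T}A(G)^k\mathbf 1$ (with $\mathbf 1$ the all-one vector of length $|V(G)|$) is the total number of walks of length $k$ in $G$. *)

theory Defs
  imports
    "Graph_Theory.Digraph_Isomorphism"
    "Graph_Theory.Digraph_Component"
    "Graph_Theory.Pair_Digraph"
    "HOL-Computational_Algebra.Polynomial"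
    "Jordan_Normal_Form.Char_Poly"
begin

text \<open>
  Finite simple undirected graphs are the symmetric loop-free digraphs of the locale
  \<open>pair_graph\<close>: an undirected edge \<open>uv\<close> is represented by the two arcs \<open>(u, v)\<close> and \<open>(v, u)\<close>.

  The library predicate \<open>Digraph_Component.forest\<close> forbids directed cycles, and \<open>u, v, u\<close> is a
  directed cycle in a symmetric digraph; hence \<open>Digraph_Component.tree\<close> fails for every symmetric
  digraph with an arc. The cycles of an undirected simple graph are exactly the directed cycles
  with at least three arcs. Connectedness includes that there is at least one vertex.
\<close>

definition is_tree :: "'a pair_pre_digraph \<Rightarrow> bool" where
  "is_tree G \<longleftrightarrow> pair_graph G \<and> Digraph_Component.connected (with_proj G) \<and>
     \<not> (\<exists>p. pre_digraph.cycle (with_proj G) p \<and> length p \<ge> 3)"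

definition edges :: "'a pair_pre_digraph \<Rightarrow> 'a set set" where
  "edges G = {{u, v} | u v. (u, v) \<in> parcs G}"

definition is_matching :: "'a pair_pre_digraph \<Rightarrow> 'a set set \<Rightarrow> bool" where
  "is_matching G M \<longleftrightarrow> M \<subseteq> edges G \<and> (\<forall>e\<in>M. \<forall>f\<in>M. e \<noteq> f \<longrightarrow> e \<inter> f = {})"

definition matching_number :: "'a pair_pre_digraph \<Rightarrow> nat" where
  "matching_number G = Max (card ` {M. is_matching G M})"

text \<open>
  The rows and columns of the adjacency matrix are indexed by an arbitrary but fixed enumeration
  of the vertices. Another enumeration conjugates the matrix by a permutation matrix, which changes
  neither the spectrum nor the numbers of walks.
\<close>

definition vertex_list :: "'a pair_pre_digraph \<Rightarrow> 'a list" where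
  "vertex_list G = (SOME xs. distinct xs \<and> set xs = pverts G)"

lemma vertex_list:
  assumes "finite (pverts G)"
  shows "distinct (vertex_list G)" and "set (vertex_list G) = pverts G"
proof -
  have "\<exists>xs. distinct xs \<and> set xs = pverts G"
    using finite_distinct_list[OF assms] by blast
  then have "distinct (vertex_list G) \<and> set (vertex_list G) = pverts G"
    unfolding vertex_list_def by (rule someI_ex)
  then show "distinct (vertex_list G)" and "set (vertex_list G) = pverts G"
    by auto
qed

definition adjacency_matrix :: "'a pair_pre_digraph \<Rightarrow> real mat" where
  "adjacency_matrix G =
     mat (card (pverts G)) (card (pverts G))
       (\<lambda>(i, j). if (vertex_list G ! i, vertex_list G ! j) \<in> parcs G then 1 else 0)"

text \<open>
  The eigenvalues are taken over the complex numbers, with their algebraic multiplicities.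
\<close>

definition spectrum_mset :: "'a pair_pre_digraph \<Rightarrow> complex multiset" where
  "spectrum_mset G = proots (char_poly (map_mat complex_of_real (adjacency_matrix G)))"

definition num_walks :: "nat \<Rightarrow> 'a pair_pre_digraph \<Rightarrow> real" where
  "num_walks k G =
     (let n = card (pverts G); ones = vec n (\<lambda>_. 1)
      in ones \<bullet> (adjacency_matrix G ^\<^sub>m k *\<^sub>v ones))"

end

theory Submission
  imports Defs
begin

text \<open>
  By Koenig's theorem a tree with matching number at most four has a vertex cover of at most four
  vertices. Adjacency and common neighbours outside the cover join the cover vertices into a tree-
  like structure; all other vertices are leaves attached to the cover. Exchanging cover vertices
  brings the tree into one of twenty shapes, its skeleton, whose only parameters are the numbers
  of leaves at the cover vertices.

  The spectrum determines the numbers of edges and of matchings of sizes two to four, and together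
  with the walks of length at most eight it determines the defects of the walk numbers in the
  linear recurrence given by the characteristic polynomial, which are polynomials of degree at
  most four in the leaf numbers. Linear functionals of these ten quantities separate the
  skeletons, and for each skeleton they recover the leaf numbers up to the symmetries of the
  shape.
\<close>

section \<open>Trees as acyclic connected symmetric relations\<close>

text \<open>Put \<open>q(x) = x^8 - (n-1) x^6 + m2 x^4 - m3 x^2 + m4\<close>. Every nonzero
  eigenvalue is a root of \<open>q\<close>, and the adjacency matrix \<open>A\<close> is symmetric,
  so \<open>A q(A) = 0\<close>: from length nine on the walk numbers obey the recurrence of
  \<open>q\<close>, and lengths up to eight carry all that they can tell. Lengths one and two are
  already fixed by \<open>n\<close> and \<open>m2\<close>, hence the range from three to eight. The
  defects are the coefficients of the numerator of the rational walk generating function. Unlike the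
  walk numbers, whose degree grows with the length, they have degree at most one in each leaf
  number; this is what makes linear certificates possible. The obstacle is that the cover is not
  unique. A leafless cover vertex of degree two with one neighbour outside the cover can be traded
  for that neighbour, so one tree may fit several skeletons, or one skeleton with several lists of
  leaf numbers. A canonical choice has to be made before the invariants can determine
  anything.\<close>

locale fgraph =
  fixes V :: "'a set" and E :: "('a \<times> 'a) set"
  assumes finite_V: "finite V"
    and E_subset: "E \<subseteq> V \<times> V"
    and E_sym: "(u, v) \<in> E \<Longrightarrow> (v, u) \<in> E"
    and E_irrefl: "(u, u) \<notin> E"
begin

definition nb :: "'a \<Rightarrow> 'a set" where
  "nb v = {u. (v, u) \<in> E}"

lemma nb_iff: "u \<in> nb v \<longleftrightarrow> (v, u) \<in> E"
  by (simp add: nb_def)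

lemma nb_sym: "u \<in> nb v \<longleftrightarrow> v \<in> nb u"
  using E_sym by (auto simp: nb_iff)

lemma nb_subset: "nb v \<subseteq> V"
  using E_subset by (auto simp: nb_iff)

lemma nb_irrefl: "v \<notin> nb v"
  using E_irrefl by (simp add: nb_iff)

lemma finite_nb: "finite (nb v)"
  using nb_subset finite_V finite_subset by blast

lemma finite_E: "finite E"
  using E_subset finite_V by (meson finite_SigmaI finite_subset)

lemma arcs_remove:
  assumes "finite X" and "v \<in> X"
  shows "card (E \<inter> X \<times> X) = card (E \<inter> (X - {v}) \<times> (X - {v})) + 2 * card (nb v \<inter> X)"
proof -
  let ?A = "E \<inter> (X - {v}) \<times> (X - {v})"
  let ?B = "Pair v ` (nb v \<inter> X)" and ?C = "(\<lambda>u. (u, v)) ` (nb v \<inter> X)"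
  have eq: "E \<inter> X \<times> X = ?A \<union> (?B \<union> ?C)"
    using \<open>v \<in> X\<close> E_sym by (auto simp: nb_iff)
  have fin: "finite ?A" "finite ?B" "finite ?C"
    using finite_E finite_nb by auto
  have "?B \<inter> ?C = {}"
    using nb_irrefl by auto
  then have "card (?B \<union> ?C) = 2 * card (nb v \<inter> X)"
    using fin by (simp add: card_Un_disjoint card_image inj_on_def)
  moreover have "?A \<inter> (?B \<union> ?C) = {}"
    by auto
  ultimately show ?thesis
    using fin by (simp add: eq card_Un_disjoint)
qed

end

text \<open>Acyclicity is encoded as 1-degeneracy: every nonempty vertex set induces a subgraph with
  a vertex of degree at most one. Inductions by leaf removal use exactly this form.\<close>

locale ftree = fgraph +
  assumes V_nonempty: "V \<noteq> {}"
    and connected: "u \<in> V \<Longrightarrow> v \<in> V \<Longrightarrow> (u, v) \<in> E\<^sup>*"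
    and degenerate: "X \<subseteq> V \<Longrightarrow> X \<noteq> {} \<Longrightarrow> \<exists>v\<in>X. card (nb v \<inter> X) \<le> 1"
begin

text \<open>Removing a vertex of degree at most one loses at most two arcs, since an edge is counted
  in both directions. The last remaining vertex carries no arc, hence the
  \<open>- 1\<close>.\<close>

lemma arcs_within_le:
  assumes "X \<subseteq> V" and "X \<noteq> {}"
  shows "card (E \<inter> X \<times> X) \<le> 2 * (card X - 1)"
proof -
  have "finite X"
    using assms finite_V finite_subset by blast
  then show ?thesis
    using assms
  proof (induction X rule: finite_psubset_induct)
    case (psubset X)
    obtain v where v: "v \<in> X" "card (nb v \<inter> X) \<le> 1"
      using degenerate psubset.prems by blast
    have fin: "finite X" by fact
    show ?case
    proof (cases "X = {v}")
      case True
      then have "E \<inter> X \<times> X = {}" using E_irrefl by auto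
      then show ?thesis by simp
    next
      case False
      then have ne: "X - {v} \<noteq> {}" using v by auto
      have "card (E \<inter> (X - {v}) \<times> (X - {v})) \<le> 2 * (card (X - {v}) - 1)"
        using psubset.IH[of "X - {v}"] ne v psubset.prems by auto
      moreover have "card (X - {v}) = card X - 1"
        using v by simp
      moreover have "card (X - {v}) > 0"
        using fin ne card_gt_0_iff by blast
      ultimately show ?thesis
        using arcs_remove[OF fin v(1)] v(2) by linarith
    qed
  qed
qed

lemma cut_edge:
  assumes "S \<subseteq> V" "S \<noteq> V" "r \<in> S"
  obtains u v where "u \<in> S" "v \<in> V - S" "(u, v) \<in> E"
proof -
  obtain w where w: "w \<in> V - S" using assms by auto
  have "(r, w) \<in> E\<^sup>*" using connected assms w by auto
  then have "w \<in> S \<or> (\<exists>u\<in>S. \<exists>v\<in>V - S. (u, v) \<in> E)"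
  proof (induction rule: rtrancl_induct)
    case base
    then show ?case using assms by simp
  next
    case (step y z)
    then show ?case using E_subset by blast
  qed
  then show ?thesis using w that by blast
qed

text \<open>A spanning tree grown from \<open>r\<close> along \<open>cut_edge\<close> already has
  \<open>2 * (card V - 1)\<close> arcs, the maximum that \<open>arcs_within_le\<close> allows, so it
  contains every edge. \<open>d\<close> is the time of insertion and not the distance from the root;
  only its decrease towards the root matters.\<close>

lemma rooted:
  assumes r: "r \<in> V"
  obtains p :: "'a \<Rightarrow> 'a" and d :: "'a \<Rightarrow> nat" where
    "\<And>v. v \<in> V - {r} \<Longrightarrow> (v, p v) \<in> E"
    "\<And>v. v \<in> V - {r} \<Longrightarrow> d (p v) < d v"
    "\<And>u v. (u, v) \<in> E \<Longrightarrow> u \<noteq> r \<and> v = p u \<or> v \<noteq> r \<and> u = p v"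
proof -
  define ok where "ok = (\<lambda>S p (d :: 'a \<Rightarrow> nat). S \<subseteq> V \<and> r \<in> S \<and>
    (\<forall>v\<in>S - {r}. p v \<in> S \<and> (v, p v) \<in> E \<and> d (p v) < d v) \<and> (\<forall>v\<in>S. d v < card S))"
  have grow: "\<exists>S p d. ok S p d \<and> card S = Suc m" if "Suc m \<le> card V" for m
    using that
  proof (induction m)
    case 0
    have "ok {r} id (\<lambda>_. 0)" using r by (simp add: ok_def)
    then show ?case by (intro exI[of _ "{r}"]) auto
  next
    case (Suc m)
    then obtain S p d where S: "ok S p d" "card S = Suc m" by auto
    then have "S \<noteq> V" "S \<subseteq> V" "r \<in> S" using Suc.prems by (auto simp: ok_def)
    then obtain u v where uv: "u \<in> S" "v \<in> V - S" "(u, v) \<in> E"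
      using cut_edge by metis
    have fin: "finite S" using \<open>S \<subseteq> V\<close> finite_V finite_subset by blast
    have c: "card (insert v S) = Suc (Suc m)" using uv fin S by simp
    \<comment> \<open>All values of \<open>d\<close> on \<open>S\<close> are below
      \<open>card S = Suc m\<close>, so the new vertex lies above its parent.\<close>
    have "ok (insert v S) (p(v := u)) (d(v := Suc m))"
      using S uv E_sym[OF uv(3)] c fin unfolding ok_def
      by (auto split: if_splits simp: less_Suc_eq)
    then show ?case using c by blast
  qed
  have "card V > 0" using r finite_V card_gt_0_iff by blast
  then obtain S p d where S: "ok S p d" "card S = card V"
    using grow[of "card V - 1"] by auto
  have SV: "S = V"
    using S finite_V card_subset_eq[of V S] by (simp add: ok_def)
  let ?A = "(\<lambda>v. (v, p v)) ` (V - {r})" and ?B = "(\<lambda>v. (p v, v)) ` (V - {r})"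
  have sub: "?A \<union> ?B \<subseteq> E"
    using S E_sym unfolding ok_def SV by auto
  \<comment> \<open>A common arc would make two vertices each other's parent, against the decrease
    of \<open>d\<close>.\<close>
  have "?A \<inter> ?B = {}"
  proof -
    have False if "v \<in> V - {r}" "w \<in> V - {r}" "v = p w" "p v = w" for v w
    proof -
      have "d (p v) < d v" "d (p w) < d w"
        using S that(1,2) unfolding ok_def SV by blast+
      then show False using that(3,4) by simp
    qed
    then show ?thesis by auto
  qed
  then have "card (?A \<union> ?B) = 2 * (card V - 1)"
    using finite_V r by (simp add: card_Un_disjoint card_image inj_on_def)
  moreover have "card E \<le> 2 * (card V - 1)"
  proof -
    have "E \<inter> V \<times> V = E" using E_subset by auto
    then show ?thesis using arcs_within_le[of V] r by auto
  qed
  ultimately have "?A \<union> ?B = E"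
    using card_mono[OF finite_E sub] by (intro card_subset_eq[OF finite_E sub]) linarith
  then have "u \<noteq> r \<and> v = p u \<or> v \<noteq> r \<and> u = p v" if "(u, v) \<in> E" for u v
    using that by auto
  moreover have "(v, p v) \<in> E" "d (p v) < d v" if "v \<in> V - {r}" for v
    using S that unfolding ok_def SV by auto
  ultimately show ?thesis using that by blast
qed

end

section \<open>From the library's cycles to 1-degeneracy\<close>

text \<open>Library cycles are lists of arcs. Zipping a vertex list with its tail yields the arcs of
  the walk, and repeating the first vertex at the end closes it.\<close>

lemma cycle_of_vertex_list:
  assumes G: "pair_graph G" and d: "distinct xs" and len: "length xs \<ge> 3"
    and succ: "successively (\<lambda>u v. (u, v) \<in> parcs G) xs"
    and close: "(last xs, hd xs) \<in> parcs G"
  shows "\<exists>p. pre_digraph.cycle (with_proj G) p \<and> length p \<ge> 3"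
proof -
  interpret pair_graph G by (rule G)
  define as where "as = (\<lambda>ys :: 'a list. zip ys (tl ys))"
  have as_Cons: "as (y # z # ys) = (y, z) # as (z # ys)" for y z ys
    by (simp add: as_def)
  have walk: "pawalk_verts (hd ys) (as ys) = ys \<and> pcas (hd ys) (as ys) (last ys) \<and> set (as ys) \<subseteq> parcs G"
    if "ys \<noteq> []" "successively (\<lambda>u v. (u, v) \<in> parcs G) ys" for ys
    using that
  proof (induction ys rule: induct_list012)
    case (2 x)
    then show ?case by (simp add: as_def)
  next
    case (3 x y zs)
    then show ?case by (simp add: as_Cons)
  qed simp
  let ?ys = "xs @ [hd xs]"
  have ne: "xs \<noteq> []" using len by auto
  have s: "successively (\<lambda>u v. (u, v) \<in> parcs G) ?ys"
    using succ close ne by (simp add: successively_append_iff)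
  have w: "pawalk_verts (hd xs) (as ?ys) = ?ys" "pcas (hd xs) (as ?ys) (hd xs)" "set (as ?ys) \<subseteq> parcs G"
    using walk[of ?ys] s ne by auto
  have l: "length (as ?ys) = length xs"
    using ne by (simp add: as_def)
  have "hd xs \<in> pverts G"
    using close in_arcsD2 by blast
  then have "awalk (hd xs) (as ?ys) (hd xs)"
    using w by (simp add: awalk_def)
  moreover have "distinct (tl ?ys)"
    using d ne by (cases xs) auto
  moreover have "as ?ys \<noteq> []"
    using l ne by (metis length_0_conv)
  ultimately have "cycle (as ?ys)"
    unfolding cycle_def using w(1) by metis
  then show ?thesis using l len by metis
qed

lemma successively_take: "successively P xs \<Longrightarrow> successively P (take n xs)"
  by (metis append_take_drop_id successively_append_iff)

text \<open>If every vertex of \<open>X\<close> had two neighbours in \<open>X\<close>, take a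
  longest path in \<open>X\<close>. By maximality all neighbours in \<open>X\<close> of its first
  vertex lie on the path, and one that is not the second vertex closes a cycle.\<close>

lemma is_tree_imp_ftree:
  assumes T: "is_tree T"
  shows "ftree (pverts T) (parcs T)"
proof -
  have G: "pair_graph T" and con: "Digraph_Component.connected (with_proj T)"
    and acyc: "\<not> (\<exists>p. pre_digraph.cycle (with_proj T) p \<and> length p \<ge> 3)"
    using T by (auto simp: is_tree_def)
  interpret pair_graph T by (rule G)
  interpret F: fgraph "pverts T" "parcs T"
    by unfold_locales (use pair_finite_verts in_arcsD1 in_arcsD2 arcs_symmetric adj_not_same in auto)
  have sc: "strongly_connected (with_proj (mk_symmetric (with_proj T)))"
    using con by (simp add: Digraph_Component.connected_def)
  show ?thesis
  proof unfold_locales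
    show "pverts T \<noteq> {}"
      using sc by (auto simp: strongly_connected_def parcs_mk_symmetric)
  next
    fix u v assume "u \<in> pverts T" "v \<in> pverts T"
    then have "u \<rightarrow>\<^sup>*\<^bsub>with_proj (mk_symmetric (with_proj T))\<^esub> v"
      using sc by (auto simp: strongly_connected_def)
    then have "u \<rightarrow>\<^sup>*\<^bsub>with_proj T\<^esub> v"
      by (simp add: reachable_mk_symmetric_eq sym_arcs)
    then show "(u, v) \<in> (parcs T)\<^sup>*"
      by (auto simp: reachable_def dest: rtrancl_on_rtranclI)
  next
    fix X assume X: "X \<subseteq> pverts T" "X \<noteq> {}"
    show "\<exists>v\<in>X. card (F.nb v \<inter> X) \<le> 1"
    proof (rule ccontr)
      assume "\<not> ?thesis"
      then have deg: "card (F.nb v \<inter> X) \<ge> 2" if "v \<in> X" for v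
        using that by fastforce
      define P where "P = (\<lambda>xs. xs \<noteq> [] \<and> distinct xs \<and> set xs \<subseteq> X \<and> successively (\<lambda>u v. (u, v) \<in> parcs T) xs)"
      have fin: "finite X" using X F.finite_V finite_subset by blast
      obtain x where "x \<in> X" using X by auto
      then have "P [x]" by (simp add: P_def)
      moreover have "length xs < Suc (card X)" if "P xs" for xs
        using that fin by (metis P_def card_mono distinct_card le_imp_less_Suc)
      ultimately obtain xs where xs: "P xs" and max: "\<And>ys. P ys \<Longrightarrow> length ys \<le> length xs"
        using ex_has_greatest_nat[of P "[x]" length "Suc (card X)"] by (metis less_imp_le)
      obtain y ys where ys: "xs = y # ys" using xs by (cases xs) (auto simp: P_def)
      have y: "y \<in> X" using xs ys by (auto simp: P_def)
      have nbs: "F.nb y \<inter> X \<subseteq> set ys"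
      proof
        fix z assume z: "z \<in> F.nb y \<inter> X"
        then have e: "(z, y) \<in> parcs T" "z \<noteq> y"
          using F.E_sym F.E_irrefl by (auto simp: F.nb_iff)
        show "z \<in> set ys"
        proof (rule ccontr)
          assume "z \<notin> set ys"
          then have "P (z # xs)"
            using xs ys e z by (auto simp: P_def)
          then show False using max by fastforce
        qed
      qed
      obtain z where z: "z \<in> F.nb y \<inter> X" "z \<noteq> hd ys"
      proof -
        have "\<not> F.nb y \<inter> X \<subseteq> {hd ys}"
          using deg[OF y] card_mono[of "{hd ys}" "F.nb y \<inter> X"] by auto
        then show ?thesis using that by auto
      qed
      then obtain i where i: "i < length ys" "ys ! i = z"
        using nbs by (auto simp: in_set_conv_nth subset_iff)
      \<comment> \<open>Index 0 is the second vertex of the path; excluding it gives the cycle at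
        least three vertices.\<close>
      have "i \<noteq> 0" using i z by (metis hd_conv_nth length_0_conv not_less_zero)
      define zs where "zs = y # take (Suc i) ys"
      have zs: "zs = take (Suc (Suc i)) xs" by (simp add: zs_def ys)
      have "distinct zs" "successively (\<lambda>u v. (u, v) \<in> parcs T) zs"
        using xs by (auto simp: zs P_def intro: successively_take)
      moreover have "length zs \<ge> 3" using i \<open>i \<noteq> 0\<close> by (simp add: zs_def)
      moreover have "last zs = z" using i by (simp add: zs_def take_Suc_conv_app_nth)
      moreover have "hd zs = y" by (simp add: zs_def)
      moreover have "(z, y) \<in> parcs T" using z F.E_sym by (auto simp: F.nb_iff)
      ultimately show False
        using cycle_of_vertex_list[OF G, of zs] acyc by auto
    qed
  qed
qed

section \<open>Vertex covers\<close>

context fgraph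
begin

definition cover :: "'a set \<Rightarrow> bool" where
  "cover C \<longleftrightarrow> C \<subseteq> V \<and> (\<forall>u v. (u, v) \<in> E \<longrightarrow> u \<in> C \<or> v \<in> C)"

text \<open>The injection \<open>f\<close> is a matching of the cover into its complement; this ties
  the size of the cover to the matching number.\<close>

definition saturated_cover :: "'a set \<Rightarrow> bool" where
  "saturated_cover C \<longleftrightarrow> cover C \<and> (\<exists>f. inj_on f C \<and> (\<forall>c\<in>C. f c \<in> nb c - C))"

lemma cover_nb: "cover C \<Longrightarrow> u \<notin> C \<Longrightarrow> nb u \<subseteq> C"
  unfolding cover_def nb_def by blast

lemma cover_finite: "cover C \<Longrightarrow> finite C"
  using finite_V finite_subset by (auto simp: cover_def)

text \<open>The injection would have to send both vertices to \<open>x\<close>: Hall's condition for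
  two vertices.\<close>

lemma saturated_cover_Hall:
  assumes "saturated_cover C" and "c \<in> C" "c' \<in> C" "c \<noteq> c'"
    and "nb c - C \<subseteq> {x}" "nb c' - C \<subseteq> {x}"
  shows False
proof -
  obtain f where f: "inj_on f C" "\<forall>c\<in>C. f c \<in> nb c - C"
    using assms(1) by (auto simp: saturated_cover_def)
  have "f c = x" "f c' = x"
    using f(2) assms(2,3,5,6) by blast+
  then show False
    using f(1) assms(2-4) by (auto dest: inj_onD)
qed

lemma saturated_cover_nonempty:
  assumes "saturated_cover C" and "c \<in> C"
  shows "nb c - C \<noteq> {}"
  using assms by (auto simp: saturated_cover_def)

text \<open>An edge from \<open>c\<close> that leaves the cover must end in \<open>x\<close>, so
  \<open>x\<close> covers whatever only \<open>c\<close> covered.\<close>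

lemma cover_exchange:
  assumes cov: "cover C" and c: "c \<in> C" and x: "nb c - C = {x}"
  shows "cover (insert x (C - {c}))"
  unfolding cover_def
proof (intro conjI allI impI)
  have "x \<in> nb c" using x by blast
  then show "insert x (C - {c}) \<subseteq> V"
    using cov nb_subset by (auto simp: cover_def)
next
  fix u v assume uv: "(u, v) \<in> E"
  then have "u \<in> C \<or> v \<in> C" "v \<in> nb u" "u \<in> nb v"
    using cov nb_sym by (auto simp: cover_def nb_iff)
  moreover have "w \<in> insert x (C - {c})" if "w \<in> nb c" for w
    using that x nb_irrefl by blast
  ultimately show "u \<in> insert x (C - {c}) \<or> v \<in> insert x (C - {c})"
    by blast
qed

text \<open>The matching has to send \<open>c\<close> to its only outside neighbour
  \<open>x\<close>. Reversing this one edge matches \<open>x\<close> to \<open>c\<close>.\<close>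

lemma saturated_cover_exchange:
  assumes C: "saturated_cover C" and c: "c \<in> C" and x: "nb c - C = {x}"
  shows "saturated_cover (insert x (C - {c}))"
proof -
  obtain f where f: "inj_on f C" "\<forall>c\<in>C. f c \<in> nb c - C" and cov: "cover C"
    using C by (auto simp: saturated_cover_def)
  have xc: "x \<in> nb c" "x \<notin> C" "x \<noteq> c"
    using x nb_irrefl c by auto
  have "f c = x" using f(2) c x by blast
  have fx: "f c' \<noteq> x" if "c' \<in> C - {c}" for c'
    using f(1) \<open>f c = x\<close> that c by (auto dest: inj_onD)
  have "inj_on (f(x := c)) (insert x (C - {c}))"
    using f xc c by (auto simp: inj_on_def)
  moreover have "\<forall>c'\<in>insert x (C - {c}). (f(x := c)) c' \<in> nb c' - insert x (C - {c})"
    using f(2) fx xc nb_sym by auto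
  ultimately show ?thesis
    using cover_exchange[OF cov c x] unfolding saturated_cover_def by blast
qed

definition direct_edges :: "'a set \<Rightarrow> 'a set set" where
  "direct_edges C = {{u, v} |u v. u \<in> C \<and> v \<in> C \<and> (u, v) \<in> E}"

text \<open>Outside vertices are pairwise nonadjacent. Apart from isolated ones they are either
  leaves at a cover vertex or connectors, whose neighbourhoods act as hyperedges on the
  cover.\<close>

definition connectors :: "'a set \<Rightarrow> 'a set" where
  "connectors C = {u \<in> V - C. 2 \<le> card (nb u)}"

definition links :: "'a set \<Rightarrow> 'a set set" where
  "links C = nb ` connectors C"

definition pendants :: "'a set \<Rightarrow> 'a \<Rightarrow> nat" where
  "pendants C v = card {u \<in> V - C. nb u = {v}}"

lemma direct_edges_iff: "{u, v} \<in> direct_edges C \<longleftrightarrow> u \<in> C \<and> v \<in> C \<and> (u, v) \<in> E"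
  using E_sym by (auto simp: direct_edges_def doubleton_eq_iff)

text \<open>After the exchange \<open>c\<close> lies outside with its old neighbours and is a
  connector, while the former connector \<open>x\<close> turns its hyperedge into direct edges to
  the other members of \<open>nb x\<close>. No leaf hangs at \<open>x\<close>: its neighbours other
  than \<open>c\<close> stay in the cover, and \<open>c\<close> has degree at least two.\<close>

lemma exchange_structure:
  assumes C: "cover C" and c: "c \<in> C" and x: "nb c - C = {x}" and x2: "2 \<le> card (nb x)"
    and c2: "2 \<le> card (nb c)" and inj: "inj_on nb (connectors C)"
  defines "C' \<equiv> insert x (C - {c})"
  shows "direct_edges C' = {e \<in> direct_edges C. c \<notin> e} \<union> (\<lambda>u. {x, u}) ` (nb x - {c})"
    and "links C' = insert (nb c) (links C - {nb x})"
    and "inj_on nb (connectors C')"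
    and "\<And>u. u \<in> C - {c} \<Longrightarrow> pendants C' u = pendants C u"
    and "pendants C' x = 0"
proof -
  have xc: "x \<in> nb c" "x \<notin> C" "x \<noteq> c" "c \<in> nb x" "x \<in> V" "c \<in> V"
    using x nb_irrefl[of c] c nb_sym[of x c] nb_subset[of c] C unfolding cover_def by blast+
  have nbx: "nb x \<subseteq> C" using cover_nb[OF C xc(2)] .
  have xcon: "x \<in> connectors C" using xc x2 by (simp add: connectors_def)
  have notx: "x \<notin> nb u" if "u \<notin> C" for u
    using cover_nb[OF C that] xc by blast
  have V': "V - C' = insert c (V - C - {x})"
    using c xc by (auto simp: C'_def)
  have con: "connectors C' = insert c (connectors C - {x})"
    unfolding connectors_def V' using c2 by auto
  show "direct_edges C' = {e \<in> direct_edges C. c \<notin> e} \<union> (\<lambda>u. {x, u}) ` (nb x - {c})" (is "_ = ?R")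
  proof
    show "direct_edges C' \<subseteq> ?R"
    proof
      fix e assume "e \<in> direct_edges C'"
      then obtain u v where uv: "e = {u, v}" "u \<in> C'" "v \<in> C'" "(u, v) \<in> E"
        by (auto simp: direct_edges_def)
      then have "u \<noteq> v" using E_irrefl by auto
      show "e \<in> ?R"
      proof (cases "u = x \<or> v = x")
        case True
        then show ?thesis
          using uv E_sym \<open>u \<noteq> v\<close> xc by (auto simp: nb_iff C'_def insert_commute)
      next
        case False
        then show ?thesis
          using uv by (auto simp: C'_def direct_edges_iff)
      qed
    qed
  next
    have "{x, u} \<in> direct_edges C'" if "u \<in> nb x - {c}" for u
      using that nbx by (auto simp: direct_edges_iff C'_def nb_iff)
    moreover have "{e \<in> direct_edges C. c \<notin> e} \<subseteq> direct_edges C'"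
      by (auto simp: direct_edges_def C'_def)
    ultimately show "?R \<subseteq> direct_edges C'" by blast
  qed
  have other: "nb u \<noteq> nb x" if "u \<in> connectors C - {x}" for u
    using inj xcon that by (auto dest: inj_onD)
  show "links C' = insert (nb c) (links C - {nb x})"
    unfolding links_def con using other xcon by auto
  have "nb u \<noteq> nb c" if "u \<in> connectors C" for u
    using notx[of u] xc that by (auto simp: connectors_def)
  then show "inj_on nb (connectors C')"
    using inj unfolding con by (auto simp: inj_on_def)
  show "pendants C' u = pendants C u" if u: "u \<in> C - {c}" for u
  proof -
    have "{w \<in> V - C'. nb w = {u}} = {w \<in> V - C. nb w = {u}}"
      unfolding V' using u xc by auto
    then show ?thesis by (simp add: pendants_def)
  qed
  have "{w \<in> V - C'. nb w = {x}} = {}"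
    unfolding V' using notx c2 by auto
  then show "pendants C' x = 0" by (simp only: pendants_def card.empty)
qed

end

section \<open>Koenig's theorem for trees and an extremal cover\<close>

context ftree
begin

text \<open>Leaf removal: if \<open>v\<close> has the single neighbour \<open>u\<close> in
  \<open>X\<close>, then \<open>u\<close> enters the cover with \<open>v\<close> as its partner, and
  both are deleted. A vertex without neighbours in \<open>X\<close> is simply dropped.\<close>

lemma Konig:
  assumes "X \<subseteq> V"
  shows "\<exists>C f. C \<subseteq> X \<and> (\<forall>u\<in>X. \<forall>v\<in>X. (u, v) \<in> E \<longrightarrow> u \<in> C \<or> v \<in> C) \<and>
    inj_on f C \<and> (\<forall>c\<in>C. f c \<in> nb c \<inter> (X - C))"
proof -
  have "finite X" using assms finite_V finite_subset by blast
  then show ?thesis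
    using assms
  proof (induction X rule: finite_psubset_induct)
    case (psubset X)
    show ?case
    proof (cases "X = {}")
      case False
      then obtain v where v: "v \<in> X" "card (nb v \<inter> X) \<le> 1"
        using degenerate psubset.prems by blast
      show ?thesis
      proof (cases "nb v \<inter> X = {}")
        case True
        obtain C f where "C \<subseteq> X - {v}" "\<forall>u\<in>X - {v}. \<forall>w\<in>X - {v}. (u, w) \<in> E \<longrightarrow> u \<in> C \<or> w \<in> C"
          "inj_on f C" "\<forall>c\<in>C. f c \<in> nb c \<inter> (X - {v} - C)"
          using psubset.IH[of "X - {v}"] psubset.prems v by blast
        moreover have "(v, w) \<notin> E" "(w, v) \<notin> E" if "w \<in> X" for w
          using True that E_sym[of w v] by (auto simp: nb_iff)
        ultimately show ?thesis
          by (intro exI[of _ C] exI[of _ f]) blast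
      next
        case nonempty: False
        then obtain u where u: "nb v \<inter> X = {u}"
          using v(2) finite_nb[of v] card_le_Suc0_iff_eq[of "nb v \<inter> X"] by auto
        then have "u \<in> nb v \<inter> X" by simp
        then have uX: "u \<in> X" "u \<noteq> v" "(u, v) \<in> E" "(v, u) \<in> E"
          using nb_irrefl[of v] E_sym[of v u] by (auto simp: nb_iff)
        let ?Y = "X - {u, v}"
        obtain C f where C: "C \<subseteq> ?Y" "\<forall>a\<in>?Y. \<forall>b\<in>?Y. (a, b) \<in> E \<longrightarrow> a \<in> C \<or> b \<in> C"
          "inj_on f C" "\<forall>c\<in>C. f c \<in> nb c \<inter> (?Y - C)"
          using psubset.IH[of ?Y] psubset.prems v by blast
        have onlyu: "b = u" if "(v, b) \<in> E" "b \<in> X" for b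
        proof -
          have "b \<in> nb v \<inter> X" using that by (simp add: nb_iff)
          then show ?thesis by (simp add: u)
        qed
        have "inj_on (f(u := v)) (insert u C)"
          using C by (auto simp: inj_on_def)
        moreover have "\<forall>c\<in>insert u C. (f(u := v)) c \<in> nb c \<inter> (X - insert u C)"
          using C uX v by (auto simp: nb_iff)
        moreover have "\<forall>a\<in>X. \<forall>b\<in>X. (a, b) \<in> E \<longrightarrow> a \<in> insert u C \<or> b \<in> insert u C"
        proof (intro ballI impI)
          fix a b assume ab: "a \<in> X" "b \<in> X" "(a, b) \<in> E"
          show "a \<in> insert u C \<or> b \<in> insert u C"
          proof (cases "a = v \<or> b = v")
            case True
            then show ?thesis using onlyu ab E_sym by auto
          next
            case False
            then show ?thesis using C(2) ab by auto
          qed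
        qed
        moreover have "insert u C \<subseteq> X" using C uX by auto
        ultimately show ?thesis by blast
      qed
    qed auto
  qed
qed

lemma saturated_cover_exists: "\<exists>C. saturated_cover C"
proof -
  obtain C f where C: "C \<subseteq> V" "\<forall>u\<in>V. \<forall>v\<in>V. (u, v) \<in> E \<longrightarrow> u \<in> C \<or> v \<in> C"
    and f: "inj_on f C" "\<forall>c\<in>C. f c \<in> nb c \<inter> (V - C)"
    using Konig[of V] by auto
  have "cover C" using C E_subset by (auto simp: cover_def)
  moreover have "\<forall>c\<in>C. f c \<in> nb c - C" using f by auto
  ultimately show ?thesis using f by (auto simp: saturated_cover_def)
qed

text \<open>Maximise the sum of degrees over all saturated covers. Exchanging \<open>c\<close> for
  \<open>x\<close> gives another saturated cover, so it cannot increase the sum.\<close>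

lemma optimal_cover:
  obtains C where "saturated_cover C"
    "\<And>c x. c \<in> C \<Longrightarrow> nb c - C = {x} \<Longrightarrow> card (nb x) \<le> card (nb c)"
proof -
  let ?w = "\<lambda>C. \<Sum>v\<in>C. card (nb v)"
  obtain C0 where C0: "saturated_cover C0" using saturated_cover_exists by blast
  have bound: "?w C < Suc (\<Sum>v\<in>V. card (nb v))" if "saturated_cover C" for C
    using that finite_V by (auto simp: saturated_cover_def cover_def less_Suc_eq_le intro!: sum_mono2)
  obtain C where C: "saturated_cover C" and max: "\<And>C'. saturated_cover C' \<Longrightarrow> ?w C' \<le> ?w C"
    using ex_has_greatest_nat[of saturated_cover C0 ?w "Suc (\<Sum>v\<in>V. card (nb v))"] C0 bound
    by (metis (no_types, lifting) less_imp_le)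
  have "card (nb x) \<le> card (nb c)" if c: "c \<in> C" and x: "nb c - C = {x}" for c x
  proof -
    have fin: "finite C" using C cover_finite by (auto simp: saturated_cover_def)
    have "x \<notin> C" using x by auto
    have "?w (insert x (C - {c})) \<le> ?w C"
      using max saturated_cover_exchange[OF C c x] by blast
    also have "?w C = card (nb c) + ?w (C - {c})"
      using fin c by (simp add: sum.remove)
    finally show ?thesis using fin \<open>x \<notin> C\<close> by simp
  qed
  then show ?thesis using that C by blast
qed

lemma nb_nonempty:
  assumes "v \<in> V" and "V \<noteq> {v}"
  shows "nb v \<noteq> {}"
proof -
  obtain u where "u \<in> V" "u \<noteq> v" using assms by auto
  then have "(v, u) \<in> E\<^sup>*" using connected assms by auto
  then show ?thesis
    using \<open>u \<noteq> v\<close> by (cases rule: converse_rtranclE) (auto simp: nb_iff)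
qed

text \<open>Two connectors with the same neighbours \<open>a\<close> and \<open>b\<close> would form
  a 4-cycle with them, in which every degree is at least two, against 1-degeneracy.\<close>

lemma inj_on_nb_connectors: "inj_on nb (connectors C)"
proof (rule inj_onI, rule ccontr)
  fix u v assume u: "u \<in> connectors C" and v: "v \<in> connectors C" and eq: "nb u = nb v" and "u \<noteq> v"
  obtain a b where ab: "a \<in> nb u" "b \<in> nb u" "a \<noteq> b"
    using u card_le_Suc0_iff_eq[OF finite_nb[of u]] by (auto simp: connectors_def)
  let ?X = "{u, v, a, b}"
  have two: "2 \<le> card A" if "x \<in> A" "y \<in> A" "x \<noteq> y" "finite A" for x y and A :: "'a set"
    using card_mono[of A "{x, y}"] that by auto
  have sub: "?X \<subseteq> V" using ab nb_subset u v by (auto simp: connectors_def)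
  have "2 \<le> card (nb w \<inter> ?X)" if "w \<in> ?X" for w
  proof -
    have "(a \<in> nb w \<and> b \<in> nb w) \<or> (u \<in> nb w \<and> v \<in> nb w)"
      using that ab eq nb_sym by blast
    then show ?thesis
      using two[of a "nb w \<inter> ?X" b] two[of u "nb w \<inter> ?X" v] ab \<open>u \<noteq> v\<close> by auto
  qed
  then show False
    using degenerate[OF sub] by fastforce
qed

end

section \<open>The tree structure on the cover\<close>

text \<open>Acyclicity is built into the growth: each new cover vertex attaches in exactly one way,
  along a direct edge, through a new connector, or to a connector that is already present.\<close>

inductive hypertree :: "'a set \<Rightarrow> 'a set set \<Rightarrow> 'a set set \<Rightarrow> bool" where
  single: "hypertree {r} {} {}"
| direct: "hypertree S D H \<Longrightarrow> c \<notin> S \<Longrightarrow> q \<in> S \<Longrightarrow> hypertree (insert c S) (insert {c, q} D) H"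
| link: "hypertree S D H \<Longrightarrow> c \<notin> S \<Longrightarrow> q \<in> S \<Longrightarrow> hypertree (insert c S) D (insert {c, q} H)"
| join: "hypertree S D H \<Longrightarrow> c \<notin> S \<Longrightarrow> h \<in> H \<Longrightarrow> hypertree (insert c S) D (insert (insert c h) (H - {h}))"

text \<open>Root the tree in the cover. The parent of a cover vertex, or its grandparent if the
  parent lies outside, is again a cover vertex. Removing a cover vertex with maximal
  \<open>d\<close> keeps the set closed under this relation, and its removal undoes one of the three
  ways of growing.\<close>

lemma (in ftree) cover_hypertree:
  assumes C: "cover C" and r: "r \<in> C"
  shows "hypertree C (direct_edges C) (links C)"
proof -
  have CV: "C \<subseteq> V" and rV: "r \<in> V" using C r by (auto simp: cover_def)
  obtain p and d :: "'a \<Rightarrow> nat" where pE: "\<And>v. v \<in> V - {r} \<Longrightarrow> (v, p v) \<in> E"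
    and pd: "\<And>v. v \<in> V - {r} \<Longrightarrow> d (p v) < d v"
    and Ep: "\<And>u v. (u, v) \<in> E \<Longrightarrow> u \<noteq> r \<and> v = p u \<or> v \<noteq> r \<and> u = p v"
    by (rule rooted[OF rV]) (rule that; assumption)
  \<comment> \<open>For a partial cover \<open>S\<close>: \<open>DS\<close> holds the direct edges
    to parents, \<open>KS\<close> the outside vertices that are parents of members of
    \<open>S\<close>, and \<open>N\<close> the part of such a vertex's neighbourhood that is known
    so far.\<close>
  define DS where "DS S = (\<lambda>c. {c, p c}) ` {c \<in> S - {r}. p c \<in> C}" for S
  define N where "N S u = insert (p u) {c \<in> S - {r}. p c = u}" for S u
  define KS where "KS S = p ` (S - {r}) - C" for S
  have parent: "p v \<in> V" if "v \<in> V - {r}" for v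
    using pE[OF that] E_subset by auto
  have grand: "p u \<in> C" "u \<in> V - {r}" if "u \<in> KS S" "S \<subseteq> C" for u S
  proof -
    obtain c where c: "c \<in> S - {r}" "u = p c" "u \<notin> C" using \<open>u \<in> KS S\<close> by (auto simp: KS_def)
    then show u: "u \<in> V - {r}" using parent[of c] CV \<open>S \<subseteq> C\<close> r by auto
    show "p u \<in> C" using pE[OF u] C c by (auto simp: cover_def)
  qed
  have main: "hypertree S (DS S) (N S ` KS S)"
    if "S \<subseteq> C" "r \<in> S" "\<forall>c\<in>S - {r}. p c \<in> S \<or> p c \<notin> C \<and> p (p c) \<in> S" for S
  proof -
    have "finite S" using \<open>S \<subseteq> C\<close> cover_finite[OF C] finite_subset by blast
    then show ?thesis
      using that
    proof (induction S rule: finite_psubset_induct)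
      case (psubset S)
      show ?case
      proof (cases "S = {r}")
        case True
        then show ?thesis by (simp add: DS_def KS_def hypertree.single)
      next
        case False
        then have "d ` (S - {r}) \<noteq> {}" using psubset.prems(2) by auto
        then have "Max (d ` (S - {r})) \<in> d ` (S - {r})"
          using psubset.hyps by (intro Max_in) auto
        then obtain c where c: "c \<in> S - {r}" "Max (d ` (S - {r})) = d c" by blast
        have max: "d y \<le> d c" if "y \<in> S - {r}" for y
          using that psubset.hyps c(2) Max_ge[of "d ` (S - {r})" "d y"] by auto
        note c = c(1)
        define S' where "S' = S - {c}"
        have S: "S = insert c S'" "c \<notin> S'" "r \<in> S'" "r \<noteq> c" "S' \<subseteq> C"
          using c psubset.prems by (auto simp: S'_def)
        have inV: "y \<in> V - {r}" if "y \<in> S - {r}" for y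
          using that psubset.prems(1) CV by auto
        have notpar: "p y \<noteq> c" "p y \<notin> C \<Longrightarrow> p (p y) \<noteq> c" if y: "y \<in> S - {r}" for y
        proof -
          show "p y \<noteq> c" using pd[OF inV[OF y]] max[OF y] by auto
          assume "p y \<notin> C"
          then have "p y \<in> V - {r}" using parent[OF inV[OF y]] r by auto
          then show "p (p y) \<noteq> c" using pd[of "p y"] pd[OF inV[OF y]] max[OF y] by auto
        qed
        have closed: "\<forall>y\<in>S' - {r}. p y \<in> S' \<or> p y \<notin> C \<and> p (p y) \<in> S'"
          using psubset.prems(3) notpar S by auto
        have IH: "hypertree S' (DS S') (N S' ` KS S')"
          using psubset.IH[of S'] closed S by auto
        show ?thesis
        proof (cases "p c \<in> C")
          case True
          then have "p c \<in> S'" using psubset.prems(3) c notpar[OF c] S by auto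
          moreover have "DS S = insert {c, p c} (DS S')"
            using True S by (auto simp: DS_def)
          moreover have KS: "KS S = KS S'" using True S by (auto simp: KS_def)
          moreover have "N S u = N S' u" if "u \<in> KS S" for u
            using that True S by (auto simp: N_def KS_def)
          then have "N S ` KS S = N S' ` KS S'" unfolding KS by simp
          ultimately show ?thesis
            using hypertree.direct[OF IH \<open>c \<notin> S'\<close>] S(1) by simp
        next
          case False
          then have q: "p (p c) \<in> S'"
            using psubset.prems(1,3) c notpar[OF c] S by auto
          have DS: "DS S = DS S'" using False S by (auto simp: DS_def)
          have same: "N S u = N S' u" if "u \<noteq> p c" for u
            using that S by (auto simp: N_def)
          have KS: "KS S = insert (p c) (KS S')" using False S by (auto simp: KS_def)
          show ?thesis
          proof (cases "p c \<in> KS S'")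
            case True
            have new: "N S (p c) = insert c (N S' (p c))" using S by (auto simp: N_def)
            \<comment> \<open>Removing the hyperedge of \<open>p c\<close> must not remove that of
              another connector \<open>u\<close>. If the two were equal, a child of each would be
              the parent of the other, and \<open>d\<close> would decrease around a circle.\<close>
            have neq: "N S' u \<noteq> N S' (p c)" if u: "u \<in> KS S'" "u \<noteq> p c" for u
            proof
              assume eq: "N S' u = N S' (p c)"
              obtain a where a: "a \<in> S' - {r}" "u = p a" using u by (auto simp: KS_def)
              obtain b where b: "b \<in> S' - {r}" "p c = p b" using True by (auto simp: KS_def)
              have "a \<in> N S' (p c)" "b \<in> N S' u" using a b eq by (auto simp: N_def)
              then have "a = p (p b)" "b = p (p a)" using a b u by (auto simp: N_def)
              moreover have "d (p a) < d a" "d (p b) < d b"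
                using a b S CV by (auto intro!: pd)
              moreover have "d (p (p a)) < d (p a)" "d (p (p b)) < d (p b)"
                using grand(2)[of u S'] grand(2)[of "p c" S'] True u a b S by (auto intro!: pd)
              ultimately show False by simp
            qed
            have "N S ` KS S = insert (N S (p c)) (N S' ` (KS S' - {p c}))"
            proof -
              have "N S ` KS S = insert (N S (p c)) (N S ` (KS S' - {p c}))" unfolding KS by auto
              also have "N S ` (KS S' - {p c}) = N S' ` (KS S' - {p c})"
                by (intro image_cong refl same) blast
              finally show ?thesis .
            qed
            also have "N S' ` (KS S' - {p c}) = N S' ` KS S' - {N S' (p c)}"
              using neq by auto
            finally show ?thesis
              using hypertree.join[OF IH \<open>c \<notin> S'\<close>, of "N S' (p c)"] True S(1) DS new by simp
          next
            case new: False
            have "p y \<noteq> p c" if "y \<in> S' - {r}" for y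
              using new False imageI[OF that, of p] by (auto simp: KS_def)
            then have "{y \<in> S - {r}. p y = p c} = {c}"
              using S by auto
            then have "N S (p c) = {c, p (p c)}"
              by (auto simp: N_def)
            moreover have "N S ` KS S' = N S' ` KS S'"
              by (intro image_cong refl same) (use new in blast)
            ultimately show ?thesis
              using hypertree.link[OF IH \<open>c \<notin> S'\<close> q] S(1) DS KS by simp
          qed
        qed
      qed
    qed
  qed
  have "p c \<in> C \<or> p c \<notin> C \<and> p (p c) \<in> C" if "c \<in> C - {r}" for c
    using grand(1)[of "p c" C] that by (auto simp: KS_def)
  then have "hypertree C (DS C) (N C ` KS C)"
    using main[of C] r by blast
  moreover have "DS C = direct_edges C"
  proof -
    have "DS C \<subseteq> direct_edges C"
      using pE CV by (auto simp: DS_def direct_edges_iff)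
    moreover have "direct_edges C \<subseteq> DS C"
    proof
      fix e assume "e \<in> direct_edges C"
      then obtain u v where "e = {u, v}" "u \<in> C" "v \<in> C" "(u, v) \<in> E"
        by (auto simp: direct_edges_def)
      then show "e \<in> DS C"
        using Ep[of u v] by (auto simp: DS_def)
    qed
    ultimately show ?thesis by simp
  qed
  moreover have "N C ` KS C = links C"
  proof -
    have nbu: "nb u = N C u" if u: "u \<in> V - C" for u
    proof
      have "u \<in> V - {r}" using u r by auto
      show "nb u \<subseteq> N C u"
      proof
        fix w assume w: "w \<in> nb u"
        then have "w \<in> C" using cover_nb[OF C] u by auto
        then show "w \<in> N C u" using w Ep[of u w] by (auto simp: nb_iff N_def)
      qed
      show "N C u \<subseteq> nb u"
        using pE[OF \<open>u \<in> V - {r}\<close>] pE E_sym CV by (auto simp: N_def nb_iff)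
    qed
    have "connectors C = KS C"
    proof
      show "connectors C \<subseteq> KS C"
      proof
        fix u assume u: "u \<in> connectors C"
        then have "u \<in> V - C" "2 \<le> card (N C u)" using nbu[of u] by (auto simp: connectors_def)
        moreover have "{c \<in> C - {r}. p c = u} \<noteq> {}"
        proof
          assume "{c \<in> C - {r}. p c = u} = {}"
          then have "N C u = {p u}" by (simp only: N_def)
          then show False using \<open>2 \<le> card (N C u)\<close> by simp
        qed
        ultimately show "u \<in> KS C" by (auto simp: KS_def)
      qed
      show "KS C \<subseteq> connectors C"
      proof
        fix u assume u: "u \<in> KS C"
        then obtain c where c: "c \<in> C - {r}" "u = p c" by (auto simp: KS_def)
        have uV: "u \<in> V - {r}" "u \<notin> C" using grand[OF u] u by (auto simp: KS_def)
        have "d (p u) < d u" "d u < d c" using pd[OF uV(1)] pd[of c] c CV by auto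
        then have "p u \<noteq> c" by auto
        moreover have "{p u, c} \<subseteq> nb u"
          using c nbu[of u] uV by (auto simp: N_def)
        ultimately have "2 \<le> card (nb u)"
          using card_mono[OF finite_nb[of u], of "{p u, c}"] by simp
        then show "u \<in> connectors C" using uV by (simp add: connectors_def)
      qed
    qed
    then show ?thesis
      using nbu by (auto simp: links_def connectors_def)
  qed
  ultimately show ?thesis by simp
qed

section \<open>Skeletons\<close>

text \<open>
  In \<open>shape s cs S D H\<close>, \<open>D\<close> holds the edges inside the cover \<open>S\<close> and \<open>H\<close> the neighbourhoods of the
  vertices outside the cover that have at least two neighbours. The first letter of a skeleton stands
  for a single vertex or star (\<open>S\<close>), an edge (\<open>E\<close>), a path (\<open>P\<close>), or a hyperedge with at least three
  vertices (\<open>H\<close>); then \<open>D\<close> is an edge inside the cover and \<open>C\<close> a connection through a vertex outside.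
\<close>

datatype skeleton = S1 | ED | EC | PDD | PDC | PCC | H3 | PDDD | PDDC | PDCD | PDCC | PCDC | PCCC | SDDD | SDDC | SDCC | SCCC | HD | HC | H4

primrec shape :: "skeleton \<Rightarrow> 'a list \<Rightarrow> 'a set \<Rightarrow> 'a set set \<Rightarrow> 'a set set \<Rightarrow> bool" where
  "shape S1 cs S D H \<longleftrightarrow> (\<exists>x. cs = [x] \<and> distinct cs \<and> S = set cs \<and> D = {} \<and> H = {})"
| "shape ED cs S D H \<longleftrightarrow> (\<exists>x y. cs = [x, y] \<and> distinct cs \<and> S = set cs \<and> D = {{x, y}} \<and> H = {})"
| "shape EC cs S D H \<longleftrightarrow> (\<exists>x y. cs = [x, y] \<and> distinct cs \<and> S = set cs \<and> D = {} \<and> H = {{x, y}})"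
| "shape PDD cs S D H \<longleftrightarrow> (\<exists>x y z. cs = [x, y, z] \<and> distinct cs \<and> S = set cs \<and> D = {{x, y}, {y, z}} \<and> H = {})"
| "shape PDC cs S D H \<longleftrightarrow> (\<exists>x y z. cs = [x, y, z] \<and> distinct cs \<and> S = set cs \<and> D = {{x, y}} \<and> H = {{y, z}})"
| "shape PCC cs S D H \<longleftrightarrow> (\<exists>x y z. cs = [x, y, z] \<and> distinct cs \<and> S = set cs \<and> D = {} \<and> H = {{x, y}, {y, z}})"
| "shape H3 cs S D H \<longleftrightarrow> (\<exists>x y z. cs = [x, y, z] \<and> distinct cs \<and> S = set cs \<and> D = {} \<and> H = {{x, y, z}})"
| "shape PDDD cs S D H \<longleftrightarrow> (\<exists>w x y z. cs = [w, x, y, z] \<and> distinct cs \<and> S = set cs \<and> D = {{w, x}, {x, y}, {y, z}} \<and> H = {})"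
| "shape PDDC cs S D H \<longleftrightarrow> (\<exists>w x y z. cs = [w, x, y, z] \<and> distinct cs \<and> S = set cs \<and> D = {{w, x}, {x, y}} \<and> H = {{y, z}})"
| "shape PDCD cs S D H \<longleftrightarrow> (\<exists>w x y z. cs = [w, x, y, z] \<and> distinct cs \<and> S = set cs \<and> D = {{w, x}, {y, z}} \<and> H = {{x, y}})"
| "shape PDCC cs S D H \<longleftrightarrow> (\<exists>w x y z. cs = [w, x, y, z] \<and> distinct cs \<and> S = set cs \<and> D = {{w, x}} \<and> H = {{x, y}, {y, z}})"
| "shape PCDC cs S D H \<longleftrightarrow> (\<exists>w x y z. cs = [w, x, y, z] \<and> distinct cs \<and> S = set cs \<and> D = {{x, y}} \<and> H = {{w, x}, {y, z}})"
| "shape PCCC cs S D H \<longleftrightarrow> (\<exists>w x y z. cs = [w, x, y, z] \<and> distinct cs \<and> S = set cs \<and> D = {} \<and> H = {{w, x}, {x, y}, {y, z}})"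
| "shape SDDD cs S D H \<longleftrightarrow> (\<exists>w x y z. cs = [w, x, y, z] \<and> distinct cs \<and> S = set cs \<and> D = {{w, x}, {w, y}, {w, z}} \<and> H = {})"
| "shape SDDC cs S D H \<longleftrightarrow> (\<exists>w x y z. cs = [w, x, y, z] \<and> distinct cs \<and> S = set cs \<and> D = {{w, x}, {w, y}} \<and> H = {{w, z}})"
| "shape SDCC cs S D H \<longleftrightarrow> (\<exists>w x y z. cs = [w, x, y, z] \<and> distinct cs \<and> S = set cs \<and> D = {{w, x}} \<and> H = {{w, y}, {w, z}})"
| "shape SCCC cs S D H \<longleftrightarrow> (\<exists>w x y z. cs = [w, x, y, z] \<and> distinct cs \<and> S = set cs \<and> D = {} \<and> H = {{w, x}, {w, y}, {w, z}})"
| "shape HD cs S D H \<longleftrightarrow> (\<exists>w x y z. cs = [w, x, y, z] \<and> distinct cs \<and> S = set cs \<and> D = {{y, z}} \<and> H = {{w, x, y}})"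
| "shape HC cs S D H \<longleftrightarrow> (\<exists>w x y z. cs = [w, x, y, z] \<and> distinct cs \<and> S = set cs \<and> D = {} \<and> H = {{w, x, y}, {y, z}})"
| "shape H4 cs S D H \<longleftrightarrow> (\<exists>w x y z. cs = [w, x, y, z] \<and> distinct cs \<and> S = set cs \<and> D = {} \<and> H = {{w, x, y, z}})"

text \<open>The lists are rearranged because every skeleton is fixed in one orientation: the role of
  a vertex is read off from its position. The same holds for the two lemmas that follow.\<close>

lemma shape_direct_cases:
  assumes "c \<notin> S"
  shows "shape S1 [x] S D H \<Longrightarrow> shape ED [x, c] (insert c S) (insert {c, x} D) H"
    and "shape ED [x, y] S D H \<Longrightarrow> shape PDD [y, x, c] (insert c S) (insert {c, x} D) H"
    and "shape ED [x, y] S D H \<Longrightarrow> shape PDD [x, y, c] (insert c S) (insert {c, y} D) H"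
    and "shape EC [x, y] S D H \<Longrightarrow> shape PDC [c, x, y] (insert c S) (insert {c, x} D) H"
    and "shape EC [x, y] S D H \<Longrightarrow> shape PDC [c, y, x] (insert c S) (insert {c, y} D) H"
    and "shape PDD [x, y, z] S D H \<Longrightarrow> shape PDDD [z, y, x, c] (insert c S) (insert {c, x} D) H"
    and "shape PDD [x, y, z] S D H \<Longrightarrow> shape SDDD [y, x, z, c] (insert c S) (insert {c, y} D) H"
    and "shape PDD [x, y, z] S D H \<Longrightarrow> shape PDDD [x, y, z, c] (insert c S) (insert {c, z} D) H"
    and "shape PDC [x, y, z] S D H \<Longrightarrow> shape PDDC [c, x, y, z] (insert c S) (insert {c, x} D) H"
    and "shape PDC [x, y, z] S D H \<Longrightarrow> shape SDDC [y, x, c, z] (insert c S) (insert {c, y} D) H"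
    and "shape PDC [x, y, z] S D H \<Longrightarrow> shape PDCD [x, y, z, c] (insert c S) (insert {c, z} D) H"
    and "shape PCC [x, y, z] S D H \<Longrightarrow> shape PDCC [c, x, y, z] (insert c S) (insert {c, x} D) H"
    and "shape PCC [x, y, z] S D H \<Longrightarrow> shape SDCC [y, c, x, z] (insert c S) (insert {c, y} D) H"
    and "shape PCC [x, y, z] S D H \<Longrightarrow> shape PDCC [c, z, y, x] (insert c S) (insert {c, z} D) H"
    and "shape H3 [x, y, z] S D H \<Longrightarrow> shape HD [y, z, x, c] (insert c S) (insert {c, x} D) H"
    and "shape H3 [x, y, z] S D H \<Longrightarrow> shape HD [x, z, y, c] (insert c S) (insert {c, y} D) H"
    and "shape H3 [x, y, z] S D H \<Longrightarrow> shape HD [x, y, z, c] (insert c S) (insert {c, z} D) H"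
  using assms by (auto simp: insert_commute doubleton_eq_iff)

lemma shape_link_cases:
  assumes "c \<notin> S"
  shows "shape S1 [x] S D H \<Longrightarrow> shape EC [x, c] (insert c S) D (insert {c, x} H)"
    and "shape ED [x, y] S D H \<Longrightarrow> shape PDC [y, x, c] (insert c S) D (insert {c, x} H)"
    and "shape ED [x, y] S D H \<Longrightarrow> shape PDC [x, y, c] (insert c S) D (insert {c, y} H)"
    and "shape EC [x, y] S D H \<Longrightarrow> shape PCC [y, x, c] (insert c S) D (insert {c, x} H)"
    and "shape EC [x, y] S D H \<Longrightarrow> shape PCC [x, y, c] (insert c S) D (insert {c, y} H)"
    and "shape PDD [x, y, z] S D H \<Longrightarrow> shape PDDC [z, y, x, c] (insert c S) D (insert {c, x} H)"
    and "shape PDD [x, y, z] S D H \<Longrightarrow> shape SDDC [y, x, z, c] (insert c S) D (insert {c, y} H)"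
    and "shape PDD [x, y, z] S D H \<Longrightarrow> shape PDDC [x, y, z, c] (insert c S) D (insert {c, z} H)"
    and "shape PDC [x, y, z] S D H \<Longrightarrow> shape PCDC [z, y, x, c] (insert c S) D (insert {c, x} H)"
    and "shape PDC [x, y, z] S D H \<Longrightarrow> shape SDCC [y, x, z, c] (insert c S) D (insert {c, y} H)"
    and "shape PDC [x, y, z] S D H \<Longrightarrow> shape PDCC [x, y, z, c] (insert c S) D (insert {c, z} H)"
    and "shape PCC [x, y, z] S D H \<Longrightarrow> shape PCCC [z, y, x, c] (insert c S) D (insert {c, x} H)"
    and "shape PCC [x, y, z] S D H \<Longrightarrow> shape SCCC [y, x, z, c] (insert c S) D (insert {c, y} H)"
    and "shape PCC [x, y, z] S D H \<Longrightarrow> shape PCCC [x, y, z, c] (insert c S) D (insert {c, z} H)"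
    and "shape H3 [x, y, z] S D H \<Longrightarrow> shape HC [y, z, x, c] (insert c S) D (insert {c, x} H)"
    and "shape H3 [x, y, z] S D H \<Longrightarrow> shape HC [x, z, y, c] (insert c S) D (insert {c, y} H)"
    and "shape H3 [x, y, z] S D H \<Longrightarrow> shape HC [x, y, z, c] (insert c S) D (insert {c, z} H)"
  using assms by (auto simp: insert_commute doubleton_eq_iff)

lemma shape_join_cases:
  assumes "c \<notin> S"
  shows "shape EC [x, y] S D H \<Longrightarrow> shape H3 [x, y, c] (insert c S) D (insert (insert c {x, y}) (H - {{x, y}}))"
    and "shape PDC [x, y, z] S D H \<Longrightarrow> shape HD [z, c, y, x] (insert c S) D (insert (insert c {y, z}) (H - {{y, z}}))"
    and "shape PCC [x, y, z] S D H \<Longrightarrow> shape HC [x, c, y, z] (insert c S) D (insert (insert c {x, y}) (H - {{x, y}}))"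
    and "shape PCC [x, y, z] S D H \<Longrightarrow> shape HC [z, c, y, x] (insert c S) D (insert (insert c {y, z}) (H - {{y, z}}))"
    and "shape H3 [x, y, z] S D H \<Longrightarrow> shape H4 [x, y, z, c] (insert c S) D (insert (insert c {x, y, z}) (H - {{x, y, z}}))"
  using assms by (auto simp: insert_commute doubleton_eq_iff)

primrec skeleton_size :: "skeleton \<Rightarrow> nat" where
  "skeleton_size S1 = 1" | "skeleton_size ED = 2" | "skeleton_size EC = 2"
| "skeleton_size PDD = 3" | "skeleton_size PDC = 3" | "skeleton_size PCC = 3" | "skeleton_size H3 = 3"
| "skeleton_size PDDD = 4" | "skeleton_size PDDC = 4" | "skeleton_size PDCD = 4" | "skeleton_size PDCC = 4"
| "skeleton_size PCDC = 4" | "skeleton_size PCCC = 4" | "skeleton_size SDDD = 4" | "skeleton_size SDDC = 4"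
| "skeleton_size SDCC = 4" | "skeleton_size SCCC = 4" | "skeleton_size HD = 4" | "skeleton_size HC = 4"
| "skeleton_size H4 = 4"

lemma shapeD:
  assumes "shape s cs S D H"
  shows "S = set cs" "distinct cs" "length cs = skeleton_size s"
  using assms by (cases s; auto)+

text \<open>For the \<open>join\<close> step: these are the only hyperedges that a further cover
  vertex can enter.\<close>

lemma shape_links:
  assumes "shape s cs S D H" and "h \<in> H" and "skeleton_size s \<le> 3"
  shows "s = EC \<and> h = {cs ! 0, cs ! 1} \<or> s = PDC \<and> h = {cs ! 1, cs ! 2} \<or>
    s = PCC \<and> (h = {cs ! 0, cs ! 1} \<or> h = {cs ! 1, cs ! 2}) \<or> s = H3 \<and> h = {cs ! 0, cs ! 1, cs ! 2}"
  using assms by (cases s) auto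

lemma hypertree_nonempty: "hypertree S D H \<Longrightarrow> finite S \<and> S \<noteq> {}"
  by (induction rule: hypertree.induct) auto

text \<open>The last vertex is attached to a skeleton with at most three vertices, so the finite
  lists of cases above are exhaustive.\<close>

lemma hypertree_shape:
  assumes "hypertree S D H" and "card S \<le> 4"
  shows "\<exists>s cs. shape s cs S D H"
  using assms
proof (induction rule: hypertree.induct)
  case (single r)
  have "shape S1 [r] {r} {} {}" by simp
  then show ?case by blast
next
  case (direct S D H c q)
  have "finite S" using hypertree_nonempty[OF direct.hyps(1)] ..
  then have S: "card S \<le> 3" "finite S" using direct.hyps(2) direct.prems by auto
  with direct obtain s cs where sh: "shape s cs S D H" by fastforce
  note cs = shapeD[OF sh]
  have "skeleton_size s \<le> 3" using S cs by (metis distinct_card)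
  then consider x where "cs = [x]" | x y where "cs = [x, y]" | x y z where "cs = [x, y, z]"
    using cs(3) by (cases s) (auto simp: length_Suc_conv numeral_eq_Suc)
  moreover have "q \<in> set cs" using \<open>q \<in> S\<close> cs(1) by simp
  ultimately show ?case
    using sh cs(3)
    by cases (cases s; auto simp del: shape.simps dest: shape_direct_cases[OF \<open>c \<notin> S\<close>])+
next
  case (link S D H c q)
  have "finite S" using hypertree_nonempty[OF link.hyps(1)] ..
  then have S: "card S \<le> 3" "finite S" using link.hyps(2) link.prems by auto
  with link obtain s cs where sh: "shape s cs S D H" by fastforce
  note cs = shapeD[OF sh]
  have "skeleton_size s \<le> 3" using S cs by (metis distinct_card)
  then consider x where "cs = [x]" | x y where "cs = [x, y]" | x y z where "cs = [x, y, z]"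
    using cs(3) by (cases s) (auto simp: length_Suc_conv numeral_eq_Suc)
  moreover have "q \<in> set cs" using \<open>q \<in> S\<close> cs(1) by simp
  ultimately show ?case
    using sh cs(3)
    by cases (cases s; auto simp del: shape.simps dest: shape_link_cases[OF \<open>c \<notin> S\<close>])+
next
  case (join S D H c h)
  have "finite S" using hypertree_nonempty[OF join.hyps(1)] ..
  then have S: "card S \<le> 3" "finite S" using join.hyps(2) join.prems by auto
  with join obtain s cs where sh: "shape s cs S D H" by fastforce
  note cs = shapeD[OF sh]
  have size: "skeleton_size s \<le> 3" using S cs by (metis distinct_card)
  then consider x where "cs = [x]" | x y where "cs = [x, y]" | x y z where "cs = [x, y, z]"
    using cs(3) by (cases s) (auto simp: length_Suc_conv numeral_eq_Suc)
  then show ?case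
    using sh cs(3) shape_links[OF sh \<open>h \<in> H\<close> size]
    by cases (auto simp del: shape.simps dest: shape_join_cases[OF \<open>c \<notin> S\<close>])+
qed

section \<open>Leaf conditions and exchanges of the cover\<close>

text \<open>Positions that do not occur may be leafless. The conditions on the third vertex of
  \<open>PDDC\<close> and \<open>PDCD\<close> and on the two inner vertices of \<open>PCDC\<close>
  are achieved by exchanging or reversing the cover in \<open>canonical_form\<close>; without them
  the same tree could fit two skeletons, or one skeleton in two ways.\<close>

primrec admissible :: "skeleton \<Rightarrow> nat list \<Rightarrow> bool" where
  "admissible S1 a \<longleftrightarrow> True"
| "admissible ED a \<longleftrightarrow> 1 \<le> a ! 0 \<and> 1 \<le> a ! 1"
| "admissible EC a \<longleftrightarrow> 1 \<le> a ! 0 \<and> 1 \<le> a ! 1"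
| "admissible PDD a \<longleftrightarrow> 1 \<le> a ! 0 \<and> 1 \<le> a ! 1 \<and> 1 \<le> a ! 2"
| "admissible PDC a \<longleftrightarrow> 1 \<le> a ! 0 \<and> 1 \<le> a ! 2"
| "admissible PCC a \<longleftrightarrow> 1 \<le> a ! 0 \<and> 1 \<le> a ! 2"
| "admissible H3 a \<longleftrightarrow> 1 \<le> a ! 0 \<and> 1 \<le> a ! 1 \<and> 1 \<le> a ! 2"
| "admissible PDDD a \<longleftrightarrow> 1 \<le> a ! 0 \<and> 1 \<le> a ! 1 \<and> 1 \<le> a ! 2 \<and> 1 \<le> a ! 3"
| "admissible PDDC a \<longleftrightarrow> 1 \<le> a ! 0 \<and> 1 \<le> a ! 1 \<and> 1 \<le> a ! 2 \<and> 1 \<le> a ! 3"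
| "admissible PDCD a \<longleftrightarrow> 1 \<le> a ! 0 \<and> 1 \<le> a ! 2 \<and> 1 \<le> a ! 3"
| "admissible PDCC a \<longleftrightarrow> 1 \<le> a ! 0 \<and> 1 \<le> a ! 3"
| "admissible PCDC a \<longleftrightarrow> 1 \<le> a ! 0 \<and> 1 \<le> a ! 1 \<and> 1 \<le> a ! 2 \<and> 1 \<le> a ! 3"
| "admissible PCCC a \<longleftrightarrow> 1 \<le> a ! 0 \<and> 1 \<le> a ! 3"
| "admissible SDDD a \<longleftrightarrow> 1 \<le> a ! 0 \<and> 1 \<le> a ! 1 \<and> 1 \<le> a ! 2 \<and> 1 \<le> a ! 3"
| "admissible SDDC a \<longleftrightarrow> 1 \<le> a ! 1 \<and> 1 \<le> a ! 2 \<and> 1 \<le> a ! 3"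
| "admissible SDCC a \<longleftrightarrow> 1 \<le> a ! 1 \<and> 1 \<le> a ! 2 \<and> 1 \<le> a ! 3"
| "admissible SCCC a \<longleftrightarrow> 1 \<le> a ! 1 \<and> 1 \<le> a ! 2 \<and> 1 \<le> a ! 3"
| "admissible HD a \<longleftrightarrow> 1 \<le> a ! 0 \<and> 1 \<le> a ! 1 \<and> 1 \<le> a ! 2 \<and> 1 \<le> a ! 3"
| "admissible HC a \<longleftrightarrow> 1 \<le> a ! 0 \<and> 1 \<le> a ! 1 \<and> 1 \<le> a ! 3"
| "admissible H4 a \<longleftrightarrow> 1 \<le> a ! 0 \<and> 1 \<le> a ! 1 \<and> 1 \<le> a ! 2 \<and> 1 \<le> a ! 3"

context fgraph
begin

text \<open>Injectivity of \<open>nb\<close> on the connectors and the absence of isolated outside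
  vertices make the shape and the leaf numbers a complete description of the graph.\<close>

definition skeleton_cover :: "skeleton \<Rightarrow> 'a list \<Rightarrow> bool" where
  "skeleton_cover s cs \<longleftrightarrow> cover (set cs) \<and> inj_on nb (connectors (set cs)) \<and>
    (\<forall>u\<in>V - set cs. nb u \<noteq> {}) \<and> shape s cs (set cs) (direct_edges (set cs)) (links (set cs))"

abbreviation pendant_list :: "'a list \<Rightarrow> nat list" where
  "pendant_list cs \<equiv> map (pendants (set cs)) cs"

lemma nb_Int_cover: "c \<in> C \<Longrightarrow> nb c \<inter> C = {v. {c, v} \<in> direct_edges C}"
  by (auto simp: direct_edges_iff nb_iff)

lemma no_pendants:
  assumes C: "cover C" and c: "c \<in> C" and p: "pendants C c = 0"
  shows "nb c - C = {u \<in> connectors C. c \<in> nb u}"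
proof -
  have fin: "finite {u \<in> V - C. nb u = {c}}" using finite_V by simp
  have "u \<in> connectors C" if u: "u \<in> nb c - C" for u
  proof -
    have "u \<in> V - C" using u nb_subset by blast
    moreover have "nb u \<noteq> {c}"
      using p fin \<open>u \<in> V - C\<close> by (auto simp: pendants_def)
    moreover have "c \<in> nb u" using u nb_sym by blast
    ultimately have "nb u - {c} \<noteq> {}" by auto
    then obtain v where "v \<in> nb u" "v \<noteq> c" by auto
    then have "2 \<le> card (nb u)"
      using card_mono[OF finite_nb[of u], of "{c, v}"] \<open>c \<in> nb u\<close> by simp
    then show ?thesis using \<open>u \<in> V - C\<close> by (simp add: connectors_def)
  qed
  then show ?thesis
    using nb_sym by (auto simp: connectors_def)
qed

text \<open>Connectors are determined by their neighbourhoods, so the connectors at \<open>c\<close>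
  correspond to the links through \<open>c\<close>; without leaves at \<open>c\<close> nothing else
  lies outside.\<close>

lemma single_link:
  assumes C: "cover C" and inj: "inj_on nb (connectors C)" and c: "c \<in> C" and p: "pendants C c = 0"
    and h: "{g \<in> links C. c \<in> g} = {h}"
  obtains x where "nb c - C = {x}" "nb x = h" "x \<in> connectors C"
proof -
  have "h \<in> links C" "c \<in> h" using h by auto
  then obtain x where x: "x \<in> connectors C" "nb x = h" by (auto simp: links_def)
  have "u = x" if "u \<in> connectors C" "c \<in> nb u" for u
  proof -
    have "nb u \<in> {g \<in> links C. c \<in> g}" using that by (auto simp: links_def)
    then have "nb u = nb x" using h x by simp
    then show ?thesis using inj that x by (auto dest: inj_onD)
  qed
  then have "{u \<in> connectors C. c \<in> nb u} = {x}"
    using x \<open>c \<in> h\<close> by blast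
  then have "nb c - C = {x}"
    by (simp only: no_pendants[OF C c p])
  then show ?thesis using that x by blast
qed

text \<open>A leafless cover vertex with one link and one direct edge has degree two. Trading it for
  its connector \<open>x\<close> swaps the two kinds of connection: the direct edge
  \<open>{c, v}\<close> becomes the link \<open>{v, x}\<close>, and the link \<open>h\<close>
  becomes direct edges from \<open>x\<close>.\<close>

lemma exchange:
  assumes C: "cover C" and inj: "inj_on nb (connectors C)" and nonempty: "\<forall>u\<in>V - C. nb u \<noteq> {}"
    and c: "c \<in> C" and p: "pendants C c = 0"
    and h: "{g \<in> links C. c \<in> g} = {h}" and v: "{w. {c, w} \<in> direct_edges C} = {v}"
  obtains x where "x \<notin> C" "cover (insert x (C - {c}))"
    "direct_edges (insert x (C - {c})) = {e \<in> direct_edges C. c \<notin> e} \<union> (\<lambda>w. {x, w}) ` (h - {c})"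
    "links (insert x (C - {c})) = insert {v, x} (links C - {h})"
    "inj_on nb (connectors (insert x (C - {c})))"
    "\<forall>u\<in>V - insert x (C - {c}). nb u \<noteq> {}"
    "\<And>w. w \<in> C - {c} \<Longrightarrow> pendants (insert x (C - {c})) w = pendants C w"
    "pendants (insert x (C - {c})) x = 0"
proof -
  obtain x where x: "nb c - C = {x}" "nb x = h" "x \<in> connectors C"
    using single_link[OF C inj c p h] .
  have "nb c = (nb c - C) \<union> (nb c \<inter> C)" by blast
  then have nbc: "nb c = {v, x}"
    using x(1) v nb_Int_cover[OF c] by auto
  have "x \<notin> C" "v \<in> C" using x(1) v by (auto simp: direct_edges_iff)
  then have "v \<noteq> x" by auto
  then have two: "2 \<le> card (nb c)" "2 \<le> card (nb x)"
    using nbc x(3) by (auto simp: connectors_def)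
  note str = exchange_structure[OF C c x(1) two(2,1) inj]
  have "\<forall>u\<in>V - insert x (C - {c}). nb u \<noteq> {}"
    using nonempty nbc by auto
  then show ?thesis
    using that[OF \<open>x \<notin> C\<close> cover_exchange[OF C c x(1)]] str nbc x(2) by simp
qed

end

context ftree
begin

lemma skeleton_cover_exists:
  assumes "cover C" and "C \<noteq> {}" and "card C \<le> 4"
  obtains s cs where "set cs = C" "skeleton_cover s cs"
proof -
  obtain r where r: "r \<in> C" using assms by auto
  obtain s cs where sh: "shape s cs C (direct_edges C) (links C)"
    using hypertree_shape[OF cover_hypertree[OF assms(1) r] assms(3)] by blast
  have "nb u \<noteq> {}" if "u \<in> V - C" for u
    using nb_nonempty[of u] that r assms(1) by (auto simp: cover_def)
  then have "skeleton_cover s cs"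
    using assms(1) sh inj_on_nb_connectors shapeD(1)[OF sh] by (auto simp: skeleton_cover_def)
  then show ?thesis using that shapeD(1)[OF sh] by metis
qed

text \<open>Saturation gives \<open>c\<close> a neighbour outside the cover, and without links only
  a leaf qualifies.\<close>

lemma pendants_pos_unlinked:
  assumes "saturated_cover C" and "c \<in> C" and "{h \<in> links C. c \<in> h} = {}"
  shows "1 \<le> pendants C c"
proof (rule ccontr)
  assume "\<not> ?thesis"
  then have "nb c - C = {u \<in> connectors C. c \<in> nb u}"
    using no_pendants assms by (auto simp: saturated_cover_def)
  then have "nb c - C = {}" using assms(3) by (auto simp: links_def)
  then show False using saturated_cover_nonempty assms by blast
qed

text \<open>A leafless \<open>c\<close> would have one connector as its only outside neighbour, so
  its degree would be at most one more than the number of its direct edges. The extremal cover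
  bounds the degree \<open>card h\<close> of that connector by the degree of
  \<open>c\<close>.\<close>

lemma pendants_pos_linked:
  assumes C: "saturated_cover C"
    and opt: "\<And>c x. c \<in> C \<Longrightarrow> nb c - C = {x} \<Longrightarrow> card (nb x) \<le> card (nb c)"
    and c: "c \<in> C" and h: "{g \<in> links C. c \<in> g} = {h}"
    and card: "Suc (card {v. {c, v} \<in> direct_edges C}) < card h"
  shows "1 \<le> pendants C c"
proof (rule ccontr)
  assume "\<not> ?thesis"
  then have p: "pendants C c = 0" by simp
  have cov: "cover C" using C by (simp add: saturated_cover_def)
  obtain x where x: "nb c - C = {x}" "nb x = h"
    using single_link[OF cov inj_on_nb_connectors c p h] .
  have "card (nb c) \<le> card (nb c \<inter> C) + card (nb c - C)"
    by (metis card_Un_le Int_Diff_Un)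
  then show False
    using opt[OF c x(1)] card x unfolding nb_Int_cover[OF c] by simp
qed

text \<open>Two leafless vertices with the same single link would compete for the same connector in
  the saturating matching.\<close>

lemma pendants_pos_Hall:
  assumes C: "saturated_cover C" and c: "c \<in> C" "c' \<in> C" "c \<noteq> c'"
    and h: "{g \<in> links C. c \<in> g} = {h}" "{g \<in> links C. c' \<in> g} = {h}"
    and p: "pendants C c = 0"
  shows "1 \<le> pendants C c'"
proof (rule ccontr)
  assume "\<not> ?thesis"
  then have p': "pendants C c' = 0" by simp
  have cov: "cover C" using C by (simp add: saturated_cover_def)
  obtain x where x: "nb c - C = {x}" "nb x = h" "x \<in> connectors C"
    using single_link[OF cov inj_on_nb_connectors c(1) p h(1)] .
  obtain y where y: "nb c' - C = {y}" "nb y = h" "y \<in> connectors C"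
    using single_link[OF cov inj_on_nb_connectors c(2) p' h(2)] .
  have "x = y" using x y by (intro inj_onD[OF inj_on_nb_connectors[of C]]) auto
  then show False
    using saturated_cover_Hall[OF C c(1,2,3), of x] x y by simp
qed

end

context fgraph
begin

lemma skeleton_coverI:
  assumes "cover (set cs)" "inj_on nb (connectors (set cs))" "\<forall>u\<in>V - set cs. nb u \<noteq> {}"
    and "shape s cs (set cs) (direct_edges (set cs)) (links (set cs))"
  shows "skeleton_cover s cs"
  using assms by (simp add: skeleton_cover_def)

text \<open>If two adjacent vertices of degree two join two supports, either of them may serve in the
  cover.\<close>

lemma exchange_PDDC:
  assumes sc: "skeleton_cover PDDC [w, x, y, z]" and p: "pendants {w, x, y, z} y = 0"
  shows "\<exists>cs. skeleton_cover PDCD cs \<and> pendant_list cs =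
    [pendants {w, x, y, z} z, 0, pendants {w, x, y, z} x, pendants {w, x, y, z} w]"
proof -
  let ?C = "{w, x, y, z}"
  have d: "distinct [w, x, y, z]" and D: "direct_edges ?C = {{w, x}, {x, y}}" and H: "links ?C = {{y, z}}"
    and cov: "cover ?C" and inj: "inj_on nb (connectors ?C)" and ne: "\<forall>u\<in>V - ?C. nb u \<noteq> {}"
    using sc by (auto simp: skeleton_cover_def)
  have h: "{g \<in> links ?C. y \<in> g} = {{y, z}}" using d H by auto
  have v: "{u. {y, u} \<in> direct_edges ?C} = {x}" using d D by (auto simp: doubleton_eq_iff)
  obtain t where t: "t \<notin> ?C" "cover (insert t (?C - {y}))"
    "direct_edges (insert t (?C - {y})) = {e \<in> direct_edges ?C. y \<notin> e} \<union> (\<lambda>u. {t, u}) ` ({y, z} - {y})"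
    "links (insert t (?C - {y})) = insert {x, t} (links ?C - {{y, z}})"
    "inj_on nb (connectors (insert t (?C - {y})))"
    "\<forall>u\<in>V - insert t (?C - {y}). nb u \<noteq> {}"
    "\<And>u. u \<in> ?C - {y} \<Longrightarrow> pendants (insert t (?C - {y})) u = pendants ?C u"
    "pendants (insert t (?C - {y})) t = 0"
    using exchange[OF cov inj ne _ p h v] by blast
  have eq: "insert t (?C - {y}) = set [z, t, x, w]" using d by auto
  have simps: "{e \<in> direct_edges ?C. y \<notin> e} = {{w, x}}" "{y, z} - {y} = {z}" "links ?C - {{y, z}} = {}"
    unfolding D H using d by (auto simp: doubleton_eq_iff)
  note t = t[unfolded simps eq]
  have "skeleton_cover PDCD [z, t, x, w]"
    using t(2,5,6) by (rule skeleton_coverI) (use t(1,3,4) d in \<open>simp add: insert_commute, blast?\<close>)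
  moreover have "pendant_list [z, t, x, w] = [pendants ?C z, 0, pendants ?C x, pendants ?C w]"
    using t(7,8) d by auto
  ultimately show ?thesis by (intro exI[of _ "[z, t, x, w]"] conjI)
qed

text \<open>Serves to remove leafless inner vertices from \<open>PCDC\<close>: such a tree is also a
  \<open>PDCC\<close>.\<close>

lemma exchange_PCDC:
  assumes sc: "skeleton_cover PCDC [w, x, y, z]" and p: "pendants {w, x, y, z} x = 0"
  shows "\<exists>t. skeleton_cover PDCC [w, t, y, z] \<and> pendant_list [w, t, y, z] =
    [pendants {w, x, y, z} w, 0, pendants {w, x, y, z} y, pendants {w, x, y, z} z]"
proof -
  let ?C = "{w, x, y, z}"
  have d: "distinct [w, x, y, z]" and D: "direct_edges ?C = {{x, y}}" and H: "links ?C = {{w, x}, {y, z}}"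
    and cov: "cover ?C" and inj: "inj_on nb (connectors ?C)" and ne: "\<forall>u\<in>V - ?C. nb u \<noteq> {}"
    using sc by (auto simp: skeleton_cover_def)
  have h: "{g \<in> links ?C. x \<in> g} = {{w, x}}" using d H by auto
  have v: "{u. {x, u} \<in> direct_edges ?C} = {y}" using d D by (auto simp: doubleton_eq_iff)
  obtain t where t: "t \<notin> ?C" "cover (insert t (?C - {x}))"
    "direct_edges (insert t (?C - {x})) = {e \<in> direct_edges ?C. x \<notin> e} \<union> (\<lambda>u. {t, u}) ` ({w, x} - {x})"
    "links (insert t (?C - {x})) = insert {y, t} (links ?C - {{w, x}})"
    "inj_on nb (connectors (insert t (?C - {x})))"
    "\<forall>u\<in>V - insert t (?C - {x}). nb u \<noteq> {}"
    "\<And>u. u \<in> ?C - {x} \<Longrightarrow> pendants (insert t (?C - {x})) u = pendants ?C u"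
    "pendants (insert t (?C - {x})) t = 0"
    using exchange[OF cov inj ne _ p h v] by blast
  have eq: "insert t (?C - {x}) = set [w, t, y, z]" using d by auto
  have simps: "{e \<in> direct_edges ?C. x \<notin> e} = {}" "{w, x} - {x} = {w}" "links ?C - {{w, x}} = {{y, z}}"
    unfolding D H using d by (auto simp: doubleton_eq_iff)
  note t = t[unfolded simps eq]
  have "skeleton_cover PDCC [w, t, y, z]"
    using t(2,5,6) by (rule skeleton_coverI) (use t(1,3,4) d in \<open>simp add: insert_commute, blast?\<close>)
  moreover have "pendant_list [w, t, y, z] = [pendants ?C w, 0, pendants ?C y, pendants ?C z]"
    using t(7,8) d by auto
  ultimately show ?thesis by (intro exI[of _ t] conjI)
qed

text \<open>The converse of \<open>exchange_PCDC\<close>. Together they yield the hidden symmetry of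
  \<open>PDCC\<close> in \<open>exchange_PDCC_twice\<close>.\<close>

lemma exchange_PDCC:
  assumes sc: "skeleton_cover PDCC [w, x, y, z]" and p: "pendants {w, x, y, z} x = 0"
  shows "\<exists>t. skeleton_cover PCDC [w, t, y, z] \<and> pendant_list [w, t, y, z] =
    [pendants {w, x, y, z} w, 0, pendants {w, x, y, z} y, pendants {w, x, y, z} z]"
proof -
  let ?C = "{w, x, y, z}"
  have d: "distinct [w, x, y, z]" and D: "direct_edges ?C = {{w, x}}" and H: "links ?C = {{x, y}, {y, z}}"
    and cov: "cover ?C" and inj: "inj_on nb (connectors ?C)" and ne: "\<forall>u\<in>V - ?C. nb u \<noteq> {}"
    using sc by (auto simp: skeleton_cover_def)
  have h: "{g \<in> links ?C. x \<in> g} = {{x, y}}" using d H by auto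
  have v: "{u. {x, u} \<in> direct_edges ?C} = {w}" using d D by (auto simp: doubleton_eq_iff)
  obtain t where t: "t \<notin> ?C" "cover (insert t (?C - {x}))"
    "direct_edges (insert t (?C - {x})) = {e \<in> direct_edges ?C. x \<notin> e} \<union> (\<lambda>u. {t, u}) ` ({x, y} - {x})"
    "links (insert t (?C - {x})) = insert {w, t} (links ?C - {{x, y}})"
    "inj_on nb (connectors (insert t (?C - {x})))"
    "\<forall>u\<in>V - insert t (?C - {x}). nb u \<noteq> {}"
    "\<And>u. u \<in> ?C - {x} \<Longrightarrow> pendants (insert t (?C - {x})) u = pendants ?C u"
    "pendants (insert t (?C - {x})) t = 0"
    using exchange[OF cov inj ne _ p h v] by blast
  have eq: "insert t (?C - {x}) = set [w, t, y, z]" using d by auto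
  have simps: "{e \<in> direct_edges ?C. x \<notin> e} = {}" "{x, y} - {x} = {y}" "links ?C - {{x, y}} = {{y, z}}"
    unfolding D H using d by (auto simp: doubleton_eq_iff)
  note t = t[unfolded simps eq]
  have "skeleton_cover PCDC [w, t, y, z]"
    using t(2,5,6) by (rule skeleton_coverI) (use t(1,3,4) d in \<open>simp add: insert_commute, blast?\<close>)
  moreover have "pendant_list [w, t, y, z] = [pendants ?C w, 0, pendants ?C y, pendants ?C z]"
    using t(7,8) d by auto
  ultimately show ?thesis by (intro exI[of _ t] conjI)
qed

text \<open>With a leafless middle vertex the ends \<open>x\<close> and \<open>z\<close> are joined
  by a path with two inner vertices, either of which may serve as the middle of the cover. Reversing
  this path is a symmetry that does not preserve the cover.\<close>

lemma exchange_PDC: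
  assumes sc: "skeleton_cover PDC [x, y, z]" and p: "pendants {x, y, z} y = 0"
  shows "\<exists>cs. skeleton_cover PDC cs \<and> pendant_list cs =
    [pendants {x, y, z} z, 0, pendants {x, y, z} x]"
proof -
  let ?C = "{x, y, z}"
  have d: "distinct [x, y, z]" and D: "direct_edges ?C = {{x, y}}" and H: "links ?C = {{y, z}}"
    and cov: "cover ?C" and inj: "inj_on nb (connectors ?C)" and ne: "\<forall>u\<in>V - ?C. nb u \<noteq> {}"
    using sc by (auto simp: skeleton_cover_def)
  have h: "{g \<in> links ?C. y \<in> g} = {{y, z}}" using d H by auto
  have v: "{u. {y, u} \<in> direct_edges ?C} = {x}" using d D by (auto simp: doubleton_eq_iff)
  obtain t where t: "t \<notin> ?C" "cover (insert t (?C - {y}))"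
    "direct_edges (insert t (?C - {y})) = {e \<in> direct_edges ?C. y \<notin> e} \<union> (\<lambda>u. {t, u}) ` ({y, z} - {y})"
    "links (insert t (?C - {y})) = insert {x, t} (links ?C - {{y, z}})"
    "inj_on nb (connectors (insert t (?C - {y})))"
    "\<forall>u\<in>V - insert t (?C - {y}). nb u \<noteq> {}"
    "\<And>u. u \<in> ?C - {y} \<Longrightarrow> pendants (insert t (?C - {y})) u = pendants ?C u"
    "pendants (insert t (?C - {y})) t = 0"
    using exchange[OF cov inj ne _ p h v] by blast
  have eq: "insert t (?C - {y}) = set [z, t, x]" using d by auto
  have simps: "{e \<in> direct_edges ?C. y \<notin> e} = {}" "{y, z} - {y} = {z}" "links ?C - {{y, z}} = {}"
    unfolding D H using d by (auto simp: doubleton_eq_iff)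
  note t = t[unfolded simps eq]
  have "skeleton_cover PDC [z, t, x]"
    using t(2,5,6) by (rule skeleton_coverI) (use t(1,3,4) d in \<open>simp add: insert_commute, blast?\<close>)
  moreover have "pendant_list [z, t, x] = [pendants ?C z, 0, pendants ?C x]"
    using t(7,8) d by auto
  ultimately show ?thesis by (intro exI[of _ "[z, t, x]"] conjI)
qed

lemma skeleton_cover_rev:
  assumes "skeleton_cover s cs" and "s \<in> {PDCD, PCDC}"
  shows "skeleton_cover s (rev cs)"
  using assms by (auto simp: skeleton_cover_def insert_commute)

text \<open>If both inner cover vertices are leafless, the ends \<open>w\<close> and
  \<open>z\<close> are joined by a path with four inner vertices, and the path can be reversed. The
  reversal passes through \<open>PCDC\<close>, whose shape is symmetric.\<close>

lemma exchange_PDCC_twice: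
  assumes sc: "skeleton_cover PDCC [w, x, y, z]"
    and p: "pendants {w, x, y, z} x = 0" "pendants {w, x, y, z} y = 0"
  shows "\<exists>cs. skeleton_cover PDCC cs \<and> pendant_list cs =
    [pendants {w, x, y, z} z, 0, 0, pendants {w, x, y, z} w]"
proof -
  obtain t where t: "skeleton_cover PCDC [w, t, y, z]" "pendant_list [w, t, y, z] =
    [pendants {w, x, y, z} w, 0, pendants {w, x, y, z} y, pendants {w, x, y, z} z]"
    using exchange_PDCC[OF sc p(1)] by (elim exE conjE) (rule that)
  have rev: "skeleton_cover PCDC [z, y, t, w]"
    using skeleton_cover_rev[OF t(1)] by simp
  have eq: "{z, y, t, w} = {w, t, y, z}" by auto
  have 0: "pendants {z, y, t, w} y = 0" using t(2) p(2) unfolding eq by simp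
  obtain u where "skeleton_cover PDCC [z, u, t, w]" "pendant_list [z, u, t, w] =
    [pendants {z, y, t, w} z, 0, pendants {z, y, t, w} t, pendants {z, y, t, w} w]"
    using exchange_PCDC[OF rev 0] by (elim exE conjE) (rule that)
  then show ?thesis using t(2) unfolding eq by (intro exI[of _ "[z, u, t, w]"]) simp
qed

end

context ftree
begin

text \<open>The extremal cover already forces most of the leaves. What remains are leafless vertices
  with one link and one direct edge: an exchange turns \<open>PDDC\<close> into \<open>PDCD\<close>
  and \<open>PCDC\<close> into \<open>PDCC\<close>, and in \<open>PDCD\<close> Hall's condition
  leaves at most one such vertex, which a reversal brings to the second position.\<close>

lemma canonical_form:
  assumes small: "\<And>C. saturated_cover C \<Longrightarrow> card C \<le> 4"
  obtains s cs where "skeleton_cover s cs" "admissible s (pendant_list cs)"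
proof -
  obtain C where sat: "saturated_cover C"
    and opt: "\<And>c x. c \<in> C \<Longrightarrow> nb c - C = {x} \<Longrightarrow> card (nb x) \<le> card (nb c)"
    by (rule optimal_cover) (rule that; assumption)
  have cov: "cover C" using sat by (simp add: saturated_cover_def)
  note unlinked = pendants_pos_unlinked[OF sat]
  note linked = pendants_pos_linked[OF sat opt]
  show ?thesis
  proof (cases "C = {}")
    case True
    then have noE: "(u, v) \<notin> E" for u v using cov by (auto simp: cover_def)
    then have nb: "nb v = {}" for v by (auto simp: nb_iff)
    obtain r where "r \<in> V" using V_nonempty by auto
    then have V: "V = {r}" using nb_nonempty[of r] nb by blast
    \<comment> \<open>A tree without edges has the empty saturated cover. Its vertex is taken as the
      cover instead, so that it becomes \<open>S1\<close> with no leaf.\<close>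
    have "cover {r}" unfolding cover_def using V noE by blast
    moreover have "connectors {r} = {}" unfolding connectors_def using V by blast
    moreover have "direct_edges {r} = {}" unfolding direct_edges_def using noE by blast
    moreover have "\<forall>u\<in>V - {r}. nb u \<noteq> {}" using V by blast
    ultimately have "skeleton_cover S1 [r]"
      by (simp add: skeleton_cover_def links_def)
    then show ?thesis using that[of S1 "[r]"] by simp
  next
    case False
    obtain s cs where C_cs: "set cs = C" and sc: "skeleton_cover s cs"
      by (rule skeleton_cover_exists[OF cov False small[OF sat]]) (rule that)
    then have sh: "shape s cs C (direct_edges C) (links C)" by (simp add: skeleton_cover_def)
    show ?thesis
    proof (cases s)
    case S1
    then obtain x where cs: "cs = [x]" and d: "distinct [x]"
      and D: "direct_edges C = {}" and H: "links C = {}"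
      using sh by auto
    have C: "C = {x}" using C_cs cs by simp
    then have mem: "x \<in> C" by auto
    show ?thesis using sc  by (intro that[of s cs]) (auto simp: S1 cs C[symmetric])
  next
    case ED
    then obtain x y where cs: "cs = [x, y]" and d: "distinct [x, y]"
      and D: "direct_edges C = {{x, y}}" and H: "links C = {}"
      using sh by auto
    have C: "C = {x, y}" using C_cs cs by simp
    then have mem: "x \<in> C" "y \<in> C" by auto
    have p0: "1 \<le> pendants C x" using d mem by (intro unlinked) (auto simp: H)
    have p1: "1 \<le> pendants C y" using d mem by (intro unlinked) (auto simp: H)
    show ?thesis using sc p0 p1 by (intro that[of s cs]) (auto simp: ED cs C[symmetric])
  next
    case EC
    then obtain x y where cs: "cs = [x, y]" and d: "distinct [x, y]"
      and D: "direct_edges C = {}" and H: "links C = {{x, y}}"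
      using sh by auto
    have C: "C = {x, y}" using C_cs cs by simp
    then have mem: "x \<in> C" "y \<in> C" by auto
    have p0: "1 \<le> pendants C x" using d mem by (intro linked[of _ "{x, y}"]) (auto simp: D H doubleton_eq_iff)
    have p1: "1 \<le> pendants C y" using d mem by (intro linked[of _ "{x, y}"]) (auto simp: D H doubleton_eq_iff)
    show ?thesis using sc p0 p1 by (intro that[of s cs]) (auto simp: EC cs C[symmetric])
  next
    case PDD
    then obtain x y z where cs: "cs = [x, y, z]" and d: "distinct [x, y, z]"
      and D: "direct_edges C = {{x, y}, {y, z}}" and H: "links C = {}"
      using sh by auto
    have C: "C = {x, y, z}" using C_cs cs by simp
    then have mem: "x \<in> C" "y \<in> C" "z \<in> C" by auto
    have p0: "1 \<le> pendants C x" using d mem by (intro unlinked) (auto simp: H)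
    have p1: "1 \<le> pendants C y" using d mem by (intro unlinked) (auto simp: H)
    have p2: "1 \<le> pendants C z" using d mem by (intro unlinked) (auto simp: H)
    show ?thesis using sc p0 p1 p2 by (intro that[of s cs]) (auto simp: PDD cs C[symmetric])
  next
    case PDC
    then obtain x y z where cs: "cs = [x, y, z]" and d: "distinct [x, y, z]"
      and D: "direct_edges C = {{x, y}}" and H: "links C = {{y, z}}"
      using sh by auto
    have C: "C = {x, y, z}" using C_cs cs by simp
    then have mem: "x \<in> C" "y \<in> C" "z \<in> C" by auto
    have p0: "1 \<le> pendants C x" using d mem by (intro unlinked) (auto simp: H)
    have p2: "1 \<le> pendants C z" using d mem by (intro linked[of _ "{y, z}"]) (auto simp: D H doubleton_eq_iff)
    show ?thesis using sc p0 p2 by (intro that[of s cs]) (auto simp: PDC cs C[symmetric])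
  next
    case PCC
    then obtain x y z where cs: "cs = [x, y, z]" and d: "distinct [x, y, z]"
      and D: "direct_edges C = {}" and H: "links C = {{x, y}, {y, z}}"
      using sh by auto
    have C: "C = {x, y, z}" using C_cs cs by simp
    then have mem: "x \<in> C" "y \<in> C" "z \<in> C" by auto
    have p0: "1 \<le> pendants C x" using d mem by (intro linked[of _ "{x, y}"]) (auto simp: D H doubleton_eq_iff)
    have p2: "1 \<le> pendants C z" using d mem by (intro linked[of _ "{y, z}"]) (auto simp: D H doubleton_eq_iff)
    show ?thesis using sc p0 p2 by (intro that[of s cs]) (auto simp: PCC cs C[symmetric])
  next
    case H3
    then obtain x y z where cs: "cs = [x, y, z]" and d: "distinct [x, y, z]"
      and D: "direct_edges C = {}" and H: "links C = {{x, y, z}}"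
      using sh by auto
    have C: "C = {x, y, z}" using C_cs cs by simp
    then have mem: "x \<in> C" "y \<in> C" "z \<in> C" by auto
    have p0: "1 \<le> pendants C x" using d mem by (intro linked[of _ "{x, y, z}"]) (auto simp: D H doubleton_eq_iff)
    have p1: "1 \<le> pendants C y" using d mem by (intro linked[of _ "{x, y, z}"]) (auto simp: D H doubleton_eq_iff)
    have p2: "1 \<le> pendants C z" using d mem by (intro linked[of _ "{x, y, z}"]) (auto simp: D H doubleton_eq_iff)
    show ?thesis using sc p0 p1 p2 by (intro that[of s cs]) (auto simp: H3 cs C[symmetric])
  next
    case PDDD
    then obtain w x y z where cs: "cs = [w, x, y, z]" and d: "distinct [w, x, y, z]"
      and D: "direct_edges C = {{w, x}, {x, y}, {y, z}}" and H: "links C = {}"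
      using sh by auto
    have C: "C = {w, x, y, z}" using C_cs cs by simp
    then have mem: "w \<in> C" "x \<in> C" "y \<in> C" "z \<in> C" by auto
    have p0: "1 \<le> pendants C w" using d mem by (intro unlinked) (auto simp: H)
    have p1: "1 \<le> pendants C x" using d mem by (intro unlinked) (auto simp: H)
    have p2: "1 \<le> pendants C y" using d mem by (intro unlinked) (auto simp: H)
    have p3: "1 \<le> pendants C z" using d mem by (intro unlinked) (auto simp: H)
    show ?thesis using sc p0 p1 p2 p3 by (intro that[of s cs]) (auto simp: PDDD cs C[symmetric])
  next
    case PDDC
    then obtain w x y z where cs: "cs = [w, x, y, z]" and d: "distinct [w, x, y, z]"
      and D: "direct_edges C = {{w, x}, {x, y}}" and H: "links C = {{y, z}}"
      using sh by auto
    have C: "C = {w, x, y, z}" using C_cs cs by simp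
    then have mem: "w \<in> C" "x \<in> C" "y \<in> C" "z \<in> C" by auto
    have p0: "1 \<le> pendants C w" using d mem by (intro unlinked) (auto simp: H)
    have p1: "1 \<le> pendants C x" using d mem by (intro unlinked) (auto simp: H)
    have p3: "1 \<le> pendants C z" using d mem by (intro linked[of _ "{y, z}"]) (auto simp: D H doubleton_eq_iff)
    show ?thesis
    proof (cases "1 \<le> pendants C y")
      case True
      then show ?thesis using sc p0 p1 p3 by (intro that[of s cs]) (auto simp: PDDC cs C[symmetric])
    next
      case False
      then have "\<exists>cs. skeleton_cover PDCD cs \<and> pendant_list cs = [pendants C z, 0, pendants C x, pendants C w]"
        using exchange_PDDC[of w x y z] sc PDDC by (simp add: cs C)
      then obtain cs' where "skeleton_cover PDCD cs'" "pendant_list cs' = [pendants C z, 0, pendants C x, pendants C w]"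
        by (elim exE conjE)
      then show ?thesis using p0 p1 p3 by (intro that[of PDCD cs']) simp_all
    qed
  next
    case PDCD
    then obtain w x y z where cs: "cs = [w, x, y, z]" and d: "distinct [w, x, y, z]"
      and D: "direct_edges C = {{w, x}, {y, z}}" and H: "links C = {{x, y}}"
      using sh by auto
    have C: "C = {w, x, y, z}" using C_cs cs by simp
    then have mem: "w \<in> C" "x \<in> C" "y \<in> C" "z \<in> C" by auto
    have p0: "1 \<le> pendants C w" using d mem by (intro unlinked) (auto simp: H)
    have p3: "1 \<le> pendants C z" using d mem by (intro unlinked) (auto simp: H)
    show ?thesis
    proof (cases "1 \<le> pendants C y")
      case True
      then show ?thesis using sc p0 p3 by (intro that[of s cs]) (auto simp: PDCD cs C[symmetric])
    next
      case False
      \<comment> \<open>The vertices \<open>x\<close> and \<open>y\<close> have the link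
        \<open>{x, y}\<close> as their only link, so they cannot both be leafless.\<close>
      have "1 \<le> pendants C x"
        using d False mem by (intro pendants_pos_Hall[OF sat, of y x "{x, y}"]) (auto simp: H)
      moreover have "set (rev cs) = C" using C_cs by simp
      ultimately show ?thesis
        using skeleton_cover_rev[OF sc] p0 p3 PDCD by (intro that[of s "rev cs"]) (simp_all add: cs)
    qed
  next
    case PDCC
    then obtain w x y z where cs: "cs = [w, x, y, z]" and d: "distinct [w, x, y, z]"
      and D: "direct_edges C = {{w, x}}" and H: "links C = {{x, y}, {y, z}}"
      using sh by auto
    have C: "C = {w, x, y, z}" using C_cs cs by simp
    then have mem: "w \<in> C" "x \<in> C" "y \<in> C" "z \<in> C" by auto
    have p0: "1 \<le> pendants C w" using d mem by (intro unlinked) (auto simp: H)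
    have p3: "1 \<le> pendants C z" using d mem by (intro linked[of _ "{y, z}"]) (auto simp: D H doubleton_eq_iff)
    show ?thesis using sc p0 p3 by (intro that[of s cs]) (auto simp: PDCC cs C[symmetric])
  next
    case PCDC
    then obtain w x y z where cs: "cs = [w, x, y, z]" and d: "distinct [w, x, y, z]"
      and D: "direct_edges C = {{x, y}}" and H: "links C = {{w, x}, {y, z}}"
      using sh by auto
    have C: "C = {w, x, y, z}" using C_cs cs by simp
    then have mem: "w \<in> C" "x \<in> C" "y \<in> C" "z \<in> C" by auto
    have p0: "1 \<le> pendants C w" using d mem by (intro linked[of _ "{w, x}"]) (auto simp: D H doubleton_eq_iff)
    have p3: "1 \<le> pendants C z" using d mem by (intro linked[of _ "{y, z}"]) (auto simp: D H doubleton_eq_iff)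
    consider "1 \<le> pendants C x" "1 \<le> pendants C y" | "pendants C x = 0" | "pendants C y = 0"
      by linarith
    then show ?thesis
    proof cases
      case 1
      then show ?thesis using sc p0 p3 by (intro that[of s cs]) (auto simp: PCDC cs C[symmetric])
    next
      case 2
      then have "\<exists>t. skeleton_cover PDCC [w, t, y, z] \<and> pendant_list [w, t, y, z] =
          [pendants C w, 0, pendants C y, pendants C z]"
        using exchange_PCDC[of w x y z] sc PCDC unfolding cs C by blast
      then obtain t where "skeleton_cover PDCC [w, t, y, z]"
        "pendant_list [w, t, y, z] = [pendants C w, 0, pendants C y, pendants C z]"
        by (elim exE conjE)
      then show ?thesis using p0 p3 by (intro that[of PDCC "[w, t, y, z]"]) simp_all
    next
      case 3
      have C': "C = {z, y, x, w}" using C by auto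
      have "skeleton_cover PCDC [z, y, x, w]"
        using skeleton_cover_rev[OF sc] PCDC by (simp add: cs)
      then have "\<exists>t. skeleton_cover PDCC [z, t, x, w] \<and> pendant_list [z, t, x, w] =
          [pendants C z, 0, pendants C x, pendants C w]"
        using exchange_PCDC[of z y x w] 3 unfolding C' by blast
      then obtain t where "skeleton_cover PDCC [z, t, x, w]"
        "pendant_list [z, t, x, w] = [pendants C z, 0, pendants C x, pendants C w]"
        by (elim exE conjE)
      then show ?thesis using p0 p3 by (intro that[of PDCC "[z, t, x, w]"]) simp_all
    qed
  next
    case PCCC
    then obtain w x y z where cs: "cs = [w, x, y, z]" and d: "distinct [w, x, y, z]"
      and D: "direct_edges C = {}" and H: "links C = {{w, x}, {x, y}, {y, z}}"
      using sh by auto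
    have C: "C = {w, x, y, z}" using C_cs cs by simp
    then have mem: "w \<in> C" "x \<in> C" "y \<in> C" "z \<in> C" by auto
    have p0: "1 \<le> pendants C w" using d mem by (intro linked[of _ "{w, x}"]) (auto simp: D H doubleton_eq_iff)
    have p3: "1 \<le> pendants C z" using d mem by (intro linked[of _ "{y, z}"]) (auto simp: D H doubleton_eq_iff)
    show ?thesis using sc p0 p3 by (intro that[of s cs]) (auto simp: PCCC cs C[symmetric])
  next
    case SDDD
    then obtain w x y z where cs: "cs = [w, x, y, z]" and d: "distinct [w, x, y, z]"
      and D: "direct_edges C = {{w, x}, {w, y}, {w, z}}" and H: "links C = {}"
      using sh by auto
    have C: "C = {w, x, y, z}" using C_cs cs by simp
    then have mem: "w \<in> C" "x \<in> C" "y \<in> C" "z \<in> C" by auto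
    have p0: "1 \<le> pendants C w" using d mem by (intro unlinked) (auto simp: H)
    have p1: "1 \<le> pendants C x" using d mem by (intro unlinked) (auto simp: H)
    have p2: "1 \<le> pendants C y" using d mem by (intro unlinked) (auto simp: H)
    have p3: "1 \<le> pendants C z" using d mem by (intro unlinked) (auto simp: H)
    show ?thesis using sc p0 p1 p2 p3 by (intro that[of s cs]) (auto simp: SDDD cs C[symmetric])
  next
    case SDDC
    then obtain w x y z where cs: "cs = [w, x, y, z]" and d: "distinct [w, x, y, z]"
      and D: "direct_edges C = {{w, x}, {w, y}}" and H: "links C = {{w, z}}"
      using sh by auto
    have C: "C = {w, x, y, z}" using C_cs cs by simp
    then have mem: "w \<in> C" "x \<in> C" "y \<in> C" "z \<in> C" by auto
    have p1: "1 \<le> pendants C x" using d mem by (intro unlinked) (auto simp: H)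
    have p2: "1 \<le> pendants C y" using d mem by (intro unlinked) (auto simp: H)
    have p3: "1 \<le> pendants C z" using d mem by (intro linked[of _ "{w, z}"]) (auto simp: D H doubleton_eq_iff)
    show ?thesis using sc p1 p2 p3 by (intro that[of s cs]) (auto simp: SDDC cs C[symmetric])
  next
    case SDCC
    then obtain w x y z where cs: "cs = [w, x, y, z]" and d: "distinct [w, x, y, z]"
      and D: "direct_edges C = {{w, x}}" and H: "links C = {{w, y}, {w, z}}"
      using sh by auto
    have C: "C = {w, x, y, z}" using C_cs cs by simp
    then have mem: "w \<in> C" "x \<in> C" "y \<in> C" "z \<in> C" by auto
    have p1: "1 \<le> pendants C x" using d mem by (intro unlinked) (auto simp: H)
    have p2: "1 \<le> pendants C y" using d mem by (intro linked[of _ "{w, y}"]) (auto simp: D H doubleton_eq_iff)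
    have p3: "1 \<le> pendants C z" using d mem by (intro linked[of _ "{w, z}"]) (auto simp: D H doubleton_eq_iff)
    show ?thesis using sc p1 p2 p3 by (intro that[of s cs]) (auto simp: SDCC cs C[symmetric])
  next
    case SCCC
    then obtain w x y z where cs: "cs = [w, x, y, z]" and d: "distinct [w, x, y, z]"
      and D: "direct_edges C = {}" and H: "links C = {{w, x}, {w, y}, {w, z}}"
      using sh by auto
    have C: "C = {w, x, y, z}" using C_cs cs by simp
    then have mem: "w \<in> C" "x \<in> C" "y \<in> C" "z \<in> C" by auto
    have p1: "1 \<le> pendants C x" using d mem by (intro linked[of _ "{w, x}"]) (auto simp: D H doubleton_eq_iff)
    have p2: "1 \<le> pendants C y" using d mem by (intro linked[of _ "{w, y}"]) (auto simp: D H doubleton_eq_iff)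
    have p3: "1 \<le> pendants C z" using d mem by (intro linked[of _ "{w, z}"]) (auto simp: D H doubleton_eq_iff)
    show ?thesis using sc p1 p2 p3 by (intro that[of s cs]) (auto simp: SCCC cs C[symmetric])
  next
    case HD
    then obtain w x y z where cs: "cs = [w, x, y, z]" and d: "distinct [w, x, y, z]"
      and D: "direct_edges C = {{y, z}}" and H: "links C = {{w, x, y}}"
      using sh by auto
    have C: "C = {w, x, y, z}" using C_cs cs by simp
    then have mem: "w \<in> C" "x \<in> C" "y \<in> C" "z \<in> C" by auto
    have p0: "1 \<le> pendants C w" using d mem by (intro linked[of _ "{w, x, y}"]) (auto simp: D H doubleton_eq_iff)
    have p1: "1 \<le> pendants C x" using d mem by (intro linked[of _ "{w, x, y}"]) (auto simp: D H doubleton_eq_iff)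
    have p2: "1 \<le> pendants C y" using d mem by (intro linked[of _ "{w, x, y}"]) (auto simp: D H doubleton_eq_iff)
    have p3: "1 \<le> pendants C z" using d mem by (intro unlinked) (auto simp: H)
    show ?thesis using sc p0 p1 p2 p3 by (intro that[of s cs]) (auto simp: HD cs C[symmetric])
  next
    case HC
    then obtain w x y z where cs: "cs = [w, x, y, z]" and d: "distinct [w, x, y, z]"
      and D: "direct_edges C = {}" and H: "links C = {{w, x, y}, {y, z}}"
      using sh by auto
    have C: "C = {w, x, y, z}" using C_cs cs by simp
    then have mem: "w \<in> C" "x \<in> C" "y \<in> C" "z \<in> C" by auto
    have p0: "1 \<le> pendants C w" using d mem by (intro linked[of _ "{w, x, y}"]) (auto simp: D H doubleton_eq_iff)
    have p1: "1 \<le> pendants C x" using d mem by (intro linked[of _ "{w, x, y}"]) (auto simp: D H doubleton_eq_iff)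
    have p3: "1 \<le> pendants C z" using d mem by (intro linked[of _ "{y, z}"]) (auto simp: D H doubleton_eq_iff)
    show ?thesis using sc p0 p1 p3 by (intro that[of s cs]) (auto simp: HC cs C[symmetric])
  next
    case H4
    then obtain w x y z where cs: "cs = [w, x, y, z]" and d: "distinct [w, x, y, z]"
      and D: "direct_edges C = {}" and H: "links C = {{w, x, y, z}}"
      using sh by auto
    have C: "C = {w, x, y, z}" using C_cs cs by simp
    then have mem: "w \<in> C" "x \<in> C" "y \<in> C" "z \<in> C" by auto
    have p0: "1 \<le> pendants C w" using d mem by (intro linked[of _ "{w, x, y, z}"]) (auto simp: D H doubleton_eq_iff)
    have p1: "1 \<le> pendants C x" using d mem by (intro linked[of _ "{w, x, y, z}"]) (auto simp: D H doubleton_eq_iff)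
    have p2: "1 \<le> pendants C y" using d mem by (intro linked[of _ "{w, x, y, z}"]) (auto simp: D H doubleton_eq_iff)
    have p3: "1 \<le> pendants C z" using d mem by (intro linked[of _ "{w, x, y, z}"]) (auto simp: D H doubleton_eq_iff)
    show ?thesis using sc p0 p1 p2 p3 by (intro that[of s cs]) (auto simp: H4 cs C[symmetric])
    qed
  qed
qed

end

section \<open>Isomorphism from equal skeletons and leaf numbers; covers and matchings\<close>

lemma (in fgraph) card_link_fibre:
  assumes "inj_on nb (connectors C)" and "2 \<le> card S"
  shows "card {u \<in> V - C. nb u = S} = (if S \<in> links C then 1 else 0)"
proof (cases "S \<in> links C")
  case True
  then obtain x where x: "x \<in> connectors C" "nb x = S" by (auto simp: links_def)
  have "{u \<in> V - C. nb u = S} = {x}"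
  proof
    show "{u \<in> V - C. nb u = S} \<subseteq> {x}"
    proof
      fix u assume "u \<in> {u \<in> V - C. nb u = S}"
      then have "u \<in> connectors C" "nb u = nb x" using x assms(2) by (simp_all add: connectors_def)
      then show "u \<in> {x}" using inj_onD[OF assms(1)] x(1) by blast
    qed
    show "{x} \<subseteq> {u \<in> V - C. nb u = S}" using x by (simp add: connectors_def)
  qed
  then show ?thesis using True by simp
next
  case False
  then have "{u \<in> V - C. nb u = S} = {}"
    using assms(2) by (auto simp: links_def connectors_def)
  then show ?thesis using False by (simp only: card.empty if_False)
qed

text \<open>Fibres of equal size are matched one by one, and the bijections are glued
  together.\<close>

lemma fibrewise_bij:
  assumes "finite A" "finite B"
    and card: "\<And>k. k \<in> f ` A \<union> g ` B \<Longrightarrow> card {a \<in> A. f a = k} = card {b \<in> B. g b = k}"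
  obtains h where "bij_betw h A B" "\<And>a. a \<in> A \<Longrightarrow> g (h a) = f a"
proof -
  have "\<exists>h. bij_betw h {a \<in> A. f a = k} {b \<in> B. g b = k}" if "k \<in> f ` A \<union> g ` B" for k
    using card[OF that] assms(1,2) by (intro finite_same_card_bij) auto
  then obtain h where h: "\<And>k. k \<in> f ` A \<union> g ` B \<Longrightarrow> bij_betw (h k) {a \<in> A. f a = k} {b \<in> B. g b = k}"
    by metis
  have mem: "h (f a) a \<in> B \<and> g (h (f a) a) = f a" if "a \<in> A" for a
    using bij_betwE[OF h[of "f a"]] that by blast
  have "inj_on (\<lambda>a. h (f a) a) A"
  proof (rule inj_onI)
    fix a b assume ab: "a \<in> A" "b \<in> A" "h (f a) a = h (f b) b"
    then have "f a = f b" using mem by metis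
    then show "a = b"
      using ab bij_betw_imp_inj_on[OF h[of "f a"]] by (auto dest: inj_onD)
  qed
  moreover have "(\<lambda>a. h (f a) a) ` A = B"
  proof
    show "(\<lambda>a. h (f a) a) ` A \<subseteq> B" using mem by auto
    show "B \<subseteq> (\<lambda>a. h (f a) a) ` A"
    proof
      fix b assume b: "b \<in> B"
      then have "b \<in> h (g b) ` {a \<in> A. f a = g b}"
        using bij_betw_imp_surj_on[OF h[of "g b"]] by blast
      then obtain a where "a \<in> A" "f a = g b" "b = h (g b) a" by blast
      then show "b \<in> (\<lambda>a. h (f a) a) ` A" by (intro image_eqI[of _ _ a]) simp_all
    qed
  qed
  ultimately show ?thesis
    using that[of "\<lambda>a. h (f a) a"] mem by (simp add: bij_betw_def)
qed

lemma shape_map: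
  assumes "shape s cs S D H" and "inj_on f S"
  shows "shape s (map f cs) (f ` S) ((`) f ` D) ((`) f ` H)"
proof -
  have eq: "f x = f y \<longleftrightarrow> x = y" if "x \<in> S" "y \<in> S" for x y
    using assms(2) that by (auto dest: inj_onD)
  show ?thesis
    using assms(1) eq by (cases s) auto
qed

lemma shape_unique:
  assumes "shape s cs S D H" and "shape s cs S' D' H'"
  shows "S = S'" "D = D'" "H = H'"
  using assms by (cases s; auto)+

text \<open>Cover vertices are matched by their positions in the lists. Outside vertices are
  determined by their neighbourhoods up to interchange, and the multiplicity of each neighbourhood
  is known: zero for the empty set, the leaf number for a single vertex, one or zero for larger sets
  according to the links.\<close>

theorem skeleton_cover_iso:
  assumes G: "fgraph V E" and G': "fgraph V' E'"
    and sc: "fgraph.skeleton_cover V E s cs" and sc': "fgraph.skeleton_cover V' E' s cs'"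
    and pend: "fgraph.pendant_list V E cs = fgraph.pendant_list V' E' cs'"
  obtains f where "bij_betw f V V'"
    "\<And>u v. u \<in> V \<Longrightarrow> v \<in> V \<Longrightarrow> (f u, f v) \<in> E' \<longleftrightarrow> (u, v) \<in> E"
proof -
  interpret G: fgraph V E by (rule G)
  interpret G': fgraph V' E' by (rule G')
  let ?C = "set cs" and ?C' = "set cs'"
  have cov: "G.cover ?C" and inj: "inj_on G.nb (G.connectors ?C)" and ne: "\<forall>u\<in>V - ?C. G.nb u \<noteq> {}"
    and sh: "shape s cs ?C (G.direct_edges ?C) (G.links ?C)"
    using sc by (auto simp: G.skeleton_cover_def)
  have cov': "G'.cover ?C'" and inj': "inj_on G'.nb (G'.connectors ?C')" and ne': "\<forall>u\<in>V' - ?C'. G'.nb u \<noteq> {}"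
    and sh': "shape s cs' ?C' (G'.direct_edges ?C') (G'.links ?C')"
    using sc' by (auto simp: G'.skeleton_cover_def)
  note cs = shapeD[OF sh] and cs' = shapeD[OF sh']
  have len: "length cs = length cs'" using cs cs' by simp
  define g where "g v = the (map_of (zip cs cs') v)" for v
  have gmap: "map g cs = cs'"
    using len cs(2) by (intro nth_equalityI) (simp_all add: g_def map_of_zip_nth)
  have ginj: "inj_on g ?C"
    using cs'(2) gmap by (metis distinct_map)
  have gim: "g ` ?C = ?C'" using gmap by (metis list.set_map)
  have "shape s cs' ?C' ((`) g ` G.direct_edges ?C) ((`) g ` G.links ?C)"
    using shape_map[OF sh ginj] by (simp add: gmap gim)
  note uniq = shape_unique[OF this sh']
  have CV: "?C \<subseteq> V" and CV': "?C' \<subseteq> V'" using cov cov' by (auto simp: G.cover_def G'.cover_def)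
  have nbC: "G.nb u \<subseteq> ?C" if "u \<in> V - ?C" for u using G.cover_nb[OF cov] that by auto
  have nbC': "G'.nb u \<subseteq> ?C'" if "u \<in> V' - ?C'" for u using G'.cover_nb[OF cov'] that by auto
  have gedge: "(g u, g v) \<in> E' \<longleftrightarrow> (u, v) \<in> E" if "u \<in> ?C" "v \<in> ?C" for u v
  proof -
    have Pow: "G.direct_edges ?C \<subseteq> Pow ?C" by (auto simp: G.direct_edges_def)
    have "(g u, g v) \<in> E' \<longleftrightarrow> g ` {u, v} \<in> G'.direct_edges ?C'"
      using that gim by (auto simp: G'.direct_edges_iff)
    also have "\<dots> \<longleftrightarrow> {u, v} \<in> G.direct_edges ?C"
      unfolding uniq(2)[symmetric]
      using that Pow inj_on_image_mem_iff[OF inj_on_image_Pow[OF ginj], of "{u, v}" "G.direct_edges ?C"] by simp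
    finally show ?thesis using that by (simp add: G.direct_edges_iff)
  qed
  have pend_g: "G'.pendants ?C' (g v) = G.pendants ?C v" if v: "v \<in> ?C" for v
  proof -
    have "map (G.pendants ?C) cs = map (G'.pendants ?C') (map g cs)"
      unfolding gmap by (rule pend)
    then show ?thesis using v by simp
  qed
  have fibre: "card {u \<in> V - ?C. G.nb u = S} = card {u \<in> V' - ?C'. G'.nb u = g ` S}" if S: "S \<subseteq> ?C" for S
  proof -
    have fin: "finite S" using S finite_subset by blast
    have cardg: "card (g ` S) = card S" using ginj S by (metis card_image inj_on_subset)
    consider "S = {}" | v where "S = {v}" | "2 \<le> card S"
    proof -
      have "card S = 0 \<or> card S = 1 \<or> 2 \<le> card S" by linarith
      then show ?thesis using that fin by (auto simp: card_1_singleton_iff)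
    qed
    then show ?thesis
    proof cases
      case 1
      then have "{u \<in> V - ?C. G.nb u = S} = {}" "{u \<in> V' - ?C'. G'.nb u = g ` S} = {}"
        using ne ne' by auto
      then show ?thesis by (simp only: card.empty)
    next
      case 2
      then show ?thesis using pend_g[of v] S by (simp add: G.pendants_def G'.pendants_def)
    next
      case 3
      have "G.links ?C \<subseteq> Pow ?C"
        using nbC by (auto simp: G.links_def G.connectors_def)
      then have "g ` S \<in> G'.links ?C' \<longleftrightarrow> S \<in> G.links ?C"
        unfolding uniq(3)[symmetric]
        using S inj_on_image_mem_iff[OF inj_on_image_Pow[OF ginj], of S "G.links ?C"] by simp
      then show ?thesis
        using G.card_link_fibre[OF inj 3] G'.card_link_fibre[OF inj', of "g ` S"] 3 cardg by simp
    qed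
  qed
  have "card {u \<in> V - ?C. g ` G.nb u = k} = card {u \<in> V' - ?C'. G'.nb u = k}"
    if k: "k \<in> (\<lambda>u. g ` G.nb u) ` (V - ?C) \<union> G'.nb ` (V' - ?C')" for k
  proof -
    have "k \<subseteq> ?C'"
      using k
    proof
      assume "k \<in> (\<lambda>u. g ` G.nb u) ` (V - ?C)"
      then obtain u where "u \<in> V - ?C" "k = g ` G.nb u" by auto
      then show ?thesis using image_mono[OF nbC[of u], of g] by (simp add: gim)
    next
      assume "k \<in> G'.nb ` (V' - ?C')"
      then show ?thesis using nbC' by auto
    qed
    then obtain S where S: "S \<subseteq> ?C" "k = g ` S"
      using gim subset_imageE by metis
    have "g ` G.nb u = k \<longleftrightarrow> G.nb u = S" if "u \<in> V - ?C" for u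
      using inj_on_image_eq_iff[OF ginj nbC[OF that] S(1)] S(2) by simp
    then have "{u \<in> V - ?C. g ` G.nb u = k} = {u \<in> V - ?C. G.nb u = S}" by auto
    then show ?thesis using fibre[OF S(1)] S(2) by simp
  qed
  then obtain h where h: "bij_betw h (V - ?C) (V' - ?C')"
    and hnb: "\<And>u. u \<in> V - ?C \<Longrightarrow> G'.nb (h u) = g ` G.nb u"
    using fibrewise_bij[of "V - ?C" "V' - ?C'" "\<lambda>u. g ` G.nb u" G'.nb] G.finite_V G'.finite_V
    by blast
  define f where "f u = (if u \<in> ?C then g u else h u)" for u
  have "bij_betw f (?C \<union> (V - ?C)) (?C' \<union> (V' - ?C'))"
  proof (rule bij_betw_combine)
    show "bij_betw f ?C ?C'"
      using ginj gim by (subst bij_betw_cong[of _ _ g]) (auto simp: f_def bij_betw_def)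
    show "bij_betw f (V - ?C) (V' - ?C')"
      using h by (subst bij_betw_cong[of _ _ h]) (auto simp: f_def)
  qed auto
  then have bij: "bij_betw f V V'"
    using CV CV' by (simp add: Un_absorb1)
  have mixed: "(h u, g v) \<in> E' \<longleftrightarrow> (u, v) \<in> E" if "u \<in> V - ?C" "v \<in> ?C" for u v
  proof -
    have "(h u, g v) \<in> E' \<longleftrightarrow> g v \<in> g ` G.nb u" using hnb[OF that(1)] by (simp add: G'.nb_iff[symmetric])
    also have "\<dots> \<longleftrightarrow> v \<in> G.nb u" using inj_on_image_mem_iff[OF ginj that(2) nbC[OF that(1)]] .
    finally show ?thesis by (simp add: G.nb_iff)
  qed
  have "(f u, f v) \<in> E' \<longleftrightarrow> (u, v) \<in> E" if "u \<in> V" "v \<in> V" for u v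
  proof (cases "u \<in> ?C"; cases "v \<in> ?C")
    assume "u \<in> ?C" "v \<in> ?C"
    then show ?thesis using gedge by (simp add: f_def)
  next
    assume "u \<notin> ?C" "v \<in> ?C"
    then show ?thesis using mixed that by (simp add: f_def)
  next
    assume "u \<in> ?C" "v \<notin> ?C"
    then show ?thesis using mixed[of v u] that G.E_sym G'.E_sym by (auto simp: f_def)
  next
    assume uv: "u \<notin> ?C" "v \<notin> ?C"
    then have "h u \<notin> ?C'" "h v \<notin> ?C'" using that bij_betwE[OF h] by auto
    then show ?thesis
      using uv cov cov' by (auto simp: f_def G.cover_def G'.cover_def)
  qed
  then show ?thesis using that bij by blast
qed

lemma digraph_isoI:
  assumes "pair_graph T" and "pair_graph T'"
    and bij: "bij_betw f (pverts T) (pverts T')"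
    and f: "\<And>u v. u \<in> pverts T \<Longrightarrow> v \<in> pverts T \<Longrightarrow> (f u, f v) \<in> parcs T' \<longleftrightarrow> (u, v) \<in> parcs T"
  shows "digraph_iso (with_proj T) (with_proj T')"
proof -
  interpret T: pair_graph T by fact
  interpret T': pair_graph T' by fact
  define hom where "hom = \<lparr>iso_verts = f, iso_arcs = (\<lambda>(u, v). (f u, f v)), iso_head = snd, iso_tail = fst\<rparr>"
  have inj: "inj_on f (pverts T)" and im: "f ` pverts T = pverts T'"
    using bij by (auto simp: bij_betw_def)
  have "inj_on (\<lambda>(u, v). (f u, f v)) (parcs T)"
    using inj T.in_arcsD1 T.in_arcsD2 by (auto simp: inj_on_def)
  then have "T.digraph_isomorphism hom"
    using inj T.wf_digraph_axioms by (auto simp: T.digraph_isomorphism_def hom_def)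
  moreover have "(\<lambda>(u, v). (f u, f v)) ` parcs T = parcs T'"
  proof
    show "(\<lambda>(u, v). (f u, f v)) ` parcs T \<subseteq> parcs T'"
      using f T.in_arcsD1 T.in_arcsD2 by auto
    show "parcs T' \<subseteq> (\<lambda>(u, v). (f u, f v)) ` parcs T"
    proof
      fix e assume e: "e \<in> parcs T'"
      obtain a b where ab: "e = (a, b)" by (cases e)
      then have "a \<in> f ` pverts T" "b \<in> f ` pverts T"
        using e T'.in_arcsD1 T'.in_arcsD2 im by auto
      then obtain u v where uv: "u \<in> pverts T" "v \<in> pverts T" "e = (f u, f v)"
        using ab by blast
      then show "e \<in> (\<lambda>(u, v). (f u, f v)) ` parcs T"
        using f[OF uv(1,2)] e by (auto intro!: image_eqI[of _ _ "(u, v)"])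
    qed
  qed
  then have "with_proj T' = app_iso hom (with_proj T)"
    using im by (auto simp: app_iso_def hom_def with_proj_def)
  ultimately show ?thesis
    unfolding digraph_iso_def by blast
qed

text \<open>The edges from \<open>c\<close> to \<open>f c\<close> form a matching with one edge for
  each cover vertex.\<close>

lemma saturated_cover_le_matching_number:
  assumes T: "ftree (pverts T) (parcs T)" and C: "fgraph.saturated_cover (pverts T) (parcs T) C"
  shows "card C \<le> matching_number T"
proof -
  interpret ftree "pverts T" "parcs T" by (rule T)
  obtain f where f: "inj_on f C" "\<forall>c\<in>C. f c \<in> nb c - C"
    using C by (auto simp: saturated_cover_def)
  let ?M = "(\<lambda>c. {c, f c}) ` C"
  have sub: "edges T \<subseteq> Pow (pverts T)" using E_subset by (auto simp: edges_def)
  have "finite {M. is_matching T M}"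
    by (rule finite_subset[of _ "Pow (Pow (pverts T))"]) (use sub finite_V in \<open>auto simp: is_matching_def\<close>)
  moreover have "is_matching T ?M"
    unfolding is_matching_def
  proof (intro conjI ballI impI)
    show "?M \<subseteq> edges T" using f(2) by (auto simp: edges_def nb_iff)
    fix e e' assume "e \<in> ?M" "e' \<in> ?M" "e \<noteq> e'"
    then obtain c c' where "e = {c, f c}" "e' = {c', f c'}" "c \<in> C" "c' \<in> C" "c \<noteq> c'" by auto
    moreover have "f c \<noteq> f c'" using calculation f(1) by (auto dest: inj_onD)
    ultimately show "e \<inter> e' = {}" using f(2) by auto
  qed
  ultimately have "card ?M \<le> matching_number T"
    unfolding matching_number_def by (intro Max_ge) auto
  moreover have "inj_on (\<lambda>c. {c, f c}) C"
    using f(2) by (intro inj_onI) (auto simp: doubleton_eq_iff)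
  ultimately show ?thesis by (simp add: card_image)
qed

section \<open>Walks and the characteristic polynomial in terms of a vertex cover\<close>

lemma sum_nth_distinct:
  assumes "distinct xs"
  shows "(\<Sum>i<length xs. f (xs ! i)) = sum f (set xs)"
  using sum.reindex_bij_betw[OF bij_betw_nth[OF assms refl refl], of f] .

context fgraph
begin

primrec walks :: "nat \<Rightarrow> 'a \<Rightarrow> real" where
  "walks 0 v = 1"
| "walks (Suc k) v = (\<Sum>u\<in>nb v. walks k u)"

definition adj :: "'a \<Rightarrow> 'a \<Rightarrow> real" where
  "adj u v = (if (u, v) \<in> E then 1 else 0)"

text \<open>The entry of \<open>N^T N\<close>, where \<open>N\<close> is the incidence matrix
  between outside vertices and cover vertices. On the diagonal it counts the outside neighbours of
  \<open>u\<close>.\<close>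

definition common :: "'a set \<Rightarrow> 'a \<Rightarrow> 'a \<Rightarrow> real" where
  "common C u v = real (card {w \<in> V - C. u \<in> nb w \<and> v \<in> nb w})"

lemma sum_nb_cover:
  assumes "cover C" and c: "c \<in> C"
  shows "(\<Sum>u\<in>nb c. f u) = (\<Sum>v\<in>C. adj c v * f v) + (\<Sum>u | u \<in> V - C \<and> c \<in> nb u. f u)"
proof -
  have "nb c = nb c \<inter> C \<union> {u. u \<in> V - C \<and> c \<in> nb u}"
    using nb_subset nb_sym by blast
  then have "(\<Sum>u\<in>nb c. f u) = (\<Sum>u\<in>nb c \<inter> C \<union> {u. u \<in> V - C \<and> c \<in> nb u}. f u)"
    by (rule arg_cong)
  also have "\<dots> = (\<Sum>u\<in>nb c \<inter> C. f u) + (\<Sum>u | u \<in> V - C \<and> c \<in> nb u. f u)"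
    using finite_nb finite_V by (intro sum.union_disjoint) auto
  also have "(\<Sum>u\<in>nb c \<inter> C. f u) = (\<Sum>v\<in>C. adj c v * f v)"
    using cover_finite[OF assms(1)]
    by (subst Int_commute, subst sum.inter_restrict) (auto intro!: sum.cong simp: adj_def nb_iff)
  finally show ?thesis .
qed

lemma sum_common:
  assumes "cover C"
  shows "(\<Sum>u | u \<in> V - C \<and> c \<in> nb u. \<Sum>v\<in>nb u. f v) = (\<Sum>v\<in>C. common C c v * f v)"
proof -
  let ?U = "{u. u \<in> V - C \<and> c \<in> nb u}"
  have finC: "finite C" using cover_finite[OF assms] .
  have finU: "finite ?U" using finite_V by auto
  have "(\<Sum>u\<in>?U. \<Sum>v\<in>nb u. f v) = (\<Sum>u\<in>?U. \<Sum>v\<in>C. if v \<in> nb u then f v else 0)"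
  proof (rule sum.cong[OF refl])
    fix u assume "u \<in> ?U"
    then have "nb u \<subseteq> C" using cover_nb[OF assms] by auto
    then show "(\<Sum>v\<in>nb u. f v) = (\<Sum>v\<in>C. if v \<in> nb u then f v else 0)"
      using finC by (simp add: sum.inter_restrict[symmetric] Int_absorb1)
  qed
  also have "\<dots> = (\<Sum>v\<in>C. \<Sum>u\<in>?U. if v \<in> nb u then f v else 0)"
    by (rule sum.swap)
  also have "\<dots> = (\<Sum>v\<in>C. common C c v * f v)"
  proof (rule sum.cong[OF refl])
    fix v
    have "(\<Sum>u\<in>?U. if v \<in> nb u then f v else 0) = (\<Sum>u\<in>{u\<in>?U. v \<in> nb u}. f v)"
      using finU by (rule sum.inter_filter[symmetric])
    also have "{u\<in>?U. v \<in> nb u} = {w \<in> V - C. c \<in> nb w \<and> v \<in> nb w}" by auto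
    finally show "(\<Sum>u\<in>?U. if v \<in> nb u then f v else 0) = common C c v * f v"
      by (simp add: common_def)
  qed
  finally show ?thesis .
qed

lemma walks_cover_1:
  assumes "cover C" "c \<in> C"
  shows "walks (Suc 0) c = (\<Sum>v\<in>C. adj c v) + common C c c"
  using sum_nb_cover[OF assms, of "\<lambda>_. 1"] by (simp add: common_def)

text \<open>A walk from the cover either moves inside it or leaves it and returns in the next step,
  because outside vertices have all their neighbours in the cover. So the walk counts on the cover
  obey a second-order recurrence among themselves.\<close>

lemma walks_cover_Suc:
  assumes "cover C" "c \<in> C"
  shows "walks (Suc (Suc k)) c =
    (\<Sum>v\<in>C. adj c v * walks (Suc k) v) + (\<Sum>v\<in>C. common C c v * walks k v)"
  using sum_nb_cover[OF assms, of "walks (Suc k)"] sum_common[OF assms(1), where c = c and f = "walks k"] by simp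

text \<open>A walk of positive length from an outside vertex enters the cover in its first step, and
  \<open>c\<close> is entered from \<open>common C c c\<close> outside vertices.\<close>

lemma sum_walks_cover:
  assumes "cover C"
  shows "(\<Sum>v\<in>V. walks (Suc k) v) = (\<Sum>c\<in>C. walks (Suc k) c) + (\<Sum>c\<in>C. common C c c * walks k c)"
proof -
  have finC: "finite C" and CV: "C \<subseteq> V" using cover_finite[OF assms] assms by (auto simp: cover_def)
  have "(\<Sum>v\<in>V. walks (Suc k) v) = (\<Sum>v\<in>V - C. walks (Suc k) v) + (\<Sum>v\<in>C. walks (Suc k) v)"
    by (rule sum.subset_diff[OF CV finite_V])
  also have "(\<Sum>v\<in>V - C. walks (Suc k) v) = (\<Sum>v\<in>V - C. \<Sum>c\<in>C. if c \<in> nb v then walks k c else 0)"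
  proof (rule sum.cong[OF refl])
    fix v assume "v \<in> V - C"
    then have "nb v \<subseteq> C" using cover_nb[OF assms] by auto
    then show "walks (Suc k) v = (\<Sum>c\<in>C. if c \<in> nb v then walks k c else 0)"
      using finC by (simp add: sum.inter_restrict[symmetric] Int_absorb1)
  qed
  also have "\<dots> = (\<Sum>c\<in>C. \<Sum>v\<in>V - C. if c \<in> nb v then walks k c else 0)"
    by (rule sum.swap)
  also have "\<dots> = (\<Sum>c\<in>C. common C c c * walks k c)"
    using finite_V by (intro sum.cong refl) (simp add: common_def sum.inter_filter[symmetric])
  finally show ?thesis by simp
qed

end

lemma num_walks_eq:
  assumes "pair_graph T"
  shows "num_walks k T = (\<Sum>v\<in>pverts T. fgraph.walks (parcs T) k v)"
proof -
  interpret pair_graph T by fact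
  interpret F: fgraph "pverts T" "parcs T"
    by unfold_locales (use pair_finite_verts in_arcsD1 in_arcsD2 arcs_symmetric adj_not_same in auto)
  let ?n = "card (pverts T)" and ?xs = "vertex_list T" and ?A = "adjacency_matrix T"
  have xs: "distinct ?xs" "set ?xs = pverts T" using vertex_list[OF pair_finite_verts] by auto
  then have len: "length ?xs = ?n" by (metis distinct_card)
  have A: "?A \<in> carrier_mat ?n ?n" by (simp add: adjacency_matrix_def)
  have step: "?A *\<^sub>v vec ?n (\<lambda>i. f (?xs ! i)) = vec ?n (\<lambda>i. \<Sum>u\<in>F.nb (?xs ! i). f u)" for f
  proof (rule eq_vecI)
    fix i assume "i < dim_vec (vec ?n (\<lambda>i. \<Sum>u\<in>F.nb (?xs ! i). f u))"
    then have i: "i < ?n" by simp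
    have "(?A *\<^sub>v vec ?n (\<lambda>i. f (?xs ! i))) $ i =
        (\<Sum>j<?n. (\<lambda>u. if u \<in> F.nb (?xs ! i) then f u else 0) (?xs ! j))"
      using i by (auto simp: adjacency_matrix_def scalar_prod_def F.nb_iff lessThan_atLeast0 intro!: sum.cong)
    also have "\<dots> = (\<Sum>u\<in>pverts T. if u \<in> F.nb (?xs ! i) then f u else 0)"
      using sum_nth_distinct[OF xs(1)] by (simp add: len xs(2))
    also have "\<dots> = (\<Sum>u\<in>F.nb (?xs ! i). f u)"
      using F.finite_V F.nb_subset by (simp add: sum.inter_restrict[symmetric] Int_absorb1)
    finally show "(?A *\<^sub>v vec ?n (\<lambda>i. f (?xs ! i))) $ i = vec ?n (\<lambda>i. \<Sum>u\<in>F.nb (?xs ! i). f u) $ i"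
      using i by simp
  qed (use A in simp)
  \<comment> \<open>Generalised over the initial length \<open>l\<close>, because the matrix power
    splits off its last factor on the right, next to the vector.\<close>
  have "?A ^\<^sub>m k *\<^sub>v vec ?n (\<lambda>i. F.walks l (?xs ! i)) = vec ?n (\<lambda>i. F.walks (l + k) (?xs ! i))" for l
  proof (induction k arbitrary: l)
    case 0
    then show ?case using A by simp
  next
    case (Suc k)
    have "?A ^\<^sub>m Suc k *\<^sub>v vec ?n (\<lambda>i. F.walks l (?xs ! i)) =
        ?A ^\<^sub>m k *\<^sub>v (?A *\<^sub>v vec ?n (\<lambda>i. F.walks l (?xs ! i)))"
      using A by (simp add: assoc_mult_mat_vec[of _ ?n ?n _ ?n])
    also have "?A *\<^sub>v vec ?n (\<lambda>i. F.walks l (?xs ! i)) = vec ?n (\<lambda>i. F.walks (Suc l) (?xs ! i))"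
      unfolding step by simp
    finally show ?case using Suc.IH[of "Suc l"] by simp
  qed
  from this[of 0] have eq: "?A ^\<^sub>m k *\<^sub>v vec ?n (\<lambda>_. 1) = vec ?n (\<lambda>i. F.walks k (?xs ! i))"
    by simp
  have "num_walks k T = (\<Sum>i<?n. F.walks k (?xs ! i))"
    unfolding num_walks_def Let_def eq by (simp add: scalar_prod_def lessThan_atLeast0)
  then show ?thesis
    using sum_nth_distinct[OF xs(1), of "F.walks k"] by (simp add: len xs(2))
qed

section \<open>The characteristic polynomial as a determinant over the cover\<close>

text \<open>Columns are permuted as rows of the transpose, and the two signs cancel.\<close>

lemma det_permute_rows_cols:
  fixes f :: "nat \<Rightarrow> nat \<Rightarrow> 'a :: comm_ring_1"
  assumes p: "p permutes {0..<n}"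
  shows "det (mat n n (\<lambda>(i, j). f (p i) (p j))) = det (mat n n (\<lambda>(i, j). f i j))"
proof -
  have lt: "p i < n" if "i < n" for i using p that permutes_in_image[OF p, of i] by simp
  let ?M = "mat n n (\<lambda>(i, j). f i j)" and ?R = "mat n n (\<lambda>(i, j). f (p i) j)"
  have "mat n n (\<lambda>(i, j). ?M $$ (p i, j)) = ?R"
    using lt by (intro eq_matI) auto
  then have R: "det ?R = signof p * det ?M"
    using det_permute_rows[OF _ p, of ?M] by simp
  have "det (mat n n (\<lambda>(i, j). f (p i) (p j))) = det (transpose_mat (mat n n (\<lambda>(i, j). f (p i) (p j))))"
    by (rule det_transpose[symmetric]) auto
  also have "transpose_mat (mat n n (\<lambda>(i, j). f (p i) (p j))) = mat n n (\<lambda>(i, j). transpose_mat ?R $$ (p i, j))"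
    using lt by (intro eq_matI) auto
  also have "det \<dots> = signof p * det (transpose_mat ?R)"
    using p by (intro det_permute_rows) auto
  also have "\<dots> = signof p * signof p * det ?M"
    using R by (simp add: det_transpose[of _ n])
  also have "signof p * signof p = (1 :: 'a)"
    by (cases p rule: sign_cases) auto
  finally show ?thesis by simp
qed

text \<open>The adjacency matrix uses an arbitrary enumeration of the vertices; this allows one that
  lists the cover first.\<close>

lemma det_enumeration:
  fixes f :: "'v \<Rightarrow> 'v \<Rightarrow> 'a :: comm_ring_1"
  assumes "distinct xs" "distinct ys" "set xs = set ys" "length xs = n"
  shows "det (mat n n (\<lambda>(i, j). f (xs ! i) (xs ! j))) = det (mat n n (\<lambda>(i, j). f (ys ! i) (ys ! j)))"
proof -
  have len: "length ys = n" using assms by (metis distinct_card)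
  have bx: "bij_betw ((!) xs) {..<n} (set ys)" and bY: "bij_betw ((!) ys) {..<n} (set ys)"
    using assms len by (auto intro!: bij_betw_nth)
  define q where "q = inv_into {..<n} ((!) ys) \<circ> (!) xs"
  define p where "p i = (if i < n then q i else i)" for i
  have bq: "bij_betw q {..<n} {..<n}"
    unfolding q_def by (rule bij_betw_trans[OF bx bij_betw_inv_into[OF bY]])
  then have "bij_betw p {0..<n} {0..<n}"
    unfolding lessThan_atLeast0[symmetric] by (subst bij_betw_cong[of _ _ q]) (auto simp: p_def)
  then have p: "p permutes {0..<n}"
    by (rule bij_imp_permutes) (simp add: p_def)
  have nth: "ys ! p i = xs ! i" if "i < n" for i
  proof -
    have "xs ! i \<in> set ys" using that assms(4) nth_mem[of i xs] unfolding assms(3) by simp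
    then have "ys ! inv_into {..<n} ((!) ys) (xs ! i) = xs ! i"
      by (rule bij_betw_inv_into_right[OF bY])
    then show ?thesis using that by (simp add: p_def q_def)
  qed
  have "mat n n (\<lambda>(i, j). f (xs ! i) (xs ! j)) = mat n n (\<lambda>(i, j). f (ys ! p i) (ys ! p j))"
    using nth by (intro eq_matI) auto
  then show ?thesis
    using det_permute_rows_cols[OF p, of "\<lambda>i j. f (ys ! i) (ys ! j)"] by simp
qed

text \<open>A Schur complement without division: multiplication by \<open>?Q\<close> clears the
  lower left block, so the identity holds for \<open>x = 0\<close> as well.\<close>

lemma det_cover_block:
  fixes x :: "'a :: field"
  assumes A: "A \<in> carrier_mat k k" and N: "N \<in> carrier_mat m k"
  shows "det (four_block_mat (x \<cdot>\<^sub>m 1\<^sub>m k - A) (- transpose_mat N) (- N) (x \<cdot>\<^sub>m 1\<^sub>m m)) * x ^ k =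
    det (x \<cdot>\<^sub>m (x \<cdot>\<^sub>m 1\<^sub>m k - A) - transpose_mat N * N) * x ^ m"
proof -
  let ?P = "four_block_mat (x \<cdot>\<^sub>m 1\<^sub>m k - A) (- transpose_mat N) (- N) (x \<cdot>\<^sub>m 1\<^sub>m m)"
  let ?Q = "four_block_mat (x \<cdot>\<^sub>m 1\<^sub>m k) (0\<^sub>m k m) N (1\<^sub>m m)"
  let ?S = "x \<cdot>\<^sub>m (x \<cdot>\<^sub>m 1\<^sub>m k - A) - transpose_mat N * N"
  note carr = A N
  have P: "?P \<in> carrier_mat (k + m) (k + m)" and Q: "?Q \<in> carrier_mat (k + m) (k + m)"
    using carr by (auto intro!: four_block_carrier_mat)
  have "(x \<cdot>\<^sub>m 1\<^sub>m k - A) * (x \<cdot>\<^sub>m 1\<^sub>m k) + - transpose_mat N * N = ?S"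
    using carr by (auto simp: mult_smult_distrib[of _ k k] minus_add_uminus_mat[symmetric, of _ k k])
  moreover have "(x \<cdot>\<^sub>m 1\<^sub>m k - A) * 0\<^sub>m k m + - transpose_mat N * 1\<^sub>m m = - transpose_mat N"
    using carr by simp
  moreover have "- N * (x \<cdot>\<^sub>m 1\<^sub>m k) + x \<cdot>\<^sub>m 1\<^sub>m m * N = 0\<^sub>m m k"
    using carr by (auto simp: mult_smult_distrib[of _ m k] intro!: eq_matI)
  moreover have "- N * 0\<^sub>m k m + x \<cdot>\<^sub>m 1\<^sub>m m * 1\<^sub>m m = x \<cdot>\<^sub>m 1\<^sub>m m"
    using carr by simp
  ultimately have PQ: "?P * ?Q = four_block_mat ?S (- transpose_mat N) (0\<^sub>m m k) (x \<cdot>\<^sub>m 1\<^sub>m m)"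
    using carr by (subst mult_four_block_mat[of _ k k _ m _ m _ _ k _ m]) auto
  have "det ?P * det ?Q = det (?P * ?Q)" using det_mult[OF P Q] by simp
  also have "\<dots> = det ?S * det (x \<cdot>\<^sub>m 1\<^sub>m m)"
    unfolding PQ using carr by (intro det_four_block_mat_lower_left_zero[of _ k _ m]) auto
  also have "det ?Q = det (x \<cdot>\<^sub>m 1\<^sub>m k) * det (1\<^sub>m m :: 'a mat)"
    using carr by (intro det_four_block_mat_upper_right_zero[of _ k _ m]) auto
  finally show ?thesis by (simp add: det_smult)
qed

lemma fgraph_pair_graph: "pair_graph T \<Longrightarrow> fgraph (pverts T) (parcs T)"
proof -
  assume "pair_graph T"
  then interpret pair_graph T .
  show ?thesis
    by unfold_locales (use pair_finite_verts in_arcsD1 in_arcsD2 arcs_symmetric adj_not_same in auto)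
qed

text \<open>With the cover listed first, the block of the outside vertices is \<open>x\<close> times
  the identity, since they are pairwise nonadjacent. \<open>det_cover_block\<close> then eliminates
  them.\<close>

lemma char_poly_cover:
  fixes x :: real
  assumes T: "pair_graph T" and C: "fgraph.cover (pverts T) (parcs T) (set cs)" and d: "distinct cs"
    and k: "length cs = k"
  shows "poly (char_poly (adjacency_matrix T)) x * x ^ k =
    det (mat k k (\<lambda>(i, j). (if cs ! i = cs ! j then x\<^sup>2 else 0) - x * fgraph.adj (parcs T) (cs ! i) (cs ! j)
      - fgraph.common (pverts T) (parcs T) (set cs) (cs ! i) (cs ! j))) * x ^ (card (pverts T) - k)"
    and "k \<le> card (pverts T)"
proof -
  interpret F: fgraph "pverts T" "parcs T" using T by (rule fgraph_pair_graph)
  let ?n = "card (pverts T)" and ?xs = "vertex_list T" and ?A = "adjacency_matrix T"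
  let ?C = "set cs"
  define f where "f u v = (if u = v then x else 0) - F.adj u v" for u v
  have xs: "distinct ?xs" "set ?xs = pverts T" using vertex_list[OF F.finite_V] by auto
  then have len: "length ?xs = ?n" by (metis distinct_card)
  obtain rs where rs: "distinct rs" "set rs = pverts T - ?C"
    using finite_distinct_list[of "pverts T - ?C"] F.finite_V by auto
  let ?m = "length rs" and ?ys = "cs @ rs"
  have CV: "?C \<subseteq> pverts T" using C by (simp add: F.cover_def)
  have ys: "distinct ?ys" "set ?xs = set ?ys" using d rs xs CV by auto
  have n: "?n = k + ?m"
    using distinct_card[OF ys(1)] ys(2) xs(2) k by simp
  then show "k \<le> ?n" by simp
  have "poly (char_poly ?A) x = det (mat ?n ?n (\<lambda>(i, j). f (?xs ! i) (?xs ! j)))"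
  proof -
    have A: "?A \<in> carrier_mat ?n ?n" by (simp add: adjacency_matrix_def)
    have "- char_matrix ?A x = mat ?n ?n (\<lambda>(i, j). f (?xs ! i) (?xs ! j))"
      using A len xs(1)
      by (intro eq_matI) (auto simp: char_matrix_def adjacency_matrix_def f_def F.adj_def nth_eq_iff_index_eq)
    then show ?thesis using char_poly_matrix[OF A, of x] by simp
  qed
  also have "\<dots> = det (mat ?n ?n (\<lambda>(i, j). f (?ys ! i) (?ys ! j)))"
    by (rule det_enumeration[OF xs(1) ys len])
  also have "mat ?n ?n (\<lambda>(i, j). f (?ys ! i) (?ys ! j)) =
    four_block_mat (x \<cdot>\<^sub>m 1\<^sub>m k - mat k k (\<lambda>(i, j). F.adj (cs ! i) (cs ! j)))
      (- transpose_mat (mat ?m k (\<lambda>(i, j). F.adj (rs ! i) (cs ! j))))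
      (- mat ?m k (\<lambda>(i, j). F.adj (rs ! i) (cs ! j))) (x \<cdot>\<^sub>m 1\<^sub>m ?m)" (is "_ = ?B")
  proof (rule eq_matI)
    fix i j assume ij: "i < dim_row ?B" "j < dim_col ?B"
    then have ij: "i < k + ?m" "j < k + ?m" by auto
    have csC: "cs ! l \<in> ?C" if "l < k" for l using that k by auto
    have rsC: "rs ! l \<in> pverts T - ?C" if "l < ?m" for l using that rs(2) nth_mem by metis
    have sym: "F.adj u v = F.adj v u" for u v using F.E_sym by (auto simp: F.adj_def)
    have "F.adj (rs ! l) (rs ! l') = 0" if "l < ?m" "l' < ?m" for l l'
      using rsC[OF that(1)] rsC[OF that(2)] C by (auto simp: F.adj_def F.cover_def)
    moreover have "cs ! l \<noteq> rs ! l'" "rs ! l' \<noteq> cs ! l" if "l < k" "l' < ?m" for l l'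
      using csC[OF that(1)] rsC[OF that(2)] by auto
    moreover have "i - k < ?m" if "\<not> i < k" using ij that by auto
    moreover have "j - k < ?m" if "\<not> j < k" using ij that by auto
    moreover have "i - k = j - k \<longleftrightarrow> i = j" if "\<not> i < k" "\<not> j < k" using that by auto
    ultimately show "mat ?n ?n (\<lambda>(i, j). f (?ys ! i) (?ys ! j)) $$ (i, j) = ?B $$ (i, j)"
      using ij n k d rs(1)
      by (cases "i < k"; cases "j < k") (auto simp: f_def nth_append nth_eq_iff_index_eq sym)
  qed (use n in auto)
  finally have "poly (char_poly ?A) x * x ^ k = det (x \<cdot>\<^sub>m (x \<cdot>\<^sub>m 1\<^sub>m k - mat k k (\<lambda>(i, j). F.adj (cs ! i) (cs ! j))) -
      transpose_mat (mat ?m k (\<lambda>(i, j). F.adj (rs ! i) (cs ! j))) * mat ?m k (\<lambda>(i, j). F.adj (rs ! i) (cs ! j))) * x ^ ?m"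
    by (simp add: det_cover_block[of _ k _ ?m])
  also have "x \<cdot>\<^sub>m (x \<cdot>\<^sub>m 1\<^sub>m k - mat k k (\<lambda>(i, j). F.adj (cs ! i) (cs ! j))) -
      transpose_mat (mat ?m k (\<lambda>(i, j). F.adj (rs ! i) (cs ! j))) * mat ?m k (\<lambda>(i, j). F.adj (rs ! i) (cs ! j)) =
    mat k k (\<lambda>(i, j). (if cs ! i = cs ! j then x\<^sup>2 else 0) - x * F.adj (cs ! i) (cs ! j) - F.common ?C (cs ! i) (cs ! j))"
    (is "?L = ?R")
  proof (rule eq_matI)
    fix i j assume "i < dim_row ?R" "j < dim_col ?R"
    then have ij: "i < k" "j < k" by auto
    have "(\<Sum>l<?m. F.adj (rs ! l) (cs ! i) * F.adj (rs ! l) (cs ! j)) =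
        (\<Sum>u\<in>pverts T - ?C. F.adj u (cs ! i) * F.adj u (cs ! j))"
      using sum_nth_distinct[OF rs(1), of "\<lambda>u. F.adj u (cs ! i) * F.adj u (cs ! j)"] by (simp add: rs(2))
    also have "\<dots> = (\<Sum>u\<in>pverts T - ?C. if cs ! i \<in> F.nb u \<and> cs ! j \<in> F.nb u then 1 else 0)"
      by (intro sum.cong) (auto simp: F.adj_def F.nb_iff)
    also have "\<dots> = F.common ?C (cs ! i) (cs ! j)"
      using F.finite_V by (simp add: F.common_def sum.inter_filter[symmetric])
    finally show "?L $$ (i, j) = ?R $$ (i, j)"
      using ij k d by (auto simp: scalar_prod_def lessThan_atLeast0 nth_eq_iff_index_eq power2_eq_square algebra_simps)
  qed auto
  finally show "poly (char_poly ?A) x * x ^ k =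
    det (mat k k (\<lambda>(i, j). (if cs ! i = cs ! j then x\<^sup>2 else 0) - x * F.adj (cs ! i) (cs ! j)
      - F.common ?C (cs ! i) (cs ! j))) * x ^ (?n - k)"
    using n by simp
qed

lemma adjacency_matrix_carrier:
  "adjacency_matrix T \<in> carrier_mat (card (pverts T)) (card (pverts T))"
  by (simp add: adjacency_matrix_def)

text \<open>A monic polynomial is recovered from its complex roots with multiplicities.\<close>

lemma char_poly_spectrum:
  "map_poly complex_of_real (char_poly (adjacency_matrix T)) = (\<Prod>x\<in>#spectrum_mset T. [:- x, 1:])"
proof -
  let ?B = "map_mat complex_of_real (adjacency_matrix T)"
  have "?B \<in> carrier_mat (card (pverts T)) (card (pverts T))"
    by (simp add: adjacency_matrix_def)
  from degree_monic_char_poly[OF this] have "lead_coeff (char_poly ?B) = 1" by auto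
  then have "char_poly ?B = (\<Prod>x\<in>#spectrum_mset T. [:- x, 1:])"
    using complex_poly_decompose_multiset[of "char_poly ?B"] by (simp add: spectrum_mset_def)
  then show ?thesis
    by (simp add: of_real_hom.char_poly_hom[OF adjacency_matrix_carrier])
qed

lemma char_poly_eq_if_spectrum_eq:
  assumes "spectrum_mset T = spectrum_mset T'"
  shows "char_poly (adjacency_matrix T) = char_poly (adjacency_matrix T')"
    and "card (pverts T) = card (pverts T')"
proof -
  have "map_poly complex_of_real (char_poly (adjacency_matrix T)) =
      map_poly complex_of_real (char_poly (adjacency_matrix T'))"
    unfolding char_poly_spectrum assms ..
  then show eq: "char_poly (adjacency_matrix T) = char_poly (adjacency_matrix T')"
    by (simp add: poly_eq_iff coeff_map_poly)
  show "card (pverts T) = card (pverts T')"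
    using degree_monic_char_poly[OF adjacency_matrix_carrier, of T]
      degree_monic_char_poly[OF adjacency_matrix_carrier, of T'] eq by simp
qed

text \<open>Laplace expansion along the first row, phrased for entry functions so that small
  determinants unfold into polynomials.\<close>

lemma det_mat_Suc:
  fixes f :: "nat \<Rightarrow> nat \<Rightarrow> 'a :: comm_ring_1"
  shows "det (mat (Suc n) (Suc n) (\<lambda>(i, j). f i j)) =
    (\<Sum>l<Suc n. (- 1) ^ l * f 0 l * det (mat n n (\<lambda>(i, j). f (Suc i) (if j < l then j else Suc j))))"
proof -
  let ?A = "mat (Suc n) (Suc n) (\<lambda>(i, j). f i j)"
  have "mat_delete ?A 0 l = mat n n (\<lambda>(i, j). f (Suc i) (if j < l then j else Suc j))" if "l < Suc n" for l
    using that by (intro eq_matI) (auto simp: mat_delete_def)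
  then show ?thesis
    using laplace_expansion_row[of ?A "Suc n" 0]
    by (auto simp: cofactor_def algebra_simps intro!: sum.cong)
qed

lemma det_mat_0: "det (mat 0 0 f) = 1"
  by simp

lemma det_mat_1:
  fixes f :: "nat \<Rightarrow> nat \<Rightarrow> 'a :: comm_ring_1"
  shows "det (mat 1 1 (\<lambda>(i, j). f i j)) = f 0 0"
  unfolding One_nat_def by (subst det_mat_Suc) simp

lemma det_mat_2:
  fixes f :: "nat \<Rightarrow> nat \<Rightarrow> 'a :: comm_ring_1"
  shows "det (mat 2 2 (\<lambda>(i, j). f i j)) = f 0 0 * f 1 1 - f 0 1 * f 1 0"
  unfolding numeral_2_eq_2 One_nat_def by (simp add: det_mat_Suc det_mat_0)

lemma det_mat_3:
  fixes f :: "nat \<Rightarrow> nat \<Rightarrow> 'a :: comm_ring_1"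
  shows "det (mat 3 3 (\<lambda>(i, j). f i j)) =
    f 0 0 * (f 1 1 * f 2 2 - f 1 2 * f 2 1) - f 0 1 * (f 1 0 * f 2 2 - f 1 2 * f 2 0) +
    f 0 2 * (f 1 0 * f 2 1 - f 1 1 * f 2 0)"
  unfolding numeral_3_eq_3 numeral_2_eq_2 One_nat_def by (simp add: det_mat_Suc det_mat_0)

lemma det_mat_4:
  fixes f :: "nat \<Rightarrow> nat \<Rightarrow> 'a :: comm_ring_1"
  shows "det (mat 4 4 (\<lambda>(i, j). f i j)) =
    f 0 0 * (f 1 1 * (f 2 2 * f 3 3 - f 2 3 * f 3 2) - f 1 2 * (f 2 1 * f 3 3 - f 2 3 * f 3 1) +
      f 1 3 * (f 2 1 * f 3 2 - f 2 2 * f 3 1)) -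
    f 0 1 * (f 1 0 * (f 2 2 * f 3 3 - f 2 3 * f 3 2) - f 1 2 * (f 2 0 * f 3 3 - f 2 3 * f 3 0) +
      f 1 3 * (f 2 0 * f 3 2 - f 2 2 * f 3 0)) +
    f 0 2 * (f 1 0 * (f 2 1 * f 3 3 - f 2 3 * f 3 1) - f 1 1 * (f 2 0 * f 3 3 - f 2 3 * f 3 0) +
      f 1 3 * (f 2 0 * f 3 1 - f 2 1 * f 3 0)) -
    f 0 3 * (f 1 0 * (f 2 1 * f 3 2 - f 2 2 * f 3 1) - f 1 1 * (f 2 0 * f 3 2 - f 2 2 * f 3 0) +
      f 1 2 * (f 2 0 * f 3 1 - f 2 1 * f 3 0))"
proof -
  have 4: "4 = Suc (Suc (Suc (Suc 0)))" by simp
  show ?thesis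
    unfolding 4 numeral_3_eq_3 numeral_2_eq_2 One_nat_def by (simp add: det_mat_Suc det_mat_0)
qed

section \<open>The matrices and the invariants of a skeleton\<close>

context fgraph
begin

lemma adj_eq_direct:
  assumes "u \<in> C" "v \<in> C"
  shows "adj u v = (if {u, v} \<in> direct_edges C then 1 else 0)"
  using assms by (simp add: adj_def direct_edges_iff)

lemma finite_connectors: "finite (connectors C)"
  using finite_V by (simp add: connectors_def)

lemma card_connectors_filter:
  assumes "inj_on nb (connectors C)"
  shows "real (card {w \<in> connectors C. P (nb w)}) = (\<Sum>h\<in>links C. if P h then 1 else 0)"
proof -
  have "(\<Sum>h\<in>links C. if P h then 1 else (0::real)) = (\<Sum>w\<in>connectors C. if P (nb w) then 1 else 0)"
    unfolding links_def by (subst sum.reindex[OF assms]) simp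
  then show ?thesis
    using finite_connectors by (simp add: sum.inter_filter[symmetric])
qed

text \<open>A leaf is a common neighbour only of a cover vertex with itself, and connectors
  correspond one to one to links.\<close>

lemma common_eq_links:
  assumes inj: "inj_on nb (connectors C)"
  shows "common C u v = (if u = v then real (pendants C u) else 0) + (\<Sum>h\<in>links C. if u \<in> h \<and> v \<in> h then 1 else 0)"
proof -
  have "{w \<in> V - C. u \<in> nb w \<and> v \<in> nb w} =
      {w \<in> V - C. u = v \<and> nb w = {u}} \<union> {w \<in> connectors C. u \<in> nb w \<and> v \<in> nb w}" (is "?L = ?P \<union> ?Q")
  proof
    show "?P \<union> ?Q \<subseteq> ?L" by (auto simp: connectors_def)
    show "?L \<subseteq> ?P \<union> ?Q"
    proof
      fix w assume w: "w \<in> ?L"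
      show "w \<in> ?P \<union> ?Q"
      proof (cases "w \<in> connectors C")
        case False
        then have "card (nb w) \<le> Suc 0" using w by (auto simp: connectors_def)
        then have "\<forall>a\<in>nb w. \<forall>b\<in>nb w. a = b"
          using card_le_Suc0_iff_eq[OF finite_nb] by blast
        then show ?thesis using w by auto
      qed (use w in auto)
    qed
  qed
  moreover have "?P \<inter> ?Q = {}" by (auto simp: connectors_def)
  moreover have "finite ?P" "finite ?Q" using finite_V finite_connectors by auto
  ultimately have "common C u v = real (card ?P) + real (card ?Q)"
    unfolding common_def by (simp add: card_Un_disjoint)
  moreover have "real (card ?P) = (if u = v then real (pendants C u) else 0)"
    by (simp add: pendants_def)
  ultimately show ?thesis
    using card_connectors_filter[OF inj, of "\<lambda>h. u \<in> h \<and> v \<in> h"] by simp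
qed

text \<open>An outside vertex has a neighbour, so it is a leaf at exactly one cover vertex or a
  connector, and connectors are counted by their links.\<close>

lemma card_V_eq:
  assumes C: "cover C" and inj: "inj_on nb (connectors C)" and ne: "\<forall>u\<in>V - C. nb u \<noteq> {}"
  shows "real (card V) = real (card C) + (\<Sum>c\<in>C. real (pendants C c)) + real (card (links C))"
proof -
  have finC: "finite C" and CV: "C \<subseteq> V" using cover_finite[OF C] C by (auto simp: cover_def)
  have eq: "V = C \<union> ((\<Union>c\<in>C. {u \<in> V - C. nb u = {c}}) \<union> connectors C)" (is "V = C \<union> (?P \<union> ?K)")
  proof
    show "C \<union> (?P \<union> ?K) \<subseteq> V" using CV by (auto simp: connectors_def)
    show "V \<subseteq> C \<union> (?P \<union> ?K)"
    proof
      fix u assume u: "u \<in> V"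
      show "u \<in> C \<union> (?P \<union> ?K)"
      proof (cases "u \<in> C \<or> u \<in> ?K")
        case False
        then have "u \<in> V - C" "card (nb u) \<le> Suc 0" using u by (auto simp: connectors_def)
        moreover obtain c where "c \<in> nb u" using ne \<open>u \<in> V - C\<close> by blast
        ultimately have "nb u = {c}" "c \<in> C"
          using card_le_Suc0_iff_eq[OF finite_nb[of u]] cover_nb[OF C, of u] by auto
        then show ?thesis using \<open>u \<in> V - C\<close> by blast
      qed auto
    qed
  qed
  have finP: "finite ?P" using finite_V finC by auto
  have "card V = card C + card (?P \<union> ?K)"
    by (subst eq, rule card_Un_disjoint) (use finC finP finite_connectors in \<open>auto simp: connectors_def\<close>)
  also have "card (?P \<union> ?K) = card ?P + card ?K"
    using finP finite_connectors by (intro card_Un_disjoint) (auto simp: connectors_def)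
  also have "card ?P = (\<Sum>c\<in>C. pendants C c)"
    unfolding pendants_def using finC finite_V by (intro card_UN_disjoint) auto
  also have "card ?K = card (links C)"
    unfolding links_def using inj by (simp add: card_image)
  finally show ?thesis by simp
qed

end

primrec cover_adj :: "skeleton \<Rightarrow> real list list" where
  "cover_adj S1 = [[0]]"
| "cover_adj ED = [[0, 1], [1, 0]]"
| "cover_adj EC = [[0, 0], [0, 0]]"
| "cover_adj PDD = [[0, 1, 0], [1, 0, 1], [0, 1, 0]]"
| "cover_adj PDC = [[0, 1, 0], [1, 0, 0], [0, 0, 0]]"
| "cover_adj PCC = [[0, 0, 0], [0, 0, 0], [0, 0, 0]]"
| "cover_adj H3 = [[0, 0, 0], [0, 0, 0], [0, 0, 0]]"
| "cover_adj PDDD = [[0, 1, 0, 0], [1, 0, 1, 0], [0, 1, 0, 1], [0, 0, 1, 0]]"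
| "cover_adj PDDC = [[0, 1, 0, 0], [1, 0, 1, 0], [0, 1, 0, 0], [0, 0, 0, 0]]"
| "cover_adj PDCD = [[0, 1, 0, 0], [1, 0, 0, 0], [0, 0, 0, 1], [0, 0, 1, 0]]"
| "cover_adj PDCC = [[0, 1, 0, 0], [1, 0, 0, 0], [0, 0, 0, 0], [0, 0, 0, 0]]"
| "cover_adj PCDC = [[0, 0, 0, 0], [0, 0, 1, 0], [0, 1, 0, 0], [0, 0, 0, 0]]"
| "cover_adj PCCC = [[0, 0, 0, 0], [0, 0, 0, 0], [0, 0, 0, 0], [0, 0, 0, 0]]"
| "cover_adj SDDD = [[0, 1, 1, 1], [1, 0, 0, 0], [1, 0, 0, 0], [1, 0, 0, 0]]"
| "cover_adj SDDC = [[0, 1, 1, 0], [1, 0, 0, 0], [1, 0, 0, 0], [0, 0, 0, 0]]"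
| "cover_adj SDCC = [[0, 1, 0, 0], [1, 0, 0, 0], [0, 0, 0, 0], [0, 0, 0, 0]]"
| "cover_adj SCCC = [[0, 0, 0, 0], [0, 0, 0, 0], [0, 0, 0, 0], [0, 0, 0, 0]]"
| "cover_adj HD = [[0, 0, 0, 0], [0, 0, 0, 0], [0, 0, 0, 1], [0, 0, 1, 0]]"
| "cover_adj HC = [[0, 0, 0, 0], [0, 0, 0, 0], [0, 0, 0, 0], [0, 0, 0, 0]]"
| "cover_adj H4 = [[0, 0, 0, 0], [0, 0, 0, 0], [0, 0, 0, 0], [0, 0, 0, 0]]"

text \<open>Leaves contribute to the diagonal only; each hyperedge adds one to every entry whose two
  indices it contains.\<close>

primrec cover_common :: "skeleton \<Rightarrow> real list \<Rightarrow> real list list" where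
  "cover_common S1 r = (let a = r ! 0 in [[a]])"
| "cover_common ED r = (let a = r ! 0; b = r ! 1 in [[a, 0], [0, b]])"
| "cover_common EC r = (let a = r ! 0; b = r ! 1 in [[a + 1, 1], [1, b + 1]])"
| "cover_common PDD r = (let a = r ! 0; b = r ! 1; c = r ! 2 in [[a, 0, 0], [0, b, 0], [0, 0, c]])"
| "cover_common PDC r = (let a = r ! 0; b = r ! 1; c = r ! 2 in [[a, 0, 0], [0, b + 1, 1], [0, 1, c + 1]])"
| "cover_common PCC r = (let a = r ! 0; b = r ! 1; c = r ! 2 in [[a + 1, 1, 0], [1, b + 2, 1], [0, 1, c + 1]])"
| "cover_common H3 r = (let a = r ! 0; b = r ! 1; c = r ! 2 in [[a + 1, 1, 1], [1, b + 1, 1], [1, 1, c + 1]])"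
| "cover_common PDDD r = (let a = r ! 0; b = r ! 1; c = r ! 2; d = r ! 3 in [[a, 0, 0, 0], [0, b, 0, 0], [0, 0, c, 0], [0, 0, 0, d]])"
| "cover_common PDDC r = (let a = r ! 0; b = r ! 1; c = r ! 2; d = r ! 3 in [[a, 0, 0, 0], [0, b, 0, 0], [0, 0, c + 1, 1], [0, 0, 1, d + 1]])"
| "cover_common PDCD r = (let a = r ! 0; b = r ! 1; c = r ! 2; d = r ! 3 in [[a, 0, 0, 0], [0, b + 1, 1, 0], [0, 1, c + 1, 0], [0, 0, 0, d]])"
| "cover_common PDCC r = (let a = r ! 0; b = r ! 1; c = r ! 2; d = r ! 3 in [[a, 0, 0, 0], [0, b + 1, 1, 0], [0, 1, c + 2, 1], [0, 0, 1, d + 1]])"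
| "cover_common PCDC r = (let a = r ! 0; b = r ! 1; c = r ! 2; d = r ! 3 in [[a + 1, 1, 0, 0], [1, b + 1, 0, 0], [0, 0, c + 1, 1], [0, 0, 1, d + 1]])"
| "cover_common PCCC r = (let a = r ! 0; b = r ! 1; c = r ! 2; d = r ! 3 in [[a + 1, 1, 0, 0], [1, b + 2, 1, 0], [0, 1, c + 2, 1], [0, 0, 1, d + 1]])"
| "cover_common SDDD r = (let a = r ! 0; b = r ! 1; c = r ! 2; d = r ! 3 in [[a, 0, 0, 0], [0, b, 0, 0], [0, 0, c, 0], [0, 0, 0, d]])"
| "cover_common SDDC r = (let a = r ! 0; b = r ! 1; c = r ! 2; d = r ! 3 in [[a + 1, 0, 0, 1], [0, b, 0, 0], [0, 0, c, 0], [1, 0, 0, d + 1]])"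
| "cover_common SDCC r = (let a = r ! 0; b = r ! 1; c = r ! 2; d = r ! 3 in [[a + 2, 0, 1, 1], [0, b, 0, 0], [1, 0, c + 1, 0], [1, 0, 0, d + 1]])"
| "cover_common SCCC r = (let a = r ! 0; b = r ! 1; c = r ! 2; d = r ! 3 in [[a + 3, 1, 1, 1], [1, b + 1, 0, 0], [1, 0, c + 1, 0], [1, 0, 0, d + 1]])"
| "cover_common HD r = (let a = r ! 0; b = r ! 1; c = r ! 2; d = r ! 3 in [[a + 1, 1, 1, 0], [1, b + 1, 1, 0], [1, 1, c + 1, 0], [0, 0, 0, d]])"
| "cover_common HC r = (let a = r ! 0; b = r ! 1; c = r ! 2; d = r ! 3 in [[a + 1, 1, 1, 0], [1, b + 1, 1, 0], [1, 1, c + 2, 1], [0, 0, 1, d + 1]])"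
| "cover_common H4 r = (let a = r ! 0; b = r ! 1; c = r ! 2; d = r ! 3 in [[a + 1, 1, 1, 1], [1, b + 1, 1, 1], [1, 1, c + 1, 1], [1, 1, 1, d + 1]])"

primrec link_count :: "skeleton \<Rightarrow> real" where
  "link_count S1 = 0"
| "link_count ED = 0"
| "link_count EC = 1"
| "link_count PDD = 0"
| "link_count PDC = 1"
| "link_count PCC = 2"
| "link_count H3 = 1"
| "link_count PDDD = 0"
| "link_count PDDC = 1"
| "link_count PDCD = 1"
| "link_count PDCC = 2"
| "link_count PCDC = 2"
| "link_count PCCC = 3"
| "link_count SDDD = 0"
| "link_count SDDC = 1"
| "link_count SDCC = 2"
| "link_count SCCC = 3"
| "link_count HD = 1"
| "link_count HC = 2"
| "link_count H4 = 1"

text \<open>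
  The entries are the number of vertices, the numbers of matchings of sizes two, three and four, and
  for \<open>k = 3, \<dots>, 8\<close> the defect of the \<open>k\<close>-th walk number in the linear recurrence whose coefficients
  are those of the characteristic polynomial. The numbers \<open>r\<close> count the leaves at the cover vertices.
\<close>

primrec invs :: "skeleton \<Rightarrow> real list \<Rightarrow> real list" where
  "invs S1 r = (let a = r ! 0 in
    [a + 1,
     0, 0, 0, 0, 0, 0, 0, 0, 0])"
| "invs ED r = (let a = r ! 0; b = r ! 1 in
    [a + b + 2,
     a * b,
     0, 0,
     - 2 * a * b,
     0, 0, 0, 0, 0])"
| "invs EC r = (let a = r ! 0; b = r ! 1 in
    [a + b + 3,
     a * b + a + b,
     0, 0,
     - 4 * a * b - 2 * a - 2 * b,
     a * b,
     0, 0, 0, 0])"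
| "invs PDD r = (let a = r ! 0; b = r ! 1; c = r ! 2 in
    [a + b + c + 3,
     a * b + a * c + b * c + a + c,
     a * b * c,
     0,
     - 2 * a * b - 4 * a * c - 2 * b * c - 2 * a - 2 * c,
     3 * a * b * c + a * c,
     2 * a * b * c,
     0, 0, 0])"
| "invs PDC r = (let a = r ! 0; b = r ! 1; c = r ! 2 in
    [a + b + c + 4,
     a * b + a * c + b * c + 2 * a + b + 2 * c + 1,
     a * b * c + a * b + a * c,
     0,
     - 2 * a * b - 4 * a * c - 4 * b * c - 6 * a - 2 * b - 6 * c - 2,
     3 * a * b * c + 3 * a * b + 2 * a * c + b * c + a + c,
     4 * a * b * c + 2 * a * b + 4 * a * c,
     - a * b * c,
     0, 0])"
| "invs PCC r = (let a = r ! 0; b = r ! 1; c = r ! 2 in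
    [a + b + c + 5,
     a * b + a * c + b * c + 3 * a + 2 * b + 3 * c + 3,
     a * b * c + a * b + 2 * a * c + b * c + a + b + c,
     0,
     - 4 * a * b - 4 * a * c - 4 * b * c - 10 * a - 4 * b - 10 * c - 8,
     3 * a * b * c + 4 * a * b + 5 * a * c + 4 * b * c + 3 * a + 3 * b + 3 * c + 1,
     6 * a * b * c + 4 * a * b + 8 * a * c + 4 * b * c + 4 * a + 2 * b + 4 * c,
     - 2 * a * b * c - a * b - b * c,
     0, 0])"
| "invs H3 r = (let a = r ! 0; b = r ! 1; c = r ! 2 in
    [a + b + c + 4,
     a * b + a * c + b * c + 2 * a + 2 * b + 2 * c,
     a * b * c + a * b + a * c + b * c,
     0,
     - 4 * a * b - 4 * a * c - 4 * b * c - 4 * a - 4 * b - 4 * c,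
     3 * a * b * c + 4 * a * b + 4 * a * c + 4 * b * c,
     6 * a * b * c + 2 * a * b + 2 * a * c + 2 * b * c,
     - 4 * a * b * c,
     0, 0])"
| "invs PDDD r = (let a = r ! 0; b = r ! 1; c = r ! 2; d = r ! 3 in
    [a + b + c + d + 4,
     a * b + a * c + a * d + b * c + b * d + c * d + 2 * a + b + c + 2 * d + 1,
     a * b * c + a * b * d + a * c * d + b * c * d + a * b + a * d + c * d,
     a * b * c * d,
     - 2 * a * b - 4 * a * c - 4 * a * d - 2 * b * c - 4 * b * d - 2 * c * d - 6 * a - 2 * b - 2 * c - 6 * d - 2,
     3 * a * b * c + 3 * a * b * d + 3 * a * c * d + 3 * b * c * d + 3 * a * b + a * c + 2 * a * d + b * d + 3 * c * d + a + d,
     2 * a * b * c + 4 * a * b * d + 4 * a * c * d + 2 * b * c * d + 2 * a * b + 4 * a * d + 2 * c * d,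
     - 4 * a * b * c * d - a * b * d - a * c * d,
     - 2 * a * b * c * d,
     0])"
| "invs PDDC r = (let a = r ! 0; b = r ! 1; c = r ! 2; d = r ! 3 in
    [a + b + c + d + 5,
     a * b + a * c + a * d + b * c + b * d + c * d + 3 * a + 2 * b + 2 * c + 3 * d + 3,
     a * b * c + a * b * d + a * c * d + b * c * d + 2 * a * b + a * c + 2 * a * d + b * c + b * d + c * d + a + c + d,
     a * b * c * d + a * b * c + a * b * d,
     - 2 * a * b - 4 * a * c - 4 * a * d - 2 * b * c - 4 * b * d - 4 * c * d - 10 * a - 6 * b - 4 * c - 10 * d - 8,
     3 * a * b * c + 3 * a * b * d + 3 * a * c * d + 3 * b * c * d + 6 * a * b + 4 * a * c + 5 * a * d + 3 * b * c + 2 * b * d + 4 * c * d + 3 * a + b + 3 * c + 3 * d + 1,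
     2 * a * b * c + 4 * a * b * d + 6 * a * c * d + 4 * b * c * d + 6 * a * b + 4 * a * c + 8 * a * d + 2 * b * c + 4 * b * d + 4 * c * d + 4 * a + 2 * c + 4 * d,
     - 4 * a * b * c * d - 4 * a * b * c - 3 * a * b * d - 2 * a * c * d - b * c * d - a * b - a * c - c * d,
     - 4 * a * b * c * d - 2 * a * b * c - 4 * a * b * d,
     a * b * c * d])"
| "invs PDCD r = (let a = r ! 0; b = r ! 1; c = r ! 2; d = r ! 3 in
    [a + b + c + d + 5,
     a * b + a * c + a * d + b * c + b * d + c * d + 3 * a + 2 * b + 2 * c + 3 * d + 3,
     a * b * c + a * b * d + a * c * d + b * c * d + 2 * a * b + a * c + 2 * a * d + b * d + 2 * c * d + a + d,
     a * b * c * d + a * b * d + a * c * d,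
     - 2 * a * b - 4 * a * c - 4 * a * d - 4 * b * c - 4 * b * d - 2 * c * d - 10 * a - 6 * b - 6 * c - 10 * d - 8,
     3 * a * b * c + 3 * a * b * d + 3 * a * c * d + 3 * b * c * d + 6 * a * b + 2 * a * c + 5 * a * d + b * c + 2 * b * d + 6 * c * d + 3 * a + b + c + 3 * d + 1,
     4 * a * b * c + 4 * a * b * d + 4 * a * c * d + 4 * b * c * d + 6 * a * b + 4 * a * c + 8 * a * d + 4 * b * d + 6 * c * d + 4 * a + 4 * d,
     - 4 * a * b * c * d - a * b * c - 3 * a * b * d - 3 * a * c * d - b * c * d - a * b - c * d,
     - 4 * a * b * c * d - 4 * a * b * d - 4 * a * c * d,
     a * b * c * d])"
| "invs PDCC r = (let a = r ! 0; b = r ! 1; c = r ! 2; d = r ! 3 in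
    [a + b + c + d + 6,
     a * b + a * c + a * d + b * c + b * d + c * d + 4 * a + 3 * b + 3 * c + 4 * d + 6,
     a * b * c + a * b * d + a * c * d + b * c * d + 3 * a * b + 2 * a * c + 3 * a * d + b * c + 2 * b * d + 2 * c * d + 3 * a + b + 2 * c + 3 * d + 1,
     a * b * c * d + a * b * c + 2 * a * b * d + a * c * d + a * b + a * c + a * d,
     - 2 * a * b - 4 * a * c - 4 * a * d - 4 * b * c - 4 * b * d - 4 * c * d - 14 * a - 10 * b - 8 * c - 14 * d - 18,
     3 * a * b * c + 3 * a * b * d + 3 * a * c * d + 3 * b * c * d + 9 * a * b + 5 * a * c + 8 * a * d + 4 * b * c + 5 * b * d + 7 * c * d + 8 * a + 3 * b + 7 * c + 8 * d + 4,
     4 * a * b * c + 4 * a * b * d + 6 * a * c * d + 6 * b * c * d + 10 * a * b + 8 * a * c + 14 * a * d + 4 * b * c + 8 * b * d + 10 * c * d + 12 * a + 4 * b + 6 * c + 12 * d + 4,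
     - 4 * a * b * c * d - 5 * a * b * c - 7 * a * b * d - 4 * a * c * d - 2 * b * c * d - 4 * a * b - 3 * a * c - 4 * a * d - b * c - 3 * c * d - c,
     - 6 * a * b * c * d - 4 * a * b * c - 8 * a * b * d - 6 * a * c * d - 4 * a * b - 4 * a * c - 4 * a * d,
     2 * a * b * c * d + a * b * c + a * c * d])"
| "invs PCDC r = (let a = r ! 0; b = r ! 1; c = r ! 2; d = r ! 3 in
    [a + b + c + d + 6,
     a * b + a * c + a * d + b * c + b * d + c * d + 4 * a + 3 * b + 3 * c + 4 * d + 6,
     a * b * c + a * b * d + a * c * d + b * c * d + 2 * a * b + 2 * a * c + 3 * a * d + 2 * b * c + 2 * b * d + 2 * c * d + 3 * a + 2 * b + 2 * c + 3 * d + 1,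
     a * b * c * d + a * b * c + a * b * d + a * c * d + b * c * d + a * c + a * d + b * c + b * d,
     - 4 * a * b - 4 * a * c - 4 * a * d - 2 * b * c - 4 * b * d - 4 * c * d - 14 * a - 8 * b - 8 * c - 14 * d - 18,
     3 * a * b * c + 3 * a * b * d + 3 * a * c * d + 3 * b * c * d + 7 * a * b + 5 * a * c + 8 * a * d + 6 * b * c + 5 * b * d + 7 * c * d + 8 * a + 7 * b + 7 * c + 8 * d + 4,
     4 * a * b * c + 6 * a * b * d + 6 * a * c * d + 4 * b * c * d + 10 * a * b + 8 * a * c + 14 * a * d + 4 * b * c + 8 * b * d + 10 * c * d + 12 * a + 6 * b + 6 * c + 12 * d + 4,
     - 4 * a * b * c * d - 5 * a * b * c - 4 * a * b * d - 4 * a * c * d - 5 * b * c * d - 3 * a * b - 3 * a * c - 4 * a * d - 4 * b * c - 3 * b * d - 3 * c * d - b - c,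
     - 6 * a * b * c * d - 4 * a * b * c - 6 * a * b * d - 6 * a * c * d - 4 * b * c * d - 4 * a * c - 4 * a * d - 2 * b * c - 4 * b * d,
     2 * a * b * c * d + a * b * c + a * b * d + a * c * d + b * c * d])"
| "invs PCCC r = (let a = r ! 0; b = r ! 1; c = r ! 2; d = r ! 3 in
    [a + b + c + d + 7,
     a * b + a * c + a * d + b * c + b * d + c * d + 5 * a + 4 * b + 4 * c + 5 * d + 10,
     a * b * c + a * b * d + a * c * d + b * c * d + 3 * a * b + 3 * a * c + 4 * a * d + 2 * b * c + 3 * b * d + 3 * c * d + 6 * a + 4 * b + 4 * c + 6 * d + 4,
     a * b * c * d + a * b * c + 2 * a * b * d + 2 * a * c * d + b * c * d + a * b + 2 * a * c + 3 * a * d + b * c + 2 * b * d + c * d + a + b + c + d,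
     - 4 * a * b - 4 * a * c - 4 * a * d - 4 * b * c - 4 * b * d - 4 * c * d - 18 * a - 12 * b - 12 * c - 18 * d - 32,
     3 * a * b * c + 3 * a * b * d + 3 * a * c * d + 3 * b * c * d + 10 * a * b + 8 * a * c + 11 * a * d + 7 * b * c + 8 * b * d + 10 * c * d + 16 * a + 12 * b + 12 * c + 16 * d + 12,
     6 * a * b * c + 6 * a * b * d + 6 * a * c * d + 6 * b * c * d + 16 * a * b + 12 * a * c + 20 * a * d + 8 * b * c + 12 * b * d + 16 * c * d + 26 * a + 14 * b + 14 * c + 26 * d + 16,
     - 4 * a * b * c * d - 6 * a * b * c - 8 * a * b * d - 8 * a * c * d - 6 * b * c * d - 7 * a * b - 7 * a * c - 10 * a * d - 6 * b * c - 7 * b * d - 7 * c * d - 4 * a - 4 * b - 4 * c - 4 * d,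
     - 8 * a * b * c * d - 6 * a * b * c - 12 * a * b * d - 12 * a * c * d - 6 * b * c * d - 6 * a * b - 8 * a * c - 16 * a * d - 4 * b * c - 8 * b * d - 6 * c * d - 4 * a - 4 * b - 4 * c - 4 * d,
     3 * a * b * c * d + 2 * a * b * c + 2 * a * b * d + 2 * a * c * d + 2 * b * c * d + a * b + a * d + b * c + c * d])"
| "invs SDDD r = (let a = r ! 0; b = r ! 1; c = r ! 2; d = r ! 3 in
    [a + b + c + d + 4,
     a * b + a * c + a * d + b * c + b * d + c * d + 2 * b + 2 * c + 2 * d,
     a * b * c + a * b * d + a * c * d + b * c * d + b * c + b * d + c * d,
     a * b * c * d,
     - 2 * a * b - 2 * a * c - 2 * a * d - 4 * b * c - 4 * b * d - 4 * c * d - 4 * b - 4 * c - 4 * d,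
     3 * a * b * c + 3 * a * b * d + 3 * a * c * d + 3 * b * c * d + 4 * b * c + 4 * b * d + 4 * c * d,
     2 * a * b * c + 2 * a * b * d + 2 * a * c * d + 6 * b * c * d + 2 * b * c + 2 * b * d + 2 * c * d,
     - 4 * a * b * c * d - 4 * b * c * d,
     - 2 * a * b * c * d,
     0])"
| "invs SDDC r = (let a = r ! 0; b = r ! 1; c = r ! 2; d = r ! 3 in
    [a + b + c + d + 5,
     a * b + a * c + a * d + b * c + b * d + c * d + a + 3 * b + 3 * c + 3 * d + 2,
     a * b * c + a * b * d + a * c * d + b * c * d + a * b + a * c + 2 * b * c + 2 * b * d + 2 * c * d + b + c,
     a * b * c * d + a * b * c + b * c * d,
     - 2 * a * b - 2 * a * c - 4 * a * d - 4 * b * c - 4 * b * d - 4 * c * d - 2 * a - 8 * b - 8 * c - 10 * d - 4,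
     3 * a * b * c + 3 * a * b * d + 3 * a * c * d + 3 * b * c * d + 3 * a * b + 3 * a * c + a * d + 7 * b * c + 5 * b * d + 5 * c * d + 4 * b + 4 * c + 2 * d,
     2 * a * b * c + 4 * a * b * d + 4 * a * c * d + 6 * b * c * d + 2 * a * b + 2 * a * c + 8 * b * c + 8 * b * d + 8 * c * d + 2 * b + 2 * c,
     - 4 * a * b * c * d - 4 * a * b * c - a * b * d - a * c * d - 4 * b * c * d - 4 * b * c - b * d - c * d,
     - 4 * a * b * c * d - 2 * a * b * c - 6 * b * c * d,
     a * b * c * d])"
| "invs SDCC r = (let a = r ! 0; b = r ! 1; c = r ! 2; d = r ! 3 in
    [a + b + c + d + 6,
     a * b + a * c + a * d + b * c + b * d + c * d + 2 * a + 4 * b + 4 * c + 4 * d + 5,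
     a * b * c + a * b * d + a * c * d + b * c * d + 2 * a * b + a * c + a * d + 3 * b * c + 3 * b * d + 3 * c * d + a + 3 * b + 2 * c + 2 * d + 1,
     a * b * c * d + a * b * c + a * b * d + 2 * b * c * d + a * b + b * c + b * d,
     - 2 * a * b - 4 * a * c - 4 * a * d - 4 * b * c - 4 * b * d - 4 * c * d - 4 * a - 12 * b - 14 * c - 14 * d - 12,
     3 * a * b * c + 3 * a * b * d + 3 * a * c * d + 3 * b * c * d + 6 * a * b + 4 * a * c + 4 * a * d + 8 * b * c + 8 * b * d + 8 * c * d + 3 * a + 11 * b + 7 * c + 7 * d + 4,
     4 * a * b * c + 4 * a * b * d + 6 * a * c * d + 6 * b * c * d + 4 * a * b + 4 * a * c + 4 * a * d + 14 * b * c + 14 * b * d + 14 * c * d + 2 * a + 10 * b + 8 * c + 8 * d + 2,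
     - 4 * a * b * c * d - 5 * a * b * c - 5 * a * b * d - 2 * a * c * d - 6 * b * c * d - 4 * a * b - a * c - a * d - 5 * b * c - 5 * b * d - 2 * c * d - 4 * b - c - d,
     - 6 * a * b * c * d - 4 * a * b * c - 4 * a * b * d - 12 * b * c * d - 2 * a * b - 6 * b * c - 6 * b * d,
     2 * a * b * c * d + a * b * c + a * b * d])"
| "invs SCCC r = (let a = r ! 0; b = r ! 1; c = r ! 2; d = r ! 3 in
    [a + b + c + d + 7,
     a * b + a * c + a * d + b * c + b * d + c * d + 3 * a + 5 * b + 5 * c + 5 * d + 9,
     a * b * c + a * b * d + a * c * d + b * c * d + 2 * a * b + 2 * a * c + 2 * a * d + 4 * b * c + 4 * b * d + 4 * c * d + 3 * a + 5 * b + 5 * c + 5 * d + 4,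
     a * b * c * d + a * b * c + a * b * d + a * c * d + 3 * b * c * d + a * b + a * c + a * d + 2 * b * c + 2 * b * d + 2 * c * d + a + b + c + d,
     - 4 * a * b - 4 * a * c - 4 * a * d - 4 * b * c - 4 * b * d - 4 * c * d - 6 * a - 18 * b - 18 * c - 18 * d - 24,
     3 * a * b * c + 3 * a * b * d + 3 * a * c * d + 3 * b * c * d + 7 * a * b + 7 * a * c + 7 * a * d + 11 * b * c + 11 * b * d + 11 * c * d + 9 * a + 15 * b + 15 * c + 15 * d + 15,
     6 * a * b * c + 6 * a * b * d + 6 * a * c * d + 6 * b * c * d + 8 * a * b + 8 * a * c + 8 * a * d + 20 * b * c + 20 * b * d + 20 * c * d + 6 * a + 22 * b + 22 * c + 22 * d + 12,
     - 4 * a * b * c * d - 6 * a * b * c - 6 * a * b * d - 6 * a * c * d - 10 * b * c * d - 6 * a * b - 6 * a * c - 6 * a * d - 8 * b * c - 8 * b * d - 8 * c * d - 4 * a - 6 * b - 6 * c - 6 * d - 4,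
     - 8 * a * b * c * d - 6 * a * b * c - 6 * a * b * d - 6 * a * c * d - 18 * b * c * d - 4 * a * b - 4 * a * c - 4 * a * d - 12 * b * c - 12 * b * d - 12 * c * d - 2 * a - 6 * b - 6 * c - 6 * d,
     3 * a * b * c * d + 2 * a * b * c + 2 * a * b * d + 2 * a * c * d + a * b + a * c + a * d])"
| "invs HD r = (let a = r ! 0; b = r ! 1; c = r ! 2; d = r ! 3 in
    [a + b + c + d + 5,
     a * b + a * c + a * d + b * c + b * d + c * d + 3 * a + 3 * b + 2 * c + 3 * d + 2,
     a * b * c + a * b * d + a * c * d + b * c * d + 2 * a * b + a * c + 2 * a * d + b * c + 2 * b * d + 2 * c * d + a + b,
     a * b * c * d + a * b * d + a * c * d + b * c * d,
     - 4 * a * b - 4 * a * c - 4 * a * d - 4 * b * c - 4 * b * d - 2 * c * d - 8 * a - 8 * b - 4 * c - 10 * d - 4,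
     3 * a * b * c + 3 * a * b * d + 3 * a * c * d + 3 * b * c * d + 7 * a * b + 4 * a * c + 5 * a * d + 4 * b * c + 5 * b * d + 6 * c * d + 4 * a + 4 * b + 2 * d,
     6 * a * b * c + 6 * a * b * d + 4 * a * c * d + 4 * b * c * d + 8 * a * b + 2 * a * c + 8 * a * d + 2 * b * c + 8 * b * d + 4 * c * d + 2 * a + 2 * b,
     - 4 * a * b * c * d - 4 * a * b * c - 4 * a * b * d - 5 * a * c * d - 5 * b * c * d - 4 * a * b - a * d - b * d,
     - 6 * a * b * c * d - 6 * a * b * d - 2 * a * c * d - 2 * b * c * d,
     4 * a * b * c * d])"
| "invs HC r = (let a = r ! 0; b = r ! 1; c = r ! 2; d = r ! 3 in
    [a + b + c + d + 6,
     a * b + a * c + a * d + b * c + b * d + c * d + 4 * a + 4 * b + 3 * c + 4 * d + 5,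
     a * b * c + a * b * d + a * c * d + b * c * d + 3 * a * b + 2 * a * c + 3 * a * d + 2 * b * c + 3 * b * d + 2 * c * d + 3 * a + 3 * b + 2 * c + 2 * d,
     a * b * c * d + a * b * c + 2 * a * b * d + a * c * d + b * c * d + a * b + a * c + a * d + b * c + b * d,
     - 4 * a * b - 4 * a * c - 4 * a * d - 4 * b * c - 4 * b * d - 4 * c * d - 12 * a - 12 * b - 6 * c - 14 * d - 14,
     3 * a * b * c + 3 * a * b * d + 3 * a * c * d + 3 * b * c * d + 10 * a * b + 7 * a * c + 8 * a * d + 7 * b * c + 8 * b * d + 7 * c * d + 9 * a + 9 * b + 6 * c + 5 * d + 2,
     6 * a * b * c + 6 * a * b * d + 6 * a * c * d + 6 * b * c * d + 14 * a * b + 6 * a * c + 12 * a * d + 6 * b * c + 12 * b * d + 8 * c * d + 10 * a + 10 * b + 4 * c + 8 * d,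
     - 4 * a * b * c * d - 8 * a * b * c - 8 * a * b * d - 6 * a * c * d - 6 * b * c * d - 8 * a * b - 5 * a * c - 3 * a * d - 5 * b * c - 3 * b * d - 2 * c * d - a - b,
     - 8 * a * b * c * d - 6 * a * b * c - 10 * a * b * d - 4 * a * c * d - 4 * b * c * d - 6 * a * b - 2 * a * c - 4 * a * d - 2 * b * c - 4 * b * d,
     5 * a * b * c * d + 4 * a * b * c + a * b * d + a * c * d + b * c * d])"
| "invs H4 r = (let a = r ! 0; b = r ! 1; c = r ! 2; d = r ! 3 in
    [a + b + c + d + 5,
     a * b + a * c + a * d + b * c + b * d + c * d + 3 * a + 3 * b + 3 * c + 3 * d,
     a * b * c + a * b * d + a * c * d + b * c * d + 2 * a * b + 2 * a * c + 2 * a * d + 2 * b * c + 2 * b * d + 2 * c * d,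
     a * b * c * d + a * b * c + a * b * d + a * c * d + b * c * d,
     - 4 * a * b - 4 * a * c - 4 * a * d - 4 * b * c - 4 * b * d - 4 * c * d - 6 * a - 6 * b - 6 * c - 6 * d,
     3 * a * b * c + 3 * a * b * d + 3 * a * c * d + 3 * b * c * d + 7 * a * b + 7 * a * c + 7 * a * d + 7 * b * c + 7 * b * d + 7 * c * d,
     6 * a * b * c + 6 * a * b * d + 6 * a * c * d + 6 * b * c * d + 4 * a * b + 4 * a * c + 4 * a * d + 4 * b * c + 4 * b * d + 4 * c * d,
     - 4 * a * b * c * d - 8 * a * b * c - 8 * a * b * d - 8 * a * c * d - 8 * b * c * d,
     - 8 * a * b * c * d - 2 * a * b * c - 2 * a * b * d - 2 * a * c * d - 2 * b * c * d,
     9 * a * b * c * d])"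
definition lin :: "real list list \<Rightarrow> real list \<Rightarrow> real list" where
  "lin M v = map (\<lambda>row. sum_list (map2 (*) row v)) M"

text \<open>The recurrence of \<open>walks_cover_Suc\<close> on lists, which can be evaluated
  symbolically: \<open>B\<close> is the adjacency inside the cover, \<open>L\<close> counts common
  outside neighbours, and \<open>g\<close> stands for the diagonal of \<open>L\<close>.\<close>

fun walk_list :: "real list list \<Rightarrow> real list list \<Rightarrow> real list \<Rightarrow> nat \<Rightarrow> real list" where
  "walk_list B L g 0 = map (\<lambda>_. 1) g"
| "walk_list B L g (Suc 0) = map2 (+) (lin B (map (\<lambda>_. 1) g)) g"
| "walk_list B L g (Suc (Suc r)) = map2 (+) (lin B (walk_list B L g (Suc r))) (lin L (walk_list B L g r))"

text \<open>Mind the shift: index \<open>r\<close> belongs to walks of length \<open>r + 1\<close>.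
  The first summand counts those that start in the cover, the second those that start
  outside.\<close>

definition walk_total :: "real list list \<Rightarrow> real list list \<Rightarrow> real list \<Rightarrow> nat \<Rightarrow> real" where
  "walk_total B L g r = sum_list (walk_list B L g (Suc r)) + sum_list (map2 (*) g (walk_list B L g r))"

definition diagonal :: "real list list \<Rightarrow> real list" where
  "diagonal L = map (\<lambda>i. L ! i ! i) [0..<length L]"

context fgraph
begin

lemma walk_list_eq:
  assumes C: "cover (set cs)" and d: "distinct cs"
  shows "walk_list (map (\<lambda>u. map (adj u) cs) cs) (map (\<lambda>u. map (common (set cs) u) cs) cs)
      (map (\<lambda>u. common (set cs) u u) cs) r = map (walks r) cs"
    (is "walk_list ?B ?L ?g r = _")
proof -
  have lin: "lin (map (\<lambda>u. map (F u) cs) cs) (map f cs) = map (\<lambda>u. \<Sum>v\<in>set cs. F u v * f v) cs" for F f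
    using d by (simp add: lin_def zip_map_map zip_same_conv_map comp_def sum_list_distinct_conv_sum_set)
  \<comment> \<open>Two consecutive values are carried through the induction because the recurrence
    has order two.\<close>
  have "walk_list ?B ?L ?g r = map (walks r) cs \<and> walk_list ?B ?L ?g (Suc r) = map (walks (Suc r)) cs"
  proof (induction r)
    case 0
    show ?case
      using walks_cover_1[OF C] lin[of adj "\<lambda>_. 1"]
      by (auto simp: comp_def zip_map_map zip_same_conv_map simp del: walks.simps(2))
  next
    case (Suc r)
    then show ?case
      by (auto simp: walks_cover_Suc[OF C] lin comp_def zip_map_map zip_same_conv_map simp del: walks.simps(2))
  qed
  then show ?thesis ..
qed

lemma cover_matrices:
  assumes sc: "skeleton_cover s cs"
  shows "map (\<lambda>u. map (adj u) cs) cs = cover_adj s"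
    and "map (\<lambda>u. map (common (set cs) u) cs) cs = cover_common s (map real (pendant_list cs))"
    and "real (card (links (set cs))) = link_count s"
proof -
  have inj: "inj_on nb (connectors (set cs))" and sh: "shape s cs (set cs) (direct_edges (set cs)) (links (set cs))"
    using sc by (auto simp: skeleton_cover_def)
  define C where "C = set cs"
  have adj: "map (\<lambda>u. map (adj u) cs) cs =
      map (\<lambda>u. map (\<lambda>v. if {u, v} \<in> direct_edges C then 1 else 0) cs) cs"
    by (simp add: adj_eq_direct C_def)
  have sh: "shape s cs C (direct_edges C) (links C)" using sh by (simp add: C_def)
  show "map (\<lambda>u. map (adj u) cs) cs = cover_adj s"
    unfolding adj using sh by (cases s) (auto simp: doubleton_eq_iff)
  show "map (\<lambda>u. map (common (set cs) u) cs) cs = cover_common s (map real (pendant_list cs))"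
    unfolding C_def[symmetric] using sh inj[folded C_def]
    by (cases s) (auto simp: common_eq_links Let_def doubleton_eq_iff insert_eq_iff)
  show "real (card (links (set cs))) = link_count s"
    unfolding C_def[symmetric] using sh by (cases s) (auto simp: doubleton_eq_iff card_insert_if insert_eq_iff)
qed

end

definition char_det :: "skeleton \<Rightarrow> real list \<Rightarrow> real \<Rightarrow> real" where
  "char_det s r x = det (mat (skeleton_size s) (skeleton_size s)
    (\<lambda>(i, j). (if i = j then x\<^sup>2 else 0) - x * cover_adj s ! i ! j - cover_common s r ! i ! j))"

text \<open>Here \<open>t j\<close> is the number of walks of length \<open>j + 1\<close>, and
  \<open>n\<close> stands for the walks of length zero. The equations for \<open>i3\<close> to
  \<open>i8\<close> are the recurrence cut off at length zero. The power of \<open>x\<close> in the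
  last line brings skeletons with fewer than four cover vertices to degree eight.\<close>

definition evaluates :: "skeleton \<Rightarrow> real list \<Rightarrow> bool" where
  "evaluates s r \<longleftrightarrow> (\<exists>n m2 m3 m4 i3 i4 i5 i6 i7 i8. invs s r = [n, m2, m3, m4, i3, i4, i5, i6, i7, i8] \<and>
    (let L = cover_common s r; t = walk_total (cover_adj s) L (diagonal L); m1 = n - 1 in
    t 0 = 2 * m1 \<and> t 1 = m1 * n - 2 * m2 \<and>
    t 2 - m1 * t 0 = i3 \<and> t 3 - m1 * t 1 + m2 * n = i4 \<and> t 4 - m1 * t 2 + m2 * t 0 = i5 \<and>
    t 5 - m1 * t 3 + m2 * t 1 - m3 * n = i6 \<and> t 6 - m1 * t 4 + m2 * t 2 - m3 * t 0 = i7 \<and>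
    t 7 - m1 * t 5 + m2 * t 3 - m3 * t 1 + m4 * n = i8 \<and>
    (\<forall>x. char_det s r x * x ^ (8 - 2 * skeleton_size s) = x ^ 8 - m1 * x ^ 6 + m2 * x ^ 4 - m3 * x\<^sup>2 + m4)))"

section \<open>Symbolic evaluation for each skeleton\<close>

text \<open>The recurrence is spelled out for each length, so that every list is evaluated from the
  two before it.\<close>

lemma walk_list_eqs:
  assumes "walk_list B L g = U"
  shows "U 0 = map (\<lambda>_. 1) g" and "U 1 = map2 (+) (lin B (U 0)) g"
    and "U 2 = map2 (+) (lin B (U 1)) (lin L (U 0))" and "U 3 = map2 (+) (lin B (U 2)) (lin L (U 1))"
    and "U 4 = map2 (+) (lin B (U 3)) (lin L (U 2))" and "U 5 = map2 (+) (lin B (U 4)) (lin L (U 3))"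
    and "U 6 = map2 (+) (lin B (U 5)) (lin L (U 4))" and "U 7 = map2 (+) (lin B (U 6)) (lin L (U 5))"
    and "U 8 = map2 (+) (lin B (U 7)) (lin L (U 6))"
    and "walk_total B L g 0 = sum_list (U 1) + sum_list (map2 (*) g (U 0))"
    and "walk_total B L g 1 = sum_list (U 2) + sum_list (map2 (*) g (U 1))"
    and "walk_total B L g 2 = sum_list (U 3) + sum_list (map2 (*) g (U 2))"
    and "walk_total B L g 3 = sum_list (U 4) + sum_list (map2 (*) g (U 3))"
    and "walk_total B L g 4 = sum_list (U 5) + sum_list (map2 (*) g (U 4))"
    and "walk_total B L g 5 = sum_list (U 6) + sum_list (map2 (*) g (U 5))"
    and "walk_total B L g 6 = sum_list (U 7) + sum_list (map2 (*) g (U 6))"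
    and "walk_total B L g 7 = sum_list (U 8) + sum_list (map2 (*) g (U 7))"
  unfolding assms[symmetric] by (simp_all add: walk_total_def eval_nat_numeral comp_def)

lemma nth_list: "(x # xs) ! 0 = x" "(x # y # xs) ! 1 = y" "(x # y # z # xs) ! 2 = z" "(x # y # z # w # xs) ! 3 = w"
  by simp_all

lemmas list_eval = nth_list sum_list.Cons sum_list.Nil list.map zip_Cons_Cons zip.simps(1) prod.case
  mult_zero_left mult_1_left mult_1_right add_0_left add_0_right


text \<open>All twenty evaluations follow this scheme: the lists \<open>U0\<close> to
  \<open>U8\<close> are computed one after the other, and what is left are polynomial identities in
  the leaf numbers.\<close>

lemma evaluates_S1: "evaluates S1 [a]"
proof -
  let ?L = "cover_common S1 [a]"
  define U where "U = walk_list (cover_adj S1) ?L (diagonal ?L)"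
  note J = invs.simps(1)[of "[a]", unfolded Let_def list_eval]
  note L = cover_common.simps(1)[of "[a]", unfolded Let_def list_eval]
  have g: "diagonal ?L = [a]" by (simp add: diagonal_def)
  note g = g[unfolded L]
  note eqs = walk_list_eqs[OF U_def[symmetric], unfolded g cover_adj.simps L lin_def list_eval]
  note U0 = eqs(1) note U1 = eqs(2)[unfolded U0 list_eval]
  note U2 = eqs(3)[unfolded U1 U0 list_eval]
  note U3 = eqs(4)[unfolded U2 U1 list_eval]
  note U4 = eqs(5)[unfolded U3 U2 list_eval]
  note U5 = eqs(6)[unfolded U4 U3 list_eval]
  note U6 = eqs(7)[unfolded U5 U4 list_eval]
  note U7 = eqs(8)[unfolded U6 U5 list_eval]
  note U8 = eqs(9)[unfolded U7 U6 list_eval]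
  note det = char_det_def[of S1 "[a]", unfolded skeleton_size.simps cover_adj.simps L det_mat_1 nth_list]
  note size = skeleton_size.simps(1)
  show ?thesis
    unfolding evaluates_def Let_def g L J det size cover_adj.simps eqs(10-17) U8 U7 U6 U5 U4 U3 U2 U1 U0 list_eval
    \<comment> \<open>Reflexivity instantiates the ten existential variables with the entries of
      \<open>invs\<close>.\<close>
    by (intro exI conjI allI, rule refl) (Groebner_Basis.algebra+, simp?, Groebner_Basis.algebra?)
qed

lemma evaluates_ED: "evaluates ED [a, b]"
proof -
  let ?L = "cover_common ED [a, b]"
  define U where "U = walk_list (cover_adj ED) ?L (diagonal ?L)"
  note J = invs.simps(2)[of "[a, b]", unfolded Let_def list_eval]
  note L = cover_common.simps(2)[of "[a, b]", unfolded Let_def list_eval]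
  have g: "diagonal ?L = [a, b]" by (simp add: diagonal_def)
  note g = g[unfolded L]
  note eqs = walk_list_eqs[OF U_def[symmetric], unfolded g cover_adj.simps L lin_def list_eval]
  note U0 = eqs(1) note U1 = eqs(2)[unfolded U0 list_eval]
  note U2 = eqs(3)[unfolded U1 U0 list_eval]
  note U3 = eqs(4)[unfolded U2 U1 list_eval]
  note U4 = eqs(5)[unfolded U3 U2 list_eval]
  note U5 = eqs(6)[unfolded U4 U3 list_eval]
  note U6 = eqs(7)[unfolded U5 U4 list_eval]
  note U7 = eqs(8)[unfolded U6 U5 list_eval]
  note U8 = eqs(9)[unfolded U7 U6 list_eval]
  note det = char_det_def[of ED "[a, b]", unfolded skeleton_size.simps cover_adj.simps L det_mat_2 nth_list]
  note size = skeleton_size.simps(2)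
  show ?thesis
    unfolding evaluates_def Let_def g L J det size cover_adj.simps eqs(10-17) U8 U7 U6 U5 U4 U3 U2 U1 U0 list_eval
    by (intro exI conjI allI, rule refl) (Groebner_Basis.algebra+, simp?, Groebner_Basis.algebra?)
qed

lemma evaluates_EC: "evaluates EC [a, b]"
proof -
  let ?L = "cover_common EC [a, b]"
  define U where "U = walk_list (cover_adj EC) ?L (diagonal ?L)"
  note J = invs.simps(3)[of "[a, b]", unfolded Let_def list_eval]
  note L = cover_common.simps(3)[of "[a, b]", unfolded Let_def list_eval]
  have g: "diagonal ?L = [a + 1, b + 1]" by (simp add: diagonal_def)
  note g = g[unfolded L]
  note eqs = walk_list_eqs[OF U_def[symmetric], unfolded g cover_adj.simps L lin_def list_eval]
  note U0 = eqs(1) note U1 = eqs(2)[unfolded U0 list_eval]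
  note U2 = eqs(3)[unfolded U1 U0 list_eval]
  note U3 = eqs(4)[unfolded U2 U1 list_eval]
  note U4 = eqs(5)[unfolded U3 U2 list_eval]
  note U5 = eqs(6)[unfolded U4 U3 list_eval]
  note U6 = eqs(7)[unfolded U5 U4 list_eval]
  note U7 = eqs(8)[unfolded U6 U5 list_eval]
  note U8 = eqs(9)[unfolded U7 U6 list_eval]
  note det = char_det_def[of EC "[a, b]", unfolded skeleton_size.simps cover_adj.simps L det_mat_2 nth_list]
  note size = skeleton_size.simps(3)
  show ?thesis
    unfolding evaluates_def Let_def g L J det size cover_adj.simps eqs(10-17) U8 U7 U6 U5 U4 U3 U2 U1 U0 list_eval
    by (intro exI conjI allI, rule refl) (Groebner_Basis.algebra+, simp?, Groebner_Basis.algebra?)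
qed

lemma evaluates_PDD: "evaluates PDD [a, b, c]"
proof -
  let ?L = "cover_common PDD [a, b, c]"
  define U where "U = walk_list (cover_adj PDD) ?L (diagonal ?L)"
  note J = invs.simps(4)[of "[a, b, c]", unfolded Let_def list_eval]
  note L = cover_common.simps(4)[of "[a, b, c]", unfolded Let_def list_eval]
  have g: "diagonal ?L = [a, b, c]" by (simp add: diagonal_def)
  note g = g[unfolded L]
  note eqs = walk_list_eqs[OF U_def[symmetric], unfolded g cover_adj.simps L lin_def list_eval]
  note U0 = eqs(1) note U1 = eqs(2)[unfolded U0 list_eval]
  note U2 = eqs(3)[unfolded U1 U0 list_eval]
  note U3 = eqs(4)[unfolded U2 U1 list_eval]
  note U4 = eqs(5)[unfolded U3 U2 list_eval]
  note U5 = eqs(6)[unfolded U4 U3 list_eval]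
  note U6 = eqs(7)[unfolded U5 U4 list_eval]
  note U7 = eqs(8)[unfolded U6 U5 list_eval]
  note U8 = eqs(9)[unfolded U7 U6 list_eval]
  note det = char_det_def[of PDD "[a, b, c]", unfolded skeleton_size.simps cover_adj.simps L det_mat_3 nth_list]
  note size = skeleton_size.simps(4)
  show ?thesis
    unfolding evaluates_def Let_def g L J det size cover_adj.simps eqs(10-17) U8 U7 U6 U5 U4 U3 U2 U1 U0 list_eval
    by (intro exI conjI allI, rule refl) (Groebner_Basis.algebra+, simp?, Groebner_Basis.algebra?)
qed

lemma evaluates_PDC: "evaluates PDC [a, b, c]"
proof -
  let ?L = "cover_common PDC [a, b, c]"
  define U where "U = walk_list (cover_adj PDC) ?L (diagonal ?L)"
  note J = invs.simps(5)[of "[a, b, c]", unfolded Let_def list_eval]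
  note L = cover_common.simps(5)[of "[a, b, c]", unfolded Let_def list_eval]
  have g: "diagonal ?L = [a, b + 1, c + 1]" by (simp add: diagonal_def)
  note g = g[unfolded L]
  note eqs = walk_list_eqs[OF U_def[symmetric], unfolded g cover_adj.simps L lin_def list_eval]
  note U0 = eqs(1) note U1 = eqs(2)[unfolded U0 list_eval]
  note U2 = eqs(3)[unfolded U1 U0 list_eval]
  note U3 = eqs(4)[unfolded U2 U1 list_eval]
  note U4 = eqs(5)[unfolded U3 U2 list_eval]
  note U5 = eqs(6)[unfolded U4 U3 list_eval]
  note U6 = eqs(7)[unfolded U5 U4 list_eval]
  note U7 = eqs(8)[unfolded U6 U5 list_eval]
  note U8 = eqs(9)[unfolded U7 U6 list_eval]
  note det = char_det_def[of PDC "[a, b, c]", unfolded skeleton_size.simps cover_adj.simps L det_mat_3 nth_list]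
  note size = skeleton_size.simps(5)
  show ?thesis
    unfolding evaluates_def Let_def g L J det size cover_adj.simps eqs(10-17) U8 U7 U6 U5 U4 U3 U2 U1 U0 list_eval
    by (intro exI conjI allI, rule refl) (Groebner_Basis.algebra+, simp?, Groebner_Basis.algebra?)
qed

lemma evaluates_PCC: "evaluates PCC [a, b, c]"
proof -
  let ?L = "cover_common PCC [a, b, c]"
  define U where "U = walk_list (cover_adj PCC) ?L (diagonal ?L)"
  note J = invs.simps(6)[of "[a, b, c]", unfolded Let_def list_eval]
  note L = cover_common.simps(6)[of "[a, b, c]", unfolded Let_def list_eval]
  have g: "diagonal ?L = [a + 1, b + 2, c + 1]" by (simp add: diagonal_def)
  note g = g[unfolded L]
  note eqs = walk_list_eqs[OF U_def[symmetric], unfolded g cover_adj.simps L lin_def list_eval]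
  note U0 = eqs(1) note U1 = eqs(2)[unfolded U0 list_eval]
  note U2 = eqs(3)[unfolded U1 U0 list_eval]
  note U3 = eqs(4)[unfolded U2 U1 list_eval]
  note U4 = eqs(5)[unfolded U3 U2 list_eval]
  note U5 = eqs(6)[unfolded U4 U3 list_eval]
  note U6 = eqs(7)[unfolded U5 U4 list_eval]
  note U7 = eqs(8)[unfolded U6 U5 list_eval]
  note U8 = eqs(9)[unfolded U7 U6 list_eval]
  note det = char_det_def[of PCC "[a, b, c]", unfolded skeleton_size.simps cover_adj.simps L det_mat_3 nth_list]
  note size = skeleton_size.simps(6)
  show ?thesis
    unfolding evaluates_def Let_def g L J det size cover_adj.simps eqs(10-17) U8 U7 U6 U5 U4 U3 U2 U1 U0 list_eval
    by (intro exI conjI allI, rule refl) (Groebner_Basis.algebra+, simp?, Groebner_Basis.algebra?)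
qed

lemma evaluates_H3: "evaluates H3 [a, b, c]"
proof -
  let ?L = "cover_common H3 [a, b, c]"
  define U where "U = walk_list (cover_adj H3) ?L (diagonal ?L)"
  note J = invs.simps(7)[of "[a, b, c]", unfolded Let_def list_eval]
  note L = cover_common.simps(7)[of "[a, b, c]", unfolded Let_def list_eval]
  have g: "diagonal ?L = [a + 1, b + 1, c + 1]" by (simp add: diagonal_def)
  note g = g[unfolded L]
  note eqs = walk_list_eqs[OF U_def[symmetric], unfolded g cover_adj.simps L lin_def list_eval]
  note U0 = eqs(1) note U1 = eqs(2)[unfolded U0 list_eval]
  note U2 = eqs(3)[unfolded U1 U0 list_eval]
  note U3 = eqs(4)[unfolded U2 U1 list_eval]
  note U4 = eqs(5)[unfolded U3 U2 list_eval]
  note U5 = eqs(6)[unfolded U4 U3 list_eval]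
  note U6 = eqs(7)[unfolded U5 U4 list_eval]
  note U7 = eqs(8)[unfolded U6 U5 list_eval]
  note U8 = eqs(9)[unfolded U7 U6 list_eval]
  note det = char_det_def[of H3 "[a, b, c]", unfolded skeleton_size.simps cover_adj.simps L det_mat_3 nth_list]
  note size = skeleton_size.simps(7)
  show ?thesis
    unfolding evaluates_def Let_def g L J det size cover_adj.simps eqs(10-17) U8 U7 U6 U5 U4 U3 U2 U1 U0 list_eval
    by (intro exI conjI allI, rule refl) (Groebner_Basis.algebra+, simp?, Groebner_Basis.algebra?)
qed

lemma evaluates_PDDD: "evaluates PDDD [a, b, c, d]"
proof -
  let ?L = "cover_common PDDD [a, b, c, d]"
  define U where "U = walk_list (cover_adj PDDD) ?L (diagonal ?L)"
  note J = invs.simps(8)[of "[a, b, c, d]", unfolded Let_def list_eval]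
  note L = cover_common.simps(8)[of "[a, b, c, d]", unfolded Let_def list_eval]
  have g: "diagonal ?L = [a, b, c, d]" by (simp add: diagonal_def)
  note g = g[unfolded L]
  note eqs = walk_list_eqs[OF U_def[symmetric], unfolded g cover_adj.simps L lin_def list_eval]
  note U0 = eqs(1) note U1 = eqs(2)[unfolded U0 list_eval]
  note U2 = eqs(3)[unfolded U1 U0 list_eval]
  note U3 = eqs(4)[unfolded U2 U1 list_eval]
  note U4 = eqs(5)[unfolded U3 U2 list_eval]
  note U5 = eqs(6)[unfolded U4 U3 list_eval]
  note U6 = eqs(7)[unfolded U5 U4 list_eval]
  note U7 = eqs(8)[unfolded U6 U5 list_eval]
  note U8 = eqs(9)[unfolded U7 U6 list_eval]
  note det = char_det_def[of PDDD "[a, b, c, d]", unfolded skeleton_size.simps cover_adj.simps L det_mat_4 nth_list]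
  note size = skeleton_size.simps(8)
  show ?thesis
    unfolding evaluates_def Let_def g L J det size cover_adj.simps eqs(10-17) U8 U7 U6 U5 U4 U3 U2 U1 U0 list_eval
    by (intro exI conjI allI, rule refl) (Groebner_Basis.algebra+, simp?, Groebner_Basis.algebra?)
qed

lemma evaluates_PDDC: "evaluates PDDC [a, b, c, d]"
proof -
  let ?L = "cover_common PDDC [a, b, c, d]"
  define U where "U = walk_list (cover_adj PDDC) ?L (diagonal ?L)"
  note J = invs.simps(9)[of "[a, b, c, d]", unfolded Let_def list_eval]
  note L = cover_common.simps(9)[of "[a, b, c, d]", unfolded Let_def list_eval]
  have g: "diagonal ?L = [a, b, c + 1, d + 1]" by (simp add: diagonal_def)
  note g = g[unfolded L]
  note eqs = walk_list_eqs[OF U_def[symmetric], unfolded g cover_adj.simps L lin_def list_eval]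
  note U0 = eqs(1) note U1 = eqs(2)[unfolded U0 list_eval]
  note U2 = eqs(3)[unfolded U1 U0 list_eval]
  note U3 = eqs(4)[unfolded U2 U1 list_eval]
  note U4 = eqs(5)[unfolded U3 U2 list_eval]
  note U5 = eqs(6)[unfolded U4 U3 list_eval]
  note U6 = eqs(7)[unfolded U5 U4 list_eval]
  note U7 = eqs(8)[unfolded U6 U5 list_eval]
  note U8 = eqs(9)[unfolded U7 U6 list_eval]
  note det = char_det_def[of PDDC "[a, b, c, d]", unfolded skeleton_size.simps cover_adj.simps L det_mat_4 nth_list]
  note size = skeleton_size.simps(9)
  show ?thesis
    unfolding evaluates_def Let_def g L J det size cover_adj.simps eqs(10-17) U8 U7 U6 U5 U4 U3 U2 U1 U0 list_eval
    by (intro exI conjI allI, rule refl) (Groebner_Basis.algebra+, simp?, Groebner_Basis.algebra?)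
qed

lemma evaluates_PDCD: "evaluates PDCD [a, b, c, d]"
proof -
  let ?L = "cover_common PDCD [a, b, c, d]"
  define U where "U = walk_list (cover_adj PDCD) ?L (diagonal ?L)"
  note J = invs.simps(10)[of "[a, b, c, d]", unfolded Let_def list_eval]
  note L = cover_common.simps(10)[of "[a, b, c, d]", unfolded Let_def list_eval]
  have g: "diagonal ?L = [a, b + 1, c + 1, d]" by (simp add: diagonal_def)
  note g = g[unfolded L]
  note eqs = walk_list_eqs[OF U_def[symmetric], unfolded g cover_adj.simps L lin_def list_eval]
  note U0 = eqs(1) note U1 = eqs(2)[unfolded U0 list_eval]
  note U2 = eqs(3)[unfolded U1 U0 list_eval]
  note U3 = eqs(4)[unfolded U2 U1 list_eval]
  note U4 = eqs(5)[unfolded U3 U2 list_eval]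
  note U5 = eqs(6)[unfolded U4 U3 list_eval]
  note U6 = eqs(7)[unfolded U5 U4 list_eval]
  note U7 = eqs(8)[unfolded U6 U5 list_eval]
  note U8 = eqs(9)[unfolded U7 U6 list_eval]
  note det = char_det_def[of PDCD "[a, b, c, d]", unfolded skeleton_size.simps cover_adj.simps L det_mat_4 nth_list]
  note size = skeleton_size.simps(10)
  show ?thesis
    unfolding evaluates_def Let_def g L J det size cover_adj.simps eqs(10-17) U8 U7 U6 U5 U4 U3 U2 U1 U0 list_eval
    by (intro exI conjI allI, rule refl) (Groebner_Basis.algebra+, simp?, Groebner_Basis.algebra?)
qed

lemma evaluates_PDCC: "evaluates PDCC [a, b, c, d]"
proof -
  let ?L = "cover_common PDCC [a, b, c, d]"
  define U where "U = walk_list (cover_adj PDCC) ?L (diagonal ?L)"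
  note J = invs.simps(11)[of "[a, b, c, d]", unfolded Let_def list_eval]
  note L = cover_common.simps(11)[of "[a, b, c, d]", unfolded Let_def list_eval]
  have g: "diagonal ?L = [a, b + 1, c + 2, d + 1]" by (simp add: diagonal_def)
  note g = g[unfolded L]
  note eqs = walk_list_eqs[OF U_def[symmetric], unfolded g cover_adj.simps L lin_def list_eval]
  note U0 = eqs(1) note U1 = eqs(2)[unfolded U0 list_eval]
  note U2 = eqs(3)[unfolded U1 U0 list_eval]
  note U3 = eqs(4)[unfolded U2 U1 list_eval]
  note U4 = eqs(5)[unfolded U3 U2 list_eval]
  note U5 = eqs(6)[unfolded U4 U3 list_eval]
  note U6 = eqs(7)[unfolded U5 U4 list_eval]
  note U7 = eqs(8)[unfolded U6 U5 list_eval]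
  note U8 = eqs(9)[unfolded U7 U6 list_eval]
  note det = char_det_def[of PDCC "[a, b, c, d]", unfolded skeleton_size.simps cover_adj.simps L det_mat_4 nth_list]
  note size = skeleton_size.simps(11)
  show ?thesis
    unfolding evaluates_def Let_def g L J det size cover_adj.simps eqs(10-17) U8 U7 U6 U5 U4 U3 U2 U1 U0 list_eval
    by (intro exI conjI allI, rule refl) (Groebner_Basis.algebra+, simp?, Groebner_Basis.algebra?)
qed

lemma evaluates_PCDC: "evaluates PCDC [a, b, c, d]"
proof -
  let ?L = "cover_common PCDC [a, b, c, d]"
  define U where "U = walk_list (cover_adj PCDC) ?L (diagonal ?L)"
  note J = invs.simps(12)[of "[a, b, c, d]", unfolded Let_def list_eval]
  note L = cover_common.simps(12)[of "[a, b, c, d]", unfolded Let_def list_eval]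
  have g: "diagonal ?L = [a + 1, b + 1, c + 1, d + 1]" by (simp add: diagonal_def)
  note g = g[unfolded L]
  note eqs = walk_list_eqs[OF U_def[symmetric], unfolded g cover_adj.simps L lin_def list_eval]
  note U0 = eqs(1) note U1 = eqs(2)[unfolded U0 list_eval]
  note U2 = eqs(3)[unfolded U1 U0 list_eval]
  note U3 = eqs(4)[unfolded U2 U1 list_eval]
  note U4 = eqs(5)[unfolded U3 U2 list_eval]
  note U5 = eqs(6)[unfolded U4 U3 list_eval]
  note U6 = eqs(7)[unfolded U5 U4 list_eval]
  note U7 = eqs(8)[unfolded U6 U5 list_eval]
  note U8 = eqs(9)[unfolded U7 U6 list_eval]
  note det = char_det_def[of PCDC "[a, b, c, d]", unfolded skeleton_size.simps cover_adj.simps L det_mat_4 nth_list]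
  note size = skeleton_size.simps(12)
  show ?thesis
    unfolding evaluates_def Let_def g L J det size cover_adj.simps eqs(10-17) U8 U7 U6 U5 U4 U3 U2 U1 U0 list_eval
    by (intro exI conjI allI, rule refl) (Groebner_Basis.algebra+, simp?, Groebner_Basis.algebra?)
qed

lemma evaluates_PCCC: "evaluates PCCC [a, b, c, d]"
proof -
  let ?L = "cover_common PCCC [a, b, c, d]"
  define U where "U = walk_list (cover_adj PCCC) ?L (diagonal ?L)"
  note J = invs.simps(13)[of "[a, b, c, d]", unfolded Let_def list_eval]
  note L = cover_common.simps(13)[of "[a, b, c, d]", unfolded Let_def list_eval]
  have g: "diagonal ?L = [a + 1, b + 2, c + 2, d + 1]" by (simp add: diagonal_def)
  note g = g[unfolded L]
  note eqs = walk_list_eqs[OF U_def[symmetric], unfolded g cover_adj.simps L lin_def list_eval]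
  note U0 = eqs(1) note U1 = eqs(2)[unfolded U0 list_eval]
  note U2 = eqs(3)[unfolded U1 U0 list_eval]
  note U3 = eqs(4)[unfolded U2 U1 list_eval]
  note U4 = eqs(5)[unfolded U3 U2 list_eval]
  note U5 = eqs(6)[unfolded U4 U3 list_eval]
  note U6 = eqs(7)[unfolded U5 U4 list_eval]
  note U7 = eqs(8)[unfolded U6 U5 list_eval]
  note U8 = eqs(9)[unfolded U7 U6 list_eval]
  note det = char_det_def[of PCCC "[a, b, c, d]", unfolded skeleton_size.simps cover_adj.simps L det_mat_4 nth_list]
  note size = skeleton_size.simps(13)
  show ?thesis
    unfolding evaluates_def Let_def g L J det size cover_adj.simps eqs(10-17) U8 U7 U6 U5 U4 U3 U2 U1 U0 list_eval
    by (intro exI conjI allI, rule refl) (Groebner_Basis.algebra+, simp?, Groebner_Basis.algebra?)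
qed

lemma evaluates_SDDD: "evaluates SDDD [a, b, c, d]"
proof -
  let ?L = "cover_common SDDD [a, b, c, d]"
  define U where "U = walk_list (cover_adj SDDD) ?L (diagonal ?L)"
  note J = invs.simps(14)[of "[a, b, c, d]", unfolded Let_def list_eval]
  note L = cover_common.simps(14)[of "[a, b, c, d]", unfolded Let_def list_eval]
  have g: "diagonal ?L = [a, b, c, d]" by (simp add: diagonal_def)
  note g = g[unfolded L]
  note eqs = walk_list_eqs[OF U_def[symmetric], unfolded g cover_adj.simps L lin_def list_eval]
  note U0 = eqs(1) note U1 = eqs(2)[unfolded U0 list_eval]
  note U2 = eqs(3)[unfolded U1 U0 list_eval]
  note U3 = eqs(4)[unfolded U2 U1 list_eval]
  note U4 = eqs(5)[unfolded U3 U2 list_eval]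
  note U5 = eqs(6)[unfolded U4 U3 list_eval]
  note U6 = eqs(7)[unfolded U5 U4 list_eval]
  note U7 = eqs(8)[unfolded U6 U5 list_eval]
  note U8 = eqs(9)[unfolded U7 U6 list_eval]
  note det = char_det_def[of SDDD "[a, b, c, d]", unfolded skeleton_size.simps cover_adj.simps L det_mat_4 nth_list]
  note size = skeleton_size.simps(14)
  show ?thesis
    unfolding evaluates_def Let_def g L J det size cover_adj.simps eqs(10-17) U8 U7 U6 U5 U4 U3 U2 U1 U0 list_eval
    by (intro exI conjI allI, rule refl) (Groebner_Basis.algebra+, simp?, Groebner_Basis.algebra?)
qed

lemma evaluates_SDDC: "evaluates SDDC [a, b, c, d]"
proof -
  let ?L = "cover_common SDDC [a, b, c, d]"
  define U where "U = walk_list (cover_adj SDDC) ?L (diagonal ?L)"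
  note J = invs.simps(15)[of "[a, b, c, d]", unfolded Let_def list_eval]
  note L = cover_common.simps(15)[of "[a, b, c, d]", unfolded Let_def list_eval]
  have g: "diagonal ?L = [a + 1, b, c, d + 1]" by (simp add: diagonal_def)
  note g = g[unfolded L]
  note eqs = walk_list_eqs[OF U_def[symmetric], unfolded g cover_adj.simps L lin_def list_eval]
  note U0 = eqs(1) note U1 = eqs(2)[unfolded U0 list_eval]
  note U2 = eqs(3)[unfolded U1 U0 list_eval]
  note U3 = eqs(4)[unfolded U2 U1 list_eval]
  note U4 = eqs(5)[unfolded U3 U2 list_eval]
  note U5 = eqs(6)[unfolded U4 U3 list_eval]
  note U6 = eqs(7)[unfolded U5 U4 list_eval]
  note U7 = eqs(8)[unfolded U6 U5 list_eval]
  note U8 = eqs(9)[unfolded U7 U6 list_eval]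
  note det = char_det_def[of SDDC "[a, b, c, d]", unfolded skeleton_size.simps cover_adj.simps L det_mat_4 nth_list]
  note size = skeleton_size.simps(15)
  show ?thesis
    unfolding evaluates_def Let_def g L J det size cover_adj.simps eqs(10-17) U8 U7 U6 U5 U4 U3 U2 U1 U0 list_eval
    by (intro exI conjI allI, rule refl) (Groebner_Basis.algebra+, simp?, Groebner_Basis.algebra?)
qed

lemma evaluates_SDCC: "evaluates SDCC [a, b, c, d]"
proof -
  let ?L = "cover_common SDCC [a, b, c, d]"
  define U where "U = walk_list (cover_adj SDCC) ?L (diagonal ?L)"
  note J = invs.simps(16)[of "[a, b, c, d]", unfolded Let_def list_eval]
  note L = cover_common.simps(16)[of "[a, b, c, d]", unfolded Let_def list_eval]
  have g: "diagonal ?L = [a + 2, b, c + 1, d + 1]" by (simp add: diagonal_def)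
  note g = g[unfolded L]
  note eqs = walk_list_eqs[OF U_def[symmetric], unfolded g cover_adj.simps L lin_def list_eval]
  note U0 = eqs(1) note U1 = eqs(2)[unfolded U0 list_eval]
  note U2 = eqs(3)[unfolded U1 U0 list_eval]
  note U3 = eqs(4)[unfolded U2 U1 list_eval]
  note U4 = eqs(5)[unfolded U3 U2 list_eval]
  note U5 = eqs(6)[unfolded U4 U3 list_eval]
  note U6 = eqs(7)[unfolded U5 U4 list_eval]
  note U7 = eqs(8)[unfolded U6 U5 list_eval]
  note U8 = eqs(9)[unfolded U7 U6 list_eval]
  note det = char_det_def[of SDCC "[a, b, c, d]", unfolded skeleton_size.simps cover_adj.simps L det_mat_4 nth_list]
  note size = skeleton_size.simps(16)
  show ?thesis
    unfolding evaluates_def Let_def g L J det size cover_adj.simps eqs(10-17) U8 U7 U6 U5 U4 U3 U2 U1 U0 list_eval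
    by (intro exI conjI allI, rule refl) (Groebner_Basis.algebra+, simp?, Groebner_Basis.algebra?)
qed

lemma evaluates_SCCC: "evaluates SCCC [a, b, c, d]"
proof -
  let ?L = "cover_common SCCC [a, b, c, d]"
  define U where "U = walk_list (cover_adj SCCC) ?L (diagonal ?L)"
  note J = invs.simps(17)[of "[a, b, c, d]", unfolded Let_def list_eval]
  note L = cover_common.simps(17)[of "[a, b, c, d]", unfolded Let_def list_eval]
  have g: "diagonal ?L = [a + 3, b + 1, c + 1, d + 1]" by (simp add: diagonal_def)
  note g = g[unfolded L]
  note eqs = walk_list_eqs[OF U_def[symmetric], unfolded g cover_adj.simps L lin_def list_eval]
  note U0 = eqs(1) note U1 = eqs(2)[unfolded U0 list_eval]
  note U2 = eqs(3)[unfolded U1 U0 list_eval]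
  note U3 = eqs(4)[unfolded U2 U1 list_eval]
  note U4 = eqs(5)[unfolded U3 U2 list_eval]
  note U5 = eqs(6)[unfolded U4 U3 list_eval]
  note U6 = eqs(7)[unfolded U5 U4 list_eval]
  note U7 = eqs(8)[unfolded U6 U5 list_eval]
  note U8 = eqs(9)[unfolded U7 U6 list_eval]
  note det = char_det_def[of SCCC "[a, b, c, d]", unfolded skeleton_size.simps cover_adj.simps L det_mat_4 nth_list]
  note size = skeleton_size.simps(17)
  show ?thesis
    unfolding evaluates_def Let_def g L J det size cover_adj.simps eqs(10-17) U8 U7 U6 U5 U4 U3 U2 U1 U0 list_eval
    by (intro exI conjI allI, rule refl) (Groebner_Basis.algebra+, simp?, Groebner_Basis.algebra?)
qed

lemma evaluates_HD: "evaluates HD [a, b, c, d]"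
proof -
  let ?L = "cover_common HD [a, b, c, d]"
  define U where "U = walk_list (cover_adj HD) ?L (diagonal ?L)"
  note J = invs.simps(18)[of "[a, b, c, d]", unfolded Let_def list_eval]
  note L = cover_common.simps(18)[of "[a, b, c, d]", unfolded Let_def list_eval]
  have g: "diagonal ?L = [a + 1, b + 1, c + 1, d]" by (simp add: diagonal_def)
  note g = g[unfolded L]
  note eqs = walk_list_eqs[OF U_def[symmetric], unfolded g cover_adj.simps L lin_def list_eval]
  note U0 = eqs(1) note U1 = eqs(2)[unfolded U0 list_eval]
  note U2 = eqs(3)[unfolded U1 U0 list_eval]
  note U3 = eqs(4)[unfolded U2 U1 list_eval]
  note U4 = eqs(5)[unfolded U3 U2 list_eval]
  note U5 = eqs(6)[unfolded U4 U3 list_eval]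
  note U6 = eqs(7)[unfolded U5 U4 list_eval]
  note U7 = eqs(8)[unfolded U6 U5 list_eval]
  note U8 = eqs(9)[unfolded U7 U6 list_eval]
  note det = char_det_def[of HD "[a, b, c, d]", unfolded skeleton_size.simps cover_adj.simps L det_mat_4 nth_list]
  note size = skeleton_size.simps(18)
  show ?thesis
    unfolding evaluates_def Let_def g L J det size cover_adj.simps eqs(10-17) U8 U7 U6 U5 U4 U3 U2 U1 U0 list_eval
    by (intro exI conjI allI, rule refl) (Groebner_Basis.algebra+, simp?, Groebner_Basis.algebra?)
qed

lemma evaluates_HC: "evaluates HC [a, b, c, d]"
proof -
  let ?L = "cover_common HC [a, b, c, d]"
  define U where "U = walk_list (cover_adj HC) ?L (diagonal ?L)"
  note J = invs.simps(19)[of "[a, b, c, d]", unfolded Let_def list_eval]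
  note L = cover_common.simps(19)[of "[a, b, c, d]", unfolded Let_def list_eval]
  have g: "diagonal ?L = [a + 1, b + 1, c + 2, d + 1]" by (simp add: diagonal_def)
  note g = g[unfolded L]
  note eqs = walk_list_eqs[OF U_def[symmetric], unfolded g cover_adj.simps L lin_def list_eval]
  note U0 = eqs(1) note U1 = eqs(2)[unfolded U0 list_eval]
  note U2 = eqs(3)[unfolded U1 U0 list_eval]
  note U3 = eqs(4)[unfolded U2 U1 list_eval]
  note U4 = eqs(5)[unfolded U3 U2 list_eval]
  note U5 = eqs(6)[unfolded U4 U3 list_eval]
  note U6 = eqs(7)[unfolded U5 U4 list_eval]
  note U7 = eqs(8)[unfolded U6 U5 list_eval]
  note U8 = eqs(9)[unfolded U7 U6 list_eval]
  note det = char_det_def[of HC "[a, b, c, d]", unfolded skeleton_size.simps cover_adj.simps L det_mat_4 nth_list]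
  note size = skeleton_size.simps(19)
  show ?thesis
    unfolding evaluates_def Let_def g L J det size cover_adj.simps eqs(10-17) U8 U7 U6 U5 U4 U3 U2 U1 U0 list_eval
    by (intro exI conjI allI, rule refl) (Groebner_Basis.algebra+, simp?, Groebner_Basis.algebra?)
qed

lemma evaluates_H4: "evaluates H4 [a, b, c, d]"
proof -
  let ?L = "cover_common H4 [a, b, c, d]"
  define U where "U = walk_list (cover_adj H4) ?L (diagonal ?L)"
  note J = invs.simps(20)[of "[a, b, c, d]", unfolded Let_def list_eval]
  note L = cover_common.simps(20)[of "[a, b, c, d]", unfolded Let_def list_eval]
  have g: "diagonal ?L = [a + 1, b + 1, c + 1, d + 1]" by (simp add: diagonal_def)
  note g = g[unfolded L]
  note eqs = walk_list_eqs[OF U_def[symmetric], unfolded g cover_adj.simps L lin_def list_eval]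
  note U0 = eqs(1) note U1 = eqs(2)[unfolded U0 list_eval]
  note U2 = eqs(3)[unfolded U1 U0 list_eval]
  note U3 = eqs(4)[unfolded U2 U1 list_eval]
  note U4 = eqs(5)[unfolded U3 U2 list_eval]
  note U5 = eqs(6)[unfolded U4 U3 list_eval]
  note U6 = eqs(7)[unfolded U5 U4 list_eval]
  note U7 = eqs(8)[unfolded U6 U5 list_eval]
  note U8 = eqs(9)[unfolded U7 U6 list_eval]
  note det = char_det_def[of H4 "[a, b, c, d]", unfolded skeleton_size.simps cover_adj.simps L det_mat_4 nth_list]
  note size = skeleton_size.simps(20)
  show ?thesis
    unfolding evaluates_def Let_def g L J det size cover_adj.simps eqs(10-17) U8 U7 U6 U5 U4 U3 U2 U1 U0 list_eval
    by (intro exI conjI allI, rule refl) (Groebner_Basis.algebra+, simp?, Groebner_Basis.algebra?)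
qed

lemma evaluates:
  assumes "length r = skeleton_size s"
  shows "evaluates s r"
proof -
  have r: "skeleton_size s = 1 \<Longrightarrow> \<exists>a. r = [a]" "skeleton_size s = 2 \<Longrightarrow> \<exists>a b. r = [a, b]"
    "skeleton_size s = 3 \<Longrightarrow> \<exists>a b c. r = [a, b, c]" "skeleton_size s = 4 \<Longrightarrow> \<exists>a b c d. r = [a, b, c, d]"
    using assms by (auto simp: length_Suc_conv numeral_eq_Suc)
  show ?thesis
    using r by (cases s) (auto simp: evaluates_S1 evaluates_ED evaluates_EC evaluates_PDD evaluates_PDC evaluates_PCC evaluates_H3 evaluates_PDDD evaluates_PDDC evaluates_PDCD evaluates_PDCC evaluates_PCDC evaluates_PCCC evaluates_SDDD evaluates_SDDC evaluates_SDCC evaluates_SCCC evaluates_HD evaluates_HC evaluates_H4)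
qed

section \<open>The invariants of a graph with a skeleton\<close>

lemma invs_0:
  assumes "length r = skeleton_size s"
  shows "invs s r ! 0 = real (skeleton_size s) + sum_list r + link_count s"
  using assms by (cases s) (auto simp: length_Suc_conv numeral_eq_Suc)

lemma diagonal_map: "diagonal (map (\<lambda>u. map (f u) cs) cs) = map (\<lambda>u. f u u) cs"
  by (auto simp: diagonal_def intro!: nth_equalityI)

text \<open>Transfers the symbolic evaluation to the graph. The characteristic polynomial is
  multiplied by \<open>x ^ 8\<close> because the exponents \<open>card (pverts T) - 2 * i\<close>
  could be negative for small trees.\<close>

theorem skeleton_invariants:
  fixes T :: "'a pair_pre_digraph"
  assumes T: "pair_graph T" and sc: "fgraph.skeleton_cover (pverts T) (parcs T) s cs"
    and ne: "cs \<noteq> []"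
  obtains n m2 m3 m4 i3 i4 i5 i6 i7 i8 where
    "invs s (map real (fgraph.pendant_list (pverts T) (parcs T) cs)) = [n, m2, m3, m4, i3, i4, i5, i6, i7, i8]"
    "n = real (card (pverts T))"
    "num_walks 1 T = 2 * (n - 1)" "num_walks 2 T = (n - 1) * n - 2 * m2"
    "num_walks 3 T - (n - 1) * num_walks 1 T = i3"
    "num_walks 4 T - (n - 1) * num_walks 2 T + m2 * n = i4"
    "num_walks 5 T - (n - 1) * num_walks 3 T + m2 * num_walks 1 T = i5"
    "num_walks 6 T - (n - 1) * num_walks 4 T + m2 * num_walks 2 T - m3 * n = i6"
    "num_walks 7 T - (n - 1) * num_walks 5 T + m2 * num_walks 3 T - m3 * num_walks 1 T = i7"
    "num_walks 8 T - (n - 1) * num_walks 6 T + m2 * num_walks 4 T - m3 * num_walks 2 T + m4 * n = i8"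
    "\<And>x. poly (char_poly (adjacency_matrix T)) x * x ^ 8 =
      x ^ card (pverts T) * (x ^ 8 - (n - 1) * x ^ 6 + m2 * x ^ 4 - m3 * x\<^sup>2 + m4)"
proof -
  interpret fgraph "pverts T" "parcs T" using T by (rule fgraph_pair_graph)
  let ?C = "set cs" and ?r = "map real (pendant_list cs)"
  have cov: "cover ?C" and inj: "inj_on nb (connectors ?C)" and nonempty: "\<forall>u\<in>pverts T - ?C. nb u \<noteq> {}"
    and sh: "shape s cs ?C (direct_edges ?C) (links ?C)"
    using sc by (auto simp: skeleton_cover_def)
  note cs = shapeD[OF sh]
  note mats = cover_matrices[OF sc]
  have "evaluates s ?r" using cs by (intro evaluates) simp
  then obtain n m2 m3 m4 i3 i4 i5 i6 i7 i8 where J: "invs s ?r = [n, m2, m3, m4, i3, i4, i5, i6, i7, i8]"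
    and t: "let L = cover_common s ?r; t = walk_total (cover_adj s) L (diagonal L); m1 = n - 1 in
    t 0 = 2 * m1 \<and> t 1 = m1 * n - 2 * m2 \<and>
    t 2 - m1 * t 0 = i3 \<and> t 3 - m1 * t 1 + m2 * n = i4 \<and> t 4 - m1 * t 2 + m2 * t 0 = i5 \<and>
    t 5 - m1 * t 3 + m2 * t 1 - m3 * n = i6 \<and> t 6 - m1 * t 4 + m2 * t 2 - m3 * t 0 = i7 \<and>
    t 7 - m1 * t 5 + m2 * t 3 - m3 * t 1 + m4 * n = i8 \<and>
    (\<forall>x. char_det s ?r x * x ^ (8 - 2 * skeleton_size s) = x ^ 8 - m1 * x ^ 6 + m2 * x ^ 4 - m3 * x\<^sup>2 + m4)"
    unfolding evaluates_def by blast
  have n: "n = real (card (pverts T))"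
  proof -
    have "sum_list ?r = (\<Sum>c\<in>?C. real (pendants ?C c))"
      using cs(2) by (simp add: sum_list_distinct_conv_sum_set comp_def)
    moreover have "card ?C = skeleton_size s" using cs by (simp add: distinct_card)
    moreover have "length ?r = skeleton_size s" using cs by simp
    ultimately show ?thesis
      using invs_0[of ?r s] card_V_eq[OF cov inj nonempty] mats(3) J by simp
  qed
  have W: "num_walks (Suc k) T = walk_total (cover_adj s) (cover_common s ?r) (diagonal (cover_common s ?r)) k" for k
  proof -
    have "num_walks (Suc k) T = (\<Sum>c\<in>?C. walks (Suc k) c) + (\<Sum>c\<in>?C. common ?C c c * walks k c)"
      using num_walks_eq[OF T] sum_walks_cover[OF cov] by simp
    also have "\<dots> = walk_total (cover_adj s) (cover_common s ?r) (diagonal (cover_common s ?r)) k"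
      unfolding mats(1,2)[symmetric] walk_total_def diagonal_map walk_list_eq[OF cov cs(2)]
      using cs(2) by (simp add: sum_list_distinct_conv_sum_set zip_map_map zip_same_conv_map comp_def del: walks.simps)
    finally show ?thesis .
  qed
  have Ws: "num_walks 1 T = walk_total (cover_adj s) (cover_common s ?r) (diagonal (cover_common s ?r)) 0"
    "num_walks 2 T = walk_total (cover_adj s) (cover_common s ?r) (diagonal (cover_common s ?r)) 1"
    "num_walks 3 T = walk_total (cover_adj s) (cover_common s ?r) (diagonal (cover_common s ?r)) 2"
    "num_walks 4 T = walk_total (cover_adj s) (cover_common s ?r) (diagonal (cover_common s ?r)) 3"
    "num_walks 5 T = walk_total (cover_adj s) (cover_common s ?r) (diagonal (cover_common s ?r)) 4"
    "num_walks 6 T = walk_total (cover_adj s) (cover_common s ?r) (diagonal (cover_common s ?r)) 5"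
    "num_walks 7 T = walk_total (cover_adj s) (cover_common s ?r) (diagonal (cover_common s ?r)) 6"
    "num_walks 8 T = walk_total (cover_adj s) (cover_common s ?r) (diagonal (cover_common s ?r)) 7"
    using W[of 0] W[of 1] W[of 2] W[of 3] W[of 4] W[of 5] W[of 6] W[of 7] by (simp_all add: eval_nat_numeral)
  have det: "char_det s ?r x = det (mat (length cs) (length cs) (\<lambda>(i, j). (if cs ! i = cs ! j then x\<^sup>2 else 0) -
      x * adj (cs ! i) (cs ! j) - common ?C (cs ! i) (cs ! j)))" for x
    unfolding char_det_def mats(1,2)[symmetric]
    by (rule arg_cong[where f = det], rule eq_matI) (use cs in \<open>auto simp: nth_eq_iff_index_eq\<close>)
  have "poly (char_poly (adjacency_matrix T)) x * x ^ 8 =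
      x ^ card (pverts T) * (x ^ 8 - (n - 1) * x ^ 6 + m2 * x ^ 4 - m3 * x\<^sup>2 + m4)" for x
  proof -
    let ?k = "length cs"
    note cp = char_poly_cover[OF T cov cs(2) refl]
    have k4: "?k \<le> 4" unfolding cs(3) by (cases s) auto
    have "poly (char_poly (adjacency_matrix T)) x * x ^ 8 =
        poly (char_poly (adjacency_matrix T)) x * x ^ ?k * x ^ (8 - ?k)"
      using k4 by (simp add: mult.assoc power_add[symmetric])
    also have "\<dots> = char_det s ?r x * x ^ (card (pverts T) - ?k + (8 - ?k))"
      unfolding cp(1)[of x] det by (simp add: power_add)
    \<comment> \<open>No subtraction is truncated here: \<open>?k\<close> is at most four and at
      most the number of vertices.\<close>
    also have "card (pverts T) - ?k + (8 - ?k) = card (pverts T) + (8 - 2 * skeleton_size s)"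
      using cp(2) k4 cs(3) by simp
    finally have "poly (char_poly (adjacency_matrix T)) x * x ^ 8 =
        x ^ card (pverts T) * (char_det s ?r x * x ^ (8 - 2 * skeleton_size s))"
      by (simp add: power_add mult_ac)
    moreover have "char_det s ?r x * x ^ (8 - 2 * skeleton_size s) =
        x ^ 8 - (n - 1) * x ^ 6 + m2 * x ^ 4 - m3 * x\<^sup>2 + m4"
      using t unfolding Let_def by blast
    ultimately show ?thesis by simp
  qed
  then show ?thesis
    using that[OF J n] t unfolding Ws Let_def by blast
qed

section \<open>The invariants determine the skeleton\<close>

definition sep :: "real list \<Rightarrow> real list \<Rightarrow> real" where
  "sep l J = sum_list (map2 (*) l J)"

lemmas sep_eval = sep_def invs.simps Let_def list_eval of_nat_add of_nat_mult of_nat_numeral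

text \<open>The nonconstant part of a polynomial with nonnegative integer coefficients is written as
  \<open>real\<close> of a natural number, so that the bound is its constant term.\<close>

lemma less_add_of_nat: "x = c + real p \<Longrightarrow> t < c \<Longrightarrow> t < x"
  by simp

lemma diff_of_nat_le: "x = c - real p \<Longrightarrow> c \<le> t \<Longrightarrow> x \<le> t"
  by simp

text \<open>\<open>x\<close> is the value of one functional, expressed by the leaf numbers of two
  skeletons. A contradiction arises when the lower bound \<open>c\<close> exceeds the upper bound
  \<open>d\<close>.\<close>

lemma separate: "x = c + real p \<Longrightarrow> x = d - real q \<Longrightarrow> c \<le> d"
  by simp

text \<open>Normalises a variable that was shifted by one and is then split into zero and
  successor.\<close>

lemma nat_shift: "1 + (1 + real n) = 2 + real n" "1 + (0::real) = 1"
  by simp_all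

text \<open>The functionals below were found by linear programming; a sign is read off after shifting the
  variables by their lower bounds, when all coefficients but the constant have the same sign.\<close>

lemma signs_S1:
  assumes "admissible S1 xs" and "length xs = 1"
  defines "J \<equiv> invs S1 (map real xs)"
  shows "sep [0, 0, 0, 1, 0, 0, 0, 0, 0, 0] J \<le> 0" and "sep [0, 0, 1, 0, 0, 0, 0, 0, 0, 0] J \<le> 0" and "sep [0, 1, 0, 0, 0, 0, 0, 0, 0, 0] J \<le> 0"
proof -
  obtain a where "xs = [a]"
    using assms(1,2) by (auto simp: length_Suc_conv numeral_eq_Suc Suc_le_eq gr0_conv_Suc)
  then have J: "J = invs S1 [real a]" by (simp add: J_def del: invs.simps)
  have "sep [0, 0, 0, 1, 0, 0, 0, 0, 0, 0] J = 0"
    unfolding J sep_eval by (Groebner_Basis.algebra | simp add: algebra_simps)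
  then show "sep [0, 0, 0, 1, 0, 0, 0, 0, 0, 0] J \<le> 0" by simp
  have "sep [0, 0, 1, 0, 0, 0, 0, 0, 0, 0] J = 0"
    unfolding J sep_eval by (Groebner_Basis.algebra | simp add: algebra_simps)
  then show "sep [0, 0, 1, 0, 0, 0, 0, 0, 0, 0] J \<le> 0" by simp
  have "sep [0, 1, 0, 0, 0, 0, 0, 0, 0, 0] J = 0"
    unfolding J sep_eval by (Groebner_Basis.algebra | simp add: algebra_simps)
  then show "sep [0, 1, 0, 0, 0, 0, 0, 0, 0, 0] J \<le> 0" by simp
qed

text \<open>The first functionals are the numbers of matchings of sizes four, three and two, which
  reveal the number of cover vertices. The last one is \<open>- i4\<close>, which vanishes for
  \<open>ED\<close> but not for \<open>EC\<close>.\<close>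

lemma signs_ED:
  assumes "admissible ED xs" and "length xs = 2"
  defines "J \<equiv> invs ED (map real xs)"
  shows "sep [0, 0, 0, 1, 0, 0, 0, 0, 0, 0] J \<le> 0" and "sep [0, 0, 1, 0, 0, 0, 0, 0, 0, 0] J \<le> 0" and "0 < sep [0, 1, 0, 0, 0, 0, 0, 0, 0, 0] J" and "-1 < sep [0, 0, 0, 0, 0, -1, 0, 0, 0, 0] J"
proof -
  obtain a b where "xs = [Suc a, Suc b]"
    using assms(1,2) by (auto simp: length_Suc_conv numeral_eq_Suc Suc_le_eq gr0_conv_Suc)
  then have J: "J = invs ED [1 + real a, 1 + real b]" by (simp add: J_def del: invs.simps)
  have "sep [0, 0, 0, 1, 0, 0, 0, 0, 0, 0] J = 0"
    unfolding J sep_eval by (Groebner_Basis.algebra | simp add: algebra_simps)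
  then show "sep [0, 0, 0, 1, 0, 0, 0, 0, 0, 0] J \<le> 0" by simp
  have "sep [0, 0, 1, 0, 0, 0, 0, 0, 0, 0] J = 0"
    unfolding J sep_eval by (Groebner_Basis.algebra | simp add: algebra_simps)
  then show "sep [0, 0, 1, 0, 0, 0, 0, 0, 0, 0] J \<le> 0" by simp
  have "sep [0, 1, 0, 0, 0, 0, 0, 0, 0, 0] J = 1 + real (a * b + a + b)"
    unfolding J sep_eval by (Groebner_Basis.algebra | simp add: algebra_simps)
  then show "0 < sep [0, 1, 0, 0, 0, 0, 0, 0, 0, 0] J" by (rule less_add_of_nat) simp
  have "sep [0, 0, 0, 0, 0, -1, 0, 0, 0, 0] J = 0"
    unfolding J sep_eval by (Groebner_Basis.algebra | simp add: algebra_simps)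
  then show "-1 < sep [0, 0, 0, 0, 0, -1, 0, 0, 0, 0] J" by simp
qed

lemma signs_EC:
  assumes "admissible EC xs" and "length xs = 2"
  defines "J \<equiv> invs EC (map real xs)"
  shows "sep [0, 0, 0, 1, 0, 0, 0, 0, 0, 0] J \<le> 0" and "sep [0, 0, 1, 0, 0, 0, 0, 0, 0, 0] J \<le> 0" and "0 < sep [0, 1, 0, 0, 0, 0, 0, 0, 0, 0] J" and "sep [0, 0, 0, 0, 0, -1, 0, 0, 0, 0] J \<le> -1"
proof -
  obtain a b where "xs = [Suc a, Suc b]"
    using assms(1,2) by (auto simp: length_Suc_conv numeral_eq_Suc Suc_le_eq gr0_conv_Suc)
  then have J: "J = invs EC [1 + real a, 1 + real b]" by (simp add: J_def del: invs.simps)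
  have "sep [0, 0, 0, 1, 0, 0, 0, 0, 0, 0] J = 0"
    unfolding J sep_eval by (Groebner_Basis.algebra | simp add: algebra_simps)
  then show "sep [0, 0, 0, 1, 0, 0, 0, 0, 0, 0] J \<le> 0" by simp
  have "sep [0, 0, 1, 0, 0, 0, 0, 0, 0, 0] J = 0"
    unfolding J sep_eval by (Groebner_Basis.algebra | simp add: algebra_simps)
  then show "sep [0, 0, 1, 0, 0, 0, 0, 0, 0, 0] J \<le> 0" by simp
  have "sep [0, 1, 0, 0, 0, 0, 0, 0, 0, 0] J = 3 + real (a * b + 2 * a + 2 * b)"
    unfolding J sep_eval by (Groebner_Basis.algebra | simp add: algebra_simps)
  then show "0 < sep [0, 1, 0, 0, 0, 0, 0, 0, 0, 0] J" by (rule less_add_of_nat) simp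
  have "sep [0, 0, 0, 0, 0, -1, 0, 0, 0, 0] J = -1 - real (a * b + a + b)"
    unfolding J sep_eval by (Groebner_Basis.algebra | simp add: algebra_simps)
  then show "sep [0, 0, 0, 0, 0, -1, 0, 0, 0, 0] J \<le> -1" by (rule diff_of_nat_le) simp
qed

lemma signs_PDD:
  assumes "admissible PDD xs" and "length xs = 3"
  defines "J \<equiv> invs PDD (map real xs)"
  shows "sep [0, 0, 0, 1, 0, 0, 0, 0, 0, 0] J \<le> 0" and "0 < sep [0, 0, 1, 0, 0, 0, 0, 0, 0, 0] J" and "-2 < sep [0, 4, -18, 0, 2, 4, 3, 6, 0, 0] J" and "-10 < sep [-2, -2, 9, -9, -1, -1, -2, -2, -9, -9] J" and "6 < sep [1, -2, 1, -2, -1, -1, 1, 2, -2, -2] J"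
proof -
  obtain a b c where "xs = [Suc a, Suc b, Suc c]"
    using assms(1,2) by (auto simp: length_Suc_conv numeral_eq_Suc Suc_le_eq gr0_conv_Suc)
  then have J: "J = invs PDD [1 + real a, 1 + real b, 1 + real c]" by (simp add: J_def del: invs.simps)
  have "sep [0, 0, 0, 1, 0, 0, 0, 0, 0, 0] J = 0"
    unfolding J sep_eval by (Groebner_Basis.algebra | simp add: algebra_simps)
  then show "sep [0, 0, 0, 1, 0, 0, 0, 0, 0, 0] J \<le> 0" by simp
  have "sep [0, 0, 1, 0, 0, 0, 0, 0, 0, 0] J = 1 + real (a * b * c + a * b + a * c + b * c + a + b + c)"
    unfolding J sep_eval by (Groebner_Basis.algebra | simp add: algebra_simps)
  then show "0 < sep [0, 0, 1, 0, 0, 0, 0, 0, 0, 0] J" by (rule less_add_of_nat) simp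
  \<comment> \<open>A linear relation among the invariants that holds for \<open>PDD\<close>; on
    \<open>PDC\<close> and \<open>H3\<close> the same combination is at most -2.\<close>
  have "sep [0, 4, -18, 0, 2, 4, 3, 6, 0, 0] J = 0"
    unfolding J sep_eval by (Groebner_Basis.algebra | simp add: algebra_simps)
  then show "-2 < sep [0, 4, -18, 0, 2, 4, 3, 6, 0, 0] J" by simp
  have "sep [-2, -2, 9, -9, -1, -1, -2, -2, -9, -9] J = -9 + real (2 * a * b * c + 2 * a * b + 3 * a * c + 2 * b * c + a + c)"
    unfolding J sep_eval by (Groebner_Basis.algebra | simp add: algebra_simps)
  then show "-10 < sep [-2, -2, 9, -9, -1, -1, -2, -2, -9, -9] J" by (rule less_add_of_nat) simp
  have "sep [1, -2, 1, -2, -1, -1, 1, 2, -2, -2] J = 7 + real (a * c + 2 * a + b + 2 * c)"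
    unfolding J sep_eval by (Groebner_Basis.algebra | simp add: algebra_simps)
  then show "6 < sep [1, -2, 1, -2, -1, -1, 1, 2, -2, -2] J" by (rule less_add_of_nat) simp
qed

lemma signs_PDC:
  assumes "admissible PDC xs" and "length xs = 3"
  defines "J \<equiv> invs PDC (map real xs)"
  shows "sep [0, 0, 0, 1, 0, 0, 0, 0, 0, 0] J \<le> 0" and "0 < sep [0, 0, 1, 0, 0, 0, 0, 0, 0, 0] J" and "sep [0, 4, -18, 0, 2, 4, 3, 6, 0, 0] J \<le> -2" and "-10 < sep [-2, -2, 9, -9, -1, -1, -2, -2, -9, -9] J" and "6 < sep [1, -2, 1, -2, -1, -1, 1, 2, -2, -2] J"
proof -
  obtain a b c where "xs = [Suc a, b, Suc c]"
    using assms(1,2) by (auto simp: length_Suc_conv numeral_eq_Suc Suc_le_eq gr0_conv_Suc)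
  then have J: "J = invs PDC [1 + real a, real b, 1 + real c]" by (simp add: J_def del: invs.simps)
  have "sep [0, 0, 0, 1, 0, 0, 0, 0, 0, 0] J = 0"
    unfolding J sep_eval by (Groebner_Basis.algebra | simp add: algebra_simps)
  then show "sep [0, 0, 0, 1, 0, 0, 0, 0, 0, 0] J \<le> 0" by simp
  have "sep [0, 0, 1, 0, 0, 0, 0, 0, 0, 0] J = 1 + real (a * b * c + 2 * a * b + a * c + b * c + a + 2 * b + c)"
    unfolding J sep_eval by (Groebner_Basis.algebra | simp add: algebra_simps)
  then show "0 < sep [0, 0, 1, 0, 0, 0, 0, 0, 0, 0] J" by (rule less_add_of_nat) simp
  have "sep [0, 4, -18, 0, 2, 4, 3, 6, 0, 0] J = -2 - real (2 * a * c + 2 * a + 2 * c)"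
    unfolding J sep_eval by (Groebner_Basis.algebra | simp add: algebra_simps)
  then show "sep [0, 4, -18, 0, 2, 4, 3, 6, 0, 0] J \<le> -2" by (rule diff_of_nat_le) simp
  have "sep [-2, -2, 9, -9, -1, -1, -2, -2, -9, -9] J = -9 + real (2 * a * b + a * c + b * c + b)"
    unfolding J sep_eval by (Groebner_Basis.algebra | simp add: algebra_simps)
  then show "-10 < sep [-2, -2, 9, -9, -1, -1, -2, -2, -9, -9] J" by (rule less_add_of_nat) simp
  have "sep [1, -2, 1, -2, -1, -1, 1, 2, -2, -2] J = 13 + real (5 * a * c + b * c + 7 * a + 2 * b + 7 * c)"
    unfolding J sep_eval by (Groebner_Basis.algebra | simp add: algebra_simps)
  then show "6 < sep [1, -2, 1, -2, -1, -1, 1, 2, -2, -2] J" by (rule less_add_of_nat) simp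
qed

lemma signs_PCC:
  assumes "admissible PCC xs" and "length xs = 3"
  defines "J \<equiv> invs PCC (map real xs)"
  shows "sep [0, 0, 0, 1, 0, 0, 0, 0, 0, 0] J \<le> 0" and "0 < sep [0, 0, 1, 0, 0, 0, 0, 0, 0, 0] J" and "-2 < sep [0, 4, -18, 0, 2, 4, 3, 6, 0, 0] J" and "sep [-2, -2, 9, -9, -1, -1, -2, -2, -9, -9] J \<le> -10" and "6 < sep [1, -2, 1, -2, -1, -1, 1, 2, -2, -2] J"
proof -
  obtain a b c where "xs = [Suc a, b, Suc c]"
    using assms(1,2) by (auto simp: length_Suc_conv numeral_eq_Suc Suc_le_eq gr0_conv_Suc)
  then have J: "J = invs PCC [1 + real a, real b, 1 + real c]" by (simp add: J_def del: invs.simps)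
  have "sep [0, 0, 0, 1, 0, 0, 0, 0, 0, 0] J = 0"
    unfolding J sep_eval by (Groebner_Basis.algebra | simp add: algebra_simps)
  then show "sep [0, 0, 0, 1, 0, 0, 0, 0, 0, 0] J \<le> 0" by simp
  have "sep [0, 0, 1, 0, 0, 0, 0, 0, 0, 0] J = 4 + real (a * b * c + 2 * a * b + 2 * a * c + 2 * b * c + 3 * a + 4 * b + 3 * c)"
    unfolding J sep_eval by (Groebner_Basis.algebra | simp add: algebra_simps)
  then show "0 < sep [0, 0, 1, 0, 0, 0, 0, 0, 0, 0] J" by (rule less_add_of_nat) simp
  have "sep [0, 4, -18, 0, 2, 4, 3, 6, 0, 0] J = 0 + real (4 * a * c + 2 * a + 2 * c)"
    unfolding J sep_eval by (Groebner_Basis.algebra | simp add: algebra_simps)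
  then show "-2 < sep [0, 4, -18, 0, 2, 4, 3, 6, 0, 0] J" by (rule less_add_of_nat) simp
  have "sep [-2, -2, 9, -9, -1, -1, -2, -2, -9, -9] J = -10 - real (2 * a * b * c + a * b + a * c + b * c + a + c)"
    unfolding J sep_eval by (Groebner_Basis.algebra | simp add: algebra_simps)
  then show "sep [-2, -2, 9, -9, -1, -1, -2, -2, -9, -9] J \<le> -10" by (rule diff_of_nat_le) simp
  have "sep [1, -2, 1, -2, -1, -1, 1, 2, -2, -2] J = 27 + real (a * b + 7 * a * c + b * c + 14 * a + 3 * b + 14 * c)"
    unfolding J sep_eval by (Groebner_Basis.algebra | simp add: algebra_simps)
  then show "6 < sep [1, -2, 1, -2, -1, -1, 1, 2, -2, -2] J" by (rule less_add_of_nat) simp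
qed

lemma signs_H3:
  assumes "admissible H3 xs" and "length xs = 3"
  defines "J \<equiv> invs H3 (map real xs)"
  shows "sep [0, 0, 0, 1, 0, 0, 0, 0, 0, 0] J \<le> 0" and "0 < sep [0, 0, 1, 0, 0, 0, 0, 0, 0, 0] J" and "sep [0, 4, -18, 0, 2, 4, 3, 6, 0, 0] J \<le> -2" and "-10 < sep [-2, -2, 9, -9, -1, -1, -2, -2, -9, -9] J" and "sep [1, -2, 1, -2, -1, -1, 1, 2, -2, -2] J \<le> 6"
proof -
  obtain a b c where "xs = [Suc a, Suc b, Suc c]"
    using assms(1,2) by (auto simp: length_Suc_conv numeral_eq_Suc Suc_le_eq gr0_conv_Suc)
  then have J: "J = invs H3 [1 + real a, 1 + real b, 1 + real c]" by (simp add: J_def del: invs.simps)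
  have "sep [0, 0, 0, 1, 0, 0, 0, 0, 0, 0] J = 0"
    unfolding J sep_eval by (Groebner_Basis.algebra | simp add: algebra_simps)
  then show "sep [0, 0, 0, 1, 0, 0, 0, 0, 0, 0] J \<le> 0" by simp
  have "sep [0, 0, 1, 0, 0, 0, 0, 0, 0, 0] J = 4 + real (a * b * c + 2 * a * b + 2 * a * c + 2 * b * c + 3 * a + 3 * b + 3 * c)"
    unfolding J sep_eval by (Groebner_Basis.algebra | simp add: algebra_simps)
  then show "0 < sep [0, 0, 1, 0, 0, 0, 0, 0, 0, 0] J" by (rule less_add_of_nat) simp
  have "sep [0, 4, -18, 0, 2, 4, 3, 6, 0, 0] J = -12 - real (12 * a * b * c + 12 * a * b + 12 * a * c + 12 * b * c + 12 * a + 12 * b + 12 * c)"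
    unfolding J sep_eval by (Groebner_Basis.algebra | simp add: algebra_simps)
  then show "sep [0, 4, -18, 0, 2, 4, 3, 6, 0, 0] J \<le> -2" by (rule diff_of_nat_le) simp
  have "sep [-2, -2, 9, -9, -1, -1, -2, -2, -9, -9] J = -3 + real (2 * a * b * c + 5 * a * b + 5 * a * c + 5 * b * c + 6 * a + 6 * b + 6 * c)"
    unfolding J sep_eval by (Groebner_Basis.algebra | simp add: algebra_simps)
  then show "-10 < sep [-2, -2, 9, -9, -1, -1, -2, -2, -9, -9] J" by (rule less_add_of_nat) simp
  have "sep [1, -2, 1, -2, -1, -1, 1, 2, -2, -2] J = 6 - real (4 * a * b * c + 3 * a * b + 3 * a * c + 3 * b * c + a + b + c)"
    unfolding J sep_eval by (Groebner_Basis.algebra | simp add: algebra_simps)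
  then show "sep [1, -2, 1, -2, -1, -1, 1, 2, -2, -2] J \<le> 6" by (rule diff_of_nat_le) simp
qed

text \<open>The combination \<open>2 * m4 + i7 + i8\<close> is zero for the two skeletons with four
  cover vertices and no connector, positive for \<open>H4\<close>, and at most -2 for all others
  with four cover vertices.\<close>

lemma signs_PDDD:
  assumes "admissible PDDD xs" and "length xs = 4"
  defines "J \<equiv> invs PDDD (map real xs)"
  shows "0 < sep [0, 0, 0, 1, 0, 0, 0, 0, 0, 0] J" and "sep [-4, 4, -4, -14, 1, 2, 0, 3, -4, 10] J \<le> -14" and "-2 < sep [0, 0, 0, 2, 0, 0, 0, 0, 1, 1] J" and "-5 < sep [-1, 0, -2, 2, 0, 0, 1, 1, -1, -2] J"
proof -
  obtain a b c d where "xs = [Suc a, Suc b, Suc c, Suc d]"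
    using assms(1,2) by (auto simp: length_Suc_conv numeral_eq_Suc Suc_le_eq gr0_conv_Suc)
  then have J: "J = invs PDDD [1 + real a, 1 + real b, 1 + real c, 1 + real d]" by (simp add: J_def del: invs.simps)
  have "sep [0, 0, 0, 1, 0, 0, 0, 0, 0, 0] J = 1 + real (a * b * c * d + a * b * c + a * b * d + a * c * d + b * c * d + a * b + a * c + a * d + b * c + b * d + c * d + a + b + c + d)"
    unfolding J sep_eval by (Groebner_Basis.algebra | simp add: algebra_simps)
  then show "0 < sep [0, 0, 0, 1, 0, 0, 0, 0, 0, 0] J" by (rule less_add_of_nat) simp
  have "sep [-4, 4, -4, -14, 1, 2, 0, 3, -4, 10] J = -20 - real (18 * a * b * c * d + 16 * a * b * c + 19 * a * b * d + 19 * a * c * d + 16 * b * c * d + 13 * a * b + 15 * a * c + 20 * a * d + 12 * b * c + 15 * b * d + 13 * c * d + 12 * a + 9 * b + 9 * c + 12 * d)"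
    unfolding J sep_eval by (Groebner_Basis.algebra | simp add: algebra_simps)
  then show "sep [-4, 4, -4, -14, 1, 2, 0, 3, -4, 10] J \<le> -14" by (rule diff_of_nat_le) simp
  have "sep [0, 0, 0, 2, 0, 0, 0, 0, 1, 1] J = 0"
    unfolding J sep_eval by (Groebner_Basis.algebra | simp add: algebra_simps)
  then show "-2 < sep [0, 0, 0, 2, 0, 0, 0, 0, 1, 1] J" by simp
  have "sep [-1, 0, -2, 2, 0, 0, 1, 1, -1, -2] J = -4 + real (a * b * d + a * c * d + a * b + a * c + 4 * a * d + b * d + c * d + 3 * a + 3 * d)"
    unfolding J sep_eval by (Groebner_Basis.algebra | simp add: algebra_simps)
  then show "-5 < sep [-1, 0, -2, 2, 0, 0, 1, 1, -1, -2] J" by (rule less_add_of_nat) simp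
qed

lemma signs_PDDC:
  assumes "admissible PDDC xs" and "length xs = 4"
  defines "J \<equiv> invs PDDC (map real xs)"
  shows "0 < sep [0, 0, 0, 1, 0, 0, 0, 0, 0, 0] J" and "sep [-4, 4, -4, -14, 1, 2, 0, 3, -4, 10] J \<le> -14" and "sep [0, 0, 0, 2, 0, 0, 0, 0, 1, 1] J \<le> -2" and "4 < sep [2, -4, 4, 40, -1, 0, -1, 0, 10, 2] J" and "-6 < sep [-1, 1, 1, 0, 0, -1, 0, -2, 1, -4] J" and "-6 < sep [-2, 4, -4, 4, 1, 0, 1, 0, 1, 0] J"
proof -
  obtain a b c d where "xs = [Suc a, Suc b, Suc c, Suc d]"
    using assms(1,2) by (auto simp: length_Suc_conv numeral_eq_Suc Suc_le_eq gr0_conv_Suc)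
  then have J: "J = invs PDDC [1 + real a, 1 + real b, 1 + real c, 1 + real d]" by (simp add: J_def del: invs.simps)
  have "sep [0, 0, 0, 1, 0, 0, 0, 0, 0, 0] J = 3 + real (a * b * c * d + 2 * a * b * c + 2 * a * b * d + a * c * d + b * c * d + 3 * a * b + 2 * a * c + 2 * a * d + 2 * b * c + 2 * b * d + c * d + 3 * a + 3 * b + 2 * c + 2 * d)"
    unfolding J sep_eval by (Groebner_Basis.algebra | simp add: algebra_simps)
  then show "0 < sep [0, 0, 0, 1, 0, 0, 0, 0, 0, 0] J" by (rule less_add_of_nat) simp
  have "sep [-4, 4, -4, -14, 1, 2, 0, 3, -4, 10] J = -27 - real (16 * a * b * c + 5 * a * b * d + 4 * a * c * d + b * c * d + 18 * a * b + 19 * a * c + 7 * a * d + 13 * b * c + 6 * b * d + 4 * c * d + 19 * a + 15 * b + 13 * c + 7 * d)"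
    unfolding J sep_eval by (Groebner_Basis.algebra | simp add: algebra_simps)
  then show "sep [-4, 4, -4, -14, 1, 2, 0, 3, -4, 10] J \<le> -14" by (rule diff_of_nat_le) simp
  have "sep [0, 0, 0, 2, 0, 0, 0, 0, 1, 1] J = -3 - real (a * b * c * d + a * b * c + 3 * a * b * d + a * c * d + b * c * d + 3 * a * b + a * c + 3 * a * d + b * c + 3 * b * d + c * d + 3 * a + 3 * b + c + 3 * d)"
    unfolding J sep_eval by (Groebner_Basis.algebra | simp add: algebra_simps)
  then show "sep [0, 0, 0, 2, 0, 0, 0, 0, 1, 1] J \<le> -2" by (rule diff_of_nat_le) simp
  have "sep [2, -4, 4, 40, -1, 0, -1, 0, 10, 2] J = 28 + real (2 * a * b * c * d + 24 * a * b * c + 2 * a * b * d + 2 * b * c * d + 24 * a * b + 22 * a * c + 24 * b * c + 2 * b * d + 22 * a + 24 * b + 22 * c)"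
    unfolding J sep_eval by (Groebner_Basis.algebra | simp add: algebra_simps)
  then show "4 < sep [2, -4, 4, 40, -1, 0, -1, 0, 10, 2] J" by (rule less_add_of_nat) simp
  have "sep [-1, 1, 1, 0, 0, -1, 0, -2, 1, -4] J = -2 + real (4 * a * b * c + 2 * a * c * d + 3 * a * b + 6 * a * c + 3 * b * c + 2 * c * d + 3 * a + 2 * b + 4 * c)"
    unfolding J sep_eval by (Groebner_Basis.algebra | simp add: algebra_simps)
  then show "-6 < sep [-1, 1, 1, 0, 0, -1, 0, -2, 1, -4] J" by (rule less_add_of_nat) simp
  have "sep [-2, 4, -4, 4, 1, 0, 1, 0, 1, 0] J = -4 + real (2 * a * c * d + 2 * a * c + 2 * a * d + 2 * c * d + 2 * a + 2 * c + 2 * d)"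
    unfolding J sep_eval by (Groebner_Basis.algebra | simp add: algebra_simps)
  then show "-6 < sep [-2, 4, -4, 4, 1, 0, 1, 0, 1, 0] J" by (rule less_add_of_nat) simp
qed

lemma signs_PDCD:
  assumes "admissible PDCD xs" and "length xs = 4"
  defines "J \<equiv> invs PDCD (map real xs)"
  shows "0 < sep [0, 0, 0, 1, 0, 0, 0, 0, 0, 0] J" and "sep [-4, 4, -4, -14, 1, 2, 0, 3, -4, 10] J \<le> -14" and "sep [0, 0, 0, 2, 0, 0, 0, 0, 1, 1] J \<le> -2" and "4 < sep [2, -4, 4, 40, -1, 0, -1, 0, 10, 2] J" and "sep [-1, 1, 1, 0, 0, -1, 0, -2, 1, -4] J \<le> -6"
proof -
  obtain a b c d where "xs = [Suc a, b, Suc c, Suc d]"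
    using assms(1,2) by (auto simp: length_Suc_conv numeral_eq_Suc Suc_le_eq gr0_conv_Suc)
  then have J: "J = invs PDCD [1 + real a, real b, 1 + real c, 1 + real d]" by (simp add: J_def del: invs.simps)
  have "sep [0, 0, 0, 1, 0, 0, 0, 0, 0, 0] J = 1 + real (a * b * c * d + a * b * c + 2 * a * b * d + a * c * d + b * c * d + 2 * a * b + a * c + a * d + b * c + 2 * b * d + c * d + a + 2 * b + c + d)"
    unfolding J sep_eval by (Groebner_Basis.algebra | simp add: algebra_simps)
  then show "0 < sep [0, 0, 0, 1, 0, 0, 0, 0, 0, 0] J" by (rule less_add_of_nat) simp
  have "sep [-4, 4, -4, -14, 1, 2, 0, 3, -4, 10] J = -14 - real (a * b * c + 5 * a * b * d + 5 * a * c * d + b * c * d + 3 * a * b + 5 * a * c + 3 * a * d + 6 * b * d + 2 * c * d + 3 * a + 2 * b + 2 * c)"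
    unfolding J sep_eval by (Groebner_Basis.algebra | simp add: algebra_simps)
  then show "sep [-4, 4, -4, -14, 1, 2, 0, 3, -4, 10] J \<le> -14" by (rule diff_of_nat_le) simp
  have "sep [0, 0, 0, 2, 0, 0, 0, 0, 1, 1] J = -2 - real (a * b * c * d + a * b * c + 3 * a * b * d + 2 * a * c * d + b * c * d + 3 * a * b + 2 * a * c + 2 * a * d + b * c + 3 * b * d + 2 * c * d + 2 * a + 3 * b + 2 * c + 2 * d)"
    unfolding J sep_eval by (Groebner_Basis.algebra | simp add: algebra_simps)
  then show "sep [0, 0, 0, 2, 0, 0, 0, 0, 1, 1] J \<le> -2" by (rule diff_of_nat_le) simp
  have "sep [2, -4, 4, 40, -1, 0, -1, 0, 10, 2] J = 6 + real (2 * a * b * c * d + 2 * a * b * c + 2 * a * b * d + 2 * b * c * d + 2 * a * b + 2 * b * c + 2 * b * d + 2 * b)"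
    unfolding J sep_eval by (Groebner_Basis.algebra | simp add: algebra_simps)
  then show "4 < sep [2, -4, 4, 40, -1, 0, -1, 0, 10, 2] J" by (rule less_add_of_nat) simp
  have "sep [-1, 1, 1, 0, 0, -1, 0, -2, 1, -4] J = -6 - real (a * b + 2 * a * d + c * d + 2 * a + b + c + 3 * d)"
    unfolding J sep_eval by (Groebner_Basis.algebra | simp add: algebra_simps)
  then show "sep [-1, 1, 1, 0, 0, -1, 0, -2, 1, -4] J \<le> -6" by (rule diff_of_nat_le) simp
qed

lemma signs_PDCC:
  assumes "admissible PDCC xs" and "length xs = 4"
  defines "J \<equiv> invs PDCC (map real xs)"
  shows "0 < sep [0, 0, 0, 1, 0, 0, 0, 0, 0, 0] J" and "sep [0, 0, 0, 2, 0, 0, 0, 0, 1, 1] J \<le> -2" and "1 < sep [0, 0, 0, -2, 0, 0, 0, 0, -1, -2] J" and "sep [2, -4, 4, 40, -1, 0, -1, 0, 10, 2] J \<le> 4" and "-8 < sep [0, 2, -8, 10, 1, 2, 1, 2, 1, 2] J" and "sep [2, -4, 7, -12, -1, -1, -1, -1, -2, -2] J \<le> 6"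
proof -
  obtain a b c d where "xs = [Suc a, b, c, Suc d]"
    using assms(1,2) by (auto simp: length_Suc_conv numeral_eq_Suc Suc_le_eq gr0_conv_Suc)
  then have J: "J = invs PDCC [1 + real a, real b, real c, 1 + real d]" by (simp add: J_def del: invs.simps)
  have "sep [0, 0, 0, 1, 0, 0, 0, 0, 0, 0] J = 1 + real (a * b * c * d + 2 * a * b * c + 2 * a * b * d + a * c * d + b * c * d + 3 * a * b + 2 * a * c + a * d + 2 * b * c + 2 * b * d + c * d + a + 3 * b + 2 * c + d)"
    unfolding J sep_eval by (Groebner_Basis.algebra | simp add: algebra_simps)
  then show "0 < sep [0, 0, 0, 1, 0, 0, 0, 0, 0, 0] J" by (rule less_add_of_nat) simp
  have "sep [0, 0, 0, 2, 0, 0, 0, 0, 1, 1] J = -2 - real (2 * a * b * c * d + 3 * a * b * c + 4 * a * b * d + 3 * a * c * d + 2 * b * c * d + 6 * a * b + 5 * a * c + 2 * a * d + 3 * b * c + 4 * b * d + 3 * c * d + 2 * a + 6 * b + 5 * c + 2 * d)"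
    unfolding J sep_eval by (Groebner_Basis.algebra | simp add: algebra_simps)
  then show "sep [0, 0, 0, 2, 0, 0, 0, 0, 1, 1] J \<le> -2" by (rule diff_of_nat_le) simp
  have "sep [0, 0, 0, -2, 0, 0, 0, 0, -1, -2] J = 2 + real (4 * a * b * d + 2 * a * c * d + 6 * a * b + 4 * a * c + 2 * a * d + 4 * b * d + 2 * c * d + 2 * a + 6 * b + 4 * c + 2 * d)"
    unfolding J sep_eval by (Groebner_Basis.algebra | simp add: algebra_simps)
  then show "1 < sep [0, 0, 0, -2, 0, 0, 0, 0, -1, -2] J" by (rule less_add_of_nat) simp
  have "sep [2, -4, 4, 40, -1, 0, -1, 0, 10, 2] J = 4 - real (16 * a * b * c * d + 14 * a * b * c + 20 * a * c * d + 18 * b * c * d + 20 * a * c + 2 * a * d + 16 * b * c + 22 * c * d + 2 * a + 22 * c + 2 * d)"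
    unfolding J sep_eval by (Groebner_Basis.algebra | simp add: algebra_simps)
  then show "sep [2, -4, 4, 40, -1, 0, -1, 0, 10, 2] J \<le> 4" by (rule diff_of_nat_le) simp
  have "sep [0, 2, -8, 10, 1, 2, 1, 2, 1, 2] J = -4 + real (2 * a * c * d + 2 * a * b + 2 * a * c + 2 * a * d + 2 * c * d + 2 * c)"
    unfolding J sep_eval by (Groebner_Basis.algebra | simp add: algebra_simps)
  then show "-8 < sep [0, 2, -8, 10, 1, 2, 1, 2, 1, 2] J" by (rule less_add_of_nat) simp
  have "sep [2, -4, 7, -12, -1, -1, -1, -1, -2, -2] J = 6 - real (a * b * c + a * b * d + a * b + a * d + b * c)"
    unfolding J sep_eval by (Groebner_Basis.algebra | simp add: algebra_simps)
  then show "sep [2, -4, 7, -12, -1, -1, -1, -1, -2, -2] J \<le> 6" by (rule diff_of_nat_le) simp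
qed

lemma signs_PCDC:
  assumes "admissible PCDC xs" and "length xs = 4"
  defines "J \<equiv> invs PCDC (map real xs)"
  shows "0 < sep [0, 0, 0, 1, 0, 0, 0, 0, 0, 0] J" and "-14 < sep [-4, 4, -4, -14, 1, 2, 0, 3, -4, 10] J" and "sep [0, 0, 0, 2, 0, 0, 0, 0, 1, 1] J \<le> -2" and "1 < sep [0, 0, 0, -2, 0, 0, 0, 0, -1, -2] J" and "-8 < sep [0, 2, -8, 10, 1, 2, 1, 2, 1, 2] J" and "sep [2, -4, 7, -12, -1, -1, -1, -1, -2, -2] J \<le> 6"
proof -
  obtain a b c d where "xs = [Suc a, Suc b, Suc c, Suc d]"
    using assms(1,2) by (auto simp: length_Suc_conv numeral_eq_Suc Suc_le_eq gr0_conv_Suc)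
  then have J: "J = invs PCDC [1 + real a, 1 + real b, 1 + real c, 1 + real d]" by (simp add: J_def del: invs.simps)
  have "sep [0, 0, 0, 1, 0, 0, 0, 0, 0, 0] J = 9 + real (a * b * c * d + 2 * a * b * c + 2 * a * b * d + 2 * a * c * d + 2 * b * c * d + 3 * a * b + 4 * a * c + 4 * a * d + 4 * b * c + 4 * b * d + 3 * c * d + 6 * a + 6 * b + 6 * c + 6 * d)"
    unfolding J sep_eval by (Groebner_Basis.algebra | simp add: algebra_simps)
  then show "0 < sep [0, 0, 0, 1, 0, 0, 0, 0, 0, 0] J" by (rule less_add_of_nat) simp
  have "sep [-4, 4, -4, -14, 1, 2, 0, 3, -4, 10] J = -2 + real (18 * a * b * c * d + 17 * a * b * c + 28 * a * b * d + 28 * a * c * d + 17 * b * c * d + 24 * a * b + 22 * a * c + 32 * a * d + 4 * b * c + 22 * b * d + 24 * c * d + 25 * a + 9 * b + 9 * c + 25 * d)"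
    unfolding J sep_eval by (Groebner_Basis.algebra | simp add: algebra_simps)
  then show "-14 < sep [-4, 4, -4, -14, 1, 2, 0, 3, -4, 10] J" by (rule less_add_of_nat) simp
  have "sep [0, 0, 0, 2, 0, 0, 0, 0, 1, 1] J = -16 - real (2 * a * b * c * d + 3 * a * b * c + 5 * a * b * d + 5 * a * c * d + 3 * b * c * d + 6 * a * b + 8 * a * c + 10 * a * d + 4 * b * c + 8 * b * d + 6 * c * d + 13 * a + 9 * b + 9 * c + 13 * d)"
    unfolding J sep_eval by (Groebner_Basis.algebra | simp add: algebra_simps)
  then show "sep [0, 0, 0, 2, 0, 0, 0, 0, 1, 1] J \<le> -2" by (rule diff_of_nat_le) simp
  have "sep [0, 0, 0, -2, 0, 0, 0, 0, -1, -2] J = 10 + real (2 * a * b * d + 2 * a * c * d + 2 * a * b + 4 * a * c + 6 * a * d + 4 * b * d + 2 * c * d + 8 * a + 4 * b + 4 * c + 8 * d)"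
    unfolding J sep_eval by (Groebner_Basis.algebra | simp add: algebra_simps)
  then show "1 < sep [0, 0, 0, -2, 0, 0, 0, 0, -1, -2] J" by (rule less_add_of_nat) simp
  have "sep [0, 2, -8, 10, 1, 2, 1, 2, 1, 2] J = 0 + real (2 * a * b * d + 2 * a * c * d + 2 * a * b + 2 * a * c + 6 * a * d + 2 * b * d + 2 * c * d + 4 * a + 2 * b + 2 * c + 4 * d)"
    unfolding J sep_eval by (Groebner_Basis.algebra | simp add: algebra_simps)
  then show "-8 < sep [0, 2, -8, 10, 1, 2, 1, 2, 1, 2] J" by (rule less_add_of_nat) simp
  have "sep [2, -4, 7, -12, -1, -1, -1, -1, -2, -2] J = 2 - real (a * b * c + b * c * d + a * b + a * c + a * d + 4 * b * c + b * d + c * d + a + 4 * b + 4 * c + d)"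
    unfolding J sep_eval by (Groebner_Basis.algebra | simp add: algebra_simps)
  then show "sep [2, -4, 7, -12, -1, -1, -1, -1, -2, -2] J \<le> 6" by (rule diff_of_nat_le) simp
qed

lemma signs_PCCC:
  assumes "admissible PCCC xs" and "length xs = 4"
  defines "J \<equiv> invs PCCC (map real xs)"
  shows "0 < sep [0, 0, 0, 1, 0, 0, 0, 0, 0, 0] J" and "-14 < sep [-4, 4, -4, -14, 1, 2, 0, 3, -4, 10] J" and "sep [0, 0, 0, 2, 0, 0, 0, 0, 1, 1] J \<le> -2" and "1 < sep [0, 0, 0, -2, 0, 0, 0, 0, -1, -2] J" and "-8 < sep [0, 2, -8, 10, 1, 2, 1, 2, 1, 2] J" and "6 < sep [2, -4, 7, -12, -1, -1, -1, -1, -2, -2] J" and "-103 < sep [-24, 17, -3, 0, 3, -1, 1, 0, 0, 0] J"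
proof -
  obtain a b c d where "xs = [Suc a, b, c, Suc d]"
    using assms(1,2) by (auto simp: length_Suc_conv numeral_eq_Suc Suc_le_eq gr0_conv_Suc)
  then have J: "J = invs PCCC [1 + real a, real b, real c, 1 + real d]" by (simp add: J_def del: invs.simps)
  have "sep [0, 0, 0, 1, 0, 0, 0, 0, 0, 0] J = 5 + real (a * b * c * d + 2 * a * b * c + 2 * a * b * d + 2 * a * c * d + 2 * b * c * d + 3 * a * b + 4 * a * c + 3 * a * d + 4 * b * c + 4 * b * d + 3 * c * d + 4 * a + 6 * b + 6 * c + 4 * d)"
    unfolding J sep_eval by (Groebner_Basis.algebra | simp add: algebra_simps)
  then show "0 < sep [0, 0, 0, 1, 0, 0, 0, 0, 0, 0] J" by (rule less_add_of_nat) simp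
  have "sep [-4, 4, -4, -14, 1, 2, 0, 3, -4, 10] J = -12 + real (36 * a * b * c * d + 50 * a * b * c + 18 * a * b * d + 18 * a * c * d + 50 * b * c * d + 25 * a * b + 5 * a * c + 8 * a * d + 64 * b * c + 5 * b * d + 25 * c * d + 4 * a + 10 * b + 10 * c + 4 * d)"
    unfolding J sep_eval by (Groebner_Basis.algebra | simp add: algebra_simps)
  then show "-14 < sep [-4, 4, -4, -14, 1, 2, 0, 3, -4, 10] J" by (rule less_add_of_nat) simp
  have "sep [0, 0, 0, 2, 0, 0, 0, 0, 1, 1] J = -13 - real (3 * a * b * c * d + 5 * a * b * c + 6 * a * b * d + 6 * a * c * d + 5 * b * c * d + 9 * a * b + 10 * a * c + 9 * a * d + 8 * b * c + 10 * b * d + 9 * c * d + 11 * a + 15 * b + 15 * c + 11 * d)"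
    unfolding J sep_eval by (Groebner_Basis.algebra | simp add: algebra_simps)
  then show "sep [0, 0, 0, 2, 0, 0, 0, 0, 1, 1] J \<le> -2" by (rule diff_of_nat_le) simp
  have "sep [0, 0, 0, -2, 0, 0, 0, 0, -1, -2] J = 12 + real (4 * a * b * d + 4 * a * c * d + 6 * a * b + 8 * a * c + 8 * a * d + 8 * b * d + 6 * c * d + 10 * a + 12 * b + 12 * c + 10 * d)"
    unfolding J sep_eval by (Groebner_Basis.algebra | simp add: algebra_simps)
  then show "1 < sep [0, 0, 0, -2, 0, 0, 0, 0, -1, -2] J" by (rule less_add_of_nat) simp
  have "sep [0, 2, -8, 10, 1, 2, 1, 2, 1, 2] J = 0 + real (2 * a * b + 4 * a * d + 2 * c * d + 4 * a + 2 * b + 2 * c + 4 * d)"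
    unfolding J sep_eval by (Groebner_Basis.algebra | simp add: algebra_simps)
  then show "-8 < sep [0, 2, -8, 10, 1, 2, 1, 2, 1, 2] J" by (rule less_add_of_nat) simp
  have "sep [2, -4, 7, -12, -1, -1, -1, -1, -2, -2] J = 7 + real (2 * a * b * c * d + 2 * a * b * c + 2 * a * b * d + 2 * a * c * d + 2 * b * c * d + 2 * a * b + 2 * a * c + a * d + b * c + 2 * b * d + 2 * c * d + a + 2 * b + 2 * c + d)"
    unfolding J sep_eval by (Groebner_Basis.algebra | simp add: algebra_simps)
  then show "6 < sep [2, -4, 7, -12, -1, -1, -1, -1, -2, -2] J" by (rule less_add_of_nat) simp
  have "sep [-24, 17, -3, 0, 3, -1, 1, 0, 0, 0] J = -102 + real (2 * a * b + 2 * a * d + 2 * c * d + a + d)"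
    unfolding J sep_eval by (Groebner_Basis.algebra | simp add: algebra_simps)
  then show "-103 < sep [-24, 17, -3, 0, 3, -1, 1, 0, 0, 0] J" by (rule less_add_of_nat) simp
qed

lemma signs_SDDD:
  assumes "admissible SDDD xs" and "length xs = 4"
  defines "J \<equiv> invs SDDD (map real xs)"
  shows "0 < sep [0, 0, 0, 1, 0, 0, 0, 0, 0, 0] J" and "sep [-4, 4, -4, -14, 1, 2, 0, 3, -4, 10] J \<le> -14" and "-2 < sep [0, 0, 0, 2, 0, 0, 0, 0, 1, 1] J" and "sep [-1, 0, -2, 2, 0, 0, 1, 1, -1, -2] J \<le> -5"
proof -
  obtain a b c d where "xs = [Suc a, Suc b, Suc c, Suc d]"
    using assms(1,2) by (auto simp: length_Suc_conv numeral_eq_Suc Suc_le_eq gr0_conv_Suc)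
  then have J: "J = invs SDDD [1 + real a, 1 + real b, 1 + real c, 1 + real d]" by (simp add: J_def del: invs.simps)
  have "sep [0, 0, 0, 1, 0, 0, 0, 0, 0, 0] J = 1 + real (a * b * c * d + a * b * c + a * b * d + a * c * d + b * c * d + a * b + a * c + a * d + b * c + b * d + c * d + a + b + c + d)"
    unfolding J sep_eval by (Groebner_Basis.algebra | simp add: algebra_simps)
  then show "0 < sep [0, 0, 0, 1, 0, 0, 0, 0, 0, 0] J" by (rule less_add_of_nat) simp
  have "sep [-4, 4, -4, -14, 1, 2, 0, 3, -4, 10] J = -24 - real (18 * a * b * c * d + 16 * a * b * c + 16 * a * b * d + 16 * a * c * d + 28 * b * c * d + 12 * a * b + 12 * a * c + 12 * a * d + 22 * b * c + 22 * b * d + 22 * c * d + 10 * a + 14 * b + 14 * c + 14 * d)"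
    unfolding J sep_eval by (Groebner_Basis.algebra | simp add: algebra_simps)
  then show "sep [-4, 4, -4, -14, 1, 2, 0, 3, -4, 10] J \<le> -14" by (rule diff_of_nat_le) simp
  have "sep [0, 0, 0, 2, 0, 0, 0, 0, 1, 1] J = 0"
    unfolding J sep_eval by (Groebner_Basis.algebra | simp add: algebra_simps)
  then show "-2 < sep [0, 0, 0, 2, 0, 0, 0, 0, 1, 1] J" by simp
  have "sep [-1, 0, -2, 2, 0, 0, 1, 1, -1, -2] J = -8 - real (a + b + c + d)"
    unfolding J sep_eval by (Groebner_Basis.algebra | simp add: algebra_simps)
  then show "sep [-1, 0, -2, 2, 0, 0, 1, 1, -1, -2] J \<le> -5" by (rule diff_of_nat_le) simp
qed

lemma signs_SDDC:
  assumes "admissible SDDC xs" and "length xs = 4"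
  defines "J \<equiv> invs SDDC (map real xs)"
  shows "0 < sep [0, 0, 0, 1, 0, 0, 0, 0, 0, 0] J" and "sep [-4, 4, -4, -14, 1, 2, 0, 3, -4, 10] J \<le> -14" and "sep [0, 0, 0, 2, 0, 0, 0, 0, 1, 1] J \<le> -2" and "sep [0, 2, -8, 10, 1, 2, 1, 2, 1, 2] J \<le> -8" and "-6 < sep [-1, 1, 1, 0, 0, -1, 0, -2, 1, -4] J" and "sep [-2, 4, -4, 4, 1, 0, 1, 0, 1, 0] J \<le> -6"
proof -
  obtain a b c d where "xs = [a, Suc b, Suc c, Suc d]"
    using assms(1,2) by (auto simp: length_Suc_conv numeral_eq_Suc Suc_le_eq gr0_conv_Suc)
  then have J: "J = invs SDDC [real a, 1 + real b, 1 + real c, 1 + real d]" by (simp add: J_def del: invs.simps)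
  have "sep [0, 0, 0, 1, 0, 0, 0, 0, 0, 0] J = 1 + real (a * b * c * d + 2 * a * b * c + a * b * d + a * c * d + b * c * d + 2 * a * b + 2 * a * c + a * d + b * c + b * d + c * d + 2 * a + b + c + d)"
    unfolding J sep_eval by (Groebner_Basis.algebra | simp add: algebra_simps)
  then show "0 < sep [0, 0, 0, 1, 0, 0, 0, 0, 0, 0] J" by (rule less_add_of_nat) simp
  have "sep [-4, 4, -4, -14, 1, 2, 0, 3, -4, 10] J = -14 - real (16 * a * b * c + a * b * d + a * c * d + 13 * a * b + 13 * a * c + 6 * b * c + b * d + c * d + 10 * a + 3 * b + 3 * c)"
    unfolding J sep_eval by (Groebner_Basis.algebra | simp add: algebra_simps)
  then show "sep [-4, 4, -4, -14, 1, 2, 0, 3, -4, 10] J \<le> -14" by (rule diff_of_nat_le) simp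
  have "sep [0, 0, 0, 2, 0, 0, 0, 0, 1, 1] J = -4 - real (a * b * c * d + a * b * c + a * b * d + a * c * d + 4 * b * c * d + a * b + a * c + a * d + 4 * b * c + 4 * b * d + 4 * c * d + a + 4 * b + 4 * c + 4 * d)"
    unfolding J sep_eval by (Groebner_Basis.algebra | simp add: algebra_simps)
  then show "sep [0, 0, 0, 2, 0, 0, 0, 0, 1, 1] J \<le> -2" by (rule diff_of_nat_le) simp
  have "sep [0, 2, -8, 10, 1, 2, 1, 2, 1, 2] J = -8 - real (4 * b * c + 2 * b * d + 2 * c * d + 6 * b + 6 * c + 4 * d)"
    unfolding J sep_eval by (Groebner_Basis.algebra | simp add: algebra_simps)
  then show "sep [0, 2, -8, 10, 1, 2, 1, 2, 1, 2] J \<le> -8" by (rule diff_of_nat_le) simp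
  have "sep [-1, 1, 1, 0, 0, -1, 0, -2, 1, -4] J = -1 + real (4 * a * b * c + 3 * a * b + 3 * a * c + 4 * b * c + 2 * a + 3 * b + 3 * c)"
    unfolding J sep_eval by (Groebner_Basis.algebra | simp add: algebra_simps)
  then show "-6 < sep [-1, 1, 1, 0, 0, -1, 0, -2, 1, -4] J" by (rule less_add_of_nat) simp
  have "sep [-2, 4, -4, 4, 1, 0, 1, 0, 1, 0] J = -6"
    unfolding J sep_eval by (Groebner_Basis.algebra | simp add: algebra_simps)
  then show "sep [-2, 4, -4, 4, 1, 0, 1, 0, 1, 0] J \<le> -6" by simp
qed

lemma signs_SDCC:
  assumes "admissible SDCC xs" and "length xs = 4"
  defines "J \<equiv> invs SDCC (map real xs)"
  shows "0 < sep [0, 0, 0, 1, 0, 0, 0, 0, 0, 0] J" and "-14 < sep [-4, 4, -4, -14, 1, 2, 0, 3, -4, 10] J" and "sep [0, 0, 0, 2, 0, 0, 0, 0, 1, 1] J \<le> -2" and "1 < sep [0, 0, 0, -2, 0, 0, 0, 0, -1, -2] J" and "sep [0, 2, -8, 10, 1, 2, 1, 2, 1, 2] J \<le> -8"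
proof -
  obtain a b c d where "xs = [a, Suc b, Suc c, Suc d]"
    using assms(1,2) by (auto simp: length_Suc_conv numeral_eq_Suc Suc_le_eq gr0_conv_Suc)
  then have J: "J = invs SDCC [real a, 1 + real b, 1 + real c, 1 + real d]" by (simp add: J_def del: invs.simps)
  have "sep [0, 0, 0, 1, 0, 0, 0, 0, 0, 0] J = 4 + real (a * b * c * d + 2 * a * b * c + 2 * a * b * d + a * c * d + 2 * b * c * d + 4 * a * b + 2 * a * c + 2 * a * d + 3 * b * c + 3 * b * d + 2 * c * d + 4 * a + 4 * b + 3 * c + 3 * d)"
    unfolding J sep_eval by (Groebner_Basis.algebra | simp add: algebra_simps)
  then show "0 < sep [0, 0, 0, 1, 0, 0, 0, 0, 0, 0] J" by (rule less_add_of_nat) simp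
  have "sep [-4, 4, -4, -14, 1, 2, 0, 3, -4, 10] J = -12 + real (18 * a * b * c * d + 17 * a * b * c + 17 * a * b * d + 14 * a * c * d + 4 * b * c * d + 4 * a * b + 14 * a * c + 14 * a * d + 3 * b * c + 3 * b * d + 2 * c * d + 4 * a + 2 * c + 2 * d)"
    unfolding J sep_eval by (Groebner_Basis.algebra | simp add: algebra_simps)
  then show "-14 < sep [-4, 4, -4, -14, 1, 2, 0, 3, -4, 10] J" by (rule less_add_of_nat) simp
  have "sep [0, 0, 0, 2, 0, 0, 0, 0, 1, 1] J = -16 - real (2 * a * b * c * d + 3 * a * b * c + 3 * a * b * d + 2 * a * c * d + 8 * b * c * d + 4 * a * b + 3 * a * c + 3 * a * d + 12 * b * c + 12 * b * d + 8 * c * d + 4 * a + 16 * b + 12 * c + 12 * d)"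
    unfolding J sep_eval by (Groebner_Basis.algebra | simp add: algebra_simps)
  then show "sep [0, 0, 0, 2, 0, 0, 0, 0, 1, 1] J \<le> -2" by (rule diff_of_nat_le) simp
  have "sep [0, 0, 0, -2, 0, 0, 0, 0, -1, -2] J = 16 + real (8 * b * c * d + 12 * b * c + 12 * b * d + 8 * c * d + 16 * b + 12 * c + 12 * d)"
    unfolding J sep_eval by (Groebner_Basis.algebra | simp add: algebra_simps)
  then show "1 < sep [0, 0, 0, -2, 0, 0, 0, 0, -1, -2] J" by (rule less_add_of_nat) simp
  have "sep [0, 2, -8, 10, 1, 2, 1, 2, 1, 2] J = -12 - real (2 * b * c + 2 * b * d + 8 * b + 4 * c + 4 * d)"
    unfolding J sep_eval by (Groebner_Basis.algebra | simp add: algebra_simps)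
  then show "sep [0, 2, -8, 10, 1, 2, 1, 2, 1, 2] J \<le> -8" by (rule diff_of_nat_le) simp
qed

lemma signs_SCCC:
  assumes "admissible SCCC xs" and "length xs = 4"
  defines "J \<equiv> invs SCCC (map real xs)"
  shows "0 < sep [0, 0, 0, 1, 0, 0, 0, 0, 0, 0] J" and "-14 < sep [-4, 4, -4, -14, 1, 2, 0, 3, -4, 10] J" and "sep [0, 0, 0, 2, 0, 0, 0, 0, 1, 1] J \<le> -2" and "1 < sep [0, 0, 0, -2, 0, 0, 0, 0, -1, -2] J" and "sep [0, 2, -8, 10, 1, 2, 1, 2, 1, 2] J \<le> -8" and "sep [-7, 1, -6, 7, 0, 1, 1, 1, 1, 1] J \<le> -39"
proof -
  obtain a b c d where "xs = [a, Suc b, Suc c, Suc d]"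
    using assms(1,2) by (auto simp: length_Suc_conv numeral_eq_Suc Suc_le_eq gr0_conv_Suc)
  then have J: "J = invs SCCC [real a, 1 + real b, 1 + real c, 1 + real d]" by (simp add: J_def del: invs.simps)
  have "sep [0, 0, 0, 1, 0, 0, 0, 0, 0, 0] J = 12 + real (a * b * c * d + 2 * a * b * c + 2 * a * b * d + 2 * a * c * d + 3 * b * c * d + 4 * a * b + 4 * a * c + 4 * a * d + 5 * b * c + 5 * b * d + 5 * c * d + 8 * a + 8 * b + 8 * c + 8 * d)"
    unfolding J sep_eval by (Groebner_Basis.algebra | simp add: algebra_simps)
  then show "0 < sep [0, 0, 0, 1, 0, 0, 0, 0, 0, 0] J" by (rule less_add_of_nat) simp
  have "sep [-4, 4, -4, -14, 1, 2, 0, 3, -4, 10] J = -6 + real (36 * a * b * c * d + 50 * a * b * c + 50 * a * b * d + 50 * a * c * d + 2 * b * c * d + 64 * a * b + 64 * a * c + 64 * a * d + 4 * b * c + 4 * b * d + 4 * c * d + 68 * a + 6 * b + 6 * c + 6 * d)"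
    unfolding J sep_eval by (Groebner_Basis.algebra | simp add: algebra_simps)
  then show "-14 < sep [-4, 4, -4, -14, 1, 2, 0, 3, -4, 10] J" by (rule less_add_of_nat) simp
  have "sep [0, 0, 0, 2, 0, 0, 0, 0, 1, 1] J = -48 - real (3 * a * b * c * d + 5 * a * b * c + 5 * a * b * d + 5 * a * c * d + 12 * b * c * d + 8 * a * b + 8 * a * c + 8 * a * d + 20 * b * c + 20 * b * d + 20 * c * d + 12 * a + 32 * b + 32 * c + 32 * d)"
    unfolding J sep_eval by (Groebner_Basis.algebra | simp add: algebra_simps)
  then show "sep [0, 0, 0, 2, 0, 0, 0, 0, 1, 1] J \<le> -2" by (rule diff_of_nat_le) simp
  have "sep [0, 0, 0, -2, 0, 0, 0, 0, -1, -2] J = 48 + real (12 * b * c * d + 20 * b * c + 20 * b * d + 20 * c * d + 32 * b + 32 * c + 32 * d)"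
    unfolding J sep_eval by (Groebner_Basis.algebra | simp add: algebra_simps)
  then show "1 < sep [0, 0, 0, -2, 0, 0, 0, 0, -1, -2] J" by (rule less_add_of_nat) simp
  have "sep [0, 2, -8, 10, 1, 2, 1, 2, 1, 2] J = -20 - real (4 * b * c * d + 4 * b * c + 4 * b * d + 4 * c * d + 8 * b + 8 * c + 8 * d)"
    unfolding J sep_eval by (Groebner_Basis.algebra | simp add: algebra_simps)
  then show "sep [0, 2, -8, 10, 1, 2, 1, 2, 1, 2] J \<le> -8" by (rule diff_of_nat_le) simp
  have "sep [-7, 1, -6, 7, 0, 1, 1, 1, 1, 1] J = -39 - real (2 * a * b * c * d + 2 * a * b * c + 2 * a * b * d + 2 * a * c * d + 4 * b * c * d + 2 * b * c + 2 * b * d + 2 * c * d + 2 * a)"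
    unfolding J sep_eval by (Groebner_Basis.algebra | simp add: algebra_simps)
  then show "sep [-7, 1, -6, 7, 0, 1, 1, 1, 1, 1] J \<le> -39" by (rule diff_of_nat_le) simp
qed

text \<open>The last functional exceeds 1 for the skeletons on four cover vertices with two or three
  connectors, all of degree two. Here it is at most 0.\<close>

lemma signs_HD:
  assumes "admissible HD xs" and "length xs = 4"
  defines "J \<equiv> invs HD (map real xs)"
  shows "0 < sep [0, 0, 0, 1, 0, 0, 0, 0, 0, 0] J" and "-14 < sep [-4, 4, -4, -14, 1, 2, 0, 3, -4, 10] J" and "sep [0, 0, 0, 2, 0, 0, 0, 0, 1, 1] J \<le> -2" and "sep [0, 0, 0, -2, 0, 0, 0, 0, -1, -2] J \<le> 1"
proof -
  obtain a b c d where "xs = [Suc a, Suc b, Suc c, Suc d]"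
    using assms(1,2) by (auto simp: length_Suc_conv numeral_eq_Suc Suc_le_eq gr0_conv_Suc)
  then have J: "J = invs HD [1 + real a, 1 + real b, 1 + real c, 1 + real d]" by (simp add: J_def del: invs.simps)
  have "sep [0, 0, 0, 1, 0, 0, 0, 0, 0, 0] J = 4 + real (a * b * c * d + a * b * c + 2 * a * b * d + 2 * a * c * d + 2 * b * c * d + 2 * a * b + 2 * a * c + 3 * a * d + 2 * b * c + 3 * b * d + 3 * c * d + 3 * a + 3 * b + 3 * c + 4 * d)"
    unfolding J sep_eval by (Groebner_Basis.algebra | simp add: algebra_simps)
  then show "0 < sep [0, 0, 0, 1, 0, 0, 0, 0, 0, 0] J" by (rule less_add_of_nat) simp
  have "sep [-4, 4, -4, -14, 1, 2, 0, 3, -4, 10] J = -10 + real (38 * a * b * c * d + 28 * a * b * c + 38 * a * b * d + 19 * a * c * d + 19 * b * c * d + 22 * a * b + 13 * a * c + 18 * a * d + 13 * b * c + 18 * b * d + 6 * c * d + 10 * a + 10 * b + 4 * c + 6 * d)"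
    unfolding J sep_eval by (Groebner_Basis.algebra | simp add: algebra_simps)
  then show "-14 < sep [-4, 4, -4, -14, 1, 2, 0, 3, -4, 10] J" by (rule less_add_of_nat) simp
  have "sep [0, 0, 0, 2, 0, 0, 0, 0, 1, 1] J = -4 - real (4 * a * b * d + 4 * a * b + 4 * a * d + 4 * b * d + 4 * a + 4 * b + 4 * d)"
    unfolding J sep_eval by (Groebner_Basis.algebra | simp add: algebra_simps)
  then show "sep [0, 0, 0, 2, 0, 0, 0, 0, 1, 1] J \<le> -2" by (rule diff_of_nat_le) simp
  have "sep [0, 0, 0, -2, 0, 0, 0, 0, -1, -2] J = 0 - real (4 * a * b * c * d + 4 * a * b * c + 4 * a * c * d + 4 * b * c * d + 4 * a * c + 4 * b * c + 4 * c * d + 4 * c)"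
    unfolding J sep_eval by (Groebner_Basis.algebra | simp add: algebra_simps)
  then show "sep [0, 0, 0, -2, 0, 0, 0, 0, -1, -2] J \<le> 1" by (rule diff_of_nat_le) simp
qed

lemma signs_HC:
  assumes "admissible HC xs" and "length xs = 4"
  defines "J \<equiv> invs HC (map real xs)"
  shows "0 < sep [0, 0, 0, 1, 0, 0, 0, 0, 0, 0] J" and "sep [0, 0, 0, 2, 0, 0, 0, 0, 1, 1] J \<le> -2" and "sep [2, -4, 4, 40, -1, 0, -1, 0, 10, 2] J \<le> 4" and "sep [-24, 17, -3, 0, 3, -1, 1, 0, 0, 0] J \<le> -103" and "-39 < sep [-7, 1, -6, 7, 0, 1, 1, 1, 1, 1] J"
proof -
  obtain a b c d where "xs = [Suc a, Suc b, c, Suc d]"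
    using assms(1,2) by (auto simp: length_Suc_conv numeral_eq_Suc Suc_le_eq gr0_conv_Suc)
  then have J: "J = invs HC [1 + real a, 1 + real b, real c, 1 + real d]" by (simp add: J_def del: invs.simps)
  have "sep [0, 0, 0, 1, 0, 0, 0, 0, 0, 0] J = 5 + real (a * b * c * d + 2 * a * b * c + 2 * a * b * d + 2 * a * c * d + 2 * b * c * d + 3 * a * b + 4 * a * c + 3 * a * d + 4 * b * c + 3 * b * d + 3 * c * d + 4 * a + 4 * b + 6 * c + 4 * d)"
    unfolding J sep_eval by (Groebner_Basis.algebra | simp add: algebra_simps)
  then show "0 < sep [0, 0, 0, 1, 0, 0, 0, 0, 0, 0] J" by (rule less_add_of_nat) simp
  have "sep [0, 0, 0, 2, 0, 0, 0, 0, 1, 1] J = -13 - real (a * b * c * d + a * b * c + 5 * a * b * d + 2 * a * c * d + 2 * b * c * d + 9 * a * b + 2 * a * c + 7 * a * d + 2 * b * c + 7 * b * d + 3 * c * d + 11 * a + 11 * b + 3 * c + 9 * d)"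
    unfolding J sep_eval by (Groebner_Basis.algebra | simp add: algebra_simps)
  then show "sep [0, 0, 0, 2, 0, 0, 0, 0, 1, 1] J \<le> -2" by (rule diff_of_nat_le) simp
  have "sep [2, -4, 4, 40, -1, 0, -1, 0, 10, 2] J = -36 - real (30 * a * b * c * d + 44 * a * b * c + 20 * a * b * d + 30 * a * c * d + 30 * b * c * d + 42 * a * b + 22 * a * c + 20 * a * d + 22 * b * c + 20 * b * d + 30 * c * d + 42 * a + 42 * b + 20 * d)"
    unfolding J sep_eval by (Groebner_Basis.algebra | simp add: algebra_simps)
  then show "sep [2, -4, 4, 40, -1, 0, -1, 0, 10, 2] J \<le> 4" by (rule diff_of_nat_le) simp
  have "sep [-24, 17, -3, 0, 3, -1, 1, 0, 0, 0] J = -104 - real (2 * a * c + 2 * b * c + 3 * c + d)"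
    unfolding J sep_eval by (Groebner_Basis.algebra | simp add: algebra_simps)
  then show "sep [-24, 17, -3, 0, 3, -1, 1, 0, 0, 0] J \<le> -103" by (rule diff_of_nat_le) simp
  have "sep [-7, 1, -6, 7, 0, 1, 1, 1, 1, 1] J = -37 + real (a * c * d + b * c * d + 3 * a * c + 3 * a * d + 3 * b * c + 3 * b * d + 4 * c * d + 2 * c + 4 * d)"
    unfolding J sep_eval by (Groebner_Basis.algebra | simp add: algebra_simps)
  then show "-39 < sep [-7, 1, -6, 7, 0, 1, 1, 1, 1, 1] J" by (rule less_add_of_nat) simp
qed

lemma signs_H4:
  assumes "admissible H4 xs" and "length xs = 4"
  defines "J \<equiv> invs H4 (map real xs)"
  shows "0 < sep [0, 0, 0, 1, 0, 0, 0, 0, 0, 0] J" and "-14 < sep [-4, 4, -4, -14, 1, 2, 0, 3, -4, 10] J" and "-2 < sep [0, 0, 0, 2, 0, 0, 0, 0, 1, 1] J"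
proof -
  obtain a b c d where "xs = [Suc a, Suc b, Suc c, Suc d]"
    using assms(1,2) by (auto simp: length_Suc_conv numeral_eq_Suc Suc_le_eq gr0_conv_Suc)
  then have J: "J = invs H4 [1 + real a, 1 + real b, 1 + real c, 1 + real d]" by (simp add: J_def del: invs.simps)
  have "sep [0, 0, 0, 1, 0, 0, 0, 0, 0, 0] J = 5 + real (a * b * c * d + 2 * a * b * c + 2 * a * b * d + 2 * a * c * d + 2 * b * c * d + 3 * a * b + 3 * a * c + 3 * a * d + 3 * b * c + 3 * b * d + 3 * c * d + 4 * a + 4 * b + 4 * c + 4 * d)"
    unfolding J sep_eval by (Groebner_Basis.algebra | simp add: algebra_simps)
  then show "0 < sep [0, 0, 0, 1, 0, 0, 0, 0, 0, 0] J" by (rule less_add_of_nat) simp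
  have "sep [-4, 4, -4, -14, 1, 2, 0, 3, -4, 10] J = 8 + real (96 * a * b * c * d + 68 * a * b * c + 68 * a * b * d + 68 * a * c * d + 68 * b * c * d + 46 * a * b + 46 * a * c + 46 * a * d + 46 * b * c + 46 * b * d + 46 * c * d + 32 * a + 32 * b + 32 * c + 32 * d)"
    unfolding J sep_eval by (Groebner_Basis.algebra | simp add: algebra_simps)
  then show "-14 < sep [-4, 4, -4, -14, 1, 2, 0, 3, -4, 10] J" by (rule less_add_of_nat) simp
  have "sep [0, 0, 0, 2, 0, 0, 0, 0, 1, 1] J = 3 + real (3 * a * b * c * d + 3 * a * b * c + 3 * a * b * d + 3 * a * c * d + 3 * b * c * d + 3 * a * b + 3 * a * c + 3 * a * d + 3 * b * c + 3 * b * d + 3 * c * d + 3 * a + 3 * b + 3 * c + 3 * d)"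
    unfolding J sep_eval by (Groebner_Basis.algebra | simp add: algebra_simps)
  then show "-2 < sep [0, 0, 0, 2, 0, 0, 0, 0, 1, 1] J" by (rule less_add_of_nat) simp
qed

section \<open>Pairs of skeletons separated by case distinctions\<close>

text \<open>The functional depends on whether the second cover vertex of \<open>PDCC\<close> carries
  a leaf: without one, the values are at least -6 against at most -7; with one, at least 21 against
  at most 16.\<close>

lemma separate_PDCC_PCDC:
  assumes "admissible PDCC xs" "length xs = 4" and "admissible PCDC ys" "length ys = 4"
  shows "invs PDCC (map real xs) \<noteq> invs PCDC (map real ys)"
proof
  assume eq: "invs PDCC (map real xs) = invs PCDC (map real ys)"
  define J where "J = invs PDCC (map real xs)"
  obtain a b c d where xs: "xs = [Suc a, b, c, Suc d]"
    using assms(1,2) by (auto simp: length_Suc_conv numeral_eq_Suc Suc_le_eq gr0_conv_Suc)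
  obtain e f g h where ys: "ys = [Suc e, Suc f, Suc g, Suc h]"
    using assms(3,4) by (auto simp: length_Suc_conv numeral_eq_Suc Suc_le_eq gr0_conv_Suc)
  have X: "J = invs PDCC [1 + real a, real b, real c, 1 + real d]" using xs by (simp add: J_def del: invs.simps)
  have Y: "J = invs PCDC [1 + real e, 1 + real f, 1 + real g, 1 + real h]" using ys eq by (simp add: J_def del: invs.simps)
  show False
  proof (cases b)
    case 0
    note X = X[unfolded 0, unfolded of_nat_0 of_nat_Suc, unfolded nat_shift] and Y = Y[unfolded 0, unfolded of_nat_0 of_nat_Suc, unfolded nat_shift]
    have x: "sep [0, -1, 1, -1, 0, 0, 0, 0, 0, 0] J = -6 + real (a * d + c * d)"
      unfolding X sep_eval by (Groebner_Basis.algebra | simp add: algebra_simps)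
    have y: "sep [0, -1, 1, -1, 0, 0, 0, 0, 0, 0] J = -7 - real (e * f * g * h + e * f * g + e * f * h + e * g * h + f * g * h + e * g + f * g + f * h + f + g)"
      unfolding Y sep_eval by (Groebner_Basis.algebra | simp add: algebra_simps)
    show False using separate[OF x y] by simp
  next
    case (Suc b')
    note X = X[unfolded Suc, unfolded of_nat_0 of_nat_Suc, unfolded nat_shift] and Y = Y[unfolded Suc, unfolded of_nat_0 of_nat_Suc, unfolded nat_shift]
    have x: "sep [2, -1, -1, -6, -1, -1, 0, -2, -1, -4] J = 21 + real (6 * a * b' * d + a * b' + 4 * a * d + 2 * b' * d + 2 * b' + d)"
      unfolding X sep_eval by (Groebner_Basis.algebra | simp add: algebra_simps)
    have y: "sep [2, -1, -1, -6, -1, -1, 0, -2, -1, -4] J = 16 - real (2 * e * h + 3 * f * g + e + 3 * f + 3 * g + h)"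
      unfolding Y sep_eval by (Groebner_Basis.algebra | simp add: algebra_simps)
    show False using separate[OF x y] by simp
  qed
qed

text \<open>The split is on \<open>g\<close>, the leaves at the vertex shared by the two links of
  \<open>HC\<close>. It is the only cover vertex of \<open>HC\<close> that may be leafless.\<close>

lemma separate_PDCC_HC:
  assumes "admissible PDCC xs" "length xs = 4" and "admissible HC ys" "length ys = 4"
  shows "invs PDCC (map real xs) \<noteq> invs HC (map real ys)"
proof
  assume eq: "invs PDCC (map real xs) = invs HC (map real ys)"
  define J where "J = invs PDCC (map real xs)"
  obtain a b c d where xs: "xs = [Suc a, b, c, Suc d]"
    using assms(1,2) by (auto simp: length_Suc_conv numeral_eq_Suc Suc_le_eq gr0_conv_Suc)
  obtain e f g h where ys: "ys = [Suc e, Suc f, g, Suc h]"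
    using assms(3,4) by (auto simp: length_Suc_conv numeral_eq_Suc Suc_le_eq gr0_conv_Suc)
  have X: "J = invs PDCC [1 + real a, real b, real c, 1 + real d]" using xs by (simp add: J_def del: invs.simps)
  have Y: "J = invs HC [1 + real e, 1 + real f, real g, 1 + real h]" using ys eq by (simp add: J_def del: invs.simps)
  show False
  proof (cases g)
    case 0
    note X = X[unfolded 0, unfolded of_nat_0 of_nat_Suc, unfolded nat_shift] and Y = Y[unfolded 0, unfolded of_nat_0 of_nat_Suc, unfolded nat_shift]
    have x: "sep [0, 0, 0, 4, 0, 0, 0, 0, 1, 2] J = 0 + real (2 * a * b * c * d + 4 * a * b * c + 2 * b * c * d + 4 * b * c)"
      unfolding X sep_eval by (Groebner_Basis.algebra | simp add: algebra_simps)
    have y: "sep [0, 0, 0, 4, 0, 0, 0, 0, 1, 2] J = -2 - real (2 * e * f + 2 * e + 2 * f)"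
      unfolding Y sep_eval by (Groebner_Basis.algebra | simp add: algebra_simps)
    show False using separate[OF x y] by simp
  next
    case (Suc g')
    note X = X[unfolded Suc, unfolded of_nat_0 of_nat_Suc, unfolded nat_shift] and Y = Y[unfolded Suc, unfolded of_nat_0 of_nat_Suc, unfolded nat_shift]
    have x: "sep [0, -2, -2, -4, -1, 0, 0, -1, -1, -3] J = 4 + real (5 * a * b * d + a * c * d + 3 * a * b + 2 * a * c + b * c + 3 * b * d + 2 * c * d + 3 * b + 2 * c)"
      unfolding X sep_eval by (Groebner_Basis.algebra | simp add: algebra_simps)
    have y: "sep [0, -2, -2, -4, -1, 0, 0, -1, -1, -3] J = 2 - real (7 * e * f * g' * h + 11 * e * f * g' + 2 * e * f * h + 6 * e * g' * h + 6 * f * g' * h + 9 * e * g' + 2 * e * h + 9 * f * g' + 2 * f * h + 5 * g' * h + 11 * g')"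
      unfolding Y sep_eval by (Groebner_Basis.algebra | simp add: algebra_simps)
    show False using separate[OF x y] by simp
  qed
qed

text \<open>Split as in \<open>separate_PDCC_HC\<close>, by whether the vertex shared by the two
  links of \<open>HC\<close> is leafless.\<close>

lemma separate_PCDC_HC:
  assumes "admissible PCDC xs" "length xs = 4" and "admissible HC ys" "length ys = 4"
  shows "invs PCDC (map real xs) \<noteq> invs HC (map real ys)"
proof
  assume eq: "invs PCDC (map real xs) = invs HC (map real ys)"
  define J where "J = invs PCDC (map real xs)"
  obtain a b c d where xs: "xs = [Suc a, Suc b, Suc c, Suc d]"
    using assms(1,2) by (auto simp: length_Suc_conv numeral_eq_Suc Suc_le_eq gr0_conv_Suc)
  obtain e f g h where ys: "ys = [Suc e, Suc f, g, Suc h]"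
    using assms(3,4) by (auto simp: length_Suc_conv numeral_eq_Suc Suc_le_eq gr0_conv_Suc)
  have X: "J = invs PCDC [1 + real a, 1 + real b, 1 + real c, 1 + real d]" using xs by (simp add: J_def del: invs.simps)
  have Y: "J = invs HC [1 + real e, 1 + real f, real g, 1 + real h]" using ys eq by (simp add: J_def del: invs.simps)
  show False
  proof (cases g)
    case 0
    note X = X[unfolded 0, unfolded of_nat_0 of_nat_Suc, unfolded nat_shift] and Y = Y[unfolded 0, unfolded of_nat_0 of_nat_Suc, unfolded nat_shift]
    have x: "sep [1, 0, 0, -1, 0, 0, 0, 0, 0, 1] J = 7 + real (a * b * c * d + a * b * c + a * b * d + a * c * d + b * c * d + a * b + c * d)"
      unfolding X sep_eval by (Groebner_Basis.algebra | simp add: algebra_simps)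
    have y: "sep [1, 0, 0, -1, 0, 0, 0, 0, 0, 1] J = 5 - real (e * f * h + 2 * e * f + 2 * e * h + 2 * f * h + 2 * e + 2 * f + 2 * h)"
      unfolding Y sep_eval by (Groebner_Basis.algebra | simp add: algebra_simps)
    show False using separate[OF x y] by simp
  next
    case (Suc g')
    note X = X[unfolded Suc, unfolded of_nat_0 of_nat_Suc, unfolded nat_shift] and Y = Y[unfolded Suc, unfolded of_nat_0 of_nat_Suc, unfolded nat_shift]
    have x: "sep [0, 1, 1, 0, 0, -1, 0, -1, 0, -2] J = 2 + real (a * b * c + b * c * d + 2 * a * c + 3 * b * c + 2 * b * d + 2 * b + 2 * c)"
      unfolding X sep_eval by (Groebner_Basis.algebra | simp add: algebra_simps)
    have y: "sep [0, 1, 1, 0, 0, -1, 0, -1, 0, -2] J = 1 - real (6 * e * f * g' * h + 8 * e * f * g' + 2 * e * f * h + 4 * e * g' * h + 4 * f * g' * h + 2 * e * f + 5 * e * g' + e * h + 5 * f * g' + f * h + 4 * g' * h + e + f + 5 * g' + h)"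
      unfolding Y sep_eval by (Groebner_Basis.algebra | simp add: algebra_simps)
    show False using separate[OF x y] by simp
  qed
qed

text \<open>The split is on \<open>a\<close>, the leaves at the centre of the star, its only vertex
  that may be leafless.\<close>

lemma separate_SDDC_HC:
  assumes "admissible SDDC xs" "length xs = 4" and "admissible HC ys" "length ys = 4"
  shows "invs SDDC (map real xs) \<noteq> invs HC (map real ys)"
proof
  assume eq: "invs SDDC (map real xs) = invs HC (map real ys)"
  define J where "J = invs SDDC (map real xs)"
  obtain a b c d where xs: "xs = [a, Suc b, Suc c, Suc d]"
    using assms(1,2) by (auto simp: length_Suc_conv numeral_eq_Suc Suc_le_eq gr0_conv_Suc)
  obtain e f g h where ys: "ys = [Suc e, Suc f, g, Suc h]"
    using assms(3,4) by (auto simp: length_Suc_conv numeral_eq_Suc Suc_le_eq gr0_conv_Suc)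
  have X: "J = invs SDDC [real a, 1 + real b, 1 + real c, 1 + real d]" using xs by (simp add: J_def del: invs.simps)
  have Y: "J = invs HC [1 + real e, 1 + real f, real g, 1 + real h]" using ys eq by (simp add: J_def del: invs.simps)
  show False
  proof (cases a)
    case 0
    note X = X[unfolded 0, unfolded of_nat_0 of_nat_Suc, unfolded nat_shift] and Y = Y[unfolded 0, unfolded of_nat_0 of_nat_Suc, unfolded nat_shift]
    have x: "sep [1, -1, 1, -1, 0, 0, 0, 0, 0, -1] J = 2 + real (b * c + b * d + c * d + b + c)"
      unfolding X sep_eval by (Groebner_Basis.algebra | simp add: algebra_simps)
    have y: "sep [1, -1, 1, -1, 0, 0, 0, 0, 0, -1] J = 1 - real (6 * e * f * g * h + 10 * e * f * g + 2 * e * f * h + 7 * e * g * h + 7 * f * g * h + e * f + 11 * e * g + e * h + 11 * f * g + f * h + 7 * g * h + 11 * g + h)"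
      unfolding Y sep_eval by (Groebner_Basis.algebra | simp add: algebra_simps)
    show False using separate[OF x y] by simp
  next
    case (Suc a')
    note X = X[unfolded Suc, unfolded of_nat_0 of_nat_Suc, unfolded nat_shift] and Y = Y[unfolded Suc, unfolded of_nat_0 of_nat_Suc, unfolded nat_shift]
    have x: "sep [3, 0, 2, 2, 0, -1, 0, -1, 1, -1] J = 22 + real (a' * b * c * d + 4 * a' * b * c + a' * b * d + a' * c * d + 3 * a' * b + 3 * a' * c + 4 * b * c + 4 * a' + 4 * b + 4 * c)"
      unfolding X sep_eval by (Groebner_Basis.algebra | simp add: algebra_simps)
    have y: "sep [3, 0, 2, 2, 0, -1, 0, -1, 1, -1] J = 18 - real (7 * e * f * g * h + 8 * e * f * g + 5 * e * g * h + 5 * f * g * h + 4 * e * g + e * h + 4 * f * g + f * h + 4 * g * h)"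
      unfolding Y sep_eval by (Groebner_Basis.algebra | simp add: algebra_simps)
    show False using separate[OF x y] by simp
  qed
qed

text \<open>The split is on the leaves at the centre of \<open>SDCC\<close>; the centre of
  \<open>SCCC\<close> stays arbitrary.\<close>

lemma separate_SDCC_SCCC:
  assumes "admissible SDCC xs" "length xs = 4" and "admissible SCCC ys" "length ys = 4"
  shows "invs SDCC (map real xs) \<noteq> invs SCCC (map real ys)"
proof
  assume eq: "invs SDCC (map real xs) = invs SCCC (map real ys)"
  define J where "J = invs SDCC (map real xs)"
  obtain a b c d where xs: "xs = [a, Suc b, Suc c, Suc d]"
    using assms(1,2) by (auto simp: length_Suc_conv numeral_eq_Suc Suc_le_eq gr0_conv_Suc)
  obtain e f g h where ys: "ys = [e, Suc f, Suc g, Suc h]"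
    using assms(3,4) by (auto simp: length_Suc_conv numeral_eq_Suc Suc_le_eq gr0_conv_Suc)
  have X: "J = invs SDCC [real a, 1 + real b, 1 + real c, 1 + real d]" using xs by (simp add: J_def del: invs.simps)
  have Y: "J = invs SCCC [real e, 1 + real f, 1 + real g, 1 + real h]" using ys eq by (simp add: J_def del: invs.simps)
  show False
  proof (cases a)
    case 0
    note X = X[unfolded 0, unfolded of_nat_0 of_nat_Suc, unfolded nat_shift] and Y = Y[unfolded 0, unfolded of_nat_0 of_nat_Suc, unfolded nat_shift]
    have x: "sep [1, 2, 1, 0, 1, 2, -1, 2, -1, -2] J = 15 + real (b * c * d + 3 * b)"
      unfolding X sep_eval by (Groebner_Basis.algebra | simp add: algebra_simps)
    have y: "sep [1, 2, 1, 0, 1, 2, -1, 2, -1, -2] J = 14 - real (6 * e * f * g * h + 15 * e * f * g + 15 * e * f * h + 15 * e * g * h + f * g * h + 28 * e * f + 28 * e * g + 28 * e * h + f * g + f * h + g * h + 35 * e + f + g + h)"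
      unfolding Y sep_eval by (Groebner_Basis.algebra | simp add: algebra_simps)
    show False using separate[OF x y] by simp
  next
    case (Suc a')
    note X = X[unfolded Suc, unfolded of_nat_0 of_nat_Suc, unfolded nat_shift] and Y = Y[unfolded Suc, unfolded of_nat_0 of_nat_Suc, unfolded nat_shift]
    have x: "sep [7, -5, 3, 6, -1, -1, 0, 0, 1, 0] J = 27 + real (2 * a' * b * c + 2 * a' * b * d + 5 * a' * b + 2 * b * c + 2 * b * d + 2 * a' + 2 * b)"
      unfolding X sep_eval by (Groebner_Basis.algebra | simp add: algebra_simps)
    have y: "sep [7, -5, 3, 6, -1, -1, 0, 0, 1, 0] J = 25 - real (2 * e * f * g * h + 2 * e * f * g + 2 * e * f * h + 2 * e * g * h + 2 * e * f + 2 * e * g + 2 * e * h)"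
      unfolding Y sep_eval by (Groebner_Basis.algebra | simp add: algebra_simps)
    show False using separate[OF x y] by simp
  qed
qed

text \<open>The split is by whether the vertex joined directly to the centre of \<open>SDCC\<close>
  has exactly one leaf. In that case the functional is constant on \<open>SDCC\<close>.\<close>

lemma separate_SDCC_HC:
  assumes "admissible SDCC xs" "length xs = 4" and "admissible HC ys" "length ys = 4"
  shows "invs SDCC (map real xs) \<noteq> invs HC (map real ys)"
proof
  assume eq: "invs SDCC (map real xs) = invs HC (map real ys)"
  define J where "J = invs SDCC (map real xs)"
  obtain a b c d where xs: "xs = [a, Suc b, Suc c, Suc d]"
    using assms(1,2) by (auto simp: length_Suc_conv numeral_eq_Suc Suc_le_eq gr0_conv_Suc)
  obtain e f g h where ys: "ys = [Suc e, Suc f, g, Suc h]"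
    using assms(3,4) by (auto simp: length_Suc_conv numeral_eq_Suc Suc_le_eq gr0_conv_Suc)
  have X: "J = invs SDCC [real a, 1 + real b, 1 + real c, 1 + real d]" using xs by (simp add: J_def del: invs.simps)
  have Y: "J = invs HC [1 + real e, 1 + real f, real g, 1 + real h]" using ys eq by (simp add: J_def del: invs.simps)
  show False
  proof (cases b)
    case 0
    note X = X[unfolded 0, unfolded of_nat_0 of_nat_Suc, unfolded nat_shift] and Y = Y[unfolded 0, unfolded of_nat_0 of_nat_Suc, unfolded nat_shift]
    have x: "sep [0, 2, -4, -8, 1, 2, 0, 0, -1, 0] J = 8 + real 0"
      unfolding X sep_eval by (Groebner_Basis.algebra | simp add: algebra_simps)
    have y: "sep [0, 2, -4, -8, 1, 2, 0, 0, -1, 0] J = -4 - real (4 * e * f * h + 2 * e * g * h + 2 * f * g * h + 4 * e * g + 6 * e * h + 4 * f * g + 6 * f * h + 12 * h)"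
      unfolding Y sep_eval by (Groebner_Basis.algebra | simp add: algebra_simps)
    show False using separate[OF x y] by simp
  next
    case (Suc b')
    note X = X[unfolded Suc, unfolded of_nat_0 of_nat_Suc, unfolded nat_shift] and Y = Y[unfolded Suc, unfolded of_nat_0 of_nat_Suc, unfolded nat_shift]
    have x: "sep [29, -21, 21, -14, -4, -3, -3, -2, -2, -2] J = 122 + real (2 * a * b' * c * d + 4 * a * b' * c + 4 * a * b' * d + 2 * a * c * d + 2 * b' * c * d + 3 * a * b' + 2 * b' * c + 2 * b' * d + a + 3 * b')"
      unfolding X sep_eval by (Groebner_Basis.algebra | simp add: algebra_simps)
    have y: "sep [29, -21, 21, -14, -4, -3, -3, -2, -2, -2] J = 121 - real (2 * e * g * h + 2 * f * g * h + 4 * e * g + 2 * e * h + 4 * f * g + 2 * f * h + 8 * g * h + e + f + 10 * g)"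
      unfolding Y sep_eval by (Groebner_Basis.algebra | simp add: algebra_simps)
    show False using separate[OF x y] by simp
  qed
qed

text \<open>The pair with the finest split, into five families of \<open>HC\<close>: one leaf at the
  first vertex; one leaf at the second; otherwise no, one, or at least two leaves at the vertex
  shared by the two links.\<close>

lemma separate_HD_HC:
  assumes "admissible HD xs" "length xs = 4" and "admissible HC ys" "length ys = 4"
  shows "invs HD (map real xs) \<noteq> invs HC (map real ys)"
proof
  assume eq: "invs HD (map real xs) = invs HC (map real ys)"
  define J where "J = invs HD (map real xs)"
  obtain a b c d where xs: "xs = [Suc a, Suc b, Suc c, Suc d]"
    using assms(1,2) by (auto simp: length_Suc_conv numeral_eq_Suc Suc_le_eq gr0_conv_Suc)
  obtain e f g h where ys: "ys = [Suc e, Suc f, g, Suc h]"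
    using assms(3,4) by (auto simp: length_Suc_conv numeral_eq_Suc Suc_le_eq gr0_conv_Suc)
  have X: "J = invs HD [1 + real a, 1 + real b, 1 + real c, 1 + real d]" using xs by (simp add: J_def del: invs.simps)
  have Y: "J = invs HC [1 + real e, 1 + real f, real g, 1 + real h]" using ys eq by (simp add: J_def del: invs.simps)
  show False
  proof (cases e)
    case 0
    note X = X[unfolded 0, unfolded of_nat_0 of_nat_Suc, unfolded nat_shift] and Y = Y[unfolded 0, unfolded of_nat_0 of_nat_Suc, unfolded nat_shift]
    have x: "sep [-18, 11, 7, -6, 1, -3, -1, -2, -1, -2] J = -72 + real (c * d + c)"
      unfolding X sep_eval by (Groebner_Basis.algebra | simp add: algebra_simps)
    have y: "sep [-18, 11, 7, -6, 1, -3, -1, -2, -1, -2] J = -74 - real (4 * g * h + 3 * g + h)"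
      unfolding Y sep_eval by (Groebner_Basis.algebra | simp add: algebra_simps)
    show False using separate[OF x y] by simp
  next
    case (Suc e')
    note X = X[unfolded Suc, unfolded of_nat_0 of_nat_Suc, unfolded nat_shift] and Y = Y[unfolded Suc, unfolded of_nat_0 of_nat_Suc, unfolded nat_shift]
    show False
    proof (cases f)
      case 0
      note X = X[unfolded 0, unfolded of_nat_0 of_nat_Suc, unfolded nat_shift] and Y = Y[unfolded 0, unfolded of_nat_0 of_nat_Suc, unfolded nat_shift]
      have x: "sep [10, -9, 19, -12, -2, -3, -3, -2, -2, -2] J = 40 + real (3 * c * d + 3 * c)"
        unfolding X sep_eval by (Groebner_Basis.algebra | simp add: algebra_simps)
      have y: "sep [10, -9, 19, -12, -2, -3, -3, -2, -2, -2] J = 36 - real (6 * g * h + 3 * g + h)"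
        unfolding Y sep_eval by (Groebner_Basis.algebra | simp add: algebra_simps)
      show False using separate[OF x y] by simp
    next
      case (Suc f')
      note X = X[unfolded Suc, unfolded of_nat_0 of_nat_Suc, unfolded nat_shift] and Y = Y[unfolded Suc, unfolded of_nat_0 of_nat_Suc, unfolded nat_shift]
      show False
      proof (cases g)
        case 0
        note X = X[unfolded 0, unfolded of_nat_0 of_nat_Suc, unfolded nat_shift] and Y = Y[unfolded 0, unfolded of_nat_0 of_nat_Suc, unfolded nat_shift]
        have x: "sep [1, -1, 1, 1, -1, -1, 0, -1, 1, 1] J = 29 + real (3 * a * b * c * d + 5 * a * b * c + 5 * a * c * d + 5 * b * c * d + 4 * a * b + 7 * a * c + 3 * a * d + 7 * b * c + 3 * b * d + 4 * c * d + 10 * a + 10 * b + 9 * c + 9 * d)"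
          unfolding X sep_eval by (Groebner_Basis.algebra | simp add: algebra_simps)
        have y: "sep [1, -1, 1, 1, -1, -1, 0, -1, 1, 1] J = 21 - real (e' * f' * h + 2 * e' * f' + 4 * e' * h + 4 * f' * h + 2 * e' + 2 * f' + 4 * h)"
          unfolding Y sep_eval by (Groebner_Basis.algebra | simp add: algebra_simps)
        show False using separate[OF x y] by simp
      next
        case (Suc g')
        note X = X[unfolded Suc, unfolded of_nat_0 of_nat_Suc, unfolded nat_shift] and Y = Y[unfolded Suc, unfolded of_nat_0 of_nat_Suc, unfolded nat_shift]
        show False
        proof (cases g')
          case 0
          note X = X[unfolded 0, unfolded of_nat_0 of_nat_Suc, unfolded nat_shift] and Y = Y[unfolded 0, unfolded of_nat_0 of_nat_Suc, unfolded nat_shift]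
          have x: "sep [0, 0, 0, 2, 0, 0, 0, 0, 1, 2] J = 0 + real (4 * a * b * c * d + 4 * a * b * c + 4 * a * c * d + 4 * b * c * d + 4 * a * c + 4 * b * c + 4 * c * d + 4 * c)"
            unfolding X sep_eval by (Groebner_Basis.algebra | simp add: algebra_simps)
          have y: "sep [0, 0, 0, 2, 0, 0, 0, 0, 1, 2] J = -8 - real (2 * e' * h + 2 * f' * h + 2 * e' + 2 * f' + 8 * h)"
            unfolding Y sep_eval by (Groebner_Basis.algebra | simp add: algebra_simps)
          show False using separate[OF x y] by simp
        next
          case (Suc g'')
          note X = X[unfolded Suc, unfolded of_nat_0 of_nat_Suc, unfolded nat_shift] and Y = Y[unfolded Suc, unfolded of_nat_0 of_nat_Suc, unfolded nat_shift]
          have x: "sep [-82, 59, -17, 6, 9, -3, 3, -2, 1, -2] J = -328 + real (c * d + c)"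
            unfolding X sep_eval by (Groebner_Basis.algebra | simp add: algebra_simps)
          have y: "sep [-82, 59, -17, 6, 9, -3, 3, -2, 1, -2] J = -332 - real (4 * e' * f' * g'' * h + 4 * e' * f' * g'' + 4 * e' * g'' * h + 4 * f' * g'' * h + 4 * e' * g'' + 4 * f' * g'' + 4 * g'' * h + 3 * g'' + 5 * h)"
            unfolding Y sep_eval by (Groebner_Basis.algebra | simp add: algebra_simps)
          show False using separate[OF x y] by simp
        qed
      qed
    qed
  qed
qed

section \<open>Signatures and the separation of the skeletons\<close>

text \<open>The signs shown in the \<open>signs\<close> lemmas. The functionals are shared between
  skeletons, and two skeletons with opposite signs at one of them cannot have equal
  invariants.\<close>

primrec signature :: "skeleton \<Rightarrow> real list \<Rightarrow> bool" where
  "signature S1 v \<longleftrightarrow> \<not> 0 < sep [0, 0, 0, 1, 0, 0, 0, 0, 0, 0] v \<and> \<not> 0 < sep [0, 0, 1, 0, 0, 0, 0, 0, 0, 0] v \<and> \<not> 0 < sep [0, 1, 0, 0, 0, 0, 0, 0, 0, 0] v"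
| "signature ED v \<longleftrightarrow> \<not> 0 < sep [0, 0, 0, 1, 0, 0, 0, 0, 0, 0] v \<and> \<not> 0 < sep [0, 0, 1, 0, 0, 0, 0, 0, 0, 0] v \<and> 0 < sep [0, 1, 0, 0, 0, 0, 0, 0, 0, 0] v \<and> -1 < sep [0, 0, 0, 0, 0, -1, 0, 0, 0, 0] v"
| "signature EC v \<longleftrightarrow> \<not> 0 < sep [0, 0, 0, 1, 0, 0, 0, 0, 0, 0] v \<and> \<not> 0 < sep [0, 0, 1, 0, 0, 0, 0, 0, 0, 0] v \<and> 0 < sep [0, 1, 0, 0, 0, 0, 0, 0, 0, 0] v \<and> \<not> -1 < sep [0, 0, 0, 0, 0, -1, 0, 0, 0, 0] v"
| "signature PDD v \<longleftrightarrow> \<not> 0 < sep [0, 0, 0, 1, 0, 0, 0, 0, 0, 0] v \<and> 0 < sep [0, 0, 1, 0, 0, 0, 0, 0, 0, 0] v \<and> -2 < sep [0, 4, -18, 0, 2, 4, 3, 6, 0, 0] v \<and> -10 < sep [-2, -2, 9, -9, -1, -1, -2, -2, -9, -9] v \<and> 6 < sep [1, -2, 1, -2, -1, -1, 1, 2, -2, -2] v"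
| "signature PDC v \<longleftrightarrow> \<not> 0 < sep [0, 0, 0, 1, 0, 0, 0, 0, 0, 0] v \<and> 0 < sep [0, 0, 1, 0, 0, 0, 0, 0, 0, 0] v \<and> \<not> -2 < sep [0, 4, -18, 0, 2, 4, 3, 6, 0, 0] v \<and> -10 < sep [-2, -2, 9, -9, -1, -1, -2, -2, -9, -9] v \<and> 6 < sep [1, -2, 1, -2, -1, -1, 1, 2, -2, -2] v"
| "signature PCC v \<longleftrightarrow> \<not> 0 < sep [0, 0, 0, 1, 0, 0, 0, 0, 0, 0] v \<and> 0 < sep [0, 0, 1, 0, 0, 0, 0, 0, 0, 0] v \<and> -2 < sep [0, 4, -18, 0, 2, 4, 3, 6, 0, 0] v \<and> \<not> -10 < sep [-2, -2, 9, -9, -1, -1, -2, -2, -9, -9] v \<and> 6 < sep [1, -2, 1, -2, -1, -1, 1, 2, -2, -2] v"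
| "signature H3 v \<longleftrightarrow> \<not> 0 < sep [0, 0, 0, 1, 0, 0, 0, 0, 0, 0] v \<and> 0 < sep [0, 0, 1, 0, 0, 0, 0, 0, 0, 0] v \<and> \<not> -2 < sep [0, 4, -18, 0, 2, 4, 3, 6, 0, 0] v \<and> -10 < sep [-2, -2, 9, -9, -1, -1, -2, -2, -9, -9] v \<and> \<not> 6 < sep [1, -2, 1, -2, -1, -1, 1, 2, -2, -2] v"
| "signature PDDD v \<longleftrightarrow> 0 < sep [0, 0, 0, 1, 0, 0, 0, 0, 0, 0] v \<and> \<not> -14 < sep [-4, 4, -4, -14, 1, 2, 0, 3, -4, 10] v \<and> -2 < sep [0, 0, 0, 2, 0, 0, 0, 0, 1, 1] v \<and> -5 < sep [-1, 0, -2, 2, 0, 0, 1, 1, -1, -2] v"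
| "signature PDDC v \<longleftrightarrow> 0 < sep [0, 0, 0, 1, 0, 0, 0, 0, 0, 0] v \<and> \<not> -14 < sep [-4, 4, -4, -14, 1, 2, 0, 3, -4, 10] v \<and> \<not> -2 < sep [0, 0, 0, 2, 0, 0, 0, 0, 1, 1] v \<and> 4 < sep [2, -4, 4, 40, -1, 0, -1, 0, 10, 2] v \<and> -6 < sep [-1, 1, 1, 0, 0, -1, 0, -2, 1, -4] v \<and> -6 < sep [-2, 4, -4, 4, 1, 0, 1, 0, 1, 0] v"
| "signature PDCD v \<longleftrightarrow> 0 < sep [0, 0, 0, 1, 0, 0, 0, 0, 0, 0] v \<and> \<not> -14 < sep [-4, 4, -4, -14, 1, 2, 0, 3, -4, 10] v \<and> \<not> -2 < sep [0, 0, 0, 2, 0, 0, 0, 0, 1, 1] v \<and> 4 < sep [2, -4, 4, 40, -1, 0, -1, 0, 10, 2] v \<and> \<not> -6 < sep [-1, 1, 1, 0, 0, -1, 0, -2, 1, -4] v"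
| "signature PDCC v \<longleftrightarrow> 0 < sep [0, 0, 0, 1, 0, 0, 0, 0, 0, 0] v \<and> \<not> -2 < sep [0, 0, 0, 2, 0, 0, 0, 0, 1, 1] v \<and> 1 < sep [0, 0, 0, -2, 0, 0, 0, 0, -1, -2] v \<and> \<not> 4 < sep [2, -4, 4, 40, -1, 0, -1, 0, 10, 2] v \<and> -8 < sep [0, 2, -8, 10, 1, 2, 1, 2, 1, 2] v \<and> \<not> 6 < sep [2, -4, 7, -12, -1, -1, -1, -1, -2, -2] v"
| "signature PCDC v \<longleftrightarrow> 0 < sep [0, 0, 0, 1, 0, 0, 0, 0, 0, 0] v \<and> -14 < sep [-4, 4, -4, -14, 1, 2, 0, 3, -4, 10] v \<and> \<not> -2 < sep [0, 0, 0, 2, 0, 0, 0, 0, 1, 1] v \<and> 1 < sep [0, 0, 0, -2, 0, 0, 0, 0, -1, -2] v \<and> -8 < sep [0, 2, -8, 10, 1, 2, 1, 2, 1, 2] v \<and> \<not> 6 < sep [2, -4, 7, -12, -1, -1, -1, -1, -2, -2] v"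
| "signature PCCC v \<longleftrightarrow> 0 < sep [0, 0, 0, 1, 0, 0, 0, 0, 0, 0] v \<and> -14 < sep [-4, 4, -4, -14, 1, 2, 0, 3, -4, 10] v \<and> \<not> -2 < sep [0, 0, 0, 2, 0, 0, 0, 0, 1, 1] v \<and> 1 < sep [0, 0, 0, -2, 0, 0, 0, 0, -1, -2] v \<and> -8 < sep [0, 2, -8, 10, 1, 2, 1, 2, 1, 2] v \<and> 6 < sep [2, -4, 7, -12, -1, -1, -1, -1, -2, -2] v \<and> -103 < sep [-24, 17, -3, 0, 3, -1, 1, 0, 0, 0] v"
| "signature SDDD v \<longleftrightarrow> 0 < sep [0, 0, 0, 1, 0, 0, 0, 0, 0, 0] v \<and> \<not> -14 < sep [-4, 4, -4, -14, 1, 2, 0, 3, -4, 10] v \<and> -2 < sep [0, 0, 0, 2, 0, 0, 0, 0, 1, 1] v \<and> \<not> -5 < sep [-1, 0, -2, 2, 0, 0, 1, 1, -1, -2] v"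
| "signature SDDC v \<longleftrightarrow> 0 < sep [0, 0, 0, 1, 0, 0, 0, 0, 0, 0] v \<and> \<not> -14 < sep [-4, 4, -4, -14, 1, 2, 0, 3, -4, 10] v \<and> \<not> -2 < sep [0, 0, 0, 2, 0, 0, 0, 0, 1, 1] v \<and> \<not> -8 < sep [0, 2, -8, 10, 1, 2, 1, 2, 1, 2] v \<and> -6 < sep [-1, 1, 1, 0, 0, -1, 0, -2, 1, -4] v \<and> \<not> -6 < sep [-2, 4, -4, 4, 1, 0, 1, 0, 1, 0] v"
| "signature SDCC v \<longleftrightarrow> 0 < sep [0, 0, 0, 1, 0, 0, 0, 0, 0, 0] v \<and> -14 < sep [-4, 4, -4, -14, 1, 2, 0, 3, -4, 10] v \<and> \<not> -2 < sep [0, 0, 0, 2, 0, 0, 0, 0, 1, 1] v \<and> 1 < sep [0, 0, 0, -2, 0, 0, 0, 0, -1, -2] v \<and> \<not> -8 < sep [0, 2, -8, 10, 1, 2, 1, 2, 1, 2] v"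
| "signature SCCC v \<longleftrightarrow> 0 < sep [0, 0, 0, 1, 0, 0, 0, 0, 0, 0] v \<and> -14 < sep [-4, 4, -4, -14, 1, 2, 0, 3, -4, 10] v \<and> \<not> -2 < sep [0, 0, 0, 2, 0, 0, 0, 0, 1, 1] v \<and> 1 < sep [0, 0, 0, -2, 0, 0, 0, 0, -1, -2] v \<and> \<not> -8 < sep [0, 2, -8, 10, 1, 2, 1, 2, 1, 2] v \<and> \<not> -39 < sep [-7, 1, -6, 7, 0, 1, 1, 1, 1, 1] v"
| "signature HD v \<longleftrightarrow> 0 < sep [0, 0, 0, 1, 0, 0, 0, 0, 0, 0] v \<and> -14 < sep [-4, 4, -4, -14, 1, 2, 0, 3, -4, 10] v \<and> \<not> -2 < sep [0, 0, 0, 2, 0, 0, 0, 0, 1, 1] v \<and> \<not> 1 < sep [0, 0, 0, -2, 0, 0, 0, 0, -1, -2] v"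
| "signature HC v \<longleftrightarrow> 0 < sep [0, 0, 0, 1, 0, 0, 0, 0, 0, 0] v \<and> \<not> -2 < sep [0, 0, 0, 2, 0, 0, 0, 0, 1, 1] v \<and> \<not> 4 < sep [2, -4, 4, 40, -1, 0, -1, 0, 10, 2] v \<and> \<not> -103 < sep [-24, 17, -3, 0, 3, -1, 1, 0, 0, 0] v \<and> -39 < sep [-7, 1, -6, 7, 0, 1, 1, 1, 1, 1] v"
| "signature H4 v \<longleftrightarrow> 0 < sep [0, 0, 0, 1, 0, 0, 0, 0, 0, 0] v \<and> -14 < sep [-4, 4, -4, -14, 1, 2, 0, 3, -4, 10] v \<and> -2 < sep [0, 0, 0, 2, 0, 0, 0, 0, 1, 1] v"

lemma signature_invs:
  assumes "admissible s xs" and "length xs = skeleton_size s"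
  shows "signature s (invs s (map real xs))"
proof (cases s)
  case S1
  then show ?thesis using assms signs_S1[of xs] by (simp del: invs.simps add: not_less)
next
  case ED
  then show ?thesis using assms signs_ED[of xs] by (simp del: invs.simps add: not_less)
next
  case EC
  then show ?thesis using assms signs_EC[of xs] by (simp del: invs.simps add: not_less)
next
  case PDD
  then show ?thesis using assms signs_PDD[of xs] by (simp del: invs.simps add: not_less)
next
  case PDC
  then show ?thesis using assms signs_PDC[of xs] by (simp del: invs.simps add: not_less)
next
  case PCC
  then show ?thesis using assms signs_PCC[of xs] by (simp del: invs.simps add: not_less)
next
  case H3
  then show ?thesis using assms signs_H3[of xs] by (simp del: invs.simps add: not_less)
next
  case PDDD
  then show ?thesis using assms signs_PDDD[of xs] by (simp del: invs.simps add: not_less)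
next
  case PDDC
  then show ?thesis using assms signs_PDDC[of xs] by (simp del: invs.simps add: not_less)
next
  case PDCD
  then show ?thesis using assms signs_PDCD[of xs] by (simp del: invs.simps add: not_less)
next
  case PDCC
  then show ?thesis using assms signs_PDCC[of xs] by (simp del: invs.simps add: not_less)
next
  case PCDC
  then show ?thesis using assms signs_PCDC[of xs] by (simp del: invs.simps add: not_less)
next
  case PCCC
  then show ?thesis using assms signs_PCCC[of xs] by (simp del: invs.simps add: not_less)
next
  case SDDD
  then show ?thesis using assms signs_SDDD[of xs] by (simp del: invs.simps add: not_less)
next
  case SDDC
  then show ?thesis using assms signs_SDDC[of xs] by (simp del: invs.simps add: not_less)
next
  case SDCC
  then show ?thesis using assms signs_SDCC[of xs] by (simp del: invs.simps add: not_less)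
next
  case SCCC
  then show ?thesis using assms signs_SCCC[of xs] by (simp del: invs.simps add: not_less)
next
  case HD
  then show ?thesis using assms signs_HD[of xs] by (simp del: invs.simps add: not_less)
next
  case HC
  then show ?thesis using assms signs_HC[of xs] by (simp del: invs.simps add: not_less)
next
  case H4
  then show ?thesis using assms signs_H4[of xs] by (simp del: invs.simps add: not_less)
qed

text \<open>Of the 190 pairs of skeletons all but seven contradict each other at a common
  functional. The seven appear in both orders, and the \<open>separate\<close> lemmas deal with
  them.\<close>

lemma signature_separates:
  assumes "signature s v" and "signature s' v" and "s \<noteq> s'"
  shows "(s, s') \<in> {(PDCC, PCDC), (PCDC, PDCC), (PDCC, HC), (HC, PDCC), (PCDC, HC), (HC, PCDC), (SDDC, HC), (HC, SDDC), (SDCC, SCCC), (SCCC, SDCC), (SDCC, HC), (HC, SDCC), (HD, HC), (HC, HD)}"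
  using assms by (cases s; cases s'; simp)

theorem skeleton_determined:
  assumes "admissible s xs" "length xs = skeleton_size s" and "admissible s' ys" "length ys = skeleton_size s'"
    and eq: "invs s (map real xs) = invs s' (map real ys)"
  shows "s = s'"
proof (rule ccontr)
  assume neq: "s \<noteq> s'"
  have "signature s (invs s (map real xs))" "signature s' (invs s (map real xs))"
    using signature_invs[OF assms(1,2)] signature_invs[OF assms(3,4)] eq by simp_all
  from signature_separates[OF this neq]
  consider "s = PDCC" "s' = PCDC"
    | "s = PCDC" "s' = PDCC"
    | "s = PDCC" "s' = HC"
    | "s = HC" "s' = PDCC"
    | "s = PCDC" "s' = HC"
    | "s = HC" "s' = PCDC"
    | "s = SDDC" "s' = HC"
    | "s = HC" "s' = SDDC"
    | "s = SDCC" "s' = SCCC"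
    | "s = SCCC" "s' = SDCC"
    | "s = SDCC" "s' = HC"
    | "s = HC" "s' = SDCC"
    | "s = HD" "s' = HC"
    | "s = HC" "s' = HD"
    unfolding insert_iff empty_iff prod.inject by argo
  then show False
  proof cases
    case 1
    from assms[unfolded 1 skeleton_size.simps] separate_PDCC_PCDC[of xs ys] show False by argo
  next
    case 2
    from assms[unfolded 2 skeleton_size.simps] separate_PDCC_PCDC[of ys xs] show False by argo
  next
    case 3
    from assms[unfolded 3 skeleton_size.simps] separate_PDCC_HC[of xs ys] show False by argo
  next
    case 4
    from assms[unfolded 4 skeleton_size.simps] separate_PDCC_HC[of ys xs] show False by argo
  next
    case 5
    from assms[unfolded 5 skeleton_size.simps] separate_PCDC_HC[of xs ys] show False by argo
  next
    case 6
    from assms[unfolded 6 skeleton_size.simps] separate_PCDC_HC[of ys xs] show False by argo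
  next
    case 7
    from assms[unfolded 7 skeleton_size.simps] separate_SDDC_HC[of xs ys] show False by argo
  next
    case 8
    from assms[unfolded 8 skeleton_size.simps] separate_SDDC_HC[of ys xs] show False by argo
  next
    case 9
    from assms[unfolded 9 skeleton_size.simps] separate_SDCC_SCCC[of xs ys] show False by argo
  next
    case 10
    from assms[unfolded 10 skeleton_size.simps] separate_SDCC_SCCC[of ys xs] show False by argo
  next
    case 11
    from assms[unfolded 11 skeleton_size.simps] separate_SDCC_HC[of xs ys] show False by argo
  next
    case 12
    from assms[unfolded 12 skeleton_size.simps] separate_SDCC_HC[of ys xs] show False by argo
  next
    case 13
    from assms[unfolded 13 skeleton_size.simps] separate_HD_HC[of xs ys] show False by argo
  next
    case 14
    from assms[unfolded 14 skeleton_size.simps] separate_HD_HC[of ys xs] show False by argo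
  qed
qed

section \<open>Recovering the pendant numbers\<close>

text \<open>The \<open>basis\<close> lemmas list, for each skeleton, linear combinations of the ten
  invariants in which enough monomials cancel for the leaf numbers to be solved for. Constant terms
  agree on both sides and drop out.\<close>

lemma basis_S1:
  assumes "invs S1 [a] = invs S1 [a']"
  shows "a = a'"
proof -
  show "a = a'"
    using arg_cong[OF assms, of "sep [1, 0, 0, 0, 0, 0, 0, 0, 0, 0]"] unfolding sep_eval by (assumption | Groebner_Basis.algebra)
qed

lemma basis_ED:
  assumes "invs ED [a, b] = invs ED [a', b']"
  shows "a * b = a' * b'"
    and "a + b = a' + b'"
proof -
  show "a * b = a' * b'"
    using arg_cong[OF assms, of "sep [0, 1, 0, 0, 0, 0, 0, 0, 0, 0]"] unfolding sep_eval by (assumption | Groebner_Basis.algebra)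
  show "a + b = a' + b'"
    using arg_cong[OF assms, of "sep [1, 0, 0, 0, 0, 0, 0, 0, 0, 0]"] unfolding sep_eval by (assumption | Groebner_Basis.algebra)
qed

lemma basis_EC:
  assumes "invs EC [a, b] = invs EC [a', b']"
  shows "a * b = a' * b'"
    and "a + b = a' + b'"
proof -
  show "a * b = a' * b'"
    using arg_cong[OF assms, of "sep [-1, 1, 0, 0, 0, 0, 0, 0, 0, 0]"] unfolding sep_eval by (assumption | Groebner_Basis.algebra)
  show "a + b = a' + b'"
    using arg_cong[OF assms, of "sep [1, 0, 0, 0, 0, 0, 0, 0, 0, 0]"] unfolding sep_eval by (assumption | Groebner_Basis.algebra)
qed

lemma basis_PDD:
  assumes "invs PDD [a, b, c] = invs PDD [a', b', c']"
  shows "a * b * c = a' * b' * c'"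
    and "a * b + b * c - b = a' * b' + b' * c' - b'"
    and "a * c = a' * c'"
    and "a + b + c = a' + b' + c'"
proof -
  show "a * b * c = a' * b' * c'"
    using arg_cong[OF assms, of "sep [0, 0, 1, 0, 0, 0, 0, 0, 0, 0]"] unfolding sep_eval by (assumption | Groebner_Basis.algebra)
  show "a * b + b * c - b = a' * b' + b' * c' - b'"
    using arg_cong[OF assms, of "sep [-2, 4, 0, 0, 1, 0, 0, 0, 0, 0]"] unfolding sep_eval by (assumption | Groebner_Basis.algebra)
  show "a * c = a' * c'"
    using arg_cong[OF assms, of "sep [0, -2, 0, 0, -1, 0, 0, 0, 0, 0]"] unfolding sep_eval by (assumption | Groebner_Basis.algebra)
  show "a + b + c = a' + b' + c'"
    using arg_cong[OF assms, of "sep [1, 0, 0, 0, 0, 0, 0, 0, 0, 0]"] unfolding sep_eval by (assumption | Groebner_Basis.algebra)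
qed

lemma basis_PDC:
  assumes "invs PDC [a, b, c] = invs PDC [a', b', c']"
  shows "a * b * c = a' * b' * c'"
    and "a * b = a' * b'"
    and "a * c = a' * c'"
    and "b * c - b = b' * c' - b'"
    and "a + b + c = a' + b' + c'"
proof -
  show "a * b * c = a' * b' * c'"
    using arg_cong[OF assms, of "sep [4, -6, -2, 0, -1, 2, 0, 0, 0, 0]"] unfolding sep_eval by (assumption | Groebner_Basis.algebra)
  show "a * b = a' * b'"
    using arg_cong[OF assms, of "sep [-2, 4, 0, 0, 1, 0, 0, 0, 0, 0]"] unfolding sep_eval by (assumption | Groebner_Basis.algebra)
  show "a * c = a' * c'"
    using arg_cong[OF assms, of "sep [0, -2, 6, 0, -1, -2, 0, 0, 0, 0]"] unfolding sep_eval by (assumption | Groebner_Basis.algebra)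
  show "b * c - b = b' * c' - b'"
    using arg_cong[OF assms, of "sep [-4, -2, -6, 0, -1, 2, 0, 0, 0, 0]"] unfolding sep_eval by (assumption | Groebner_Basis.algebra)
  show "a + b + c = a' + b' + c'"
    using arg_cong[OF assms, of "sep [1, 0, 0, 0, 0, 0, 0, 0, 0, 0]"] unfolding sep_eval by (assumption | Groebner_Basis.algebra)
qed

lemma basis_PCC:
  assumes "invs PCC [a, b, c] = invs PCC [a', b', c']"
  shows "a * b * c = a' * b' * c'"
    and "a * b + b * c = a' * b' + b' * c'"
    and "a * c = a' * c'"
    and "a + c = a' + c'"
    and "b = b'"
proof -
  show "a * b * c = a' * b' * c'"
    using arg_cong[OF assms, of "sep [20, -18, -2, 0, -3, 2, 0, 0, 0, 0]"] unfolding sep_eval by (assumption | Groebner_Basis.algebra)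
  show "a * b + b * c = a' * b' + b' * c'"
    using arg_cong[OF assms, of "sep [-8, 6, -6, 0, 1, 2, 0, 0, 0, 0]"] unfolding sep_eval by (assumption | Groebner_Basis.algebra)
  show "a * c = a' * c'"
    using arg_cong[OF assms, of "sep [-8, 6, 6, 0, 1, -2, 0, 0, 0, 0]"] unfolding sep_eval by (assumption | Groebner_Basis.algebra)
  show "a + c = a' + c'"
    using arg_cong[OF assms, of "sep [4, -4, 0, 0, -1, 0, 0, 0, 0, 0]"] unfolding sep_eval by (assumption | Groebner_Basis.algebra)
  show "b = b'"
    using arg_cong[OF assms, of "sep [-2, 4, 0, 0, 1, 0, 0, 0, 0, 0]"] unfolding sep_eval by (assumption | Groebner_Basis.algebra)
qed

lemma basis_H3:
  assumes "invs H3 [a, b, c] = invs H3 [a', b', c']"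
  shows "a * b * c = a' * b' * c'"
    and "a * b + a * c + b * c = a' * b' + a' * c' + b' * c'"
    and "a + b + c = a' + b' + c'"
proof -
  show "a * b * c = a' * b' * c'"
    using arg_cong[OF assms, of "sep [2, -1, 1, 0, 0, 0, 0, 0, 0, 0]"] unfolding sep_eval by (assumption | Groebner_Basis.algebra)
  show "a * b + a * c + b * c = a' * b' + a' * c' + b' * c'"
    using arg_cong[OF assms, of "sep [-2, 1, 0, 0, 0, 0, 0, 0, 0, 0]"] unfolding sep_eval by (assumption | Groebner_Basis.algebra)
  show "a + b + c = a' + b' + c'"
    using arg_cong[OF assms, of "sep [1, 0, 0, 0, 0, 0, 0, 0, 0, 0]"] unfolding sep_eval by (assumption | Groebner_Basis.algebra)
qed

lemma basis_PDDD:
  assumes "invs PDDD [a, b, c, d] = invs PDDD [a', b', c', d']"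
  shows "a * b * c * d = a' * b' * c' * d'"
    and "a * b * c + b * c * d - b * c = a' * b' * c' + b' * c' * d' - b' * c'"
    and "a * b * d + a * c * d = a' * b' * d' + a' * c' * d'"
    and "a * b + b * c + c * d = a' * b' + b' * c' + c' * d'"
    and "a * c + b * d - b - c = a' * c' + b' * d' - b' - c'"
    and "a * d = a' * d'"
    and "a + b + c + d = a' + b' + c' + d'"
proof -
  show "a * b * c * d = a' * b' * c' * d'"
    using arg_cong[OF assms, of "sep [0, 0, 0, 1, 0, 0, 0, 0, 0, 0]"] unfolding sep_eval by (assumption | Groebner_Basis.algebra)
  show "a * b * c + b * c * d - b * c = a' * b' * c' + b' * c' * d' - b' * c'"
    using arg_cong[OF assms, of "sep [2, -4, 4, 0, -1, 0, -1, 0, 0, 0]"] unfolding sep_eval by (assumption | Groebner_Basis.algebra)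
  show "a * b * d + a * c * d = a' * b' * d' + a' * c' * d'"
    using arg_cong[OF assms, of "sep [0, 2, -10, 0, 1, 2, 2, 0, 0, 0]"] unfolding sep_eval by (assumption | Groebner_Basis.algebra)
  show "a * b + b * c + c * d = a' * b' + b' * c' + c' * d'"
    using arg_cong[OF assms, of "sep [-2, 4, 0, 0, 1, 0, 0, 0, 0, 0]"] unfolding sep_eval by (assumption | Groebner_Basis.algebra)
  show "a * c + b * d - b - c = a' * c' + b' * d' - b' - c'"
    using arg_cong[OF assms, of "sep [-4, -2, -6, 0, -1, 2, 0, 0, 0, 0]"] unfolding sep_eval by (assumption | Groebner_Basis.algebra)
  show "a * d = a' * d'"
    using arg_cong[OF assms, of "sep [0, -2, 6, 0, -1, -2, 0, 0, 0, 0]"] unfolding sep_eval by (assumption | Groebner_Basis.algebra)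
  show "a + b + c + d = a' + b' + c' + d'"
    using arg_cong[OF assms, of "sep [1, 0, 0, 0, 0, 0, 0, 0, 0, 0]"] unfolding sep_eval by (assumption | Groebner_Basis.algebra)
qed

lemma basis_PDDC:
  assumes "invs PDDC [a, b, c, d] = invs PDDC [a', b', c', d']"
  shows "a * b * c * d = a' * b' * c' * d'"
    and "a * b * c = a' * b' * c'"
    and "a * b * d = a' * b' * d'"
    and "a * c * d = a' * c' * d'"
    and "b * c * d - b * c = b' * c' * d' - b' * c'"
    and "a * b + b * c + c = a' * b' + b' * c' + c'"
    and "a * c + c * d - c = a' * c' + c' * d' - c'"
    and "a * d = a' * d'"
    and "b * d - b - c = b' * d' - b' - c'"
    and "a + b + c + d = a' + b' + c' + d'"
proof -
  show "a * b * c * d = a' * b' * c' * d'"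
    using arg_cong[OF assms, of "sep [0, 0, 0, 0, 0, 0, 0, 0, 0, 1]"] unfolding sep_eval by (assumption | Groebner_Basis.algebra)
  show "a * b * c = a' * b' * c'"
    using arg_cong[OF assms, of "sep [0, 0, 0, 4, 0, 0, 0, 0, 1, 0]"] unfolding sep_eval by (assumption | Groebner_Basis.algebra)
  show "a * b * d = a' * b' * d'"
    using arg_cong[OF assms, of "sep [0, 0, 0, -2, 0, 0, 0, 0, -1, -2]"] unfolding sep_eval by (assumption | Groebner_Basis.algebra)
  show "a * c * d = a' * c' * d'"
    using arg_cong[OF assms, of "sep [-2, 4, -4, 4, 1, 0, 1, 0, 1, 0]"] unfolding sep_eval by (assumption | Groebner_Basis.algebra)
  show "b * c * d - b * c = b' * c' * d' - b' * c'"
    using arg_cong[OF assms, of "sep [16, -22, 22, -36, -5, -2, -4, -4, -6, -4]"] unfolding sep_eval by (assumption | Groebner_Basis.algebra)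
  show "a * b + b * c + c = a' * b' + b' * c' + c'"
    using arg_cong[OF assms, of "sep [-2, 4, 0, 0, 1, 0, 0, 0, 0, 0]"] unfolding sep_eval by (assumption | Groebner_Basis.algebra)
  show "a * c + c * d - c = a' * c' + c' * d' - c'"
    using arg_cong[OF assms, of "sep [-4, -2, -6, 0, -1, 2, 0, 0, 0, 0]"] unfolding sep_eval by (assumption | Groebner_Basis.algebra)
  show "a * d = a' * d'"
    using arg_cong[OF assms, of "sep [0, 2, -10, 24, 1, 2, 2, 4, 4, 8]"] unfolding sep_eval by (assumption | Groebner_Basis.algebra)
  show "b * d - b - c = b' * d' - b' - c'"
    using arg_cong[OF assms, of "sep [-2, -2, 8, -12, -1, -2, -1, -2, -2, -4]"] unfolding sep_eval by (assumption | Groebner_Basis.algebra)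
  show "a + b + c + d = a' + b' + c' + d'"
    using arg_cong[OF assms, of "sep [1, 0, 0, 0, 0, 0, 0, 0, 0, 0]"] unfolding sep_eval by (assumption | Groebner_Basis.algebra)
qed

lemma basis_PDCD:
  assumes "invs PDCD [a, b, c, d] = invs PDCD [a', b', c', d']"
  shows "a * b * c * d = a' * b' * c' * d'"
    and "a * b * c + b * c * d = a' * b' * c' + b' * c' * d'"
    and "a * b * d + a * c * d = a' * b' * d' + a' * c' * d'"
    and "a * b + c * d = a' * b' + c' * d'"
    and "a * c + b * d - b - c = a' * c' + b' * d' - b' - c'"
    and "a * d = a' * d'"
    and "b * c = b' * c'"
    and "a + b + c + d = a' + b' + c' + d'"
proof -
  show "a * b * c * d = a' * b' * c' * d'"
    using arg_cong[OF assms, of "sep [0, 0, 0, 0, 0, 0, 0, 0, 0, 1]"] unfolding sep_eval by (assumption | Groebner_Basis.algebra)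
  show "a * b * c + b * c * d = a' * b' * c' + b' * c' * d'"
    using arg_cong[OF assms, of "sep [2, -4, 0, -6, -1, 0, 0, -2, 0, -2]"] unfolding sep_eval by (assumption | Groebner_Basis.algebra)
  show "a * b * d + a * c * d = a' * b' * d' + a' * c' * d'"
    using arg_cong[OF assms, of "sep [0, 0, 0, 1, 0, 0, 0, 0, 0, -1]"] unfolding sep_eval by (assumption | Groebner_Basis.algebra)
  show "a * b + c * d = a' * b' + c' * d'"
    using arg_cong[OF assms, of "sep [-2, 4, 0, 0, 1, 0, 0, 0, 0, 0]"] unfolding sep_eval by (assumption | Groebner_Basis.algebra)
  show "a * c + b * d - b - c = a' * c' + b' * d' - b' - c'"
    using arg_cong[OF assms, of "sep [-2, 1, 2, -2, 0, -1, 0, -1, 0, -2]"] unfolding sep_eval by (assumption | Groebner_Basis.algebra)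
  show "a * d = a' * d'"
    using arg_cong[OF assms, of "sep [4, -6, -2, 8, -1, 2, 0, 4, 0, 8]"] unfolding sep_eval by (assumption | Groebner_Basis.algebra)
  show "b * c = b' * c'"
    using arg_cong[OF assms, of "sep [-4, -2, -6, 0, -1, 2, 0, 0, 0, 0]"] unfolding sep_eval by (assumption | Groebner_Basis.algebra)
  show "a + b + c + d = a' + b' + c' + d'"
    using arg_cong[OF assms, of "sep [1, 0, 0, 0, 0, 0, 0, 0, 0, 0]"] unfolding sep_eval by (assumption | Groebner_Basis.algebra)
qed

text \<open>The mixed term \<open>b * d - b - c\<close> occurs in several of these combinations.
  Sums and differences of them remove it in \<open>inversion_PDCC\<close>.\<close>

lemma basis_PDCC:
  assumes "invs PDCC [a, b, c, d] = invs PDCC [a', b', c', d']"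
  shows "a * b * c * d - b * d + b + c = a' * b' * c' * d' - b' * d' + b' + c'"
    and "a * b * c + b * d - b - c = a' * b' * c' + b' * d' - b' - c'"
    and "a * b * d - b * d + b + c = a' * b' * d' - b' * d' + b' + c'"
    and "a * c * d + b * d - b - c = a' * c' * d' + b' * d' - b' - c'"
    and "b * c * d + c * d = b' * c' * d' + c' * d'"
    and "a * b + c = a' * b' + c'"
    and "a * c + 2 * b * d - 2 * b - 3 * c = a' * c' + 2 * b' * d' - 2 * b' - 3 * c'"
    and "a * d - b * d + b + c = a' * d' - b' * d' + b' + c'"
    and "b * c + c * d = b' * c' + c' * d'"
    and "a + b + c + d = a' + b' + c' + d'"
proof -
  show "a * b * c * d - b * d + b + c = a' * b' * c' * d' - b' * d' + b' + c'"
    using arg_cong[OF assms, of "sep [-36, 46, -18, 20, 9, -2, 4, 0, 4, 4]"] unfolding sep_eval by (assumption | Groebner_Basis.algebra)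
  show "a * b * c + b * d - b - c = a' * b' * c' + b' * d' - b' - c'"
    using arg_cong[OF assms, of "sep [36, -46, 18, -12, -9, 2, -4, 0, -2, 0]"] unfolding sep_eval by (assumption | Groebner_Basis.algebra)
  show "a * b * d - b * d + b + c = a' * b' * d' - b' * d' + b' + c'"
    using arg_cong[OF assms, of "sep [-6, 10, -6, 6, 2, 0, 1, 0, 1, 0]"] unfolding sep_eval by (assumption | Groebner_Basis.algebra)
  show "a * c * d + b * d - b - c = a' * c' * d' + b' * d' - b' - c'"
    using arg_cong[OF assms, of "sep [36, -46, 18, -28, -9, 2, -4, 0, -6, -4]"] unfolding sep_eval by (assumption | Groebner_Basis.algebra)
  show "b * c * d + c * d = b' * c' * d' + c' * d'"
    using arg_cong[OF assms, of "sep [-6, 6, 4, -10, 1, -2, 0, -2, -1, -2]"] unfolding sep_eval by (assumption | Groebner_Basis.algebra)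
  show "a * b + c = a' * b' + c'"
    using arg_cong[OF assms, of "sep [-2, 4, 0, 0, 1, 0, 0, 0, 0, 0]"] unfolding sep_eval by (assumption | Groebner_Basis.algebra)
  show "a * c + 2 * b * d - 2 * b - 3 * c = a' * c' + 2 * b' * d' - 2 * b' - 3 * c'"
    using arg_cong[OF assms, of "sep [10, -22, 20, -24, -5, -2, -3, -2, -4, -4]"] unfolding sep_eval by (assumption | Groebner_Basis.algebra)
  show "a * d - b * d + b + c = a' * d' - b' * d' + b' + c'"
    using arg_cong[OF assms, of "sep [-28, 42, -34, 48, 9, 2, 6, 4, 8, 8]"] unfolding sep_eval by (assumption | Groebner_Basis.algebra)
  show "b * c + c * d = b' * c' + c' * d'"
    using arg_cong[OF assms, of "sep [-4, -2, -6, 0, -1, 2, 0, 0, 0, 0]"] unfolding sep_eval by (assumption | Groebner_Basis.algebra)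
  show "a + b + c + d = a' + b' + c' + d'"
    using arg_cong[OF assms, of "sep [1, 0, 0, 0, 0, 0, 0, 0, 0, 0]"] unfolding sep_eval by (assumption | Groebner_Basis.algebra)
qed

lemma basis_PCDC:
  assumes "invs PCDC [a, b, c, d] = invs PCDC [a', b', c', d']"
  shows "a * b * c * d - b - c = a' * b' * c' * d' - b' - c'"
    and "a * b * c + b * c * d = a' * b' * c' + b' * c' * d'"
    and "a * b * d + a * c * d + 2 * b + 2 * c = a' * b' * d' + a' * c' * d' + 2 * b' + 2 * c'"
    and "a * b + c * d = a' * b' + c' * d'"
    and "a * c + b * d - b - c = a' * c' + b' * d' - b' - c'"
    and "a * d - b - c = a' * d' - b' - c'"
    and "b * c + b + c = b' * c' + b' + c'"
    and "a + b + c + d = a' + b' + c' + d'"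
proof -
  show "a * b * c * d - b - c = a' * b' * c' * d' - b' - c'"
    using arg_cong[OF assms, of "sep [-14, 16, 4, -6, 3, -4, 1, -2, 0, 0]"] unfolding sep_eval by (assumption | Groebner_Basis.algebra)
  show "a * b * c + b * c * d = a' * b' * c' + b' * c' * d'"
    using arg_cong[OF assms, of "sep [24, -26, 6, 0, -5, 2, -2, 0, 0, 0]"] unfolding sep_eval by (assumption | Groebner_Basis.algebra)
  show "a * b * d + a * c * d + 2 * b + 2 * c = a' * b' * d' + a' * c' * d' + 2 * b' + 2 * c'"
    using arg_cong[OF assms, of "sep [8, -6, -10, 8, -1, 4, 0, 2, 0, 0]"] unfolding sep_eval by (assumption | Groebner_Basis.algebra)
  show "a * b + c * d = a' * b' + c' * d'"
    using arg_cong[OF assms, of "sep [-4, -2, -6, 0, -1, 2, 0, 0, 0, 0]"] unfolding sep_eval by (assumption | Groebner_Basis.algebra)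
  show "a * c + b * d - b - c = a' * c' + b' * d' - b' - c'"
    using arg_cong[OF assms, of "sep [6, -16, -6, 8, -4, 4, -1, 2, 0, 0]"] unfolding sep_eval by (assumption | Groebner_Basis.algebra)
  show "a * d - b - c = a' * d' - b' - c'"
    using arg_cong[OF assms, of "sep [-20, 30, 18, -16, 7, -10, 2, -4, 0, 0]"] unfolding sep_eval by (assumption | Groebner_Basis.algebra)
  show "b * c + b + c = b' * c' + b' + c'"
    using arg_cong[OF assms, of "sep [-2, 4, 0, 0, 1, 0, 0, 0, 0, 0]"] unfolding sep_eval by (assumption | Groebner_Basis.algebra)
  show "a + b + c + d = a' + b' + c' + d'"
    using arg_cong[OF assms, of "sep [1, 0, 0, 0, 0, 0, 0, 0, 0, 0]"] unfolding sep_eval by (assumption | Groebner_Basis.algebra)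
qed

lemma basis_PCCC:
  assumes "invs PCCC [a, b, c, d] = invs PCCC [a', b', c', d']"
  shows "a * b * c * d = a' * b' * c' * d'"
    and "a * b * c + b * c * d = a' * b' * c' + b' * c' * d'"
    and "a * b * d + a * c * d = a' * b' * d' + a' * c' * d'"
    and "a * b + c * d = a' * b' + c' * d'"
    and "a * c + b * d = a' * c' + b' * d'"
    and "a * d = a' * d'"
    and "b * c = b' * c'"
    and "a + d = a' + d'"
    and "b + c = b' + c'"
proof -
  show "a * b * c * d = a' * b' * c' * d'"
    using arg_cong[OF assms, of "sep [-110, 84, -2, -4, 14, -8, 3, -2, 0, 0]"] unfolding sep_eval by (assumption | Groebner_Basis.algebra)
  show "a * b * c + b * c * d = a' * b' * c' + b' * c' * d'"
    using arg_cong[OF assms, of "sep [92, -70, 8, 2, -11, 6, -3, 2, 0, 2]"] unfolding sep_eval by (assumption | Groebner_Basis.algebra)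
  show "a * b * d + a * c * d = a' * b' * d' + a' * c' * d'"
    using arg_cong[OF assms, of "sep [-25, 20, -3, -1, 3, -2, 1, -1, 0, -1]"] unfolding sep_eval by (assumption | Groebner_Basis.algebra)
  show "a * b + c * d = a' * b' + c' * d'"
    using arg_cong[OF assms, of "sep [-214, 168, -10, -12, 28, -16, 7, -6, 0, -4]"] unfolding sep_eval by (assumption | Groebner_Basis.algebra)
  show "a * c + b * d = a' * c' + b' * d'"
    using arg_cong[OF assms, of "sep [-186, 144, 2, -12, 24, -16, 5, -6, 0, -4]"] unfolding sep_eval by (assumption | Groebner_Basis.algebra)
  show "a * d = a' * d'"
    using arg_cong[OF assms, of "sep [166, -130, 4, 12, -21, 14, -5, 6, 0, 4]"] unfolding sep_eval by (assumption | Groebner_Basis.algebra)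
  show "b * c = b' * c'"
    using arg_cong[OF assms, of "sep [210, -170, 4, 12, -29, 18, -7, 6, 0, 4]"] unfolding sep_eval by (assumption | Groebner_Basis.algebra)
  show "a + d = a' + d'"
    using arg_cong[OF assms, of "sep [4, -4, 0, 0, -1, 0, 0, 0, 0, 0]"] unfolding sep_eval by (assumption | Groebner_Basis.algebra)
  show "b + c = b' + c'"
    using arg_cong[OF assms, of "sep [-2, 4, 0, 0, 1, 0, 0, 0, 0, 0]"] unfolding sep_eval by (assumption | Groebner_Basis.algebra)
qed

lemma basis_SDDD:
  assumes "invs SDDD [a, b, c, d] = invs SDDD [a', b', c', d']"
  shows "a * b * c * d = a' * b' * c' * d'"
    and "a * b * c + a * b * d + a * c * d = a' * b' * c' + a' * b' * d' + a' * c' * d'"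
    and "b * c * d = b' * c' * d'"
    and "a * b + a * c + a * d + 2 * b + 2 * c + 2 * d = a' * b' + a' * c' + a' * d' + 2 * b' + 2 * c' + 2 * d'"
    and "b * c + b * d + c * d = b' * c' + b' * d' + c' * d'"
    and "a + b + c + d = a' + b' + c' + d'"
proof -
  show "a * b * c * d = a' * b' * c' * d'"
    using arg_cong[OF assms, of "sep [0, 0, 0, 1, 0, 0, 0, 0, 0, 0]"] unfolding sep_eval by (assumption | Groebner_Basis.algebra)
  show "a * b * c + a * b * d + a * c * d = a' * b' * c' + a' * b' * d' + a' * c' * d'"
    using arg_cong[OF assms, of "sep [0, 4, 6, 0, 2, 0, -1, 0, 0, 0]"] unfolding sep_eval by (assumption | Groebner_Basis.algebra)
  show "b * c * d = b' * c' * d'"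
    using arg_cong[OF assms, of "sep [0, 0, -2, 0, 0, 0, 1, 0, 0, 0]"] unfolding sep_eval by (assumption | Groebner_Basis.algebra)
  show "a * b + a * c + a * d + 2 * b + 2 * c + 2 * d = a' * b' + a' * c' + a' * d' + 2 * b' + 2 * c' + 2 * d'"
    using arg_cong[OF assms, of "sep [0, 4, 0, 0, 1, 0, 0, 0, 0, 0]"] unfolding sep_eval by (assumption | Groebner_Basis.algebra)
  show "b * c + b * d + c * d = b' * c' + b' * d' + c' * d'"
    using arg_cong[OF assms, of "sep [0, -2, 0, 0, -1, 0, 0, 0, 0, 0]"] unfolding sep_eval by (assumption | Groebner_Basis.algebra)
  show "a + b + c + d = a' + b' + c' + d'"
    using arg_cong[OF assms, of "sep [1, 0, 0, 0, 0, 0, 0, 0, 0, 0]"] unfolding sep_eval by (assumption | Groebner_Basis.algebra)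
qed

lemma basis_SDDC:
  assumes "invs SDDC [a, b, c, d] = invs SDDC [a', b', c', d']"
  shows "a * b * c * d = a' * b' * c' * d'"
    and "a * b * c = a' * b' * c'"
    and "a * b * d + a * c * d = a' * b' * d' + a' * c' * d'"
    and "b * c * d = b' * c' * d'"
    and "a * b + a * c + b + c = a' * b' + a' * c' + b' + c'"
    and "a * d + b + c + 2 * d = a' * d' + b' + c' + 2 * d'"
    and "b * c = b' * c'"
    and "b * d + c * d = b' * d' + c' * d'"
    and "a + b + c + d = a' + b' + c' + d'"
proof -
  show "a * b * c * d = a' * b' * c' * d'"
    using arg_cong[OF assms, of "sep [0, 0, 0, 0, 0, 0, 0, 0, 0, 1]"] unfolding sep_eval by (assumption | Groebner_Basis.algebra)
  show "a * b * c = a' * b' * c'"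
    using arg_cong[OF assms, of "sep [2, -4, 4, 2, -1, 0, -1, 0, 0, -2]"] unfolding sep_eval by (assumption | Groebner_Basis.algebra)
  show "a * b * d + a * c * d = a' * b' * d' + a' * c' * d'"
    using arg_cong[OF assms, of "sep [8, -10, -10, 8, -1, 6, 0, 4, 0, 8]"] unfolding sep_eval by (assumption | Groebner_Basis.algebra)
  show "b * c * d = b' * c' * d'"
    using arg_cong[OF assms, of "sep [-2, 4, -4, 2, 1, 0, 1, 0, 0, -2]"] unfolding sep_eval by (assumption | Groebner_Basis.algebra)
  show "a * b + a * c + b + c = a' * b' + a' * c' + b' + c'"
    using arg_cong[OF assms, of "sep [-2, 4, 0, 0, 1, 0, 0, 0, 0, 0]"] unfolding sep_eval by (assumption | Groebner_Basis.algebra)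
  show "a * d + b + c + 2 * d = a' * d' + b' + c' + 2 * d'"
    using arg_cong[OF assms, of "sep [4, -10, -14, 12, -3, 6, 0, 4, 0, 4]"] unfolding sep_eval by (assumption | Groebner_Basis.algebra)
  show "b * c = b' * c'"
    using arg_cong[OF assms, of "sep [-4, 6, 2, -12, 1, -2, 0, -4, 0, -4]"] unfolding sep_eval by (assumption | Groebner_Basis.algebra)
  show "b * d + c * d = b' * d' + c' * d'"
    using arg_cong[OF assms, of "sep [0, -2, 6, 0, -1, -2, 0, 0, 0, 0]"] unfolding sep_eval by (assumption | Groebner_Basis.algebra)
  show "a + b + c + d = a' + b' + c' + d'"
    using arg_cong[OF assms, of "sep [1, 0, 0, 0, 0, 0, 0, 0, 0, 0]"] unfolding sep_eval by (assumption | Groebner_Basis.algebra)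
qed

lemma basis_SDCC:
  assumes "invs SDCC [a, b, c, d] = invs SDCC [a', b', c', d']"
  shows "a * b * c * d = a' * b' * c' * d'"
    and "a * b * c + a * b * d = a' * b' * c' + a' * b' * d'"
    and "a * c * d + b = a' * c' * d' + b'"
    and "b * c * d - b = b' * c' * d' - b'"
    and "a * b = a' * b'"
    and "a * c + a * d + 2 * b = a' * c' + a' * d' + 2 * b'"
    and "b * c + b * d + 2 * b = b' * c' + b' * d' + 2 * b'"
    and "c * d - 2 * b = c' * d' - 2 * b'"
    and "a + b = a' + b'"
    and "c + d = c' + d'"
proof -
  show "a * b * c * d = a' * b' * c' * d'"
    using arg_cong[OF assms, of "sep [-24, 26, -6, 0, 5, -2, 2, 0, 0, 4]"] unfolding sep_eval by (assumption | Groebner_Basis.algebra)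
  show "a * b * c + a * b * d = a' * b' * c' + a' * b' * d'"
    using arg_cong[OF assms, of "sep [24, -26, 6, 0, -5, 2, -2, 0, 0, 0]"] unfolding sep_eval by (assumption | Groebner_Basis.algebra)
  show "a * c * d + b = a' * c' * d' + b'"
    using arg_cong[OF assms, of "sep [-72, 94, -42, 0, 19, -6, 10, -8, 4, -4]"] unfolding sep_eval by (assumption | Groebner_Basis.algebra)
  show "b * c * d - b = b' * c' * d' - b'"
    using arg_cong[OF assms, of "sep [-8, 18, -38, 48, 5, 6, 6, 8, 4, 4]"] unfolding sep_eval by (assumption | Groebner_Basis.algebra)
  show "a * b = a' * b'"
    using arg_cong[OF assms, of "sep [-24, 26, -6, 12, 5, -2, 2, 0, 2, 0]"] unfolding sep_eval by (assumption | Groebner_Basis.algebra)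
  show "a * c + a * d + 2 * b = a' * c' + a' * d' + 2 * b'"
    using arg_cong[OF assms, of "sep [4, -6, 0, -6, -1, 2, -1, 0, -1, 0]"] unfolding sep_eval by (assumption | Groebner_Basis.algebra)
  show "b * c + b * d + 2 * b = b' * c' + b' * d' + 2 * b'"
    using arg_cong[OF assms, of "sep [8, -18, 38, -52, -5, -6, -6, -8, -6, -8]"] unfolding sep_eval by (assumption | Groebner_Basis.algebra)
  show "c * d - 2 * b = c' * d' - 2 * b'"
    using arg_cong[OF assms, of "sep [0, 2, -10, 20, 1, 2, 2, 4, 2, 4]"] unfolding sep_eval by (assumption | Groebner_Basis.algebra)
  show "a + b = a' + b'"
    using arg_cong[OF assms, of "sep [16, -10, 6, -12, -1, 2, -2, 0, -2, 0]"] unfolding sep_eval by (assumption | Groebner_Basis.algebra)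
  show "c + d = c' + d'"
    using arg_cong[OF assms, of "sep [-8, 10, -6, 12, 1, -2, 2, 0, 2, 0]"] unfolding sep_eval by (assumption | Groebner_Basis.algebra)
qed

lemma basis_SCCC:
  assumes "invs SCCC [a, b, c, d] = invs SCCC [a', b', c', d']"
  shows "a * b * c * d = a' * b' * c' * d'"
    and "a * b * c + a * b * d + a * c * d = a' * b' * c' + a' * b' * d' + a' * c' * d'"
    and "b * c * d = b' * c' * d'"
    and "a * b + a * c + a * d = a' * b' + a' * c' + a' * d'"
    and "b * c + b * d + c * d = b' * c' + b' * d' + c' * d'"
    and "a = a'"
    and "b + c + d = b' + c' + d'"
proof -
  show "a * b * c * d = a' * b' * c' * d'"
    using arg_cong[OF assms, of "sep [-58, 36, 16, -4, 5, -8, 0, -2, 0, 0]"] unfolding sep_eval by (assumption | Groebner_Basis.algebra)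
  show "a * b * c + a * b * d + a * c * d = a' * b' * c' + a' * b' * d' + a' * c' * d'"
    using arg_cong[OF assms, of "sep [27, -15, -1, -4, -2, 1, 0, -1, 0, 0]"] unfolding sep_eval by (assumption | Groebner_Basis.algebra)
  show "b * c * d = b' * c' * d'"
    using arg_cong[OF assms, of "sep [21, -13, -7, 4, -2, 3, 0, 1, 0, 0]"] unfolding sep_eval by (assumption | Groebner_Basis.algebra)
  show "a * b + a * c + a * d = a' * b' + a' * c' + a' * d'"
    using arg_cong[OF assms, of "sep [-12, 6, -6, 0, 1, 2, 0, 0, 0, 0]"] unfolding sep_eval by (assumption | Groebner_Basis.algebra)
  show "b * c + b * d + c * d = b' * c' + b' * d' + c' * d'"
    using arg_cong[OF assms, of "sep [-12, 6, 6, 0, 1, -2, 0, 0, 0, 0]"] unfolding sep_eval by (assumption | Groebner_Basis.algebra)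
  show "a = a'"
    using arg_cong[OF assms, of "sep [-2, 4, 0, 0, 1, 0, 0, 0, 0, 0]"] unfolding sep_eval by (assumption | Groebner_Basis.algebra)
  show "b + c + d = b' + c' + d'"
    using arg_cong[OF assms, of "sep [6, -4, 0, 0, -1, 0, 0, 0, 0, 0]"] unfolding sep_eval by (assumption | Groebner_Basis.algebra)
qed

lemma basis_HD:
  assumes "invs HD [a, b, c, d] = invs HD [a', b', c', d']"
  shows "a * b * c * d = a' * b' * c' * d'"
    and "a * b * c - a * c - b * c + c - d = a' * b' * c' - a' * c' - b' * c' + c' - d'"
    and "a * b * d = a' * b' * d'"
    and "a * c * d + b * c * d = a' * c' * d' + b' * c' * d'"
    and "a * b + a * c + b * c - c + d = a' * b' + a' * c' + b' * c' - c' + d'"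
    and "a * d + b * d = a' * d' + b' * d'"
    and "c * d - d = c' * d' - d'"
    and "a + b + c + d = a' + b' + c' + d'"
proof -
  show "a * b * c * d = a' * b' * c' * d'"
    using arg_cong[OF assms, of "sep [-96, 66, -10, 0, 9, -6, 2, -4, 0, 0]"] unfolding sep_eval by (assumption | Groebner_Basis.algebra)
  show "a * b * c - a * c - b * c + c - d = a' * b' * c' - a' * c' - b' * c' + c' - d'"
    using arg_cong[OF assms, of "sep [-16, 34, 6, -16, 9, -6, 2, -4, 0, 0]"] unfolding sep_eval by (assumption | Groebner_Basis.algebra)
  show "a * b * d = a' * b' * d'"
    using arg_cong[OF assms, of "sep [-32, 30, -38, 16, 7, 6, 6, 4, 0, 0]"] unfolding sep_eval by (assumption | Groebner_Basis.algebra)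
  show "a * c * d + b * c * d = a' * c' * d' + b' * c' * d'"
    using arg_cong[OF assms, of "sep [16, -12, 6, 0, -2, 0, -1, 0, 0, 0]"] unfolding sep_eval by (assumption | Groebner_Basis.algebra)
  show "a * b + a * c + b * c - c + d = a' * b' + a' * c' + b' * c' - c' + d'"
    using arg_cong[OF assms, of "sep [-4, -2, -6, 0, -1, 2, 0, 0, 0, 0]"] unfolding sep_eval by (assumption | Groebner_Basis.algebra)
  show "a * d + b * d = a' * d' + b' * d'"
    using arg_cong[OF assms, of "sep [0, -2, 6, 0, -1, -2, 0, 0, 0, 0]"] unfolding sep_eval by (assumption | Groebner_Basis.algebra)
  show "c * d - d = c' * d' - d'"
    using arg_cong[OF assms, of "sep [-4, 4, 0, 0, 1, 0, 0, 0, 0, 0]"] unfolding sep_eval by (assumption | Groebner_Basis.algebra)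
  show "a + b + c + d = a' + b' + c' + d'"
    using arg_cong[OF assms, of "sep [1, 0, 0, 0, 0, 0, 0, 0, 0, 0]"] unfolding sep_eval by (assumption | Groebner_Basis.algebra)
qed

lemma basis_HC:
  assumes "invs HC [a, b, c, d] = invs HC [a', b', c', d']"
  shows "a * b * c * d = a' * b' * c' * d'"
    and "a * b * c = a' * b' * c'"
    and "a * b * d = a' * b' * d'"
    and "a * c * d + b * c * d = a' * c' * d' + b' * c' * d'"
    and "a * b = a' * b'"
    and "a * c + b * c = a' * c' + b' * c'"
    and "a * d + b * d = a' * d' + b' * d'"
    and "c * d - d = c' * d' - d'"
    and "a + b + 2 * d = a' + b' + 2 * d'"
    and "c - d = c' - d'"
proof -
  show "a * b * c * d = a' * b' * c' * d'"
    using arg_cong[OF assms, of "sep [436, -270, 2, 4, -41, 26, -8, 8, -2, 4]"] unfolding sep_eval by (assumption | Groebner_Basis.algebra)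
  show "a * b * c = a' * b' * c'"
    using arg_cong[OF assms, of "sep [-616, 378, 6, -12, 57, -38, 10, -12, 2, -4]"] unfolding sep_eval by (assumption | Groebner_Basis.algebra)
  show "a * b * d = a' * b' * d'"
    using arg_cong[OF assms, of "sep [-580, 362, -22, 4, 55, -30, 12, -8, 2, -4]"] unfolding sep_eval by (assumption | Groebner_Basis.algebra)
  show "a * c * d + b * c * d = a' * c' * d' + b' * c' * d'"
    using arg_cong[OF assms, of "sep [432, -262, -6, 12, -39, 26, -6, 8, 0, 4]"] unfolding sep_eval by (assumption | Groebner_Basis.algebra)
  show "a * b = a' * b'"
    using arg_cong[OF assms, of "sep [206, -130, 12, -8, -20, 10, -5, 2, -2, 0]"] unfolding sep_eval by (assumption | Groebner_Basis.algebra)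
  show "a * c + b * c = a' * c' + b' * c'"
    using arg_cong[OF assms, of "sep [44, -30, 6, 0, -5, 2, -2, 0, 0, 0]"] unfolding sep_eval by (assumption | Groebner_Basis.algebra)
  show "a * d + b * d = a' * d' + b' * d'"
    using arg_cong[OF assms, of "sep [-12, 6, 6, 0, 1, -2, 0, 0, 0, 0]"] unfolding sep_eval by (assumption | Groebner_Basis.algebra)
  show "c * d - d = c' * d' - d'"
    using arg_cong[OF assms, of "sep [-262, 166, -24, 8, 26, -10, 7, -2, 2, 0]"] unfolding sep_eval by (assumption | Groebner_Basis.algebra)
  show "a + b + 2 * d = a' + b' + 2 * d'"
    using arg_cong[OF assms, of "sep [6, -4, 0, 0, -1, 0, 0, 0, 0, 0]"] unfolding sep_eval by (assumption | Groebner_Basis.algebra)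
  show "c - d = c' - d'"
    using arg_cong[OF assms, of "sep [-4, 4, 0, 0, 1, 0, 0, 0, 0, 0]"] unfolding sep_eval by (assumption | Groebner_Basis.algebra)
qed

lemma basis_H4:
  assumes "invs H4 [a, b, c, d] = invs H4 [a', b', c', d']"
  shows "a * b * c * d = a' * b' * c' * d'"
    and "a * b * c + a * b * d + a * c * d + b * c * d = a' * b' * c' + a' * b' * d' + a' * c' * d' + b' * c' * d'"
    and "a * b + a * c + a * d + b * c + b * d + c * d = a' * b' + a' * c' + a' * d' + b' * c' + b' * d' + c' * d'"
    and "a + b + c + d = a' + b' + c' + d'"
proof -
  show "a * b * c * d = a' * b' * c' * d'"
    using arg_cong[OF assms, of "sep [-6, 2, -1, 1, 0, 0, 0, 0, 0, 0]"] unfolding sep_eval by (assumption | Groebner_Basis.algebra)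
  show "a * b * c + a * b * d + a * c * d + b * c * d = a' * b' * c' + a' * b' * d' + a' * c' * d' + b' * c' * d'"
    using arg_cong[OF assms, of "sep [6, -2, 1, 0, 0, 0, 0, 0, 0, 0]"] unfolding sep_eval by (assumption | Groebner_Basis.algebra)
  show "a * b + a * c + a * d + b * c + b * d + c * d = a' * b' + a' * c' + a' * d' + b' * c' + b' * d' + c' * d'"
    using arg_cong[OF assms, of "sep [-3, 1, 0, 0, 0, 0, 0, 0, 0, 0]"] unfolding sep_eval by (assumption | Groebner_Basis.algebra)
  show "a + b + c + d = a' + b' + c' + d'"
    using arg_cong[OF assms, of "sep [1, 0, 0, 0, 0, 0, 0, 0, 0, 0]"] unfolding sep_eval by (assumption | Groebner_Basis.algebra)
qed

text \<open>A representative under the symmetries of the skeleton. In \<open>PDC\<close> and \<open>PDCC\<close> without leaves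
  at the inner vertices, the extra symmetry is an exchange of the cover.\<close>

primrec ordered :: "skeleton \<Rightarrow> nat list \<Rightarrow> bool" where
  "ordered S1 a \<longleftrightarrow> True"
| "ordered ED a \<longleftrightarrow> a ! 0 \<le> a ! 1"
| "ordered EC a \<longleftrightarrow> a ! 0 \<le> a ! 1"
| "ordered PDD a \<longleftrightarrow> a ! 0 \<le> a ! 2"
| "ordered PDC a \<longleftrightarrow> (a ! 1 = 0 \<longrightarrow> a ! 0 \<le> a ! 2)"
| "ordered PCC a \<longleftrightarrow> a ! 0 \<le> a ! 2"
| "ordered H3 a \<longleftrightarrow> a ! 0 \<le> a ! 1 \<and> a ! 1 \<le> a ! 2"
| "ordered PDDD a \<longleftrightarrow> a ! 0 < a ! 3 \<or> a ! 0 = a ! 3 \<and> a ! 1 \<le> a ! 2"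
| "ordered PDDC a \<longleftrightarrow> True"
| "ordered PDCD a \<longleftrightarrow> (1 \<le> a ! 1 \<longrightarrow> a ! 0 < a ! 3 \<or> a ! 0 = a ! 3 \<and> a ! 1 \<le> a ! 2)"
| "ordered PDCC a \<longleftrightarrow> (a ! 1 = 0 \<and> a ! 2 = 0 \<longrightarrow> a ! 0 \<le> a ! 3)"
| "ordered PCDC a \<longleftrightarrow> a ! 0 < a ! 3 \<or> a ! 0 = a ! 3 \<and> a ! 1 \<le> a ! 2"
| "ordered PCCC a \<longleftrightarrow> a ! 0 < a ! 3 \<or> a ! 0 = a ! 3 \<and> a ! 1 \<le> a ! 2"
| "ordered SDDD a \<longleftrightarrow> a ! 1 \<le> a ! 2 \<and> a ! 2 \<le> a ! 3"
| "ordered SDDC a \<longleftrightarrow> a ! 1 \<le> a ! 2"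
| "ordered SDCC a \<longleftrightarrow> a ! 2 \<le> a ! 3"
| "ordered SCCC a \<longleftrightarrow> a ! 1 \<le> a ! 2 \<and> a ! 2 \<le> a ! 3"
| "ordered HD a \<longleftrightarrow> a ! 0 \<le> a ! 1"
| "ordered HC a \<longleftrightarrow> a ! 0 \<le> a ! 1"
| "ordered H4 a \<longleftrightarrow> a ! 0 \<le> a ! 1 \<and> a ! 1 \<le> a ! 2 \<and> a ! 2 \<le> a ! 3"

section \<open>Inversion by symmetric functions\<close>

text \<open>By Vieta \<open>a\<close> is a root of the quadratic with roots \<open>a'\<close> and
  \<open>b'\<close>.\<close>

lemma symmetric_2:
  fixes a b :: real
  assumes "a + b = a' + b'" and "a * b = a' * b'"
  shows "a = a' \<and> b = b' \<or> a = b' \<and> b = a'"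
proof -
  have "(a - a') * (a - b') = 0" using assms by Groebner_Basis.algebra
  then show ?thesis using assms(1) by auto
qed

lemma sorted_2:
  fixes a b :: real
  assumes "a + b = a' + b'" "a * b = a' * b'" "a \<le> b" "a' \<le> b'"
  shows "a = a'" "b = b'"
  using symmetric_2[OF assms(1,2)] assms(3,4) by auto

text \<open>By Vieta the smallest number of either side occurs on the other side, so the two
  smallest numbers agree; \<open>sorted_2\<close> treats the rest.\<close>

lemma sorted_3:
  fixes a b c :: real
  assumes e: "a + b + c = a' + b' + c'" "a * b + a * c + b * c = a' * b' + a' * c' + b' * c'" "a * b * c = a' * b' * c'"
    and "a \<le> b" "b \<le> c" "a' \<le> b'" "b' \<le> c'"
  shows "a = a'" "b = b'" "c = c'"
proof -
  have "(a - a') * (a - b') * (a - c') = 0" "(a' - a) * (a' - b) * (a' - c) = 0"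
    using e by Groebner_Basis.algebra+
  then show a: "a = a'" using assms(4-) by auto
  have "b + c = b' + c'" using e a by simp
  moreover have "b * c = b' * c'" using e a \<open>b + c = b' + c'\<close> by Groebner_Basis.algebra
  ultimately show "b = b'" "c = c'" using sorted_2 assms(5,7) by blast+
qed

lemma sorted_4:
  fixes a b c d :: real
  assumes e: "a + b + c + d = a' + b' + c' + d'"
    "a * b + a * c + a * d + b * c + b * d + c * d = a' * b' + a' * c' + a' * d' + b' * c' + b' * d' + c' * d'"
    "a * b * c + a * b * d + a * c * d + b * c * d = a' * b' * c' + a' * b' * d' + a' * c' * d' + b' * c' * d'"
    "a * b * c * d = a' * b' * c' * d'"
    and "a \<le> b" "b \<le> c" "c \<le> d" "a' \<le> b'" "b' \<le> c'" "c' \<le> d'"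
  shows "a = a'" "b = b'" "c = c'" "d = d'"
proof -
  \<comment> \<open>In expanded form only the symmetric functions occur, so \<open>e\<close>
    identifies the two quartics, and each vanishes at its own smallest root.\<close>
  have root: "(x - y) * (x - z) * (x - v) * (x - w) = x ^ 4 - (y + z + v + w) * x ^ 3
    + (y * z + y * v + y * w + z * v + z * w + v * w) * x ^ 2
    - (y * z * v + y * z * w + y * v * w + z * v * w) * x + y * z * v * w" for x y z v w :: real
    by Groebner_Basis.algebra
  have "(a - a') * (a - b') * (a - c') * (a - d') = (a - a) * (a - b) * (a - c) * (a - d)"
    "(a' - a) * (a' - b) * (a' - c) * (a' - d) = (a' - a') * (a' - b') * (a' - c') * (a' - d')"
    unfolding root e by (rule refl)+
  then show a: "a = a'" using assms(5-) by auto
  have 1: "b + c + d = b' + c' + d'" using e a by simp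
  then have 2: "b * c + b * d + c * d = b' * c' + b' * d' + c' * d'" using e(2) a by Groebner_Basis.algebra
  then have 3: "b * c * d = b' * c' * d'" using e(3) a 1 by Groebner_Basis.algebra
  show "b = b'" "c = c'" "d = d'" using sorted_3[OF 1 2 3] assms(6,7,9,10) by blast+
qed

text \<open>The outer pair and the inner pair are known up to order, and
  \<open>a * b + c * d\<close> tells which inner number belongs to which outer one: interchanging
  \<open>b\<close> and \<open>c\<close> alters it by \<open>(a - d) * (b - c)\<close> up to
  sign.\<close>

lemma lexicographic_pairs:
  fixes a b c d :: real
  assumes "a + d = a' + d'" "a * d = a' * d'" "b + c = b' + c'" "b * c = b' * c'"
    and w: "a * b + c * d = a' * b' + c' * d'"
    and o: "a < d \<or> a = d \<and> b \<le> c" "a' < d' \<or> a' = d' \<and> b' \<le> c'"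
  shows "a = a'" "b = b'" "c = c'" "d = d'"
proof -
  show ad: "a = a'" "d = d'" using sorted_2[OF assms(1,2)] o by auto
  have "b = b' \<and> c = c'"
    using symmetric_2[OF assms(3,4)]
  proof
    assume swap: "b = c' \<and> c = b'"
    have "(a - d) * (b - c) = 0" using w ad conjunct1[OF swap] conjunct2[OF swap] by Groebner_Basis.algebra
    then show ?thesis using swap o ad by auto
  qed
  then show "b = b'" "c = c'" by auto
qed

lemma inversion_ED:
  fixes a b :: real
  assumes eq: "invs ED [a, b] = invs ED [a', b']"
    and ord: "a \<le> b" "a' \<le> b'"
  shows "a = a' \<and> b = b'"
proof -
  note B = basis_ED[OF eq]
  show ?thesis using sorted_2[OF B(2,1) ord] by simp
qed

lemma inversion_EC:
  fixes a b :: real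
  assumes eq: "invs EC [a, b] = invs EC [a', b']"
    and ord: "a \<le> b" "a' \<le> b'"
  shows "a = a' \<and> b = b'"
proof -
  note B = basis_EC[OF eq]
  show ?thesis using sorted_2[OF B(2,1) ord] by simp
qed

text \<open>\<open>a * c\<close> is known and positive, so \<open>a * b * c\<close> yields
  \<open>b\<close>.\<close>

lemma inversion_PDD:
  fixes a b c :: real
  assumes eq: "invs PDD [a, b, c] = invs PDD [a', b', c']"
    and pos: "1 \<le> a" "1 \<le> b" "1 \<le> c" "1 \<le> a'" "1 \<le> b'" "1 \<le> c'"
    and ord: "a \<le> c" "a' \<le> c'"
  shows "a = a' \<and> b = b' \<and> c = c'"
proof -
  note B = basis_PDD[OF eq]
  have "(a * c) * (b - b') = 0" using B by Groebner_Basis.algebra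
  then have b: "b = b'" using pos by auto
  have "a + c = a' + c'" using B(4) b by simp
  then show ?thesis using sorted_2[OF _ B(3) ord] b by simp
qed

text \<open>If \<open>b\<close> is positive, \<open>a * b\<close> and \<open>a * b * c\<close> yield
  \<open>c\<close>. If \<open>b = 0\<close>, only the unordered pair of the ends can be known, and
  the ordering decides.\<close>

lemma inversion_PDC:
  fixes a b c :: real
  assumes eq: "invs PDC [a, b, c] = invs PDC [a', b', c']"
    and pos: "1 \<le> a" "0 \<le> b" "1 \<le> c" "1 \<le> a'" "0 \<le> b'" "1 \<le> c'"
    and ord: "b = 0 \<longrightarrow> a \<le> c" "b' = 0 \<longrightarrow> a' \<le> c'"
  shows "a = a' \<and> b = b' \<and> c = c'"
proof -
  note B = basis_PDC[OF eq]
  show ?thesis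
  proof (cases "b = 0")
    case True
    then have b': "b' = 0" using B(2) pos by auto
    have "a + c = a' + c'" using B(5) True b' by simp
    then show ?thesis using sorted_2[OF _ B(3)] ord True b' by simp
  next
    case False
    have "(a * b) * (c - c') = 0" using B by Groebner_Basis.algebra
    then have c: "c = c'" using pos False by auto
    have "c * (a - a') = 0" using B(3) c by Groebner_Basis.algebra
    then have "a = a'" using pos by auto
    then show ?thesis using B(5) c by simp
  qed
qed

lemma inversion_PCC:
  fixes a b c :: real
  assumes eq: "invs PCC [a, b, c] = invs PCC [a', b', c']"
    and ord: "a \<le> c" "a' \<le> c'"
  shows "a = a' \<and> b = b' \<and> c = c'"
proof -
  note B = basis_PCC[OF eq]
  show ?thesis using sorted_2[OF B(4,3) ord] B(5) by simp
qed

lemma inversion_H3: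
  fixes a b c :: real
  assumes eq: "invs H3 [a, b, c] = invs H3 [a', b', c']"
    and ord: "a \<le> b" "b \<le> c" "a' \<le> b'" "b' \<le> c'"
  shows "a = a' \<and> b = b' \<and> c = c'"
proof -
  note B = basis_H3[OF eq]
  show ?thesis using sorted_3[OF B(3,2,1) ord] by simp
qed

text \<open>\<open>a * d\<close> is known and positive; dividing by it gives the sum and the product
  of \<open>b\<close> and \<open>c\<close>.\<close>

lemma inversion_PDDD:
  fixes a b c d :: real
  assumes eq: "invs PDDD [a, b, c, d] = invs PDDD [a', b', c', d']"
    and pos: "1 \<le> a" "1 \<le> b" "1 \<le> c" "1 \<le> d" "1 \<le> a'" "1 \<le> b'" "1 \<le> c'" "1 \<le> d'"
    and ord: "a < d \<or> a = d \<and> b \<le> c" "a' < d' \<or> a' = d' \<and> b' \<le> c'"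
  shows "a = a' \<and> b = b' \<and> c = c' \<and> d = d'"
proof -
  note B = basis_PDDD[OF eq]
  have "(a * d) * ((b + c) - (b' + c')) = 0" "(a * d) * (b * c - b' * c') = 0" using B by Groebner_Basis.algebra+
  then have bc: "b + c = b' + c'" "b * c = b' * c'" using pos by auto
  have ad: "a + d = a' + d'" using B(7) bc(1) by simp
  have w: "a * b + c * d = a' * b' + c' * d'" using B(4) bc(2) by simp
  show ?thesis using lexicographic_pairs[OF ad B(6) bc w ord] by simp
qed

lemma inversion_PDDC:
  fixes a b c d :: real
  assumes eq: "invs PDDC [a, b, c, d] = invs PDDC [a', b', c', d']"
    and pos: "1 \<le> a" "1 \<le> b" "1 \<le> c" "1 \<le> d" "1 \<le> a'" "1 \<le> b'" "1 \<le> c'" "1 \<le> d'"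
  shows "a = a' \<and> b = b' \<and> c = c' \<and> d = d'"
proof -
  note B = basis_PDDC[OF eq]
  have "(a * b * c) * (d - d') = 0" using B by Groebner_Basis.algebra
  then have d: "d = d'" using pos by auto
  have "(a * b * d) * (c - c') = 0" using B by Groebner_Basis.algebra
  then have c: "c = c'" using pos by auto
  have "d * (a - a') = 0" using B(8) d by Groebner_Basis.algebra
  then have "a = a'" using pos by auto
  then show ?thesis using B(10) c d by simp
qed

text \<open>If \<open>b = 0\<close>, the orientation is already fixed by \<open>1 \<le> c\<close>,
  so \<open>ord\<close> concerns only the case of a leaf at the second vertex.\<close>

lemma inversion_PDCD:
  fixes a b c d :: real
  assumes eq: "invs PDCD [a, b, c, d] = invs PDCD [a', b', c', d']"
    and pos: "1 \<le> a" "0 \<le> b" "1 \<le> c" "1 \<le> d" "1 \<le> a'" "0 \<le> b'" "1 \<le> c'" "1 \<le> d'"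
    and ord: "b \<noteq> 0 \<longrightarrow> a < d \<or> a = d \<and> b \<le> c" "b' \<noteq> 0 \<longrightarrow> a' < d' \<or> a' = d' \<and> b' \<le> c'"
  shows "a = a' \<and> b = b' \<and> c = c' \<and> d = d'"
proof -
  note B = basis_PDCD[OF eq]
  have "(a * d) * ((b + c) - (b' + c')) = 0" using B by Groebner_Basis.algebra
  then have bc: "b + c = b' + c'" using pos by auto
  have ad: "a + d = a' + d'" using B(8) bc by simp
  show ?thesis
  proof (cases "b = 0")
    case True
    then have b': "b' = 0" using B(7) pos by auto
    then have c: "c = c'" using bc True by simp
    have "c * (d - d') = 0" using B(4) c b' True by Groebner_Basis.algebra
    then have "d = d'" using pos by auto
    then show ?thesis using ad b' c True by simp
  next
    case False
    then have "b' \<noteq> 0" using B(7) pos by auto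
    then show ?thesis using lexicographic_pairs[OF ad B(6) bc B(7,4)] ord False by simp
  qed
qed

text \<open>If \<open>c\<close> is positive, \<open>a\<close> is determined, \<open>d\<close> grows
  weakly with \<open>b\<close>, and \<open>d * (b - 1)\<close> is known; two different values of
  \<open>b\<close> are then impossible. If \<open>c = 0\<close>, the products of \<open>a\<close>,
  \<open>b\<close> and \<open>d\<close> decide.\<close>

lemma inversion_PDCC:
  fixes a b c d :: real
  assumes eq: "invs PDCC [a, b, c, d] = invs PDCC [a', b', c', d']"
    and pos: "1 \<le> a" "0 \<le> b" "0 \<le> c" "1 \<le> d" "1 \<le> a'" "0 \<le> b'" "0 \<le> c'" "1 \<le> d'"
    and ord: "b = 0 \<and> c = 0 \<longrightarrow> a \<le> d" "b \<noteq> 0 \<longrightarrow> 1 \<le> b" "b' = 0 \<and> c' = 0 \<longrightarrow> a' \<le> d'" "b' \<noteq> 0 \<longrightarrow> 1 \<le> b'"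
  shows "a = a' \<and> b = b' \<and> c = c' \<and> d = d'"
proof -
  note B = basis_PDCC[OF eq]
  \<comment> \<open>\<open>B(5)\<close> factors as \<open>Z\<close>. Adding \<open>B(1)\<close> and
    \<open>B(4)\<close> gives \<open>a\<close> times the same product, hence \<open>Y\<close>;
    subtracting \<open>B(8)\<close> from \<open>B(3)\<close> gives \<open>U\<close>.\<close>
  have Z: "(c * d) * (b + 1) = (c' * d') * (b' + 1)" using B(5) by Groebner_Basis.algebra
  have Y: "(c * d) * (b + 1) * (a - a') = 0" using B(1,4,5) by Groebner_Basis.algebra
  have U: "(a * d) * (b - 1) = (a' * d') * (b' - 1)" using B(3,8) by Groebner_Basis.algebra
  have K: "a * b + c = a' * b' + c'" and S: "a + b + c + d = a' + b' + c' + d'"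
    using B(6,10) .
  have zero: "c = 0 \<longleftrightarrow> c' = 0"
  proof
    assume "c = 0"
    then have "(c' * d') * (b' + 1) = 0" using Z by simp
    then show "c' = 0" using pos by auto
  next
    assume "c' = 0"
    then have "(c * d) * (b + 1) = 0" using Z by simp
    then show "c = 0" using pos by auto
  qed
  show ?thesis
  proof (cases "c = 0")
    case False
    then have a: "a = a'" using Y pos by auto
    have "a * (d * (b - 1) - d' * (b' - 1)) = 0" using U a by Groebner_Basis.algebra
    then have u: "d * (b - 1) = d' * (b' - 1)" using pos by auto
    have dd: "d' - d = (a - 1) * (b' - b)" using K S a by Groebner_Basis.algebra
    \<comment> \<open>The larger of two values of \<open>b\<close> is positive, hence at least one
      by integrality, so multiplication by \<open>b2 - 1\<close> is monotone.\<close>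
    have less: False
      if b: "b1 < b2" "1 \<le> b2" and d: "d2 - d1 = (a - 1) * (b2 - b1)" "1 \<le> d1"
        and eq: "d1 * (b1 - 1) = d2 * (b2 - 1)" for b1 b2 d1 d2 :: real
    proof -
      have "0 \<le> (a - 1) * (b2 - b1)" using pos b by simp
      then have "d1 * (b2 - 1) \<le> d2 * (b2 - 1)" using b d(1) by (intro mult_right_mono) auto
      moreover have "d1 * (b1 - 1) < d1 * (b2 - 1)" using b d(2) by (intro mult_strict_left_mono) auto
      ultimately show False using eq by simp
    qed
    have "\<not> b < b'"
    proof
      assume b: "b < b'"
      then have "1 \<le> b'" using pos(2) ord by auto
      then show False using less[OF b _ dd pos(4) u] by simp
    qed
    moreover have "\<not> b' < b"
    proof
      assume b: "b' < b"
      then have "1 \<le> b" using pos(6) ord by auto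
      moreover have "d - d' = (a - 1) * (b - b')" using dd by Groebner_Basis.algebra
      ultimately show False using less[OF b _ _ pos(8) u[symmetric]] by simp
    qed
    ultimately have b: "b = b'" by simp
    then show ?thesis using K S a by simp
  next
    case True
    then have c': "c' = 0" using zero by simp
    have ab: "a * b = a' * b'" using B(6) True c' by simp
    have ad: "a * d = a' * d'" and "a * b * d = a' * b' * d'"
      using B(2,3,8) unfolding True c' by Groebner_Basis.algebra+
    then have abd: "(a * b) * (d - d') = 0" using ab by Groebner_Basis.algebra
    show ?thesis
    proof (cases "b = 0")
      case b: True
      then have b': "b' = 0" using ab pos by auto
      have "a + d = a' + d'" using S b b' True c' by simp
      then show ?thesis
        using sorted_2[OF _ ad] b b' True c' ord by simp
    next
      case b: False
      then have d: "d = d'" using abd pos by auto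
      have "d * (a - a') = 0" using ad d by Groebner_Basis.algebra
      then have "a = a'" using pos by auto
      then show ?thesis using d S True c' by simp
    qed
  qed
qed

text \<open>With \<open>s = b + c\<close> and \<open>q = a * d\<close> the basis determines
  \<open>q - s\<close> and \<open>(q + 2) * s\<close>. Subtracting the two solutions leaves the
  difference of the sums times a positive factor.\<close>

lemma inversion_PCDC:
  fixes a b c d :: real
  assumes eq: "invs PCDC [a, b, c, d] = invs PCDC [a', b', c', d']"
    and pos: "1 \<le> a" "1 \<le> b" "1 \<le> c" "1 \<le> d" "1 \<le> a'" "1 \<le> b'" "1 \<le> c'" "1 \<le> d'"
    and ord: "a < d \<or> a = d \<and> b \<le> c" "a' < d' \<or> a' = d' \<and> b' \<le> c'"
  shows "a = a' \<and> b = b' \<and> c = c' \<and> d = d'"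
proof -
  note B = basis_PCDC[OF eq]
  have "((b + c) - (b' + c')) * (a * d + b' + c' + 2) = 0" using B by Groebner_Basis.algebra
  moreover have "0 < a * d + b' + c' + 2" using pos by (simp add: add_nonneg_pos)
  ultimately have bc: "b + c = b' + c'" by auto
  then have q: "a * d = a' * d'" "b * c = b' * c'" "a + d = a' + d'" using B(6,7,8) by simp_all
  show ?thesis using lexicographic_pairs[OF q(3,1) bc q(2) B(4) ord] by simp
qed

lemma inversion_PCCC:
  fixes a b c d :: real
  assumes eq: "invs PCCC [a, b, c, d] = invs PCCC [a', b', c', d']"
    and ord: "a < d \<or> a = d \<and> b \<le> c" "a' < d' \<or> a' = d' \<and> b' \<le> c'"
  shows "a = a' \<and> b = b' \<and> c = c' \<and> d = d'"
proof -
  note B = basis_PCCC[OF eq]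
  show ?thesis using lexicographic_pairs[OF B(8,6,9,7,4) ord] by simp
qed

lemma inversion_SDDD:
  fixes a b c d :: real
  assumes eq: "invs SDDD [a, b, c, d] = invs SDDD [a', b', c', d']"
    and pos: "1 \<le> b" "1 \<le> c" "1 \<le> d" "1 \<le> b'" "1 \<le> c'" "1 \<le> d'"
    and ord: "b \<le> c" "c \<le> d" "b' \<le> c'" "c' \<le> d'"
  shows "a = a' \<and> b = b' \<and> c = c' \<and> d = d'"
proof -
  note B = basis_SDDD[OF eq]
  have "(b * c * d) * (a - a') = 0" using B by Groebner_Basis.algebra
  then have a: "a = a'" using pos by auto
  have "b + c + d = b' + c' + d'" using B(6) a by simp
  then show ?thesis using sorted_3[OF _ B(5,3)] ord a by simp
qed

lemma inversion_SDDC: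
  fixes a b c d :: real
  assumes eq: "invs SDDC [a, b, c, d] = invs SDDC [a', b', c', d']"
    and pos: "1 \<le> b" "1 \<le> c" "1 \<le> d" "1 \<le> b'" "1 \<le> c'" "1 \<le> d'"
    and ord: "b \<le> c" "b' \<le> c'"
  shows "a = a' \<and> b = b' \<and> c = c' \<and> d = d'"
proof -
  note B = basis_SDDC[OF eq]
  have "(b * c * d) * (a - a') = 0" using B by Groebner_Basis.algebra
  then have a: "a = a'" using pos by auto
  have "(b * c) * (d - d') = 0" using B by Groebner_Basis.algebra
  then have d: "d = d'" using pos by auto
  have "b + c = b' + c'" using B(9) a d by simp
  then show ?thesis using sorted_2[OF _ B(7) ord] a d by simp
qed

text \<open>\<open>c + d\<close> and \<open>b * (c + d + 2)\<close> are known, which yields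
  \<open>b\<close>.\<close>

lemma inversion_SDCC:
  fixes a b c d :: real
  assumes eq: "invs SDCC [a, b, c, d] = invs SDCC [a', b', c', d']"
    and pos: "1 \<le> b" "1 \<le> c" "1 \<le> d" "1 \<le> b'" "1 \<le> c'" "1 \<le> d'"
    and ord: "c \<le> d" "c' \<le> d'"
  shows "a = a' \<and> b = b' \<and> c = c' \<and> d = d'"
proof -
  note B = basis_SDCC[OF eq]
  have "(c + d + 2) * (b - b') = 0" using B by Groebner_Basis.algebra
  then have b: "b = b'" using pos unfolding mult_eq_0_iff by linarith
  then have "c * d = c' * d'" using B(8) by simp
  then show ?thesis using sorted_2[OF B(10) _ ord] b B(9) by simp
qed

lemma inversion_SCCC:
  fixes a b c d :: real
  assumes eq: "invs SCCC [a, b, c, d] = invs SCCC [a', b', c', d']"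
    and ord: "b \<le> c" "c \<le> d" "b' \<le> c'" "c' \<le> d'"
  shows "a = a' \<and> b = b' \<and> c = c' \<and> d = d'"
proof -
  note B = basis_SCCC[OF eq]
  show ?thesis using sorted_3[OF B(7,5,3) ord(1,2,3,4)] B(6) by simp
qed

lemma inversion_HD:
  fixes a b c d :: real
  assumes eq: "invs HD [a, b, c, d] = invs HD [a', b', c', d']"
    and pos: "1 \<le> a" "1 \<le> b" "1 \<le> c" "1 \<le> d" "1 \<le> a'" "1 \<le> b'" "1 \<le> c'" "1 \<le> d'"
    and ord: "a \<le> b" "a' \<le> b'"
  shows "a = a' \<and> b = b' \<and> c = c' \<and> d = d'"
proof -
  note B = basis_HD[OF eq]
  have "(a * b * d) * (c - c') = 0" using B by Groebner_Basis.algebra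
  then have c: "c = c'" using pos by auto
  \<comment> \<open>\<open>B(2)\<close> and \<open>B(5)\<close> add up to
    \<open>a * b * (c + 1)\<close>.\<close>
  have "(c + 1) * (a * b - a' * b') = 0" using B(2,5) c by Groebner_Basis.algebra
  then have ab: "a * b = a' * b'" using pos by auto
  have "(a * b) * (d - d') = 0" using B(3) ab by Groebner_Basis.algebra
  then have d: "d = d'" using pos by auto
  have "a + b = a' + b'" using B(8) c d by simp
  then show ?thesis using sorted_2[OF _ ab ord] c d by simp
qed

lemma inversion_HC:
  fixes a b c d :: real
  assumes eq: "invs HC [a, b, c, d] = invs HC [a', b', c', d']"
    and pos: "1 \<le> a" "1 \<le> b" "1 \<le> d" "1 \<le> a'" "1 \<le> b'" "1 \<le> d'"
    and ord: "a \<le> b" "a' \<le> b'"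
  shows "a = a' \<and> b = b' \<and> c = c' \<and> d = d'"
proof -
  note B = basis_HC[OF eq]
  have "(a * b) * (d - d') = 0" using B by Groebner_Basis.algebra
  then have d: "d = d'" using pos by auto
  then have "c = c'" "a + b = a' + b'" using B(9,10) by simp_all
  then show ?thesis using sorted_2[OF _ B(5) ord] d by simp
qed

lemma inversion_H4:
  fixes a b c d :: real
  assumes eq: "invs H4 [a, b, c, d] = invs H4 [a', b', c', d']"
    and ord: "a \<le> b" "b \<le> c" "c \<le> d" "a' \<le> b'" "b' \<le> c'" "c' \<le> d'"
  shows "a = a' \<and> b = b' \<and> c = c' \<and> d = d'"
proof -
  note B = basis_H4[OF eq]
  show ?thesis using sorted_4[OF B(4,3,2,1) ord] by simp
qed

lemma invs_inj:
  assumes "invs s (map real xs) = invs s (map real ys)"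
    and "length xs = skeleton_size s" "admissible s xs" "ordered s xs"
    and "length ys = skeleton_size s" "admissible s ys" "ordered s ys"
  shows "xs = ys"
proof (cases s)
  case S1
  then obtain a a' where "xs = [a]" "ys = [a']"
    using assms(2,5) by (auto simp: length_Suc_conv numeral_eq_Suc)
  then show ?thesis
    using assms S1 basis_S1[of "real a" "real a'"] by (auto simp: Suc_le_eq simp del: invs.simps)
next
  case ED
  then obtain a b a' b' where "xs = [a, b]" "ys = [a', b']"
    using assms(2,5) by (auto simp: length_Suc_conv numeral_eq_Suc)
  then show ?thesis
    using assms ED inversion_ED[of "real a" "real b" "real a'" "real b'"] by (auto simp: Suc_le_eq simp del: invs.simps)
next
  case EC
  then obtain a b a' b' where "xs = [a, b]" "ys = [a', b']"
    using assms(2,5) by (auto simp: length_Suc_conv numeral_eq_Suc)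
  then show ?thesis
    using assms EC inversion_EC[of "real a" "real b" "real a'" "real b'"] by (auto simp: Suc_le_eq simp del: invs.simps)
next
  case PDD
  then obtain a b c a' b' c' where "xs = [a, b, c]" "ys = [a', b', c']"
    using assms(2,5) by (auto simp: length_Suc_conv numeral_eq_Suc)
  then show ?thesis
    using assms PDD inversion_PDD[of "real a" "real b" "real c" "real a'" "real b'" "real c'"] by (auto simp: Suc_le_eq simp del: invs.simps)
next
  case PDC
  then obtain a b c a' b' c' where "xs = [a, b, c]" "ys = [a', b', c']"
    using assms(2,5) by (auto simp: length_Suc_conv numeral_eq_Suc)
  then show ?thesis
    using assms PDC inversion_PDC[of "real a" "real b" "real c" "real a'" "real b'" "real c'"] by (auto simp: Suc_le_eq simp del: invs.simps)
next
  case PCC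
  then obtain a b c a' b' c' where "xs = [a, b, c]" "ys = [a', b', c']"
    using assms(2,5) by (auto simp: length_Suc_conv numeral_eq_Suc)
  then show ?thesis
    using assms PCC inversion_PCC[of "real a" "real b" "real c" "real a'" "real b'" "real c'"] by (auto simp: Suc_le_eq simp del: invs.simps)
next
  case H3
  then obtain a b c a' b' c' where "xs = [a, b, c]" "ys = [a', b', c']"
    using assms(2,5) by (auto simp: length_Suc_conv numeral_eq_Suc)
  then show ?thesis
    using assms H3 inversion_H3[of "real a" "real b" "real c" "real a'" "real b'" "real c'"] by (auto simp: Suc_le_eq simp del: invs.simps)
next
  case PDDD
  then obtain a b c d a' b' c' d' where "xs = [a, b, c, d]" "ys = [a', b', c', d']"
    using assms(2,5) by (auto simp: length_Suc_conv numeral_eq_Suc)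
  then show ?thesis
    using assms PDDD inversion_PDDD[of "real a" "real b" "real c" "real d" "real a'" "real b'" "real c'" "real d'"] by (auto simp: Suc_le_eq simp del: invs.simps)
next
  case PDDC
  then obtain a b c d a' b' c' d' where "xs = [a, b, c, d]" "ys = [a', b', c', d']"
    using assms(2,5) by (auto simp: length_Suc_conv numeral_eq_Suc)
  then show ?thesis
    using assms PDDC inversion_PDDC[of "real a" "real b" "real c" "real d" "real a'" "real b'" "real c'" "real d'"] by (auto simp: Suc_le_eq simp del: invs.simps)
next
  case PDCD
  then obtain a b c d a' b' c' d' where "xs = [a, b, c, d]" "ys = [a', b', c', d']"
    using assms(2,5) by (auto simp: length_Suc_conv numeral_eq_Suc)
  then show ?thesis
    using assms PDCD inversion_PDCD[of "real a" "real b" "real c" "real d" "real a'" "real b'" "real c'" "real d'"] by (auto simp: Suc_le_eq simp del: invs.simps)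
next
  case PDCC
  then obtain a b c d a' b' c' d' where "xs = [a, b, c, d]" "ys = [a', b', c', d']"
    using assms(2,5) by (auto simp: length_Suc_conv numeral_eq_Suc)
  then show ?thesis
    using assms PDCC inversion_PDCC[of "real a" "real b" "real c" "real d" "real a'" "real b'" "real c'" "real d'"] by (auto simp: Suc_le_eq simp del: invs.simps)
next
  case PCDC
  then obtain a b c d a' b' c' d' where "xs = [a, b, c, d]" "ys = [a', b', c', d']"
    using assms(2,5) by (auto simp: length_Suc_conv numeral_eq_Suc)
  then show ?thesis
    using assms PCDC inversion_PCDC[of "real a" "real b" "real c" "real d" "real a'" "real b'" "real c'" "real d'"] by (auto simp: Suc_le_eq simp del: invs.simps)
next
  case PCCC
  then obtain a b c d a' b' c' d' where "xs = [a, b, c, d]" "ys = [a', b', c', d']"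
    using assms(2,5) by (auto simp: length_Suc_conv numeral_eq_Suc)
  then show ?thesis
    using assms PCCC inversion_PCCC[of "real a" "real b" "real c" "real d" "real a'" "real b'" "real c'" "real d'"] by (auto simp: Suc_le_eq simp del: invs.simps)
next
  case SDDD
  then obtain a b c d a' b' c' d' where "xs = [a, b, c, d]" "ys = [a', b', c', d']"
    using assms(2,5) by (auto simp: length_Suc_conv numeral_eq_Suc)
  then show ?thesis
    using assms SDDD inversion_SDDD[of "real a" "real b" "real c" "real d" "real a'" "real b'" "real c'" "real d'"] by (auto simp: Suc_le_eq simp del: invs.simps)
next
  case SDDC
  then obtain a b c d a' b' c' d' where "xs = [a, b, c, d]" "ys = [a', b', c', d']"
    using assms(2,5) by (auto simp: length_Suc_conv numeral_eq_Suc)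
  then show ?thesis
    using assms SDDC inversion_SDDC[of "real a" "real b" "real c" "real d" "real a'" "real b'" "real c'" "real d'"] by (auto simp: Suc_le_eq simp del: invs.simps)
next
  case SDCC
  then obtain a b c d a' b' c' d' where "xs = [a, b, c, d]" "ys = [a', b', c', d']"
    using assms(2,5) by (auto simp: length_Suc_conv numeral_eq_Suc)
  then show ?thesis
    using assms SDCC inversion_SDCC[of "real a" "real b" "real c" "real d" "real a'" "real b'" "real c'" "real d'"] by (auto simp: Suc_le_eq simp del: invs.simps)
next
  case SCCC
  then obtain a b c d a' b' c' d' where "xs = [a, b, c, d]" "ys = [a', b', c', d']"
    using assms(2,5) by (auto simp: length_Suc_conv numeral_eq_Suc)
  then show ?thesis
    using assms SCCC inversion_SCCC[of "real a" "real b" "real c" "real d" "real a'" "real b'" "real c'" "real d'"] by (auto simp: Suc_le_eq simp del: invs.simps)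
next
  case HD
  then obtain a b c d a' b' c' d' where "xs = [a, b, c, d]" "ys = [a', b', c', d']"
    using assms(2,5) by (auto simp: length_Suc_conv numeral_eq_Suc)
  then show ?thesis
    using assms HD inversion_HD[of "real a" "real b" "real c" "real d" "real a'" "real b'" "real c'" "real d'"] by (auto simp: Suc_le_eq simp del: invs.simps)
next
  case HC
  then obtain a b c d a' b' c' d' where "xs = [a, b, c, d]" "ys = [a', b', c', d']"
    using assms(2,5) by (auto simp: length_Suc_conv numeral_eq_Suc)
  then show ?thesis
    using assms HC inversion_HC[of "real a" "real b" "real c" "real d" "real a'" "real b'" "real c'" "real d'"] by (auto simp: Suc_le_eq simp del: invs.simps)
next
  case H4
  then obtain a b c d a' b' c' d' where "xs = [a, b, c, d]" "ys = [a', b', c', d']"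
    using assms(2,5) by (auto simp: length_Suc_conv numeral_eq_Suc)
  then show ?thesis
    using assms H4 inversion_H4[of "real a" "real b" "real c" "real d" "real a'" "real b'" "real c'" "real d'"] by (auto simp: Suc_le_eq simp del: invs.simps)
qed

section \<open>Ordered covers\<close>

text \<open>The list is changed by a symmetry of its skeleton: a reversal, a transposition, or
  sorting interchangeable vertices. The leafless cases of \<open>PDC\<close> and \<open>PDCC\<close>
  are excluded, because their symmetry moves the cover.\<close>

lemma shape_ordered:
  fixes p :: "'a \<Rightarrow> nat"
  assumes "shape s cs S D H" and "admissible s (map p cs)"
    and "s = PDC \<longrightarrow> p (cs ! 1) \<noteq> 0" and "s = PDCC \<longrightarrow> p (cs ! 1) \<noteq> 0 \<or> p (cs ! 2) \<noteq> 0"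
  shows "\<exists>ds. shape s ds S D H \<and> admissible s (map p ds) \<and> ordered s (map p ds)"
proof (cases "ordered s (map p cs)")
  case True
  then show ?thesis using assms(1,2) by blast
next
  case False
  show ?thesis
  proof (cases s)
    case S1
    then show ?thesis using False by simp
  next
    case ED
    then obtain x y where cs: "cs = [x, y]" using assms(1) by auto
    show ?thesis
      using assms(1,2) False by (intro exI[of _ "[y, x]"]) (auto simp: ED cs insert_commute)
  next
    case EC
    then obtain x y where cs: "cs = [x, y]" using assms(1) by auto
    show ?thesis
      using assms(1,2) False by (intro exI[of _ "[y, x]"]) (auto simp: EC cs insert_commute)
  next
    case PDD
    then obtain x y z where cs: "cs = [x, y, z]" using assms(1) by auto
    show ?thesis
      using assms(1,2) False by (intro exI[of _ "[z, y, x]"]) (auto simp: PDD cs insert_commute)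
  next
    case PDC
    then obtain x y z where cs: "cs = [x, y, z]" using assms(1) by auto
    show ?thesis using False assms(3,4) by (auto simp: PDC cs)
  next
    case PCC
    then obtain x y z where cs: "cs = [x, y, z]" using assms(1) by auto
    show ?thesis
      using assms(1,2) False by (intro exI[of _ "[z, y, x]"]) (auto simp: PCC cs insert_commute)
  next
    case H3
    then obtain x y z where cs: "cs = [x, y, z]" using assms(1) by auto
    \<comment> \<open>The three vertices are interchangeable in \<open>H3\<close>, so its list may
      be sorted by leaf numbers.\<close>
    define l where "l = sort_key p cs"
    have "length l = length cs" by (simp add: l_def)
    then have "length l = skeleton_size s" using shapeD(3)[OF assms(1)] by simp
    then obtain x' y' z' where "l = [x', y', z']" by (auto simp: H3 length_Suc_conv numeral_eq_Suc)
    then have ds: "sort_key p cs = [x', y', z']" by (simp only: l_def)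
    have "set [x', y', z'] = set cs" "distinct [x', y', z']" "sorted (map p [x', y', z'])"
      using set_sort[of p cs] distinct_sort[of p cs] sorted_sort_key[of p cs] assms(1) unfolding ds by (auto simp: H3)
    moreover from this(1) have "\<forall>v\<in>set [x', y', z']. 1 \<le> p v" using assms(2) by (auto simp: H3 cs)
    ultimately show ?thesis
      using assms(1) by (intro exI[of _ "[x', y', z']"]) (auto simp: H3 cs)
  next
    case PDDD
    then obtain w x y z where cs: "cs = [w, x, y, z]" using assms(1) by auto
    show ?thesis
      using assms(1,2) False by (intro exI[of _ "[z, y, x, w]"]) (auto simp: PDDD cs insert_commute)
  next
    case PDDC
    then show ?thesis using False by simp
  next
    case PDCD
    then obtain w x y z where cs: "cs = [w, x, y, z]" using assms(1) by auto
    show ?thesis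
      using assms(1,2) False by (intro exI[of _ "[z, y, x, w]"]) (auto simp: PDCD cs insert_commute)
  next
    case PDCC
    then obtain w x y z where cs: "cs = [w, x, y, z]" using assms(1) by auto
    show ?thesis using False assms(3,4) by (auto simp: PDCC cs)
  next
    case PCDC
    then obtain w x y z where cs: "cs = [w, x, y, z]" using assms(1) by auto
    show ?thesis
      using assms(1,2) False by (intro exI[of _ "[z, y, x, w]"]) (auto simp: PCDC cs insert_commute)
  next
    case PCCC
    then obtain w x y z where cs: "cs = [w, x, y, z]" using assms(1) by auto
    show ?thesis
      using assms(1,2) False by (intro exI[of _ "[z, y, x, w]"]) (auto simp: PCCC cs insert_commute)
  next
    case SDDD
    then obtain w x y z where cs: "cs = [w, x, y, z]" using assms(1) by auto
    define l where "l = sort_key p [x, y, z]"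
    have "length l = 3" by (simp add: l_def)
    then obtain x' y' z' where "l = [x', y', z']" by (auto simp: length_Suc_conv numeral_eq_Suc)
    then have ds: "sort_key p [x, y, z] = [x', y', z']" by (simp only: l_def)
    have set: "set [x', y', z'] = {x, y, z}" and d: "distinct [x', y', z']" "sorted (map p [x', y', z'])"
      using set_sort[of p "[x, y, z]"] distinct_sort[of p "[x, y, z]"] sorted_sort_key[of p "[x, y, z]"] assms(1)
      unfolding ds by (auto simp: SDDD cs)
    have "\<forall>v\<in>set [x', y', z']. 1 \<le> p v" using assms(2) unfolding set by (auto simp: SDDD cs)
    moreover have "w \<notin> set [x', y', z']" using assms(1) unfolding set by (auto simp: SDDD cs)
    moreover have "S = insert w (set [x', y', z'])" "D = (\<lambda>v. {w, v}) ` set [x', y', z']"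
      using assms(1) unfolding set by (auto simp: SDDD cs)
    ultimately show ?thesis
      using assms(1,2) d by (intro exI[of _ "[w, x', y', z']"]) (auto simp: SDDD cs)
  next
    case SDDC
    then obtain w x y z where cs: "cs = [w, x, y, z]" using assms(1) by auto
    show ?thesis
      using assms(1,2) False by (intro exI[of _ "[w, y, x, z]"]) (auto simp: SDDC cs insert_commute)
  next
    case SDCC
    then obtain w x y z where cs: "cs = [w, x, y, z]" using assms(1) by auto
    show ?thesis
      using assms(1,2) False by (intro exI[of _ "[w, x, z, y]"]) (auto simp: SDCC cs insert_commute)
  next
    case SCCC
    then obtain w x y z where cs: "cs = [w, x, y, z]" using assms(1) by auto
    define l where "l = sort_key p [x, y, z]"
    have "length l = 3" by (simp add: l_def)
    then obtain x' y' z' where "l = [x', y', z']" by (auto simp: length_Suc_conv numeral_eq_Suc)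
    then have ds: "sort_key p [x, y, z] = [x', y', z']" by (simp only: l_def)
    have set: "set [x', y', z'] = {x, y, z}" and d: "distinct [x', y', z']" "sorted (map p [x', y', z'])"
      using set_sort[of p "[x, y, z]"] distinct_sort[of p "[x, y, z]"] sorted_sort_key[of p "[x, y, z]"] assms(1)
      unfolding ds by (auto simp: SCCC cs)
    have "\<forall>v\<in>set [x', y', z']. 1 \<le> p v" using assms(2) unfolding set by (auto simp: SCCC cs)
    moreover have "w \<notin> set [x', y', z']" using assms(1) unfolding set by (auto simp: SCCC cs)
    moreover have "S = insert w (set [x', y', z'])" "H = (\<lambda>v. {w, v}) ` set [x', y', z']"
      using assms(1) unfolding set by (auto simp: SCCC cs)
    ultimately show ?thesis
      using assms(1,2) d by (intro exI[of _ "[w, x', y', z']"]) (auto simp: SCCC cs)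
  next
    case HD
    then obtain w x y z where cs: "cs = [w, x, y, z]" using assms(1) by auto
    show ?thesis
      using assms(1,2) False by (intro exI[of _ "[x, w, y, z]"]) (auto simp: HD cs insert_commute)
  next
    case HC
    then obtain w x y z where cs: "cs = [w, x, y, z]" using assms(1) by auto
    show ?thesis
      using assms(1,2) False by (intro exI[of _ "[x, w, y, z]"]) (auto simp: HC cs insert_commute)
  next
    case H4
    then obtain w x y z where cs: "cs = [w, x, y, z]" using assms(1) by auto
    define l where "l = sort_key p cs"
    have "length l = length cs" by (simp add: l_def)
    then have "length l = skeleton_size s" using shapeD(3)[OF assms(1)] by simp
    then obtain w' x' y' z' where "l = [w', x', y', z']" by (auto simp: H4 length_Suc_conv numeral_eq_Suc)
    then have ds: "sort_key p cs = [w', x', y', z']" by (simp only: l_def)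
    have "set [w', x', y', z'] = set cs" "distinct [w', x', y', z']" "sorted (map p [w', x', y', z'])"
      using set_sort[of p cs] distinct_sort[of p cs] sorted_sort_key[of p cs] assms(1) unfolding ds by (auto simp: H4)
    moreover from this(1) have "\<forall>v\<in>set [w', x', y', z']. 1 \<le> p v" using assms(2) by (auto simp: H4 cs)
    ultimately show ?thesis
      using assms(1) by (intro exI[of _ "[w', x', y', z']"]) (auto simp: H4 cs)
  qed
qed

context fgraph
begin

text \<open>In the two leafless cases the order is reversed by passing to another cover, otherwise
  by permuting the list of the given one.\<close>

lemma ordered_cover_exists:
  assumes sc: "skeleton_cover s cs" and adm: "admissible s (pendant_list cs)"
  shows "\<exists>ds. skeleton_cover s ds \<and> admissible s (pendant_list ds) \<and> ordered s (pendant_list ds)"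
proof -
  have sh: "shape s cs (set cs) (direct_edges (set cs)) (links (set cs))"
    using sc by (simp add: skeleton_cover_def)
  consider (PDC) "s = PDC" "pendants (set cs) (cs ! 1) = 0"
    | (PDCC) "s = PDCC" "pendants (set cs) (cs ! 1) = 0" "pendants (set cs) (cs ! 2) = 0"
    | (permute) "s = PDC \<longrightarrow> pendants (set cs) (cs ! 1) \<noteq> 0"
        "s = PDCC \<longrightarrow> pendants (set cs) (cs ! 1) \<noteq> 0 \<or> pendants (set cs) (cs ! 2) \<noteq> 0"
    by argo
  then show ?thesis
  proof cases
    case PDC
    then obtain x y z where cs: "cs = [x, y, z]" using sh by auto
    show ?thesis
    proof (cases "ordered s (pendant_list cs)")
      case True
      then show ?thesis using sc adm by (intro exI[of _ cs]) simp
    next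
      case False
      obtain ds where "skeleton_cover PDC ds" "pendant_list ds =
          [pendants {x, y, z} z, 0, pendants {x, y, z} x]"
        using exchange_PDC[of x y z] sc PDC unfolding cs by auto
      then show ?thesis using adm False PDC by (intro exI[of _ ds]) (simp add: cs)
    qed
  next
    case PDCC
    then obtain w x y z where cs: "cs = [w, x, y, z]" using sh by auto
    show ?thesis
    proof (cases "ordered s (pendant_list cs)")
      case True
      then show ?thesis using sc adm by (intro exI[of _ cs]) simp
    next
      case False
      obtain ds where "skeleton_cover PDCC ds" "pendant_list ds =
          [pendants {w, x, y, z} z, 0, 0, pendants {w, x, y, z} w]"
        using exchange_PDCC_twice[of w x y z] sc PDCC unfolding cs by auto
      then show ?thesis using adm False PDCC by (intro exI[of _ ds]) (simp add: cs)
    qed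
  next
    case permute
    obtain ds where ds: "shape s ds (set cs) (direct_edges (set cs)) (links (set cs))"
        "admissible s (map (pendants (set cs)) ds)" "ordered s (map (pendants (set cs)) ds)"
      using shape_ordered[OF sh adm permute] by (elim exE conjE) (rule that)
    have eq: "set ds = set cs" using shapeD(1)[OF ds(1)] by simp
    have "skeleton_cover s ds"
      using sc ds(1) unfolding skeleton_cover_def eq by simp
    then show ?thesis using ds(2,3) unfolding eq[symmetric] by (intro exI[of _ ds]) simp
  qed
qed

end

section \<open>Equal spectra and walk numbers give equal invariants and isomorphic trees\<close>

text \<open>The spectrum gives the number of vertices and the characteristic polynomial, hence
  \<open>m2\<close>, \<open>m3\<close> and \<open>m4\<close>. These determine the walks of lengths
  one and two, and with the assumed lengths three to eight all defects agree.\<close>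

lemma invs_eq:
  assumes T: "pair_graph T" and sc: "fgraph.skeleton_cover (pverts T) (parcs T) s cs"
    and T': "pair_graph T'" and sc': "fgraph.skeleton_cover (pverts T') (parcs T') s' cs'"
    and ne: "cs \<noteq> []" "cs' \<noteq> []"
    and spectrum: "spectrum_mset T = spectrum_mset T'"
    and walks: "\<And>k. 3 \<le> k \<Longrightarrow> k \<le> 8 \<Longrightarrow> num_walks k T = num_walks k T'"
  shows "invs s (map real (fgraph.pendant_list (pverts T) (parcs T) cs)) =
    invs s' (map real (fgraph.pendant_list (pverts T') (parcs T') cs'))"
proof -
  obtain n m2 m3 m4 i3 i4 i5 i6 i7 i8 where I:
    "invs s (map real (fgraph.pendant_list (pverts T) (parcs T) cs)) = [n, m2, m3, m4, i3, i4, i5, i6, i7, i8]"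
    "n = real (card (pverts T))"
    "num_walks 1 T = 2 * (n - 1)" "num_walks 2 T = (n - 1) * n - 2 * m2"
    "num_walks 3 T - (n - 1) * num_walks 1 T = i3"
    "num_walks 4 T - (n - 1) * num_walks 2 T + m2 * n = i4"
    "num_walks 5 T - (n - 1) * num_walks 3 T + m2 * num_walks 1 T = i5"
    "num_walks 6 T - (n - 1) * num_walks 4 T + m2 * num_walks 2 T - m3 * n = i6"
    "num_walks 7 T - (n - 1) * num_walks 5 T + m2 * num_walks 3 T - m3 * num_walks 1 T = i7"
    "num_walks 8 T - (n - 1) * num_walks 6 T + m2 * num_walks 4 T - m3 * num_walks 2 T + m4 * n = i8"
    and P: "\<And>x. poly (char_poly (adjacency_matrix T)) x * x ^ 8 =
      x ^ card (pverts T) * (x ^ 8 - (n - 1) * x ^ 6 + m2 * x ^ 4 - m3 * x\<^sup>2 + m4)"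
    by (rule skeleton_invariants[OF T sc ne(1)]) (rule that; assumption)
  obtain n' m2' m3' m4' i3' i4' i5' i6' i7' i8' where I':
    "invs s' (map real (fgraph.pendant_list (pverts T') (parcs T') cs')) = [n', m2', m3', m4', i3', i4', i5', i6', i7', i8']"
    "n' = real (card (pverts T'))"
    "num_walks 1 T' = 2 * (n' - 1)" "num_walks 2 T' = (n' - 1) * n' - 2 * m2'"
    "num_walks 3 T' - (n' - 1) * num_walks 1 T' = i3'"
    "num_walks 4 T' - (n' - 1) * num_walks 2 T' + m2' * n' = i4'"
    "num_walks 5 T' - (n' - 1) * num_walks 3 T' + m2' * num_walks 1 T' = i5'"
    "num_walks 6 T' - (n' - 1) * num_walks 4 T' + m2' * num_walks 2 T' - m3' * n' = i6'"
    "num_walks 7 T' - (n' - 1) * num_walks 5 T' + m2' * num_walks 3 T' - m3' * num_walks 1 T' = i7'"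
    "num_walks 8 T' - (n' - 1) * num_walks 6 T' + m2' * num_walks 4 T' - m3' * num_walks 2 T' + m4' * n' = i8'"
    and P': "\<And>x. poly (char_poly (adjacency_matrix T')) x * x ^ 8 =
      x ^ card (pverts T') * (x ^ 8 - (n' - 1) * x ^ 6 + m2' * x ^ 4 - m3' * x\<^sup>2 + m4')"
    by (rule skeleton_invariants[OF T' sc' ne(2)]) (rule that; assumption)
  note char_poly = char_poly_eq_if_spectrum_eq[OF spectrum]
  have n: "n' = n" using I(2) I'(2) char_poly(2) by simp
  have eq: "m2 * x ^ 4 - m3 * x\<^sup>2 + m4 = m2' * x ^ 4 - m3' * x\<^sup>2 + m4'" if "x \<noteq> 0" for x
    using P[of x] P'[of x] that unfolding char_poly n by simp
  \<comment> \<open>Both sides are quadratic in the square of \<open>x\<close>, and the points 1, 2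
    and 3 have different squares.\<close>
  have "m2 = m2' \<and> m3 = m3' \<and> m4 = m4'"
    using eq[of 1] eq[of 2] eq[of 3] by simp
  then have m: "m2' = m2" "m3' = m3" "m4' = m4" by simp_all
  have w: "num_walks 1 T' = num_walks 1 T" "num_walks 2 T' = num_walks 2 T"
    using I(3,4) I'(3,4) n m by simp_all
  have W: "num_walks 3 T' = num_walks 3 T" "num_walks 4 T' = num_walks 4 T"
    "num_walks 5 T' = num_walks 5 T" "num_walks 6 T' = num_walks 6 T"
    "num_walks 7 T' = num_walks 7 T" "num_walks 8 T' = num_walks 8 T"
    using walks by simp_all
  show ?thesis
    unfolding I(1) I'(1) I(5-)[symmetric] I'(5-)[symmetric] n m w W by (rule refl)
qed

lemma tree_normal_form:
  assumes T: "is_tree T" and small: "matching_number T \<le> 4"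
  obtains s cs where "fgraph.skeleton_cover (pverts T) (parcs T) s cs"
    "admissible s (fgraph.pendant_list (pverts T) (parcs T) cs)"
    "ordered s (fgraph.pendant_list (pverts T) (parcs T) cs)"
    "length cs = skeleton_size s"
proof -
  have ftree: "ftree (pverts T) (parcs T)" using T by (rule is_tree_imp_ftree)
  interpret ftree "pverts T" "parcs T" by fact
  have "card C \<le> 4" if "saturated_cover C" for C
    using saturated_cover_le_matching_number[OF ftree that] small by linarith
  then obtain s cs where "skeleton_cover s cs" "admissible s (pendant_list cs)"
    by (rule canonical_form)
  from ordered_cover_exists[OF this] obtain ds where ds: "skeleton_cover s ds"
    "admissible s (pendant_list ds)" "ordered s (pendant_list ds)"
    by (elim exE conjE) (rule that)
  then have "length ds = skeleton_size s"
    unfolding skeleton_cover_def by (elim conjE) (rule shapeD(3))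
  with ds show ?thesis by (rule that)
qed

theorem corollary1p3:
  fixes T :: "'a pair_pre_digraph" and T' :: "'b pair_pre_digraph"
  assumes "is_tree T" and "is_tree T'"
    and "matching_number T \<le> 4" and "matching_number T' \<le> 4"
    and "spectrum_mset T = spectrum_mset T'"
    and "\<And>k. 3 \<le> k \<Longrightarrow> k \<le> 8 \<Longrightarrow> num_walks k T = num_walks k T'"
  shows "digraph_iso (with_proj T) (with_proj T')"
proof -
  have pg: "pair_graph T" "pair_graph T'" using assms(1,2) by (simp_all add: is_tree_def)
  note G = fgraph_pair_graph[OF pg(1)] fgraph_pair_graph[OF pg(2)]
  obtain s cs where sc: "fgraph.skeleton_cover (pverts T) (parcs T) s cs"
    "admissible s (fgraph.pendant_list (pverts T) (parcs T) cs)"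
    "ordered s (fgraph.pendant_list (pverts T) (parcs T) cs)"
    "length cs = skeleton_size s"
    by (rule tree_normal_form[OF assms(1,3)]) (rule that; assumption)
  obtain s' cs' where sc': "fgraph.skeleton_cover (pverts T') (parcs T') s' cs'"
    "admissible s' (fgraph.pendant_list (pverts T') (parcs T') cs')"
    "ordered s' (fgraph.pendant_list (pverts T') (parcs T') cs')"
    "length cs' = skeleton_size s'"
    by (rule tree_normal_form[OF assms(2,4)]) (rule that; assumption)
  have size: "skeleton_size t \<noteq> 0" for t by (cases t) simp_all
  then have ne: "cs \<noteq> []" "cs' \<noteq> []"
    using sc(4) sc'(4) size[of s] size[of s'] by (metis list.size(3))+
  note invs = invs_eq[OF pg(1) sc(1) pg(2) sc'(1) ne assms(5,6)]
  have s: "s = s'"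
    using skeleton_determined[OF sc(2) _ sc'(2) _ invs] sc(4) sc'(4) by simp
  have "fgraph.pendant_list (pverts T) (parcs T) cs = fgraph.pendant_list (pverts T') (parcs T') cs'"
    by (rule invs_inj[OF invs[folded s]]) (use sc sc' s in simp_all)
  then obtain f where "bij_betw f (pverts T) (pverts T')"
    "\<And>u v. u \<in> pverts T \<Longrightarrow> v \<in> pverts T \<Longrightarrow> (f u, f v) \<in> parcs T' \<longleftrightarrow> (u, v) \<in> parcs T"
    by (rule skeleton_cover_iso[OF G sc(1) sc'(1)[folded s]]) (rule that; assumption)
  then show ?thesis by (rule digraph_isoI[OF pg])
qed

end
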